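(* Let $H=\int_\Omega^\oplus H_\omega\,d\mu(\omega)$ satisfy condition (A) (defined in the context), let $\mu$ be ergodic, and let $\lambda\in\mathbb{R}$ be arbitrary. Then the following assertions are equivalent. (i) The integrated density of states $N_H$ is discontinuous at $\lambda$. (ii) For a set $\Omega'\subset\Omega$ of positive measure there exists a compactly supported nontrivial solution $u\in\ell^2(X(\omega))$ of $(H_\omega-\lambda)u=0$ for each $\omega\in\Omega'$. (iii) For almost every $\omega\in\Omega$ the space of $\ell^2$ solutions $u$ to $(H_\omega-\lambda)u=0$ is spanned by compactly supported nontrivial solutions.
   Context: Geometric setting. $(X,d)$ is a locally compact metric space with a countable basis of the topology. $\Gamma$ is a locally compact amenable unimodular group with an invariant metric $d_\Gamma$ such that every ball is precompact; $|A|$ denotes the invariant Haar measure of a Borel set $A\subset\Gamma$ and $d\gamma$ integration against it. $\Gamma$ acts continuously by isometries on $X$ such that: (1) there is a fundamental domain $F'\subset X$ (every $x\in X$ can be written uniquely as $x=\gamma x_0$ with $\gamma\in\Gamma$, $x_0\in F'$) which is a countable union of compact sets and has compact closure $F$; (2) the map $\Phi:X\to\Gamma$, $\Phi(x)=\gamma$ whenever $x\in\gamma F'$, is a rough isometry: there are $a\ge 1$, $b\ge 0$ with $\frac1a d_\Gamma(\Phi(x),\Phi(y))-b\le d(x,y)\le a\,d_\Gamma(\Phi(x),\Phi(y))+b$ for all $x,y\in X$. Configurations. $\mathcal{D}$ is the set of all $A\subset X$ with $d(x,y)\ge 1$ for all distinct $x,y\in A$. For a compact space $Y$ let $\mathcal{D}_Y$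 be the set of all functions $f:A\to Y$ with $A\in\mathcal{D}$, identified with the measures $\sum_{x\in A}\delta_{(x,f(x))}$ on $X\times Y$ and given the induced vague topology (the coarsest one making integration against each $\varphi\in C_c(X\times Y)$ continuous). Fix a compactification $\mathbb{C}^*$ of $\mathbb{C}$. The set $\tilde{\mathcal{D}}=\{(A,h): A\in\mathcal{D},\ h:A\times A\to\mathbb{C}^*\}$ is identified, via $f(x)(y)=h(x,y)$, with the set of those $f:A\to\mathcal{D}_{\mathbb{C}^*}$ in $\mathcal{D}_{\mathcal{D}_{\mathbb{C}^*}}$ for which $f(x)$ has domain $A$ for all $x\in A$; with the resulting vague topology it is compact. $\Gamma$ acts on $\tilde{\mathcal D}$ by $\gamma(A,h)=(\gamma A,\gamma h)$, $(\gamma h)(x,y)=h(\gamma^{-1}x,\gamma^{-1}y)$. $\mu$ is a $\Gamma$-invariant probability measure on $\tilde{\mathcal{D}}$ and $\Omega$ is its topological support; ergodicity refers to this action. For $\omega=(A,h)$ write $X(\omega)=A$; for $\Lambda\subset X$ write $\omega(\Lambda)$ for the cardinality of $\Lambda\cap X(\omega)$. It is assumed that $\Omega$ does not consist of the empty set only. The measure $m(\Lambda)=\int_\Omega\omega(\Lambda)\,d\mu(\omega)$ on $X$ is $\Gamma$-invariant, and $\operatorname{dens}(m)>0$ is the constant with $m(IF')=\operatorname{dens}(m)|I|$ for all compact $I\subset\Gamma$ with $|I|\ne0$. Operators. $\mathcal{H}=\int_\Omega^\oplus \ell^2(X(\omega))\,d\mu(\omega)$. Each $\omega=(X(\omega),h)$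 gives an operator $(H_\omega v)(x)=\sum_{y\in X(\omega)}H_\omega(x,y)v(y)$ with $H_\omega(x,y)=h(x,y)$, for compactly supported functions $v$ on $X(\omega)$. Condition (A): the $H_\omega$ are bounded operators on $\ell^2(X(\omega))$ with norm bounded by one constant for all $\omega\in\Omega$; $H=\int_\Omega^\oplus H_\omega\,d\mu(\omega)$ is selfadjoint on $\mathcal{H}$; $H$ has finite hopping range, i.e. there is $R<\infty$ such that $H_\omega(x,y)=0$ for all $\omega\in\Omega$ and $x,y\in X(\omega)$ with $d(x,y)\ge R$; and $H$ is equivariant with respect to a given family of functions $s_\gamma:X\to\{z\in\mathbb{C}:|z|=1\}$, $\gamma\in\Gamma$, i.e. $s_\gamma(x)H_{\gamma\omega}(\gamma x,\gamma y)\overline{s_\gamma(y)}=H_\omega(x,y)$ for all $\gamma\in\Gamma$, $\omega\in\Omega$, $x,y\in X(\omega)$. Integrated density of states. $\nu_H$ is the measure on $\mathbb{R}$ determined by $\nu_H(\varphi)=\frac{1}{\operatorname{dens}(m)}\int_\Omega\operatorname{Tr}(u\,\varphi(H_\omega))\,d\mu(\omega)$, $\varphi\in C_c(\mathbb{R})$, where $u$ is a function on $X$ with compact support and $\int_\Gamma u(\gamma^{-1}x)\,d\gamma=1$ for all $x\in X$, e.g. $u=|I|^{-1}\chi_{IF'}$ with $I\subset\Gamma$ compact, $|I|>0$ (the result does not depend on $u$). $N_H(\lambda)=\nu_H((-\infty,\lambda])$. *)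

theory Defs
  imports "HOL-Analysis.Analysis" "HOL-Probability.Probability"
begin

section \<open>The group\<close>

text \<open>
  The group is a type of class \<open>topological_group_add\<close>: it is written additively but is
  not assumed to be commutative.
\<close>

definition haar_measure :: "'g::{topological_group_add, metric_space} measure \<Rightarrow> bool" where
  "haar_measure M \<longleftrightarrow>
     sets M = sets borel \<and> emeasure M UNIV \<noteq> 0 \<and>
     (\<forall>K. compact K \<longrightarrow> emeasure M K < \<infinity>) \<and>
     (\<forall>g. distr M M (\<lambda>x. g + x) = M)"

definition unimodular_haar :: "'g::{topological_group_add, metric_space} measure \<Rightarrow> bool" where
  "unimodular_haar M \<longleftrightarrow> haar_measure M \<and> (\<forall>g. distr M M (\<lambda>x. x + g) = M)"

text \<open>
  Amenability: existence of a left invariant mean on \<open>L\<^sup>\<infinity>\<close>.  The mean is a functional on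
  bounded Borel functions; positivity up to null sets makes it descend to classes modulo
  equality almost everywhere.
\<close>

definition amenable :: "'g::{topological_group_add, metric_space} measure \<Rightarrow> bool" where
  "amenable M \<longleftrightarrow> (\<exists>m :: ('g \<Rightarrow> real) \<Rightarrow> real.
     let B = {f. f \<in> borel_measurable borel \<and> bounded (range f)} in
       (\<forall>f\<in>B. \<forall>f'\<in>B. m (\<lambda>x. f x + f' x) = m f + m f') \<and>
       (\<forall>f\<in>B. \<forall>c. m (\<lambda>x. c * f x) = c * m f) \<and>
       (\<forall>f\<in>B. (AE x in M. 0 \<le> f x) \<longrightarrow> 0 \<le> m f) \<and>
       m (\<lambda>x. 1) = 1 \<and>
       (\<forall>f\<in>B. \<forall>g. m (\<lambda>x. f (g + x)) = m f))"


section \<open>The action on the space\<close>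

definition isometric_action ::
  "('g::{topological_group_add, metric_space} \<Rightarrow> 'x::metric_space \<Rightarrow> 'x) \<Rightarrow> bool" where
  "isometric_action act \<longleftrightarrow>
     (\<forall>x. act 0 x = x) \<and> (\<forall>g h x. act (g + h) x = act g (act h x)) \<and>
     (\<forall>g x y. dist (act g x) (act g y) = dist x y) \<and>
     continuous_on UNIV (\<lambda>(g, x). act g x)"

definition fundamental_domain :: "('g \<Rightarrow> 'x \<Rightarrow> 'x) \<Rightarrow> 'x set \<Rightarrow> bool" where
  "fundamental_domain act F' \<longleftrightarrow> (\<forall>x. \<exists>!p. snd p \<in> F' \<and> x = act (fst p) (snd p))"

definition group_coordinate :: "('g \<Rightarrow> 'x \<Rightarrow> 'x) \<Rightarrow> 'x set \<Rightarrow> 'x \<Rightarrow> 'g" where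
  "group_coordinate act F' x = (THE g. x \<in> act g ` F')"

definition rough_isometry :: "('x::metric_space \<Rightarrow> 'g::metric_space) \<Rightarrow> bool" where
  "rough_isometry \<Phi> \<longleftrightarrow> (\<exists>a\<ge>1. \<exists>b\<ge>0. \<forall>x y.
     1 / a * dist (\<Phi> x) (\<Phi> y) - b \<le> dist x y \<and> dist x y \<le> a * dist (\<Phi> x) (\<Phi> y) + b)"

definition compactly_supported :: "('a::topological_space \<Rightarrow> 'b::zero) \<Rightarrow> bool" where
  "compactly_supported f \<longleftrightarrow> compact (closure {x. f x \<noteq> 0})"

definition averaging_function ::
  "'g::{topological_group_add, metric_space} measure \<Rightarrow> ('g \<Rightarrow> 'x::metric_space \<Rightarrow> 'x)
    \<Rightarrow> ('x \<Rightarrow> real) \<Rightarrow> bool" where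
  "averaging_function haar act u \<longleftrightarrow>
     u \<in> borel_measurable borel \<and> bounded (range u) \<and> compactly_supported u \<and>
     (\<forall>x. has_bochner_integral haar (\<lambda>g. u (act (- g) x)) 1)"


section \<open>Configurations and the vague topology\<close>

definition separated_set :: "'x::metric_space set \<Rightarrow> bool" where
  "separated_set A \<longleftrightarrow> (\<forall>x\<in>A. \<forall>y\<in>A. x \<noteq> y \<longrightarrow> 1 \<le> dist x y)"

definition Cc_in :: "'a topology \<Rightarrow> ('a \<Rightarrow> real) set" where
  "Cc_in T = {\<phi>. continuous_map T euclidean \<phi> \<and>
                 compactin T (T closure_of {z \<in> topspace T. \<phi> z \<noteq> 0})}"

text \<open>
  A function from a separated set \<open>A\<close> to \<open>Y\<close> is a partial map with domain \<open>A\<close>.  The sum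
  below is the integral of \<open>\<phi>\<close> against the sum of the point masses at \<open>(x, f x)\<close>.
\<close>

definition decorated_sets :: "'y topology \<Rightarrow> ('x::metric_space \<rightharpoonup> 'y) set" where
  "decorated_sets Y = {f. separated_set (dom f) \<and> ran f \<subseteq> topspace Y}"

definition vague_topology :: "'y topology \<Rightarrow> ('x::metric_space \<rightharpoonup> 'y) topology" where
  "vague_topology Y = topology_generated_by
     {{f \<in> decorated_sets Y. (\<Sum>\<^sub>\<infinity>x\<in>dom f. \<phi> (x, the (f x))) \<in> U} | \<phi> U.
        \<phi> \<in> Cc_in (prod_topology euclidean Y) \<and> open U}"

text \<open>
  A pair \<open>(A, h)\<close> with \<open>h\<close> defined on \<open>A \<times> A\<close> is the partial map \<open>\<omega>\<close> with domain \<open>A\<close>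
  such that each \<open>\<omega> x\<close> is the partial map \<open>h(x, \<cdot>)\<close>, again with domain \<open>A\<close>.
\<close>

type_synonym ('x, 'c) config = "'x \<rightharpoonup> 'x \<rightharpoonup> 'c"

definition config_topology :: "'c topology \<Rightarrow> ('x::metric_space, 'c) config topology" where
  "config_topology Cs = subtopology (vague_topology (vague_topology Cs))
     {\<omega>. \<forall>x\<in>dom \<omega>. dom (the (\<omega> x)) = dom \<omega>}"

definition config_act ::
  "('g::group_add \<Rightarrow> 'x \<Rightarrow> 'x) \<Rightarrow> 'g \<Rightarrow> ('x, 'c) config \<Rightarrow> ('x, 'c) config" where
  "config_act act g \<omega> =
     (\<lambda>x. map_option (\<lambda>k y. k (act (- g) y)) (\<omega> (act (- g) x)))"

definition compactification :: "'c topology \<Rightarrow> (complex \<Rightarrow> 'c) \<Rightarrow> bool" where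
  "compactification Cs \<iota> \<longleftrightarrow>
     compact_space Cs \<and> Hausdorff_space Cs \<and> embedding_map euclidean Cs \<iota> \<and>
     Cs closure_of range \<iota> = topspace Cs"


section \<open>Measures on configurations\<close>

text \<open>
  Probability measures on a compact space are understood to be regular Borel measures; if
  the space is metrizable (as for the one-point compactification of the complex plane),
  regularity is automatic.
\<close>

definition regular_probability :: "'a topology \<Rightarrow> 'a measure \<Rightarrow> bool" where
  "regular_probability T \<mu> \<longleftrightarrow>
     prob_space \<mu> \<and> space \<mu> = topspace T \<and>
     sets \<mu> = sigma_sets (topspace T) {U. openin T U} \<and>
     (\<forall>B\<in>sets \<mu>. emeasure \<mu> B = (SUP K\<in>{K. compactin T K \<and> K \<subseteq> B}. emeasure \<mu> K))"

definition topological_support :: "'a topology \<Rightarrow> 'a measure \<Rightarrow> 'a set" where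
  "topological_support T \<mu> =
     {\<omega> \<in> topspace T. \<forall>U. openin T U \<and> \<omega> \<in> U \<longrightarrow> 0 < emeasure \<mu> U}"

definition invariant_measure ::
  "('g::group_add \<Rightarrow> 'x \<Rightarrow> 'x) \<Rightarrow> ('x, 'c) config measure \<Rightarrow> bool" where
  "invariant_measure act \<mu> \<longleftrightarrow> (\<forall>g. distr \<mu> \<mu> (config_act act g) = \<mu>)"

definition ergodic_measure ::
  "('g::group_add \<Rightarrow> 'x \<Rightarrow> 'x) \<Rightarrow> ('x, 'c) config measure \<Rightarrow> bool" where
  "ergodic_measure act \<mu> \<longleftrightarrow>
     (\<forall>B\<in>sets \<mu>. (\<forall>g. config_act act g ` B = B) \<longrightarrow> emeasure \<mu> B = 0 \<or> emeasure \<mu> B = 1)"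

definition intensity ::
  "('x, 'c) config measure \<Rightarrow> ('x, 'c) config set \<Rightarrow> 'x set \<Rightarrow> ennreal" where
  "intensity \<mu> \<Omega> \<Lambda> = (\<integral>\<^sup>+\<omega>\<in>\<Omega>. emeasure (count_space UNIV) (\<Lambda> \<inter> dom \<omega>) \<partial>\<mu>)"


section \<open>Square summable functions and functional calculus\<close>

text \<open>\<open>\<ell>\<^sup>2(A)\<close>, with its elements extended by zero outside \<open>A\<close>.\<close>

definition ell2 :: "'x set \<Rightarrow> ('x \<Rightarrow> complex) set" where
  "ell2 A = {v. (\<forall>x. x \<notin> A \<longrightarrow> v x = 0) \<and> (\<lambda>x. (cmod (v x))\<^sup>2) summable_on A}"

definition ell2_inner :: "'x set \<Rightarrow> ('x \<Rightarrow> complex) \<Rightarrow> ('x \<Rightarrow> complex) \<Rightarrow> complex" where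
  "ell2_inner A v w = (\<Sum>\<^sub>\<infinity>x\<in>A. cnj (v x) * w x)"

definition ell2_norm :: "'x set \<Rightarrow> ('x \<Rightarrow> complex) \<Rightarrow> real" where
  "ell2_norm A v = sqrt (\<Sum>\<^sub>\<infinity>x\<in>A. (cmod (v x))\<^sup>2)"

definition ell2_closure :: "'x set \<Rightarrow> ('x \<Rightarrow> complex) set \<Rightarrow> ('x \<Rightarrow> complex) set" where
  "ell2_closure A V = {v \<in> ell2 A. \<forall>e>0. \<exists>w\<in>V. ell2_norm A (\<lambda>x. v x - w x) < e}"

definition complex_span :: "('x \<Rightarrow> complex) set \<Rightarrow> ('x \<Rightarrow> complex) set" where
  "complex_span S = {(\<lambda>x. \<Sum>v\<in>t. c v * v x) | t c. finite t \<and> t \<subseteq> S}"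

definition ell2_onorm :: "'x set \<Rightarrow> (('x \<Rightarrow> complex) \<Rightarrow> 'x \<Rightarrow> complex) \<Rightarrow> real" where
  "ell2_onorm A T = (SUP v\<in>{v \<in> ell2 A. ell2_norm A v \<le> 1}. ell2_norm A (T v))"

definition poly_op ::
  "complex poly \<Rightarrow> (('x \<Rightarrow> complex) \<Rightarrow> 'x \<Rightarrow> complex) \<Rightarrow> ('x \<Rightarrow> complex) \<Rightarrow> 'x \<Rightarrow> complex" where
  "poly_op p T v = (\<lambda>x. \<Sum>i\<le>degree p. coeff p i * (T ^^ i) v x)"

text \<open>
  Continuous functional calculus of a bounded selfadjoint operator \<open>T\<close> on \<open>\<ell>\<^sup>2(A)\<close>:
  \<open>\<phi>(T) v\<close> is the limit of \<open>p\<^sub>n(T) v\<close> for polynomials \<open>p\<^sub>n\<close> converging to \<open>\<phi>\<close> uniformly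
  on the interval from \<open>- \<parallel>T\<parallel>\<close> to \<open>\<parallel>T\<parallel>\<close>, which contains the spectrum.  The limit does
  not depend on the polynomials, and such polynomials exist by the Weierstrass theorem.
\<close>

definition functional_calculus ::
  "'x set \<Rightarrow> (('x \<Rightarrow> complex) \<Rightarrow> 'x \<Rightarrow> complex) \<Rightarrow> (real \<Rightarrow> complex)
    \<Rightarrow> ('x \<Rightarrow> complex) \<Rightarrow> 'x \<Rightarrow> complex" where
  "functional_calculus A T \<phi> v = (THE w. w \<in> ell2 A \<and>
     (\<forall>p :: nat \<Rightarrow> complex poly.
        uniform_limit {- ell2_onorm A T .. ell2_onorm A T}
          (\<lambda>n t. poly (p n) (complex_of_real t)) \<phi> sequentially
        \<longrightarrow> (\<lambda>n. ell2_norm A (\<lambda>x. poly_op (p n) T v x - w x)) \<longlonglongrightarrow> 0))"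

text \<open>The summands are the diagonal elements of \<open>T\<close> in the basis of point masses.\<close>

definition op_trace :: "'x set \<Rightarrow> (('x \<Rightarrow> complex) \<Rightarrow> 'x \<Rightarrow> complex) \<Rightarrow> complex" where
  "op_trace A T = (\<Sum>\<^sub>\<infinity>x\<in>A. T (\<lambda>y. if y = x then 1 else 0) x)"


section \<open>The operators\<close>

definition ham_entry :: "(complex \<Rightarrow> 'c) \<Rightarrow> ('x, 'c) config \<Rightarrow> 'x \<Rightarrow> 'x \<Rightarrow> complex" where
  "ham_entry \<iota> \<omega> x y = inv \<iota> (the (the (\<omega> x) y))"

text \<open>
  The formula is used on all of \<open>\<ell>\<^sup>2\<close>.  For a matrix that is bounded on \<open>\<ell>\<^sup>2\<close> this is the
  continuous extension of the operator given on compactly supported functions.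
\<close>

definition ham ::
  "(complex \<Rightarrow> 'c) \<Rightarrow> ('x, 'c) config \<Rightarrow> ('x \<Rightarrow> complex) \<Rightarrow> 'x \<Rightarrow> complex" where
  "ham \<iota> \<omega> v = (\<lambda>x. if x \<in> dom \<omega> then \<Sum>\<^sub>\<infinity>y\<in>dom \<omega>. ham_entry \<iota> \<omega> x y * v y else 0)"

text \<open>
  Representatives of the elements of the direct integral of the spaces \<open>\<ell>\<^sup>2(dom \<omega>)\<close>.  The
  measurable sections are those which are measurable as functions of \<open>(\<omega>, x)\<close>.
\<close>

definition direct_integral ::
  "('x::metric_space, 'c) config measure \<Rightarrow> ('x, 'c) config set
    \<Rightarrow> (('x, 'c) config \<Rightarrow> 'x \<Rightarrow> complex) set" where
  "direct_integral \<mu> \<Omega> = {f.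
     (\<forall>\<omega>\<in>\<Omega>. f \<omega> \<in> ell2 (dom \<omega>)) \<and>
     (\<lambda>(\<omega>, x). f \<omega> x) \<in> borel_measurable (restrict_space \<mu> \<Omega> \<Otimes>\<^sub>M borel) \<and>
     (\<integral>\<^sup>+\<omega>\<in>\<Omega>. ennreal ((ell2_norm (dom \<omega>) (f \<omega>))\<^sup>2) \<partial>\<mu>) < \<infinity>}"

definition direct_integral_inner ::
  "('x, 'c) config measure \<Rightarrow> ('x, 'c) config set \<Rightarrow> (('x, 'c) config \<Rightarrow> 'x \<Rightarrow> complex)
    \<Rightarrow> (('x, 'c) config \<Rightarrow> 'x \<Rightarrow> complex) \<Rightarrow> complex" where
  "direct_integral_inner \<mu> \<Omega> f g = (LINT \<omega>:\<Omega>|\<mu>. ell2_inner (dom \<omega>) (f \<omega>) (g \<omega>))"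

definition uniformly_bounded :: "(complex \<Rightarrow> 'c) \<Rightarrow> ('x, 'c) config set \<Rightarrow> bool" where
  "uniformly_bounded \<iota> \<Omega> \<longleftrightarrow> (\<exists>C. \<forall>\<omega>\<in>\<Omega>. \<forall>v\<in>ell2 (dom \<omega>).
     ham \<iota> \<omega> v \<in> ell2 (dom \<omega>) \<and> ell2_norm (dom \<omega>) (ham \<iota> \<omega> v) \<le> C * ell2_norm (dom \<omega>) v)"

text \<open>For an everywhere defined operator, selfadjointness is symmetry.\<close>

definition selfadjoint_direct_integral ::
  "(complex \<Rightarrow> 'c) \<Rightarrow> ('x::metric_space, 'c) config measure \<Rightarrow> ('x, 'c) config set \<Rightarrow> bool" where
  "selfadjoint_direct_integral \<iota> \<mu> \<Omega> \<longleftrightarrow>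
     (\<forall>f\<in>direct_integral \<mu> \<Omega>. (\<lambda>\<omega>. ham \<iota> \<omega> (f \<omega>)) \<in> direct_integral \<mu> \<Omega>) \<and>
     (\<forall>f\<in>direct_integral \<mu> \<Omega>. \<forall>g\<in>direct_integral \<mu> \<Omega>.
        direct_integral_inner \<mu> \<Omega> (\<lambda>\<omega>. ham \<iota> \<omega> (f \<omega>)) g =
        direct_integral_inner \<mu> \<Omega> f (\<lambda>\<omega>. ham \<iota> \<omega> (g \<omega>)))"

definition finite_hopping_range ::
  "(complex \<Rightarrow> 'c) \<Rightarrow> ('x::metric_space, 'c) config set \<Rightarrow> bool" where
  "finite_hopping_range \<iota> \<Omega> \<longleftrightarrow>
     (\<exists>R. \<forall>\<omega>\<in>\<Omega>. \<forall>x\<in>dom \<omega>. \<forall>y\<in>dom \<omega>. R \<le> dist x y \<longrightarrow> ham_entry \<iota> \<omega> x y = 0)"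

definition equivariant ::
  "('g::group_add \<Rightarrow> 'x \<Rightarrow> 'x) \<Rightarrow> ('g \<Rightarrow> 'x \<Rightarrow> complex) \<Rightarrow> (complex \<Rightarrow> 'c)
    \<Rightarrow> ('x, 'c) config set \<Rightarrow> bool" where
  "equivariant act s \<iota> \<Omega> \<longleftrightarrow>
     (\<forall>g. \<forall>\<omega>\<in>\<Omega>. \<forall>x\<in>dom \<omega>. \<forall>y\<in>dom \<omega>.
        s g x * ham_entry \<iota> (config_act act g \<omega>) (act g x) (act g y) * cnj (s g y) =
        ham_entry \<iota> \<omega> x y)"

text \<open>The first conjunct says that the matrix entries, a priori points of the
  compactification, are complex numbers.\<close>

definition condition_A ::
  "('g::group_add \<Rightarrow> 'x::metric_space \<Rightarrow> 'x) \<Rightarrow> ('g \<Rightarrow> 'x \<Rightarrow> complex) \<Rightarrow> (complex \<Rightarrow> 'c)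
    \<Rightarrow> ('x, 'c) config measure \<Rightarrow> ('x, 'c) config set \<Rightarrow> bool" where
  "condition_A act s \<iota> \<mu> \<Omega> \<longleftrightarrow>
     (\<forall>\<omega>\<in>\<Omega>. \<forall>x\<in>dom \<omega>. \<forall>y\<in>dom \<omega>. the (the (\<omega> x) y) \<in> range \<iota>) \<and>
     uniformly_bounded \<iota> \<Omega> \<and>
     selfadjoint_direct_integral \<iota> \<mu> \<Omega> \<and>
     finite_hopping_range \<iota> \<Omega> \<and>
     equivariant act s \<iota> \<Omega>"


section \<open>The integrated density of states\<close>

text \<open>
  The defining property of the measure \<open>\<nu>\<close>; \<open>d\<close> is the density of the intensity measure
  and \<open>u\<close> an averaging function.
\<close>

definition density_of_states ::
  "(complex \<Rightarrow> 'c) \<Rightarrow> ('x::metric_space, 'c) config measure \<Rightarrow> ('x, 'c) config set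
    \<Rightarrow> real \<Rightarrow> ('x \<Rightarrow> real) \<Rightarrow> real measure \<Rightarrow> bool" where
  "density_of_states \<iota> \<mu> \<Omega> d u \<nu> \<longleftrightarrow>
     sets \<nu> = sets borel \<and> (\<forall>K. compact K \<longrightarrow> emeasure \<nu> K < \<infinity>) \<and>
     (\<forall>\<phi> :: real \<Rightarrow> complex. continuous_on UNIV \<phi> \<and> compactly_supported \<phi> \<longrightarrow>
        (LINT t|\<nu>. \<phi> t) = complex_of_real (1 / d) *
          (LINT \<omega>:\<Omega>|\<mu>. op_trace (dom \<omega>)
             (\<lambda>v x. complex_of_real (u x) *
                functional_calculus (dom \<omega>) (ham \<iota> \<omega>) \<phi> v x)))"

definition integrated_dos :: "real measure \<Rightarrow> real \<Rightarrow> real" where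
  "integrated_dos \<nu> t = measure \<nu> {..t}"

definition solutions ::
  "(complex \<Rightarrow> 'c) \<Rightarrow> ('x, 'c) config \<Rightarrow> real \<Rightarrow> ('x \<Rightarrow> complex) set" where
  "solutions \<iota> \<omega> E = {v \<in> ell2 (dom \<omega>). \<forall>x. ham \<iota> \<omega> v x - complex_of_real E * v x = 0}"

definition compact_solutions ::
  "(complex \<Rightarrow> 'c) \<Rightarrow> ('x::metric_space, 'c) config \<Rightarrow> real \<Rightarrow> ('x \<Rightarrow> complex) set" where
  "compact_solutions \<iota> \<omega> E =
     {v \<in> solutions \<iota> \<omega> E. compactly_supported v \<and> (\<exists>x. v x \<noteq> 0)}"

text \<open>
  Spanned is meant in the Hilbert space sense (closed linear span).  Being spanned by
  nontrivial compactly supported solutions includes that there are such solutions: the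
  trivial solution space does not count.
\<close>

definition spanned_by_compact_solutions ::
  "(complex \<Rightarrow> 'c) \<Rightarrow> ('x::metric_space, 'c) config \<Rightarrow> real \<Rightarrow> bool" where
  "spanned_by_compact_solutions \<iota> \<omega> E \<longleftrightarrow>
     compact_solutions \<iota> \<omega> E \<noteq> {} \<and>
     solutions \<iota> \<omega> E = ell2_closure (dom \<omega>) (complex_span (compact_solutions \<iota> \<omega> E))"

end

theory Submission
  imports Defs
begin

text \<open>
  Write \<open>e(\<omega>, x)\<close> for the diagonal of the projection onto the kernel of \<open>H\<^sub>\<omega> - E\<close>, and
  \<open>p(\<omega>, x)\<close> for that of the projection onto the closed span of the compactly supported
  solutions.  Both are invariant weights on the points of the configurations, and for an
  invariant weight \<open>w\<close> the expectation of the sum of \<open>w\<close> over the points of \<open>I F'\<close> is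
  \<open>|I|\<close> times the expectation of the sum of \<open>u w\<close>.  For \<open>w = e\<close> the latter is \<open>d\<close> times the
  jump of the integrated density of states at \<open>E\<close>: apply its definition to the powers of
  \<open>1 - ((t - E) / S)\<^sup>2\<close>, which decrease to the indicator of \<open>E\<close>.

  A solution vanishing in the boundary layer of width \<open>2 R\<close> around \<open>I F'\<close> restricts to a
  solution supported in \<open>I F'\<close>, so the sum of \<open>e - p\<close> over \<open>I F'\<close> is at most twice the number
  of points in that layer.  An amenable unimodular group has compact sets \<open>I\<close> with thickenings
  of almost the same measure, hence \<open>e = p\<close> almost surely.  By ergodicity the kernel is
  trivial almost surely or nontrivial almost surely, according to whether the jump vanishes.
\<close>

section \<open>Foelner sets in amenable unimodular groups\<close>

text \<open>Amenability is given as an invariant mean, and the passage to Foelner sets runs through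
  a random walk: if no iterate of averaging over balls almost preserved its L2-norm, the norms would
  decay geometrically and yield a positive \<open>h\<close> whose averages are at most
  \<open>s * h\<close> with \<open>s < 1\<close>. The antisymmetric flow built from
  \<open>(h y - h x) / (h y + h x)\<close> then has divergence bounded away from zero, which a mean
  forbids. No spectral theorem enters. The operator \<open>T J\<close>, the compression of
  \<open>1 - (H - E)\<^sup>2 / S\<^sup>2\<close> to \<open>J\<close>, is a positive contraction, and
  its powers converge strongly to the projection onto the solutions supported in \<open>J\<close>.
  Each power is built from operations that preserve measurable sections, so the diagonals are
  measurable; without compression the same powers are what the density of states is tested with.
  Symmetry on the direct integral gives Hermitian entries only almost everywhere; the topology of
  configurations carries this over to every point of the support.\<close>

lemma open_in_pair_borel:
  fixes U :: "('a::topological_space \<times> 'b::topological_space) set" and B :: "'b set set"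
  assumes "countable B" "topological_basis B" "open U"
  shows "U \<in> sets (borel \<Otimes>\<^sub>M borel)"
proof -
  \<comment> \<open>Only the second factor has a countable basis. All rectangles in \<open>U\<close>
    with the same second side \<open>b\<close> are merged into one, so that countably many
    remain.\<close>
  define V where "V b = \<Union>{W. open W \<and> W \<times> b \<subseteq> U}" for b
  have oV: "open (V b)" for b unfolding V_def by auto
  have "U = (\<Union>b\<in>B. V b \<times> b)"
  proof (intro equalityI subsetI)
    fix p assume "p \<in> U"
    then obtain S T where ST: "open S" "open T" "p \<in> S \<times> T" "S \<times> T \<subseteq> U"
      using open_prod_elim[OF assms(3)] by metis
    obtain b where b: "b \<in> B" "snd p \<in> b" "b \<subseteq> T"
      using topological_basisE[OF assms(2) ST(2), of "snd p"] ST(3) by (metis mem_Times_iff)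
    have "fst p \<in> V b" unfolding V_def using ST b by (intro UnionI[of S]) auto
    with b show "p \<in> (\<Union>b\<in>B. V b \<times> b)" by (auto simp: mem_Times_iff intro!: bexI[of _ b])
  next
    fix p assume "p \<in> (\<Union>b\<in>B. V b \<times> b)"
    then show "p \<in> U" unfolding V_def by auto
  qed
  moreover have "(\<Union>b\<in>B. V b \<times> b) \<in> sets (borel \<Otimes>\<^sub>M borel)"
  proof (rule sets.countable_UN''[OF assms(1)])
    show "V b \<times> b \<in> sets (borel \<Otimes>\<^sub>M borel)" if "b \<in> B" for b
      using oV topological_basis_open[OF assms(2) that] by (intro pair_measureI) auto
  qed
  ultimately show ?thesis by simp
qed

lemma continuous_pair_borel_measurable:
  fixes f :: "'a::topological_space \<times> 'b::topological_space \<Rightarrow> 'c::topological_space"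
  assumes "countable (B :: 'b set set)" "topological_basis B" "continuous_on UNIV f"
  shows "f \<in> borel_measurable (borel \<Otimes>\<^sub>M borel)"
proof (rule borel_measurableI)
  fix S :: "'c set" assume "open S"
  then have "open (f -` S)" using assms(3) by (simp add: continuous_on_open_vimage)
  then show "f -` S \<inter> space (borel \<Otimes>\<^sub>M borel) \<in> sets (borel \<Otimes>\<^sub>M borel)"
    using open_in_pair_borel[OF assms(1,2)] by (simp add: space_pair_measure)
qed

text \<open>Compact balls are totally bounded: finite nets of mesh \<open>1 / Suc m\<close> for the
  balls of radius \<open>n\<close> around one point together form a countable set.\<close>

lemma proper_countable_dense:
  assumes "\<And>(x::'a::metric_space) r. compact (cball x r)"
  obtains D :: "'a::metric_space set" where "countable D" "\<And>x e. e > 0 \<Longrightarrow> \<exists>y\<in>D. dist y x < e"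
proof -
  have "\<exists>k. finite k \<and> cball (undefined::'a) (real n) \<subseteq> (\<Union>x\<in>k. ball x (1 / real (Suc m)))" for n m
  proof -
    have "\<forall>e>0. \<exists>k. finite k \<and> k \<subseteq> cball (undefined::'a) (real n) \<and> cball undefined (real n) \<subseteq> (\<Union>x\<in>k. ball x e)"
      by (rule seq_compact_imp_totally_bounded[OF compact_imp_seq_compact[OF assms]])
    moreover have "1 / real (Suc m) > 0" by simp
    ultimately show ?thesis by blast
  qed
  then obtain k where k: "\<And>n m. finite (k n m)"
    "\<And>n m. cball (undefined::'a) (real n) \<subseteq> (\<Union>x\<in>k n m. ball x (1 / real (Suc m)))" by metis
  show ?thesis
  proof
    show "countable (\<Union>n m. k n m)" by (intro countable_UN[OF countableI_type] countable_finite k(1))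
    fix x :: 'a and e :: real assume "e > 0"
    obtain n where "dist undefined x \<le> real n" using real_arch_simple by blast
    moreover obtain m where "1 / real (Suc m) < e" using nat_approx_posE[OF \<open>e > 0\<close>] by blast
    moreover obtain y where "y \<in> k n m" "dist y x < 1 / real (Suc m)"
      using k(2)[of n m] \<open>dist undefined x \<le> real n\<close> by (auto simp: subset_iff)
    ultimately show "\<exists>y\<in>(\<Union>n m. k n m). dist y x < e"
      by (intro bexI[of _ y]) auto
  qed
qed

lemma proper_countable_basis:
  assumes "\<And>(x::'a::metric_space) r. compact (cball x r)"
  obtains B :: "'a::metric_space set set" where "countable B" "topological_basis B"
proof -
  obtain D :: "'a set" where D: "countable D" "\<And>x e. e > 0 \<Longrightarrow> \<exists>y\<in>D. dist y x < e"
    by (rule proper_countable_dense[OF assms]) blast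
  show ?thesis
  proof
    show "countable ((\<lambda>(y, n). ball y (1 / real (Suc n))) ` (D \<times> (UNIV::nat set)))"
      using D(1) by auto
    show "topological_basis ((\<lambda>(y, n). ball y (1 / real (Suc n))) ` (D \<times> (UNIV::nat set)))"
    proof (rule topological_basisI)
      fix U :: "'a set" and x assume "open U" "x \<in> U"
      then obtain e where e: "e > 0" "ball x e \<subseteq> U" by (rule openE)
      obtain n where n: "1 / real (Suc n) < e / 2" using nat_approx_posE[OF half_gt_zero[OF e(1)]] by blast
      obtain y where y: "y \<in> D" "dist y x < 1 / real (Suc n)" using D(2)[of "1 / real (Suc n)" x] by auto
      have "ball y (1 / real (Suc n)) \<subseteq> U"
      proof
        fix z assume "z \<in> ball y (1 / real (Suc n))"
        then have "dist x z < e" using y n dist_triangle[of x z y] by (auto simp: dist_commute)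
        then show "z \<in> U" using e by auto
      qed
      with y show "\<exists>B'\<in>(\<lambda>(y, n). ball y (1 / real (Suc n))) ` (D \<times> (UNIV::nat set)). x \<in> B' \<and> B' \<subseteq> U"
        by (intro bexI[of _ "ball y (1 / real (Suc n))"]) auto
    qed auto
  qed
qed

section \<open>Haar measure on a proper metric group\<close>

locale haar_metric_group =
  fixes M :: "'g::{topological_group_add, metric_space} measure"
  assumes unimodular: "unimodular_haar M"
    and dist_left: "\<And>g x y :: 'g. dist (g + x) (g + y) = dist x y"
    and precompact: "\<And>(x :: 'g) r. compact (closure (ball x r))"
begin

lemma sets_M [measurable_cong, simp]: "sets M = sets borel"
  using unimodular by (simp add: unimodular_haar_def haar_measure_def)

lemma space_M [simp]: "space M = UNIV"
  using sets_eq_imp_space_eq[OF sets_M] by simp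

lemma compact_cball: "compact (cball (x::'g) r)"
proof -
  have "cball x r \<subseteq> ball x (r + 1)" by auto
  then have "cball x r \<subseteq> closure (ball x (r + 1))" using closure_subset by blast
  then show ?thesis using compact_Int_closed[OF precompact[of x "r + 1"] closed_cball[of x r]]
    by (simp add: Int_absorb1)
qed

lemma emeasure_compact: "compact K \<Longrightarrow> emeasure M K < \<infinity>"
  using unimodular by (simp add: unimodular_haar_def haar_measure_def)

lemma nn_integral_left:
  assumes [measurable]: "f \<in> borel_measurable borel"
  shows "(\<integral>\<^sup>+x. f (g + x) \<partial>M) = (\<integral>\<^sup>+x. f x \<partial>M)"
proof -
  have [measurable]: "(\<lambda>x. g + x) \<in> borel_measurable M"
    by (subst measurable_cong_sets[OF sets_M refl]) (intro borel_measurable_continuous_onI continuous_intros)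
  have "(\<integral>\<^sup>+x. f x \<partial>M) = (\<integral>\<^sup>+x. f x \<partial>distr M M (\<lambda>x. g + x))"
    using unimodular by (simp add: unimodular_haar_def haar_measure_def)
  also have "\<dots> = (\<integral>\<^sup>+x. f (g + x) \<partial>M)"
    by (subst nn_integral_distr) (auto simp: measurable_cong_sets[OF refl sets_M])
  finally show ?thesis by simp
qed

lemma nn_integral_right:
  assumes [measurable]: "f \<in> borel_measurable borel"
  shows "(\<integral>\<^sup>+x. f (x + g) \<partial>M) = (\<integral>\<^sup>+x. f x \<partial>M)"
proof -
  have [measurable]: "(\<lambda>x. x + g) \<in> borel_measurable M"
    by (subst measurable_cong_sets[OF sets_M refl]) (intro borel_measurable_continuous_onI continuous_intros)
  have "(\<integral>\<^sup>+x. f x \<partial>M) = (\<integral>\<^sup>+x. f x \<partial>distr M M (\<lambda>x. x + g))"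
    using unimodular by (simp add: unimodular_haar_def haar_measure_def)
  also have "\<dots> = (\<integral>\<^sup>+x. f (x + g) \<partial>M)"
    by (subst nn_integral_distr) (auto simp: measurable_cong_sets[OF refl sets_M])
  finally show ?thesis by simp
qed

lemma sigma_finite: "sigma_finite_measure M"
proof
  have "countable (range (\<lambda>n::nat. cball (0::'g) (real n)))" by simp
  moreover have "(\<Union>n::nat. cball (0::'g) (real n)) = UNIV"
    using real_arch_simple by auto
  moreover have "emeasure M (cball (0::'g) (real n)) \<noteq> \<infinity>" for n
    using emeasure_compact[OF compact_cball, of 0 "real n"] by auto
  ultimately show "\<exists>A. countable A \<and> A \<subseteq> sets M \<and> \<Union>A = space M \<and> (\<forall>a\<in>A. emeasure M a \<noteq> \<infinity>)"
    by (intro exI[of _ "range (\<lambda>n::nat. cball (0::'g) (real n))"]) auto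
qed

sublocale sigma_finite_measure M by (rule sigma_finite)

sublocale pair_sigma_finite M M ..

lemma measurable_pairM:
  fixes f :: "'g \<times> 'g \<Rightarrow> 'c::topological_space"
  assumes "continuous_on UNIV f"
  shows "f \<in> borel_measurable (borel \<Otimes>\<^sub>M borel)"
proof -
  obtain B :: "'g set set" where "countable B" "topological_basis B"
    by (rule proper_countable_basis[OF compact_cball])
  then show ?thesis using assms by (rule continuous_pair_borel_measurable)
qed

lemma measurable_dist [measurable]: "(\<lambda>(x::'g, y). dist x y) \<in> borel_measurable (borel \<Otimes>\<^sub>M borel)"
  by (rule measurable_pairM) (auto intro!: continuous_intros simp: split_beta')

lemma measurable_plus [measurable]: "(\<lambda>(x::'g, y). x + y) \<in> borel_measurable (borel \<Otimes>\<^sub>M borel)"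
  by (rule measurable_pairM) (auto intro!: continuous_intros simp: split_beta')

lemma measurable_minus [measurable]: "(uminus :: 'g \<Rightarrow> 'g) \<in> borel_measurable borel"
  by (intro borel_measurable_continuous_onI continuous_intros)

text \<open>One null ball would make its left translates null, hence all balls of that radius, and
  countably many of these cover the group.\<close>

lemma emeasure_ball_pos:
  assumes "r > 0" shows "emeasure M (ball x r) > 0"
proof (rule ccontr)
  assume "\<not> ?thesis"
  then have 0: "emeasure M (ball x r) = 0" by simp
  have eq: "emeasure M (ball (g + x) r) = 0" for g
  proof -
    have "emeasure M (ball (g + x) r) = (\<integral>\<^sup>+y. indicator (ball (g + x) r) y \<partial>M)" by simp
    also have "\<dots> = (\<integral>\<^sup>+y. indicator (ball (g + x) r) (g + y) \<partial>M)"
      by (subst nn_integral_left) (auto intro!: borel_measurable_indicator)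
    also have "\<dots> = (\<integral>\<^sup>+y. indicator (ball x r) y \<partial>M)"
      by (intro nn_integral_cong) (auto simp: indicator_def dist_left)
    finally show ?thesis using 0 by simp
  qed
  obtain D :: "'g set" where D: "countable D" "\<And>x e. e > 0 \<Longrightarrow> \<exists>y\<in>D. dist y x < e"
    by (rule proper_countable_dense[OF compact_cball]) blast
  have null: "ball y r \<in> null_sets M" for y using eq[of "y - x"] by (auto simp: null_sets_def)
  have "(\<Union>y\<in>D. ball y r) \<in> null_sets M" by (rule null_sets_UN'[OF D(1) null])
  then have "emeasure M (\<Union>y\<in>D. ball y r) = 0" by (simp add: null_sets_def)
  moreover have "(\<Union>y\<in>D. ball y r) = UNIV" using D(2)[OF assms] by (auto simp: dist_commute)
  ultimately show False using unimodular by (simp add: unimodular_haar_def haar_measure_def)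
qed

text \<open>Both sides of \<open>(\<integral>\<^sup>+x. f (- x)) \<cdot> |B| = (\<integral>\<^sup>+x. f x) \<cdot> |B|\<close> equal
  \<open>\<integral>\<integral> f (- x) \<cdot> 1\<^sub>B (x + y)\<close>.\<close>

lemma nn_integral_inversion:
  assumes [measurable]: "f \<in> borel_measurable borel"
  shows "(\<integral>\<^sup>+x. f (- x) \<partial>M) = (\<integral>\<^sup>+x. f x \<partial>M)"
proof -
  define B where "B = cball (0::'g) 1"
  have [measurable]: "B \<in> sets borel" by (simp add: B_def)
  have "emeasure M B \<ge> emeasure M (ball 0 1)" unfolding B_def by (intro emeasure_mono) auto
  then have B: "emeasure M B \<noteq> 0" "emeasure M B \<noteq> \<infinity>"
    using emeasure_ball_pos[of 1 0] emeasure_compact[OF compact_cball, of 0 1] by (auto simp: B_def)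
  have mpm [measurable]: "(\<lambda>p::'g \<times> 'g. fst p + snd p) \<in> borel_measurable (borel \<Otimes>\<^sub>M borel)"
    using measurable_plus by (simp add: split_beta')
  have m2: "(\<lambda>p::'g \<times> 'g. f (- fst p) * indicator B (fst p + snd p)) \<in> borel_measurable (M \<Otimes>\<^sub>M M)"
    by measurable
  have "(\<integral>\<^sup>+x. f (- x) \<partial>M) * emeasure M B = (\<integral>\<^sup>+x. f (- x) * (\<integral>\<^sup>+y. indicator B y \<partial>M) \<partial>M)"
    by (simp add: nn_integral_multc)
  also have "\<dots> = (\<integral>\<^sup>+x. f (- x) * (\<integral>\<^sup>+(y::'g). indicator B (x + y) \<partial>M) \<partial>M)"
    using nn_integral_left[of "indicator B"] by simp
  also have "\<dots> = (\<integral>\<^sup>+x. \<integral>\<^sup>+(y::'g). f (- x) * indicator B (x + y) \<partial>M \<partial>M)"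
    by (intro nn_integral_cong nn_integral_cmult[symmetric]) measurable
  also have "\<dots> = (\<integral>\<^sup>+(y::'g). \<integral>\<^sup>+x. f (- x) * indicator B (x + y) \<partial>M \<partial>M)"
    using Fubini'[of "\<lambda>x y::'g. f (- x) * indicator B (x + y)"] m2 by (simp add: split_beta')
  \<comment> \<open>Right translation by \<open>y\<close>; the identity
    \<open>y - (x + y) = - x\<close> holds without commutativity.\<close>
  also have "\<dots> = (\<integral>\<^sup>+(y::'g). \<integral>\<^sup>+x. f (y - x) * indicator B x \<partial>M \<partial>M)"
  proof (rule nn_integral_cong)
    fix y :: 'g
    have [measurable]: "(\<lambda>x. y - x) \<in> borel_measurable borel"
      by (intro borel_measurable_continuous_onI continuous_intros)
    show "(\<integral>\<^sup>+x. f (- x) * indicator B (x + y) \<partial>M) = (\<integral>\<^sup>+x. f (y - x) * indicator B x \<partial>M)"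
      using nn_integral_right[of "\<lambda>x. f (y - x) * indicator B x" y]
      by (simp add: diff_add_eq_diff_diff_swap)
  qed
  also have "\<dots> = (\<integral>\<^sup>+x. \<integral>\<^sup>+(y::'g). f (y - x) * indicator B x \<partial>M \<partial>M)"
  proof -
    have [measurable]: "(\<lambda>p::'g \<times> 'g. snd p - fst p) \<in> borel_measurable (borel \<Otimes>\<^sub>M borel)"
      by (rule measurable_pairM) (auto intro!: continuous_intros)
    have [measurable]: "(\<lambda>p::'g \<times> 'g. f (snd p - fst p) * indicator B (fst p)) \<in> borel_measurable (M \<Otimes>\<^sub>M M)"
      by measurable
    show ?thesis using Fubini'[of "\<lambda>x y::'g. f (y - x) * indicator B x"] by (simp add: split_beta')
  qed
  also have "\<dots> = (\<integral>\<^sup>+x. (\<integral>\<^sup>+y. f y \<partial>M) * indicator B x \<partial>M)"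
  proof (rule nn_integral_cong)
    fix x :: 'g
    have [measurable]: "(\<lambda>y. y - x) \<in> borel_measurable borel"
      by (intro borel_measurable_continuous_onI continuous_intros)
    show "(\<integral>\<^sup>+y. f (y - x) * indicator B x \<partial>M) = (\<integral>\<^sup>+y. f y \<partial>M) * indicator B x"
      using nn_integral_right[of f "- x"] by (simp add: nn_integral_multc)
  qed
  also have "\<dots> = (\<integral>\<^sup>+y. f y \<partial>M) * emeasure M B" by (simp add: nn_integral_cmult)
  finally show ?thesis using B by (simp add: mult.commute[of _ "emeasure M B"] ennreal_mult_cancel_left)
qed

end

section \<open>Averaging with a tent kernel\<close>

definition (in -) kern :: "real \<Rightarrow> 'a::metric_space \<Rightarrow> 'a \<Rightarrow> real" where
  "kern L x y = max 0 (L - dist x y)"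

lemma (in -) kern_nonneg [simp]: "0 \<le> kern L x y" by (simp add: kern_def)
lemma (in -) kern_le: "L \<ge> 0 \<Longrightarrow> kern L x y \<le> L" by (simp add: kern_def)
lemma (in -) kern_sym: "kern L x y = kern L y x" by (simp add: kern_def dist_commute)
lemma (in -) kern_zero: "L \<le> dist x y \<Longrightarrow> kern L x y = 0" by (simp add: kern_def)
lemma (in -) kern_lip: "\<bar>kern L x y - kern L x' y\<bar> \<le> dist x x'"
  using dist_triangle[of x y x'] dist_triangle[of x' y x] by (auto simp: kern_def dist_commute max_def)
lemma (in -) kern_cont [continuous_intros]:
  "continuous_on S f \<Longrightarrow> continuous_on S g \<Longrightarrow> continuous_on S (\<lambda>x. kern L (f x) (g x))"
  unfolding kern_def by (intro continuous_intros)

context haar_metric_group begin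

lemma kern_left: "kern L (g + x) (g + y :: 'g) = kern L x y"
  by (simp add: kern_def dist_left)

lemma kern_measurable [measurable]:
  "(\<lambda>(x::'g, y). kern L x y) \<in> borel_measurable (borel \<Otimes>\<^sub>M borel)"
  by (rule measurable_pairM) (auto intro!: continuous_intros simp: split_beta')

lemma integrable_cont_bounded:
  fixes f :: "'g \<Rightarrow> real"
  assumes "continuous_on UNIV f" "\<And>x. r < dist a x \<Longrightarrow> f x = 0"
  shows "integrable M f"
proof -
  have "compact (f ` cball a r)"
    using assms(1) by (intro compact_continuous_image compact_cball) (auto intro: continuous_on_subset)
  then have "bounded (f ` cball a r)" by (rule compact_imp_bounded)
  then obtain B where B: "\<And>x. x \<in> cball a r \<Longrightarrow> norm (f x) \<le> B"
    unfolding bounded_iff by blast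
  show ?thesis
  proof (rule integrableI_bounded_set[where A = "cball a r" and B = B])
    show "f \<in> borel_measurable M" using assms(1) by (simp add: borel_measurable_continuous_onI measurable_cong_sets[OF sets_M refl])
    show "emeasure M (cball a r) < \<infinity>" by (rule emeasure_compact[OF compact_cball])
  qed (use B assms(2) in auto)
qed

definition Cc :: "('g \<Rightarrow> real) set" where
  "Cc = {f. continuous_on UNIV f \<and> (\<forall>x. 0 \<le> f x) \<and> (\<exists>r. \<forall>x. r < dist 0 x \<longrightarrow> f x = 0)}"

lemma CcD: assumes "f \<in> Cc"
  shows "continuous_on UNIV f" "0 \<le> f x" "\<exists>r. \<forall>x. r < dist 0 x \<longrightarrow> f x = 0" "integrable M f"
    "f \<in> borel_measurable borel"
  using assms integrable_cont_bounded[of f _ 0] by (auto simp: Cc_def intro: borel_measurable_continuous_onI)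

lemma Cc_mult: "f \<in> Cc \<Longrightarrow> continuous_on UNIV g \<Longrightarrow> (\<And>x. 0 \<le> g x) \<Longrightarrow> (\<lambda>x. g x * f x) \<in> Cc"
  unfolding Cc_def by (auto intro!: continuous_intros)

lemma Cc_add: assumes "f \<in> Cc" "g \<in> Cc" shows "(\<lambda>x. f x + g x) \<in> Cc"
proof -
  obtain r s where "\<forall>x. r < dist 0 x \<longrightarrow> f x = 0" "\<forall>x. s < dist 0 x \<longrightarrow> g x = 0"
    using CcD(3)[OF assms(1)] CcD(3)[OF assms(2)] by auto
  then have "\<forall>x. max r s < dist 0 x \<longrightarrow> f x + g x = 0" by simp
  then have "\<exists>r. \<forall>x. r < dist 0 x \<longrightarrow> f x + g x = 0" by blast
  moreover have "continuous_on UNIV (\<lambda>x. f x + g x)" "\<forall>x. 0 \<le> f x + g x"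
    using CcD(1,2)[OF assms(1)] CcD(1,2)[OF assms(2)] by (auto intro!: continuous_intros)
  ultimately show ?thesis unfolding Cc_def by simp
qed

lemma Cc_cmult: "f \<in> Cc \<Longrightarrow> 0 \<le> c \<Longrightarrow> (\<lambda>x. c * f x) \<in> Cc"
  by (rule Cc_mult) auto

lemma Cc_sq: "f \<in> Cc \<Longrightarrow> (\<lambda>x. (f x)\<^sup>2) \<in> Cc"
  using Cc_mult[of f f] CcD(1,2)[of f] by (auto simp: power2_eq_square)

lemma kern_Cc: "kern L a \<in> Cc" for a :: 'g
proof -
  have "kern L a x = 0" if "dist 0 a + L < dist 0 x" for x
    using dist_triangle[of 0 x a] that by (intro kern_zero) simp
  then show ?thesis unfolding Cc_def by (auto intro!: continuous_intros)
qed

definition Z :: "real \<Rightarrow> real" where "Z L = (\<integral>y. kern L (0::'g) y \<partial>M)"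

lemma integrable_kern: "integrable M (kern L a)" for a :: 'g by (rule CcD(4)[OF kern_Cc])

lemma nn_integral_kern: "(\<integral>\<^sup>+y. ennreal (kern L a y) \<partial>M) = ennreal (Z L)" for a :: 'g
proof -
  have "(\<integral>\<^sup>+y. ennreal (kern L a y) \<partial>M) = (\<integral>\<^sup>+y. ennreal (kern L a (a + y)) \<partial>M)"
    by (rule nn_integral_left[symmetric]) (auto intro!: borel_measurable_continuous_onI continuous_intros measurable_compose[OF _ measurable_ennreal])
  also have "\<dots> = (\<integral>\<^sup>+y. ennreal (kern L 0 y) \<partial>M)"
    using kern_left[of L a 0] by simp
  also have "\<dots> = ennreal (Z L)" unfolding Z_def
    by (rule nn_integral_eq_integral) (auto intro: integrable_kern)
  finally show ?thesis .
qed

lemma integral_kern: "(\<integral>y. kern L a y \<partial>M) = Z L" for a :: 'g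
  using nn_integral_kern[of L a] nn_integral_eq_integral[OF integrable_kern[of L a]]
  by (simp add: Z_def)

lemma Z_pos: assumes "L > 0" shows "Z L > 0"
proof -
  have "0 < ennreal (L / 2) * emeasure M (ball 0 (L / 2))"
    using assms emeasure_ball_pos[of "L / 2" 0] by (simp add: ennreal_zero_less_mult_iff)
  also have "\<dots> = (\<integral>\<^sup>+y. ennreal (L / 2) * indicator (ball 0 (L / 2)) y \<partial>M)"
    by (subst nn_integral_cmult_indicator) auto
  also have "\<dots> \<le> (\<integral>\<^sup>+y. ennreal (kern L 0 y) \<partial>M)"
    by (intro nn_integral_mono) (auto simp: indicator_def kern_def intro!: ennreal_leI)
  finally show ?thesis unfolding nn_integral_kern by simp
qed

text \<open>The transition operator of a random walk with step density proportional to the tent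
  \<open>kern L\<close>. The tent stands in for the indicator of a ball because it is Lipschitz, so
  that averages are continuous. Its symmetry makes the operator symmetric, and its left invariance
  makes the normalisation \<open>Z L\<close> independent of \<open>x\<close>.\<close>

definition A :: "real \<Rightarrow> ('g \<Rightarrow> real) \<Rightarrow> 'g \<Rightarrow> real" where
  "A L f x = (\<integral>y. kern L x y * f y \<partial>M) / Z L"

lemma integrable_kern_mult:
  assumes "continuous_on UNIV f" shows "integrable M (\<lambda>y. kern L x y * f y)"
proof -
  obtain r where "\<forall>y. r < dist 0 y \<longrightarrow> kern L x y = 0" using CcD(3)[OF kern_Cc] by metis
  then show ?thesis using assms
    by (intro integrable_cont_bounded[of _ r 0]) (auto intro!: continuous_intros)
qed

lemma A_nonneg: "f \<in> Cc \<Longrightarrow> L > 0 \<Longrightarrow> 0 \<le> A L f x"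
  unfolding A_def using CcD(2)[of f] Z_pos[of L] by (auto intro!: divide_nonneg_pos integral_nonneg_AE AE_I2)

lemma A_lip: assumes "f \<in> Cc" "L > 0"
  shows "\<bar>A L f x - A L f x'\<bar> \<le> (\<integral>y. f y \<partial>M) / Z L * dist x x'"
proof -
  have "\<bar>(\<integral>y. kern L x y * f y \<partial>M) - (\<integral>y. kern L x' y * f y \<partial>M)\<bar> = \<bar>\<integral>y. kern L x y * f y - kern L x' y * f y \<partial>M\<bar>"
    using CcD(1)[OF assms(1)] by (simp add: integrable_kern_mult)
  also have "\<dots> \<le> (\<integral>y. \<bar>kern L x y * f y - kern L x' y * f y\<bar> \<partial>M)"
    by (rule integral_abs_bound)
  also have "\<dots> \<le> (\<integral>y. dist x x' * f y \<partial>M)"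
  proof (rule integral_mono)
    fix y show "\<bar>kern L x y * f y - kern L x' y * f y\<bar> \<le> dist x x' * f y"
      using mult_right_mono[OF kern_lip[of L x y x'] CcD(2)[OF assms(1), of y]] CcD(2)[OF assms(1), of y]
      by (simp add: left_diff_distrib[symmetric] abs_mult)
  qed (use CcD[OF assms(1)] in \<open>auto intro!: integrable_kern_mult\<close>)
  finally have "\<bar>(\<integral>y. kern L x y * f y \<partial>M) - (\<integral>y. kern L x' y * f y \<partial>M)\<bar> \<le> dist x x' * (\<integral>y. f y \<partial>M)"
    by simp
  moreover have "\<bar>A L f x - A L f x'\<bar> = \<bar>(\<integral>y. kern L x y * f y \<partial>M) - (\<integral>y. kern L x' y * f y \<partial>M)\<bar> / Z L"
    using Z_pos[OF assms(2)] by (simp add: A_def diff_divide_distrib[symmetric])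
  ultimately show ?thesis using Z_pos[OF assms(2)] by (simp add: field_simps)
qed

lemma A_Cc: assumes "f \<in> Cc" "L > 0" shows "A L f \<in> Cc"
proof -
  have "continuous_on UNIV (A L f)"
  proof (rule lipschitz_on_continuous_on)
    show "((\<integral>y. f y \<partial>M) / Z L)-lipschitz_on UNIV (A L f)"
      using A_lip[OF assms] Z_pos[OF assms(2)] CcD(2)[OF assms(1)]
      by (intro lipschitz_onI divide_nonneg_pos integral_nonneg_AE) (auto simp: dist_real_def intro!: AE_I2)
  qed
  moreover obtain r where r: "\<forall>x. r < dist 0 x \<longrightarrow> f x = 0" using CcD(3)[OF assms(1)] by auto
  have "A L f x = 0" if "r + L < dist 0 x" for x
  proof -
    have "kern L x y * f y = 0" for y
      using r that dist_triangle[of 0 x y] kern_zero[of L x y] by (cases "r < dist 0 y") (auto simp: dist_commute)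
    then have "(\<lambda>y. kern L x y * f y) = (\<lambda>_. 0)" by (rule ext)
    then show ?thesis by (simp add: A_def)
  qed
  ultimately show ?thesis using A_nonneg[OF assms] by (auto simp: Cc_def)
qed

lemma ennreal_A: assumes "f \<in> Cc" "L > 0"
  shows "ennreal (A L f x) = (\<integral>\<^sup>+y. ennreal (kern L x y * f y) \<partial>M) / ennreal (Z L)"
  using Z_pos[OF assms(2)] CcD(1,2)[OF assms(1)] unfolding A_def
  by (subst nn_integral_eq_integral[OF integrable_kern_mult])
     (auto simp: divide_ennreal intro!: integral_nonneg_AE)

text \<open>By symmetry of the kernel the mass sent out by a point \<open>y\<close> is again
  \<open>Z L\<close>, and Tonelli's theorem turns this into conservation of the integral.\<close>

lemma integral_A: assumes f: "f \<in> Cc" and L: "L > 0" shows "(\<integral>x. A L f x \<partial>M) = (\<integral>x. f x \<partial>M)"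
proof -
  note [measurable] = CcD(5)[OF f] CcD(5)[OF A_Cc[OF f L]]
  have "(\<integral>\<^sup>+x. ennreal (A L f x) \<partial>M) = (\<integral>\<^sup>+x. \<integral>\<^sup>+y. ennreal (kern L x y * f y) \<partial>M \<partial>M) / ennreal (Z L)"
    unfolding ennreal_A[OF f L] by (rule nn_integral_divide) measurable
  also have "(\<integral>\<^sup>+x. \<integral>\<^sup>+y. ennreal (kern L x y * f y) \<partial>M \<partial>M) = (\<integral>\<^sup>+y. \<integral>\<^sup>+x. ennreal (kern L x y * f y) \<partial>M \<partial>M)"
    by (rule Fubini'[symmetric]) measurable
  also have "\<dots> = (\<integral>\<^sup>+y. ennreal (Z L) * ennreal (f y) \<partial>M)"
  proof (rule nn_integral_cong)
    fix y
    have "(\<integral>\<^sup>+x. ennreal (kern L x y * f y) \<partial>M) = (\<integral>\<^sup>+x. ennreal (kern L y x) * ennreal (f y) \<partial>M)"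
      using CcD(2)[OF f] by (intro nn_integral_cong) (simp add: ennreal_mult kern_sym)
    also have "\<dots> = ennreal (Z L) * ennreal (f y)"
      by (subst nn_integral_multc) (auto simp: nn_integral_kern)
    finally show "(\<integral>\<^sup>+x. ennreal (kern L x y * f y) \<partial>M) = ennreal (Z L) * ennreal (f y)" .
  qed
  also have "\<dots> = ennreal (Z L) * (\<integral>\<^sup>+y. ennreal (f y) \<partial>M)" by (rule nn_integral_cmult) measurable
  also have "\<dots> / ennreal (Z L) = (\<integral>\<^sup>+y. ennreal (f y) \<partial>M)"
    using Z_pos[OF L] by (subst mult.commute, intro mult_divide_eq_ennreal) auto
  finally show ?thesis
    using nn_integral_eq_integral[OF CcD(4)[OF f]] nn_integral_eq_integral[OF CcD(4)[OF A_Cc[OF f L]]]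
      CcD(2)[OF f] A_nonneg[OF f L] by (simp add: integral_nonneg_AE)
qed

text \<open>Expansion of the square. For \<open>c = A L f y\<close> the left side is the variance of
  \<open>f\<close> under the averaging weights, whose nonnegativity is Jensen's inequality
  \<open>A_sq_le\<close>; \<open>A_compare\<close> takes for \<open>c\<close> an average over a
  larger radius at a nearby point.\<close>

lemma variance_identity:
  assumes f: "continuous_on UNIV f" and L: "L > 0"
  shows "(\<integral>z. kern L y z * (f z - c)\<^sup>2 \<partial>M) / Z L = A L (\<lambda>z. (f z)\<^sup>2) y - 2 * c * A L f y + c\<^sup>2"
proof -
  have "(\<integral>z. kern L y z * (f z - c)\<^sup>2 \<partial>M) =
      (\<integral>z. kern L y z * (f z)\<^sup>2 - (2 * c) * (kern L y z * f z) + c\<^sup>2 * kern L y z \<partial>M)"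
    by (intro Bochner_Integration.integral_cong) (auto simp: power2_eq_square algebra_simps)
  also have "\<dots> = (\<integral>z. kern L y z * (f z)\<^sup>2 \<partial>M) - (2 * c) * (\<integral>z. kern L y z * f z \<partial>M) + c\<^sup>2 * (\<integral>z. kern L y z \<partial>M)"
    using f by (simp add: integrable_kern_mult integrable_kern continuous_intros)
  finally show ?thesis using Z_pos[OF L] by (simp add: A_def integral_kern field_simps)
qed

lemma A_sq_le: assumes "f \<in> Cc" "L > 0"
  shows "(A L f x)\<^sup>2 \<le> A L (\<lambda>z. (f z)\<^sup>2) x"
proof -
  have "0 \<le> (\<integral>z. kern L x z * (f z - A L f x)\<^sup>2 \<partial>M) / Z L"
    using Z_pos[OF assms(2)] by (intro divide_nonneg_pos integral_nonneg_AE) auto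
  then show ?thesis using variance_identity[OF CcD(1)[OF assms(1)] assms(2), of x "A L f x"]
    by (simp add: power2_eq_square)
qed

text \<open>With \<open>c = A\<^sub>L f x\<close>, both \<open>k\<^sub>1(y, \<cdot>) \<le> k\<^sub>L(x, \<cdot>)\<close> and Jensen's inequality compare the
  average of \<open>f\<close> near \<open>y\<close> with \<open>c\<close>.\<close>

lemma A_compare:
  assumes f: "f \<in> Cc" and L: "0 < L1" "L1 + R \<le> L / 2" "dist x y \<le> R"
  shows "(A L1 f y - A L f x)\<^sup>2 \<le> Z L / Z L1 * (A L (\<lambda>z. (f z)\<^sup>2) x - (A L f x)\<^sup>2)"
    and "A L1 f y \<le> Z L / Z L1 * A L f x"
proof -
  have R: "R \<ge> 0" using L(3) zero_le_dist[of x y] by linarith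
  then have L0: "L > 0" using L by linarith
  \<comment> \<open>By the triangle inequality \<open>L - dist x z\<close> is at least
    \<open>(L - R) - dist y z\<close>, and \<open>L - R\<close> is at least
    \<open>L1\<close>.\<close>
  have le: "kern L1 y z \<le> kern L x z" for z
    using dist_triangle[of x z y] L R by (auto simp: kern_def max_def)
  have fc: "continuous_on UNIV f" by (rule CcD(1)[OF f])
  define c where "c = A L f x"
  have "(A L1 f y - c)\<^sup>2 \<le> (\<integral>z. kern L1 y z * (f z - c)\<^sup>2 \<partial>M) / Z L1"
    using A_sq_le[OF f L(1), of y] unfolding variance_identity[OF fc L(1)]
    by (simp add: power2_eq_square algebra_simps)
  also have "\<dots> \<le> (\<integral>z. kern L x z * (f z - c)\<^sup>2 \<partial>M) / Z L1"
    using Z_pos[OF L(1)] fc le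
    by (intro divide_right_mono integral_mono integrable_kern_mult mult_right_mono)
       (auto intro!: continuous_intros)
  also have "\<dots> = Z L / Z L1 * ((\<integral>z. kern L x z * (f z - c)\<^sup>2 \<partial>M) / Z L)"
    using Z_pos[OF L0] by simp
  also have "\<dots> = Z L / Z L1 * (A L (\<lambda>z. (f z)\<^sup>2) x - (A L f x)\<^sup>2)"
    unfolding variance_identity[OF fc L0] c_def by (simp add: power2_eq_square)
  finally show "(A L1 f y - A L f x)\<^sup>2 \<le> Z L / Z L1 * (A L (\<lambda>z. (f z)\<^sup>2) x - (A L f x)\<^sup>2)"
    by (simp add: c_def)
  have "A L1 f y \<le> (\<integral>z. kern L x z * f z \<partial>M) / Z L1"
    unfolding A_def using Z_pos[OF L(1)] fc le CcD(2)[OF f]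
    by (intro divide_right_mono integral_mono integrable_kern_mult mult_right_mono) auto
  also have "\<dots> = Z L / Z L1 * A L f x" using Z_pos[OF L0] by (simp add: A_def)
  finally show "A L1 f y \<le> Z L / Z L1 * A L f x" .
qed

end

section \<open>Foelner sets as level sets\<close>

definition (in -) thickening :: "real \<Rightarrow> 'a::metric_space set \<Rightarrow> 'a set" where
  "thickening R I = {x. \<exists>y\<in>I. dist x y \<le> R}"

context haar_metric_group begin

lemma pair_lborel: "pair_sigma_finite lborel M"
  by (simp add: pair_sigma_finite_def sigma_finite sigma_finite_lborel)

text \<open>\<open>G x - F x\<close> is the length of the half-open interval from \<open>F x\<close>
  to \<open>G x\<close>; Tonelli's theorem exchanges levels and points.\<close>

lemma layer_cake:
  assumes F: "F \<in> borel_measurable borel" "G \<in> borel_measurable borel" "\<And>x::'g. F x \<le> G x"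
  shows "(\<integral>\<^sup>+t. emeasure M {x. F x < t \<and> t \<le> G x} \<partial>lborel) = (\<integral>\<^sup>+x. ennreal (G x - F x) \<partial>M)"
proof -
  interpret P: pair_sigma_finite lborel M by (rule pair_lborel)
  note [measurable] = F(1,2)
  have "(\<integral>\<^sup>+t. emeasure M {x. F x < t \<and> t \<le> G x} \<partial>lborel)
      = (\<integral>\<^sup>+t. (\<integral>\<^sup>+x. indicator {x. F x < t \<and> t \<le> G x} x \<partial>M) \<partial>lborel)"
    by (intro nn_integral_cong nn_integral_indicator[symmetric]) simp
  also have "\<dots> = (\<integral>\<^sup>+t. (\<integral>\<^sup>+x. indicator {F x<..G x} t \<partial>M) \<partial>lborel)"
    by (intro nn_integral_cong) (auto simp: indicator_def)
  also have "\<dots> = (\<integral>\<^sup>+x. (\<integral>\<^sup>+t. indicator {F x<..G x} t \<partial>lborel) \<partial>M)"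
  proof (rule P.Fubini'[symmetric])
    have "(\<lambda>(t, x). indicator {F x<..G x} t :: ennreal) = (\<lambda>p. if F (snd p) < fst p \<and> fst p \<le> G (snd p) then 1 else 0)"
      by (auto simp: fun_eq_iff indicator_def)
    also have "\<dots> \<in> borel_measurable (lborel \<Otimes>\<^sub>M M)" by measurable
    finally show "(\<lambda>(t, x). indicator {F x<..G x} t :: ennreal) \<in> borel_measurable (lborel \<Otimes>\<^sub>M M)" .
  qed
  also have "\<dots> = (\<integral>\<^sup>+x. ennreal (G x - F x) \<partial>M)"
    using F(3) by (intro nn_integral_cong) simp
  finally show ?thesis .
qed

text \<open>A point \<open>x\<close> that lies in the thickening of the level set
  \<open>{F \<ge> t}\<close> but not in the level set satisfies
  \<open>F x < t \<le> F x + W x\<close>. If all level sets had a large boundary, integration over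
  \<open>t\<close> with \<open>layer_cake\<close> on both sides would bound \<open>eps\<close> times
  the integral of \<open>F\<close> by the integral of \<open>W\<close>.\<close>

lemma emeasure_le_imp_coarea:
  assumes F: "F \<in> Cc" and W: "W \<in> Cc" and R: "R \<ge> 0" and eps: "eps > 0"
    and osc: "\<And>x y. dist x y \<le> R \<Longrightarrow> F y - F x \<le> W x"
    and less: "(\<integral>x. W x \<partial>M) < eps * (\<integral>x. F x \<partial>M)"
  shows "\<exists>I. compact I \<and> emeasure M I \<noteq> 0 \<and> emeasure M (thickening R I - I) \<le> ennreal eps * emeasure M I"
proof (rule ccontr)
  assume neg: "\<not> ?thesis"
  define S where "S t = {x. t \<le> F x}" for t
  note [measurable] = CcD(5)[OF F] CcD(5)[OF W]
  have cS: "compact (S t)" if t: "t > 0" for t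
  proof -
    obtain r where r: "\<forall>x. r < dist 0 x \<longrightarrow> F x = 0" using CcD(3)[OF F] by auto
    have "closed (S t)" unfolding S_def by (intro closed_Collect_le CcD(1)[OF F] continuous_intros)
    moreover have "S t \<subseteq> cball 0 r" using r t by (auto simp: S_def not_less[symmetric])
    ultimately show ?thesis using compact_Int_closed[OF compact_cball[of 0 r], of "S t"] by (simp add: Int_absorb1)
  qed
  have S_le: "ennreal eps * emeasure M {x. 0 < t \<and> t \<le> F x} \<le> emeasure M {x. F x < t \<and> t \<le> F x + W x}" for t
  proof (cases "0 < t")
    case True
    have "ennreal eps * emeasure M (S t) \<le> emeasure M (thickening R (S t) - S t)"
      using neg cS[OF True] by (cases "emeasure M (S t) = 0") (auto simp: not_le)
    also have "\<dots> \<le> emeasure M {x. F x < t \<and> t \<le> F x + W x}"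
    proof (rule emeasure_mono)
      show "thickening R (S t) - S t \<subseteq> {x. F x < t \<and> t \<le> F x + W x}"
        using osc by (fastforce simp: S_def thickening_def not_le)
    qed simp
    finally show ?thesis using True by (simp add: S_def)
  qed simp
  have iF: "(\<integral>\<^sup>+t. emeasure M {x. 0 < t \<and> t \<le> F x} \<partial>lborel) = ennreal (\<integral>x. F x \<partial>M)"
    using layer_cake[of "\<lambda>_. 0" F] CcD(2)[OF F] nn_integral_eq_integral[OF CcD(4)[OF F]] by simp
  have "ennreal (eps * (\<integral>x. F x \<partial>M)) = ennreal eps * (\<integral>\<^sup>+t. emeasure M {x. 0 < t \<and> t \<le> F x} \<partial>lborel)"
    unfolding iF using eps CcD(2)[OF F] by (simp add: ennreal_mult integral_nonneg_AE)
  also have "\<dots> = (\<integral>\<^sup>+t. ennreal eps * emeasure M {x. 0 < t \<and> t \<le> F x} \<partial>lborel)"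
  proof (rule nn_integral_cmult[symmetric])
    have "{p \<in> space (lborel \<Otimes>\<^sub>M M). 0 < fst p \<and> fst p \<le> F (snd p)} \<in> sets (lborel \<Otimes>\<^sub>M M)" by measurable
    from sigma_finite_measure.measurable_emeasure_Pair[OF sigma_finite this] show "(\<lambda>t. emeasure M {x. 0 < t \<and> t \<le> F x}) \<in> borel_measurable lborel"
      by (simp add: vimage_def space_pair_measure)
  qed
  also have "\<dots> \<le> (\<integral>\<^sup>+t. emeasure M {x. F x < t \<and> t \<le> F x + W x} \<partial>lborel)"
    by (intro nn_integral_mono S_le)
  also have "\<dots> = ennreal (\<integral>x. W x \<partial>M)"
    using layer_cake[of F "\<lambda>x. F x + W x"] CcD(2)[OF W] nn_integral_eq_integral[OF CcD(4)[OF W]] by simp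
  finally have "eps * (\<integral>x. F x \<partial>M) \<le> (\<integral>x. W x \<partial>M)"
    using CcD(2)[OF W] by (simp add: integral_nonneg_AE)
  with less show False by simp
qed

text \<open>A function whose \<open>L\<^sup>2\<close>-norm is almost preserved by averaging has an almost invariant
  square, whose level sets provide the required set.\<close>

lemma foelner_of_almost_invariant:
  assumes R: "R \<ge> 0" and eps: "eps > 0" and L: "L = 2 * (1 + R)"
  shows "\<exists>\<eta>>0. \<eta> < 1 \<and> (\<forall>f\<in>Cc. (\<integral>x. (f x)\<^sup>2 \<partial>M) > 0 \<longrightarrow>
      (\<integral>x. (A L f x)\<^sup>2 \<partial>M) \<ge> (1 - \<eta>) * (\<integral>x. (f x)\<^sup>2 \<partial>M) \<longrightarrow>
      (\<exists>I. compact I \<and> emeasure M I \<noteq> 0 \<and> emeasure M (thickening R I - I) \<le> ennreal eps * emeasure M I))"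
proof -
  have L0: "L > 0" using L R by simp
  define C where "C = Z L / Z 1"
  have C: "C > 0" using Z_pos[OF L0] Z_pos[of 1] by (simp add: C_def)
  \<comment> \<open>The first bound gives \<open>2 * C * (1 + C) * d \<le> eps / 8\<close>, which
    controls the integral of \<open>W\<close>; the second gives
    \<open>\<eta> * (1 / 2 + C) \<le> 1 / 4\<close>, which keeps the integral of \<open>F\<close>
    above \<open>N / 4\<close>. The choice \<open>\<eta> = d\<^sup>2\<close> makes the variance term
    \<open>C / d * \<eta>\<close> of \<open>W\<close> linear in \<open>d\<close>.\<close>
  define d where "d = min (eps / (16 * C * (1 + C))) (1 / (2 * (1 + C)))"
  have d: "d > 0" "d \<le> eps / (16 * C * (1 + C))" "d \<le> 1 / (2 * (1 + C))" using eps C by (auto simp: d_def)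
  define \<eta> where "\<eta> = d\<^sup>2"
  have "d * (2 * (1 + C)) \<le> 1" using d(3) C by (simp add: field_simps)
  then have dd: "2 * d + 2 * (d * C) \<le> 1" by (simp add: algebra_simps)
  have "d * C > 0" using d(1) C by simp
  then have d1: "d \<le> 1 / 2" "d * C \<le> 1 / 2" using dd d(1) by linarith+
  have \<eta>: "\<eta> > 0" "\<eta> \<le> d / 2" "\<eta> * C \<le> d / 2"
    using d(1) d1 mult_left_mono[OF d1(1), of d] mult_left_mono[OF d1(2), of d] by (auto simp: \<eta>_def power2_eq_square mult_ac)
  have \<eta>4: "\<eta> * (1 / 2 + C) \<le> 1 / 4"
  proof -
    have "\<eta> * (1 / 2 + C) \<le> d * (d + d * C)" using d(1) mult_nonneg_nonneg[of d d] unfolding \<eta>_def power2_eq_square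
      by (simp add: algebra_simps)
    also have "\<dots> \<le> (1 / 2) * (1 / 2)" using dd d1 d(1) C by (intro mult_mono) auto
    finally show ?thesis by simp
  qed
  show ?thesis
  proof (intro exI[of _ \<eta>] conjI ballI impI)
    show "\<eta> > 0" by (rule \<eta>)
    show "\<eta> < 1" using \<eta>(2) d1 d(1) by linarith
    fix f assume f: "f \<in> Cc" and pos: "(\<integral>x. (f x)\<^sup>2 \<partial>M) > 0"
      and ge: "(\<integral>x. (A L f x)\<^sup>2 \<partial>M) \<ge> (1 - \<eta>) * (\<integral>x. (f x)\<^sup>2 \<partial>M)"
    define N where "N = (\<integral>x. (f x)\<^sup>2 \<partial>M)"
    define v where "v x = A L (\<lambda>z. (f z)\<^sup>2) x - (A L f x)\<^sup>2" for x
    have ACc: "A L f \<in> Cc" "A L (\<lambda>z. (f z)\<^sup>2) \<in> Cc" "A 1 f \<in> Cc" using A_Cc f Cc_sq[OF f] L0 by auto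
    have v0: "0 \<le> v x" for x using A_sq_le[OF f L0, of x] by (simp add: v_def)
    have vCc: "v \<in> Cc"
    proof -
      obtain r where r: "\<forall>x. r < dist 0 x \<longrightarrow> A L (\<lambda>z. (f z)\<^sup>2) x = 0" using CcD(3)[OF ACc(2)] by auto
      have "v x = 0" if "r < dist 0 x" for x using r that v0[of x] unfolding v_def by (smt (verit) zero_le_power2)
      moreover have "continuous_on UNIV v" unfolding v_def[abs_def]
        using CcD(1)[OF ACc(1)] CcD(1)[OF ACc(2)] by (intro continuous_intros)
      ultimately show ?thesis using v0 unfolding Cc_def by auto
    qed
    have sqA: "integrable M (\<lambda>x. (A L f x)\<^sup>2)" "integrable M (\<lambda>x. (A 1 f x)\<^sup>2)"
      by (intro CcD(4) Cc_sq ACc)+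
    have iv: "(\<integral>x. v x \<partial>M) = N - (\<integral>x. (A L f x)\<^sup>2 \<partial>M)"
      unfolding v_def using CcD(4)[OF ACc(2)] sqA integral_A[OF Cc_sq[OF f] L0] by (simp add: N_def)
    have iv': "(\<integral>x. v x \<partial>M) \<le> \<eta> * N" using ge iv by (simp add: N_def algebra_simps)
    have iA: "(\<integral>x. (A L f x)\<^sup>2 \<partial>M) \<le> N" using iv integral_nonneg_AE[OF AE_I2[of M "\<lambda>x. 0 \<le> v x"]] v0 by simp
    have cmp: "(A 1 f y - A L f x)\<^sup>2 \<le> C * v x" "A 1 f y \<le> C * A L f x" if "dist x y \<le> R" for x y
      using A_compare[OF f, of 1 R L x y] that L unfolding C_def v_def by auto
    define F where "F x = (A 1 f x)\<^sup>2" for x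
    \<comment> \<open>The oscillation of the square \<open>F\<close> is a difference times a sum:
      both values of \<open>A 1 f\<close> are within the root of \<open>C * v x\<close> of
      \<open>A L f x\<close>, and each is at most \<open>C * A L f x\<close>. The product of these
      two bounds is split by the inequality of arithmetic and geometric mean with weight
      \<open>d\<close>.\<close>
    define W where "W x = 2 * C * (d * (A L f x)\<^sup>2 + C / d * v x)" for x
    have FCc: "F \<in> Cc" unfolding F_def[abs_def] by (intro Cc_sq ACc)
    have WCc: "W \<in> Cc" unfolding W_def[abs_def] using C d(1)
      by (intro Cc_cmult Cc_add Cc_sq ACc vCc) auto
    have "F y - F x \<le> W x" if xy: "dist x y \<le> R" for x y
    proof -
      define p where "p = sqrt (C * v x)"
      define q where "q = A L f x"
      have xx: "dist x x \<le> R" using R by simp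
      have p0: "p \<ge> 0" and p2: "p\<^sup>2 = C * v x" using C v0[of x] by (auto simp: p_def)
      have ay: "\<bar>A 1 f y - q\<bar> \<le> p" and ax: "\<bar>A 1 f x - q\<bar> \<le> p"
        using cmp(1)[OF xy] cmp(1)[OF xx] p2 p0 by (auto simp: q_def intro!: abs_le_square_iff[THEN iffD2, of _ p, simplified abs_of_nonneg[OF p0]])
      have n: "A 1 f y \<ge> 0" "A 1 f x \<ge> 0" using A_nonneg[OF f] by auto
      have "F y - F x = (A 1 f y - A 1 f x) * (A 1 f y + A 1 f x)" by (simp add: F_def power2_eq_square algebra_simps)
      also have "\<dots> \<le> (2 * p) * (2 * (C * q))"
      proof (rule mult_mono)
        show "A 1 f y - A 1 f x \<le> 2 * p" using ay ax by linarith
        show "A 1 f y + A 1 f x \<le> 2 * (C * q)" using cmp(2)[OF xy] cmp(2)[OF xx] by (simp add: q_def)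
      qed (use n p0 in auto)
      also have "\<dots> = 2 * C * (2 * p * q)" by simp
      also have "2 * p * q \<le> d * q\<^sup>2 + p\<^sup>2 / d"
      proof -
        have "0 \<le> (d * q - p)\<^sup>2 / d" using d(1) by simp
        also have "\<dots> = d * q\<^sup>2 + p\<^sup>2 / d - 2 * p * q" using d(1) by (simp add: power2_eq_square field_simps)
        finally show ?thesis by simp
      qed
      also have "2 * C * (d * q\<^sup>2 + p\<^sup>2 / d) = W x" by (simp add: W_def p2 q_def)
      finally show ?thesis using C by (simp add: mult_left_mono)
    qed
    moreover have "(\<integral>x. W x \<partial>M) < eps * (\<integral>x. F x \<partial>M)"
    proof -
      have "(\<integral>x. W x \<partial>M) = 2 * C * (d * (\<integral>x. (A L f x)\<^sup>2 \<partial>M) + C / d * (\<integral>x. v x \<partial>M))"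
        unfolding W_def using sqA CcD(4)[OF vCc] by simp
      also have "\<dots> \<le> 2 * C * (d * N + C / d * (\<eta> * N))"
        using C d(1) iA iv' by (intro mult_left_mono add_mono) auto
      also have "\<dots> = 2 * C * (1 + C) * d * N" using d(1) by (simp add: \<eta>_def power2_eq_square field_simps)
      also have "\<dots> \<le> eps / 8 * N"
      proof -
        have "0 < 16 * C * (1 + C)" using C by simp
        then have "d * (16 * C * (1 + C)) \<le> eps" using d(2) by (simp only: pos_le_divide_eq)
        then have "2 * C * (1 + C) * d \<le> eps / 8" by (simp add: algebra_simps)
        then show ?thesis using pos by (intro mult_right_mono) (auto simp: N_def)
      qed
      also have "\<dots> < eps * (N / 4)" using eps pos by (simp add: N_def)
      also have "\<dots> \<le> eps * (\<integral>x. F x \<partial>M)"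
      proof -
        \<comment> \<open>With \<open>a = A 1 f x\<close> and \<open>q = A L f x\<close> this is
          \<open>q\<^sup>2 \<le> 2 * a\<^sup>2 + 2 * (a - q)\<^sup>2\<close>.\<close>
        have "(A L f x)\<^sup>2 / 2 - C * v x \<le> F x" for x
        proof -
          have "(A 1 f x - A L f x)\<^sup>2 \<le> C * v x" using cmp(1)[of x x] R by simp
          moreover have "0 \<le> (2 * A 1 f x - A L f x)\<^sup>2" by simp
          ultimately show ?thesis unfolding F_def by (simp add: power2_eq_square algebra_simps)
        qed
        then have "(\<integral>x. (A L f x)\<^sup>2 / 2 - C * v x \<partial>M) \<le> (\<integral>x. F x \<partial>M)"
          using sqA CcD(4)[OF vCc] CcD(4)[OF FCc] by (intro integral_mono) auto
        then have "(\<integral>x. (A L f x)\<^sup>2 \<partial>M) / 2 - C * (\<integral>x. v x \<partial>M) \<le> (\<integral>x. F x \<partial>M)"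
          using sqA CcD(4)[OF vCc] by simp
        moreover have "(1 - \<eta>) * N / 2 - C * (\<eta> * N) \<le> (\<integral>x. (A L f x)\<^sup>2 \<partial>M) / 2 - C * (\<integral>x. v x \<partial>M)"
          using ge iv' C by (intro diff_mono divide_right_mono mult_left_mono) (auto simp: N_def)
        moreover have "(1 - \<eta>) * N / 2 - C * (\<eta> * N) = (1 / 2 - \<eta> * (1 / 2 + C)) * N" by (simp add: field_simps)
        moreover have "(1 / 2 - 1 / 4) * N \<le> (1 / 2 - \<eta> * (1 / 2 + C)) * N"
          using \<eta>4 pos by (intro mult_right_mono) (auto simp: N_def)
        ultimately show ?thesis using eps by (intro mult_left_mono) auto
      qed
      finally show ?thesis .
    qed
    ultimately show "\<exists>I. compact I \<and> emeasure M I \<noteq> 0 \<and> emeasure M (thickening R I - I) \<le> ennreal eps * emeasure M I"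
      using emeasure_le_imp_coarea[OF FCc WCc R eps] by blast
  qed
qed

section \<open>Supersolutions from contracting iterates\<close>

lemma iterate_Cc: "f \<in> Cc \<Longrightarrow> L > 0 \<Longrightarrow> (A L ^^ n) f \<in> Cc"
  by (induction n) (auto intro: A_Cc)

lemma A_le_integral: assumes "f \<in> Cc" "L > 0" shows "A L f x \<le> L / Z L * (\<integral>y. f y \<partial>M)"
proof -
  have "(\<integral>y. kern L x y * f y \<partial>M) \<le> (\<integral>y. L * f y \<partial>M)"
    using CcD[OF assms(1)] assms(2) by (intro integral_mono integrable_kern_mult mult_right_mono kern_le) auto
  then show ?thesis using Z_pos[OF assms(2)] by (simp add: A_def field_simps)
qed

text \<open>If averaging contracts the \<open>L\<^sup>2\<close>-norms of the iterates, the Green function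
  \<open>\<Sum>\<^sub>n s\<^sup>-\<^sup>n A\<^sup>n f\<close> is a positive strict supersolution; translates make it positive
  everywhere even if the ball of radius \<open>L\<close> does not generate the group.\<close>

lemma strict_supersolution:
  assumes L: "L > 0" and q: "0 < q" "q < 1"
    and contr: "\<And>n. (\<integral>x. ((A L ^^ Suc n) (kern L 0) x)\<^sup>2 \<partial>M) \<le> q * (\<integral>x. ((A L ^^ n) (kern L 0) x)\<^sup>2 \<partial>M)"
  obtains h :: "'g \<Rightarrow> real" and s where "s < 1" "h \<in> borel_measurable borel" "\<And>x. 0 < h x"
    "\<And>x. (\<integral>\<^sup>+y. ennreal (kern L x y * h y) \<partial>M) \<le> ennreal (s * Z L * h x)"
proof -
  define f where "f n = (A L ^^ n) (kern L 0)" for n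
  have fCc: "f n \<in> Cc" for n unfolding f_def by (intro iterate_Cc kern_Cc L)
  have fS: "f (Suc n) = A L (f n)" for n by (simp add: f_def)
  note f0 = CcD(2)[OF fCc]
  note [measurable] = CcD(5)[OF fCc]
  define N where "N n = (\<integral>x. (f n x)\<^sup>2 \<partial>M)" for n
  have N: "N n \<le> q ^ n * N 0" for n
  proof (induction n)
    case (Suc n)
    have "N (Suc n) \<le> q * N n" using contr[of n] by (simp only: N_def f_def)
    also have "\<dots> \<le> q * (q ^ n * N 0)" using Suc q by (intro mult_left_mono) auto
    finally show ?case by simp
  qed simp
  have N0: "N 0 \<ge> 0" unfolding N_def by (intro integral_nonneg_AE AE_I2) simp
  \<comment> \<open>A fourth root: the squared L2-norms decay like \<open>q ^ n\<close>, one more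
    averaging turns this into a supremum bound of order \<open>(s\<^sup>2) ^ n\<close>, and after
    division by \<open>s ^ n\<close> a convergent geometric series in \<open>s\<close> is
    left.\<close>
  define s where "s = sqrt (sqrt q)"
  have s: "0 < s" "s < 1" and s4: "(s\<^sup>2)\<^sup>2 = q" using q by (auto simp: s_def)
  define B where "B = sqrt (L / Z L * N 0)"
  have B: "B \<ge> 0" "B\<^sup>2 = L / Z L * N 0" using N0 L Z_pos[OF L] by (auto simp: B_def)
  have fB: "f (Suc n) x \<le> B * (s\<^sup>2) ^ n" for n x
  proof (rule power2_le_imp_le)
    have "(f (Suc n) x)\<^sup>2 \<le> A L (\<lambda>z. (f n z)\<^sup>2) x" unfolding fS by (rule A_sq_le[OF fCc L])
    also have "\<dots> \<le> L / Z L * N n" unfolding N_def by (rule A_le_integral[OF Cc_sq[OF fCc] L])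
    also have "\<dots> \<le> L / Z L * (q ^ n * N 0)" using L Z_pos[OF L] N by (intro mult_left_mono) auto
    also have "\<dots> = (B * (s\<^sup>2) ^ n)\<^sup>2"
    proof -
      have "((s\<^sup>2) ^ n)\<^sup>2 = q ^ n" unfolding s4[symmetric] by (simp add: power_mult[symmetric] mult.commute)
      then show ?thesis by (simp only: power_mult_distrib B(2)) simp
    qed
    finally show "(f (Suc n) x)\<^sup>2 \<le> (B * (s\<^sup>2) ^ n)\<^sup>2" .
  qed (use B s in simp)
  \<comment> \<open>\<open>L\<close> covers the starting function, which is no average; the factor
    \<open>1 / s\<^sup>2\<close> repairs the index shift in the bound \<open>fB\<close>.\<close>
  define B' where "B' = max L (B / s\<^sup>2)"
  define g where "g n x = f n x / s ^ n" for n x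
  have gB: "g n x \<le> B' * s ^ n" for n x
  proof (cases n)
    case 0
    have "f 0 x \<le> L" using kern_le[of L 0 x] L by (simp add: f_def)
    then show ?thesis using 0 by (simp add: g_def B'_def)
  next
    case (Suc m)
    have "f (Suc m) x \<le> B * (s\<^sup>2) ^ m" by (rule fB)
    also have "\<dots> = B / s\<^sup>2 * s ^ Suc m * s ^ Suc m"
      using s by (simp add: power2_eq_square power_mult_distrib field_simps)
    also have "\<dots> \<le> B' * s ^ Suc m * s ^ Suc m" using s by (intro mult_right_mono) (auto simp: B'_def)
    finally show ?thesis using Suc s by (simp add: g_def field_simps)
  qed
  have [measurable]: "g n \<in> borel_measurable borel" for n unfolding g_def[abs_def] by measurable
  define G where "G x = (\<Sum>n. ennreal (g n x))" for x
  have [measurable]: "G \<in> borel_measurable borel" unfolding G_def[abs_def] by measurable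
  have GB: "G x \<le> ennreal (B' / (1 - s))" for x
  proof -
    have "G x \<le> (\<Sum>n. ennreal (B' * s ^ n))" unfolding G_def by (intro suminf_le ennreal_leI gB summableI)
    also have "\<dots> = ennreal (\<Sum>n. B' * s ^ n)"
      using s L by (intro suminf_ennreal2 summable_mult summable_geometric) (auto simp: B'_def)
    also have "(\<Sum>n. B' * s ^ n) = B' / (1 - s)"
      using s by (simp add: suminf_mult suminf_geometric summable_geometric)
    finally show ?thesis .
  qed
  \<comment> \<open>Averaging sends \<open>g n\<close> to \<open>s\<close> times
    \<open>g (Suc n)\<close>, so it shifts the series by one term and the first term is
    lost.\<close>
  have AG: "(\<integral>\<^sup>+y. ennreal (kern L x y) * G y \<partial>M) \<le> ennreal (s * Z L) * G x" for x
  proof -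
    have "(\<integral>\<^sup>+y. ennreal (kern L x y) * G y \<partial>M) = (\<integral>\<^sup>+y. (\<Sum>n. ennreal (kern L x y) * ennreal (g n y)) \<partial>M)"
      by (simp add: G_def)
    also have "\<dots> = (\<Sum>n. \<integral>\<^sup>+y. ennreal (kern L x y) * ennreal (g n y) \<partial>M)"
      by (rule nn_integral_suminf) measurable
    also have "\<dots> = (\<Sum>n. ennreal (s * Z L) * ennreal (g (Suc n) x))"
    proof (rule suminf_cong)
      fix n
      have "(\<integral>\<^sup>+y. ennreal (kern L x y) * ennreal (g n y) \<partial>M) = (\<integral>\<^sup>+y. ennreal (kern L x y * f n y) * ennreal (1 / s ^ n) \<partial>M)"
        using s f0[of n] by (intro nn_integral_cong) (simp add: ennreal_mult[symmetric] g_def)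
      also have "\<dots> = (\<integral>\<^sup>+y. ennreal (kern L x y * f n y) \<partial>M) * ennreal (1 / s ^ n)"
        by (rule nn_integral_multc) measurable
      also have "(\<integral>\<^sup>+y. ennreal (kern L x y * f n y) \<partial>M) = ennreal (\<integral>y. kern L x y * f n y \<partial>M)"
        using CcD(1)[OF fCc] f0 by (intro nn_integral_eq_integral integrable_kern_mult) auto
      also have "(\<integral>y. kern L x y * f n y \<partial>M) = Z L * f (Suc n) x"
        using Z_pos[OF L] by (simp add: fS A_def)
      also have "ennreal (Z L * f (Suc n) x) * ennreal (1 / s ^ n) = ennreal (s * Z L) * ennreal (g (Suc n) x)"
        using s f0[of "Suc n" x] Z_pos[OF L] by (simp add: ennreal_mult[symmetric] g_def)
      finally show "(\<integral>\<^sup>+y. ennreal (kern L x y) * ennreal (g n y) \<partial>M) = ennreal (s * Z L) * ennreal (g (Suc n) x)" .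
    qed
    also have "\<dots> = ennreal (s * Z L) * (\<Sum>n. ennreal (g (Suc n) x))" by simp
    also have "\<dots> \<le> ennreal (s * Z L) * G x"
    proof (intro mult_left_mono)
      show "(\<Sum>n. ennreal (g (Suc n) x)) \<le> G x"
      proof (rule suminf_le_const[OF summableI])
        fix n
        have "(\<Sum>i<n. ennreal (g (Suc i) x)) \<le> (\<Sum>i<Suc n. ennreal (g i x))"
          unfolding sum.lessThan_Suc_shift by simp
        also have "\<dots> \<le> G x" unfolding G_def by (intro sum_le_suminf summableI) auto
        finally show "(\<Sum>i<n. ennreal (g (Suc i) x)) \<le> G x" .
      qed
    qed simp
    finally show ?thesis .
  qed
  obtain D :: "'g set" where D: "countable D" "\<And>x e. e > 0 \<Longrightarrow> \<exists>y\<in>D. dist y x < e"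
    by (rule proper_countable_dense[OF compact_cball]) blast
  have "D \<noteq> {}" using D(2)[of 1 0] by auto
  define a where "a = from_nat_into D"
  have a: "\<exists>j. dist (a j) x < e" if "e > 0" for x e
    using D(2)[OF that, of x] from_nat_into_surj[OF D(1)] unfolding a_def by metis
  \<comment> \<open>\<open>G\<close> is known to be positive only near 0. Its translates by a dense
    sequence, with summable weights, are positive everywhere, and left invariance of the kernel
    keeps the inequality \<open>AG\<close>.\<close>
  define H where "H x = (\<Sum>j. ennreal ((1/2) ^ j) * G (- a j + x))" for x
  have [measurable]: "(\<lambda>x. - a j + x) \<in> borel_measurable borel" for j
    by (intro borel_measurable_continuous_onI continuous_intros)
  have [measurable]: "H \<in> borel_measurable borel" unfolding H_def[abs_def] by measurable
  have Hfin: "H x < \<infinity>" for x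
  proof -
    have B'0: "B' / (1 - s) \<ge> 0" using s L by (simp add: B'_def)
    have "H x \<le> (\<Sum>j. ennreal ((1/2) ^ j) * ennreal (B' / (1 - s)))"
      unfolding H_def by (intro suminf_le mult_left_mono GB summableI) auto
    also have "\<dots> = (\<Sum>j. ennreal ((1/2) ^ j)) * ennreal (B' / (1 - s))" by simp
    also have "(\<Sum>j. ennreal ((1/2) ^ j)) = ennreal (\<Sum>j. (1/2) ^ j)"
      by (intro suminf_ennreal2 summable_geometric) auto
    also have "\<dots> * ennreal (B' / (1 - s)) < \<infinity>" by (simp add: ennreal_mult_less_top)
    finally show ?thesis .
  qed
  have Hpos: "0 < H x" for x
  proof -
    obtain j where j: "dist (a j) x < L" using a[OF L] by auto
    have "kern L 0 (- a j + x) = kern L (a j) x" using kern_left[of L "a j" 0 "- a j + x"] by simp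
    then have "0 < ennreal (g 0 (- a j + x))" using j by (simp add: g_def f_def kern_def)
    also have "\<dots> \<le> G (- a j + x)"
      unfolding G_def using sum_le_suminf[of "\<lambda>n. ennreal (g n (- a j + x))" "{0}"] by (simp add: summableI)
    finally have "0 < ennreal ((1/2) ^ j) * G (- a j + x)" by (simp add: ennreal_zero_less_mult_iff)
    also have "\<dots> \<le> H x"
      unfolding H_def using sum_le_suminf[of "\<lambda>j. ennreal ((1/2) ^ j) * G (- a j + x)" "{j}"] by (simp add: summableI)
    finally show ?thesis .
  qed
  have AH: "(\<integral>\<^sup>+y. ennreal (kern L x y) * H y \<partial>M) \<le> ennreal (s * Z L) * H x" for x
  proof -
    have "(\<integral>\<^sup>+y. ennreal (kern L x y) * H y \<partial>M)
        = (\<integral>\<^sup>+y. (\<Sum>j. ennreal ((1/2) ^ j) * (ennreal (kern L x y) * G (- a j + y))) \<partial>M)"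
      unfolding H_def ennreal_suminf_cmult[symmetric] by (simp add: mult_ac)
    also have "\<dots> = (\<Sum>j. \<integral>\<^sup>+y. ennreal ((1/2) ^ j) * (ennreal (kern L x y) * G (- a j + y)) \<partial>M)"
      by (rule nn_integral_suminf) measurable
    also have "\<dots> = (\<Sum>j. ennreal ((1/2) ^ j) * (\<integral>\<^sup>+y. ennreal (kern L x y) * G (- a j + y) \<partial>M))"
      by (intro suminf_cong nn_integral_cmult) measurable
    also have "\<dots> \<le> (\<Sum>j. ennreal ((1/2) ^ j) * (ennreal (s * Z L) * G (- a j + x)))"
    proof (intro suminf_le mult_left_mono summableI)
      fix j
      have "(\<integral>\<^sup>+y. ennreal (kern L x y) * G (- a j + y) \<partial>M)
          = (\<integral>\<^sup>+y. ennreal (kern L x (a j + y)) * G (- a j + (a j + y)) \<partial>M)"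
        by (rule nn_integral_left[symmetric]) measurable
      also have "\<dots> = (\<integral>\<^sup>+y. ennreal (kern L (- a j + x) y) * G y \<partial>M)"
        using kern_left[of L "a j" "- a j + x"] by (intro nn_integral_cong) simp
      also have "\<dots> \<le> ennreal (s * Z L) * G (- a j + x)" by (rule AG)
      finally show "(\<integral>\<^sup>+y. ennreal (kern L x y) * G (- a j + y) \<partial>M) \<le> ennreal (s * Z L) * G (- a j + x)" .
    qed auto
    also have "\<dots> = ennreal (s * Z L) * H x"
      unfolding H_def ennreal_suminf_cmult[symmetric] by (simp add: mult_ac)
    finally show ?thesis .
  qed
  define h where "h x = enn2real (H x)" for x
  have hH: "ennreal (h x) = H x" for x using Hfin[of x] by (simp add: h_def)
  show ?thesis
  proof
    show "s < 1" by (rule s)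
    show "h \<in> borel_measurable borel" unfolding h_def[abs_def] by measurable
    show "0 < h x" for x using Hpos[of x] hH[of x] by (metis ennreal_0 ennreal_less_zero_iff not_gr_zero)
    then have h0: "0 \<le> h x" for x by (simp add: less_imp_le)
    show "(\<integral>\<^sup>+y. ennreal (kern L x y * h y) \<partial>M) \<le> ennreal (s * Z L * h x)" for x
      using AH[of x] s Z_pos[OF L] h0 by (simp add: ennreal_mult hH)
  qed
qed

section \<open>Invariant means and antisymmetric kernels\<close>

lemma distr_inversion: "distr M M uminus = M"
proof (rule measure_eqI)
  fix S assume "S \<in> sets (distr M M uminus)"
  then have [measurable]: "S \<in> sets borel" by simp
  have "emeasure (distr M M uminus) S = emeasure M (uminus -` S)"
    by (subst emeasure_distr) (auto simp: measurable_cong_sets[OF refl sets_M])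
  also have "\<dots> = (\<integral>\<^sup>+x. indicator (uminus -` S) x \<partial>M)"
    using measurable_sets[OF measurable_minus, of S] by (intro nn_integral_indicator[symmetric]) simp
  also have "\<dots> = (\<integral>\<^sup>+x. indicator S (- x) \<partial>M)"
    by (intro nn_integral_cong) (simp add: indicator_def)
  also have "\<dots> = emeasure M S"
    using nn_integral_inversion[of "indicator S"] by simp
  finally show "emeasure (distr M M uminus) S = emeasure M S" .
qed simp

lemma integral_inversion:
  assumes [measurable]: "f \<in> borel_measurable borel"
  shows "(\<integral>x. f (- x) \<partial>M) = (\<integral>x. (f x :: real) \<partial>M)"
  using integral_distr[of uminus M M f] by (simp add: distr_inversion measurable_cong_sets[OF refl sets_M])

lemma distr_left: "distr M M (\<lambda>x. g + x) = M"
  using unimodular by (simp add: unimodular_haar_def haar_measure_def)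

lemma measurable_left [measurable]: "(\<lambda>x::'g. g + x) \<in> borel_measurable borel"
  by (intro borel_measurable_continuous_onI continuous_intros)

lemma measurable_right [measurable]: "(\<lambda>x::'g. x + g) \<in> borel_measurable borel"
  by (intro borel_measurable_continuous_onI continuous_intros)

lemma integral_left:
  assumes [measurable]: "f \<in> borel_measurable borel"
  shows "(\<integral>x. f (g + x) \<partial>M) = (\<integral>x. (f x :: real) \<partial>M)"
  using integral_distr[of "\<lambda>x. g + x" M M f] by (simp add: distr_left measurable_cong_sets[OF refl sets_M])

text \<open>The mean of \<open>x \<mapsto> \<integral> P(x, x + b) db\<close> is \<open>\<integral> \<lambda>(b) db\<close>, where \<open>\<lambda>(b)\<close> is the mean of
  \<open>x \<mapsto> P(x, x + b)\<close>; antisymmetry makes \<open>\<lambda>\<close> odd.  Riemann sums replace the exchange of the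
  mean, which is only finitely additive, with the integral.\<close>

lemma mean_antisymmetric_kernel:
  fixes P :: "'g \<Rightarrow> 'g \<Rightarrow> real"
  assumes am: "amenable M" and c: "c \<ge> 0"
    and anti: "\<And>x y. P y x = - P x y" and bnd: "\<And>x y. \<bar>P x y\<bar> \<le> c"
    and lip: "\<And>x y y'. \<bar>P x y - P x y'\<bar> \<le> c * dist y y'"
    and range: "\<And>x y. r < dist x y \<Longrightarrow> P x y = 0"
    and neg: "\<And>x. (\<integral>y. P x y \<partial>M) \<le> - \<delta>" and \<delta>: "\<delta> > 0"
  shows False
proof -
  define Bd where "Bd = {f. f \<in> borel_measurable borel \<and> bounded (range (f :: 'g \<Rightarrow> real))}"
  obtain m :: "('g \<Rightarrow> real) \<Rightarrow> real" where m: "\<And>f f'. f \<in> Bd \<Longrightarrow> f' \<in> Bd \<Longrightarrow> m (\<lambda>x. f x + f' x) = m f + m f'"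
    "\<And>f c. f \<in> Bd \<Longrightarrow> m (\<lambda>x. c * f x) = c * m f" "\<And>f. f \<in> Bd \<Longrightarrow> (AE x in M. 0 \<le> f x) \<Longrightarrow> 0 \<le> m f"
    "m (\<lambda>x. 1) = 1" "\<And>f g. f \<in> Bd \<Longrightarrow> m (\<lambda>x. f (g + x)) = m f"
    using am unfolding amenable_def Bd_def Let_def by blast
  have BdI: "f \<in> Bd" if "f \<in> borel_measurable borel" "\<And>x. \<bar>f x\<bar> \<le> C" for f :: "'g \<Rightarrow> real" and C
    using that by (auto simp: Bd_def bounded_iff)
  have BdE: "\<exists>C. \<forall>x. \<bar>f x\<bar> \<le> C" and Bdm [measurable_dest]: "f \<in> borel_measurable borel" if "f \<in> Bd" for f
    using that by (auto simp: Bd_def bounded_iff)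
  have Bd_comp: "(\<lambda>x. f (t x)) \<in> Bd" if f: "f \<in> Bd" and t: "t \<in> borel_measurable borel" for f t
    using BdE[OF f] measurable_compose[OF t Bdm[OF f]] by (auto intro: BdI)
  have Bd_add: "(\<lambda>x. f x + g x) \<in> Bd" if f: "f \<in> Bd" and g: "g \<in> Bd" for f g
  proof -
    obtain C D where "\<And>x. \<bar>f x\<bar> \<le> C" "\<And>x. \<bar>g x\<bar> \<le> D" using BdE[OF f] BdE[OF g] by blast
    then have "\<bar>f x + g x\<bar> \<le> C + D" for x using abs_triangle_ineq[of "f x" "g x"] add_mono by (meson order_trans)
    then show ?thesis using Bdm[OF f] Bdm[OF g] by (intro BdI) auto
  qed
  have Bd_cm: "(\<lambda>x. a * f x) \<in> Bd" if f: "f \<in> Bd" for f a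
  proof -
    obtain C where C: "\<And>x. \<bar>f x\<bar> \<le> C" using BdE[OF f] by blast
    have "\<bar>a * f x\<bar> \<le> \<bar>a\<bar> * C" for x unfolding abs_mult using C by (intro mult_left_mono) auto
    then show ?thesis using Bdm[OF f] by (intro BdI) auto
  qed
  \<comment> \<open>The given mean is left invariant; composed with inversion it becomes right
    invariant, as needed for the shift from \<open>x\<close> to \<open>x + b\<close>.\<close>
  define n where "n f = m (\<lambda>x. f (- x))" for f
  note inv = Bd_comp[OF _ measurable_minus]
  have n_add: "n (\<lambda>x. f x + g x) = n f + n g" if "f \<in> Bd" "g \<in> Bd" for f g
    unfolding n_def using m(1)[OF inv[OF that(1)] inv[OF that(2)]] .
  have n_cm: "n (\<lambda>x. a * f x) = a * n f" if "f \<in> Bd" for f a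
    unfolding n_def using m(2)[OF inv[OF that]] .
  have n_pos: "0 \<le> n f" if "f \<in> Bd" "\<And>x. 0 \<le> f x" for f
    unfolding n_def using m(3)[OF inv[OF that(1)]] that(2) by simp
  have n_1: "n (\<lambda>x. 1) = 1" unfolding n_def by (rule m(4))
  have n_right: "n (\<lambda>x. f (x + b)) = n f" if "f \<in> Bd" for f b
    unfolding n_def using m(5)[OF inv[OF that], of "- b"] by (simp add: minus_add)
  have one: "(\<lambda>x. 1) \<in> Bd" by (rule BdI[of _ 1]) auto
  have n_le: "n f \<le> n g" if "f \<in> Bd" "g \<in> Bd" "\<And>x. f x \<le> g x" for f g
  proof -
    have "0 \<le> n (\<lambda>x. g x + (- 1) * f x)" using that by (intro n_pos Bd_add Bd_cm) auto
    then show ?thesis using n_add[OF that(2) Bd_cm[OF that(1), of "- 1"]] n_cm[OF that(1), of "- 1"] by simp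
  qed
  have n_const: "n (\<lambda>x. a) = a" for a using n_cm[OF one, of a] n_1 by simp
  have n_diff: "\<bar>n f - n g\<bar> \<le> C" if "f \<in> Bd" "g \<in> Bd" "\<And>x. \<bar>f x - g x\<bar> \<le> C" for f g C
  proof -
    have C: "(\<lambda>x. C) \<in> Bd" by (rule BdI[of _ "\<bar>C\<bar>"]) auto
    have le: "f x \<le> g x + C" "g x \<le> f x + C" for x using that(3)[of x] by (auto simp: abs_le_iff)
    have "n f \<le> n (\<lambda>x. g x + C)" by (rule n_le[OF that(1) Bd_add[OF that(2) C] le(1)])
    moreover have "n g \<le> n (\<lambda>x. f x + C)" by (rule n_le[OF that(2) Bd_add[OF that(1) C] le(2)])
    ultimately show ?thesis using n_add[OF that(1) C] n_add[OF that(2) C] n_const[of C] by (simp add: abs_le_iff)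
  qed
  have Bd_sum: "(\<lambda>x. \<Sum>i\<in>I. a i * f i x) \<in> Bd" if "finite I" "\<And>i. f i \<in> Bd" for I :: "nat set" and a f
    using that(1)
  proof induction
    case (insert i I)
    then show ?case using Bd_add[OF Bd_cm[OF that(2)[of i], of "a i"] insert(3)] by simp
  qed (auto intro: BdI[of _ 0])
  have n_sum: "n (\<lambda>x. \<Sum>i\<in>I. a i * f i x) = (\<Sum>i\<in>I. a i * n (f i))" if "finite I" "\<And>i. f i \<in> Bd" for I :: "nat set" and a f
    using that(1)
  proof induction
    case (insert i I)
    then show ?case using n_add[OF Bd_cm[OF that(2)[of i], of "a i"] Bd_sum[OF insert(1) that(2)]] n_cm[OF that(2)]
      by simp
  qed (simp add: n_const)
  have P2: "\<bar>P x y - P x' y'\<bar> \<le> c * (dist x x' + dist y y')" for x y x' y'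
  proof -
    have "\<bar>P x y - P x' y\<bar> \<le> c * dist x x'" using lip[of y x x'] anti[of x y] anti[of x' y] by (simp add: abs_minus_commute)
    then show ?thesis using lip[of x' y y'] by (simp add: distrib_left)
  qed
  have contP: "continuous_on UNIV (\<lambda>p. P (fst p) (snd p))"
  proof (rule continuous_onI)
    fix p :: "'g \<times> 'g" and e :: real assume e: "e > 0"
    have "dist (P (fst q) (snd q)) (P (fst p) (snd p)) \<le> e" if q: "dist q p < e / (2 * (c + 1))" for q
    proof -
      have "dist (fst q) (fst p) + dist (snd q) (snd p) \<le> 2 * (e / (2 * (c + 1)))"
        using dist_fst_le[of q p] dist_snd_le[of q p] q by linarith
      also have "2 * (e / (2 * (c + 1))) = e / (c + 1)" using c by (simp add: field_simps)
      finally have "c * (dist (fst q) (fst p) + dist (snd q) (snd p)) \<le> c * (e / (c + 1))"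
        using c by (rule mult_left_mono)
      also have "\<dots> \<le> e" using c e by (simp add: field_simps)
      finally show ?thesis using P2[of "fst q" "snd q" "fst p" "snd p"] by (simp add: dist_real_def)
    qed
    then show "\<exists>d>0. \<forall>q\<in>UNIV. dist q p < d \<longrightarrow> dist (P (fst q) (snd q)) (P (fst p) (snd p)) \<le> e"
      using e c by (intro exI[of _ "e / (2 * (c + 1))"]) auto
  qed
  have mP1 [measurable]: "(\<lambda>x. P x (t x)) \<in> borel_measurable borel" if "continuous_on UNIV t" for t
    by (intro borel_measurable_continuous_onI continuous_on_compose2[OF contP, of UNIV "\<lambda>x. (x, t x)", simplified] continuous_intros that)
  have mP2 [measurable]: "(\<lambda>b. P x (x + b)) \<in> borel_measurable borel" for x
    by (intro borel_measurable_continuous_onI continuous_on_compose2[OF contP, of UNIV "\<lambda>b. (x, x + b)", simplified] continuous_intros)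
  have mP3 [measurable]: "P x \<in> borel_measurable borel" for x
    by (intro borel_measurable_continuous_onI continuous_on_compose2[OF contP, of UNIV "\<lambda>b. (x, b)", simplified] continuous_intros)
  define g where "g b x = P x (x + b)" for b x
  have gBd: "g b \<in> Bd" for b unfolding g_def using bnd by (intro BdI[of _ c] mP1 continuous_intros) auto
  have glip: "\<bar>g b x - g b' x\<bar> \<le> c * dist b b'" for b b' x using lip[of x "x + b" "x + b'"] by (simp add: g_def dist_left)
  define lam where "lam b = n (g b)" for b
  have lamlip: "\<bar>lam b - lam b'\<bar> \<le> c * dist b b'" for b b' unfolding lam_def by (rule n_diff[OF gBd gBd glip])
  have lamodd: "lam (- b) = - lam b" for b
  proof -
    have "lam (- b) = n (\<lambda>x. g (- b) (x + b))" unfolding lam_def by (rule n_right[OF gBd, symmetric])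
    also have "\<dots> = n (\<lambda>x. (- 1) * g b x)" proof -
      have "g (- b) (x + b) = (- 1) * g b x" for x using anti[of x "x + b"] by (simp add: g_def add.assoc)
      then show ?thesis by simp
    qed
    also have "\<dots> = - lam b" using n_cm[OF gBd, of "- 1"] by (simp add: lam_def)
    finally show ?thesis .
  qed
  have lamm [measurable]: "lam \<in> borel_measurable borel"
    using lamlip c by (intro borel_measurable_continuous_onI lipschitz_on_continuous_on[of c] lipschitz_onI) (auto simp: dist_real_def)
  have g_zero: "g b x = 0" if "r < dist 0 b" for b x
    using that range[of x "x + b"] dist_left[of x 0 b] by (simp add: g_def)
  have lamzero: "lam b = 0" if "r < dist 0 b" for b
  proof -
    have "g b = (\<lambda>x. 0)" by (rule ext) (rule g_zero[OF that])
    then show ?thesis unfolding lam_def by (simp add: n_const)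
  qed
  \<comment> \<open>An odd function has integral zero because Haar measure of a unimodular group is
    invariant under inversion.\<close>
  have lamint: "(\<integral>b. lam b \<partial>M) = 0" using integral_inversion[OF lamm] by (simp add: lamodd)
  define V where "V = measure M (cball 0 r)"
  have Vfin: "emeasure M (cball 0 r) < \<infinity>" by (rule emeasure_compact[OF compact_cball])
  \<comment> \<open>The two Riemann errors add up to \<open>2 * c * V * e\<close>, which this choice
    keeps at or below \<open>\<delta> / 2\<close>. The summand 1 avoids division by zero.\<close>
  define e where "e = \<delta> / (4 * (c * V + 1))"
  have cV: "c * V \<ge> 0" using c by (simp add: V_def)
  have e: "e > 0" using \<delta> cV by (simp add: e_def)
  have "\<exists>k. finite k \<and> k \<subseteq> cball 0 r \<and> cball (0::'g) r \<subseteq> (\<Union>x\<in>k. ball x e)"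
    using seq_compact_imp_totally_bounded[OF compact_imp_seq_compact[OF compact_cball]] e by blast
  then obtain k where k: "finite k" "cball (0::'g) r \<subseteq> (\<Union>x\<in>k. ball x e)" by blast
  obtain bs where bs: "k = set bs" using finite_list[OF k(1)] by blast
  define K where "K = length bs"
  \<comment> \<open>Disjoint measurable pieces of the ball, each within \<open>e\<close> of its
    sample point \<open>bs ! i\<close>: the mesh of the Riemann sums.\<close>
  define S where "S i = disjointed (\<lambda>i. ball (bs ! i) e \<inter> cball 0 r) i" for i
  have Sm [measurable]: "S i \<in> sets borel" for i unfolding S_def
  proof -
    have "range (\<lambda>i. ball (bs ! i) e \<inter> cball 0 r) \<subseteq> sets borel" by auto
    from sets.range_disjointed_sets[OF this] show "disjointed (\<lambda>i. ball (bs ! i) e \<inter> cball 0 r) i \<in> sets borel" by blast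
  qed
  have Ssub: "S i \<subseteq> ball (bs ! i) e" "S i \<subseteq> cball 0 r" for i unfolding S_def using disjointed_subset[of "\<lambda>i. ball (bs ! i) e \<inter> cball 0 r" i] by auto
  have Sfin: "emeasure M (S i) < \<infinity>" for i using emeasure_mono[OF Ssub(2)[of i], of M] Vfin by (simp add: le_less_trans)
  have ind: "indicator (cball 0 r) b = (\<Sum>i<K. indicator (S i) b :: real)" for b
  proof (cases "b \<in> cball 0 r")
    case True
    then have "b \<in> (\<Union>i\<in>{0..<K}. ball (bs ! i) e \<inter> cball 0 r)"
    proof -
      obtain x where "x \<in> set bs" "dist x b < e" using True k(2) bs by (auto simp: subset_iff)
      then obtain i where "i < K" "dist (bs ! i) b < e" by (auto simp: K_def in_set_conv_nth)
      with True show ?thesis by auto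
    qed
    then have "b \<in> (\<Union>i\<in>{0..<K}. S i)" unfolding S_def finite_UN_disjointed_eq .
    then obtain i where i: "i < K" "b \<in> S i" by auto
    have "b \<notin> S j" if "j \<noteq> i" for j
      using i(2) that disjoint_family_disjointed[of "\<lambda>i. ball (bs ! i) e \<inter> cball 0 r"] unfolding S_def disjoint_family_on_def by blast
    then have "indicator (S j) b = (if j = i then 1 else 0 :: real)" for j using i by (auto simp: indicator_def)
    then show ?thesis using True i by simp
  next
    case False
    then have "indicator (S j) b = (0::real)" for j using Ssub(2)[of j] by (auto simp: indicator_def)
    then show ?thesis using False by simp
  qed
  have riemann: "\<bar>(\<integral>b. f b \<partial>M) - (\<Sum>i<K. measure M (S i) * f (bs ! i))\<bar> \<le> c * e * V"
    if f [measurable]: "f \<in> borel_measurable borel" and fl: "\<And>b b'. \<bar>f b - f b'\<bar> \<le> c * dist b b'"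
      and fz: "\<And>b. r < dist 0 b \<Longrightarrow> f b = 0" for f
  proof -
    have fb: "f b = (\<Sum>i<K. indicator (S i) b * f b)" for b
      using fz[of b] ind[of b] by (cases "dist 0 b \<le> r") (auto simp: sum_distrib_right[symmetric])
    have eq: "f b - (\<Sum>i<K. indicator (S i) b * f (bs ! i)) = (\<Sum>i<K. indicator (S i) b * (f b - f (bs ! i)))" for b
      unfolding right_diff_distrib sum_subtractf fb[symmetric] ..
    have fint: "integrable M f"
      by (intro integrable_cont_bounded[of _ r 0] lipschitz_on_continuous_on[of c] lipschitz_onI) (use fl c fz in \<open>auto simp: dist_real_def\<close>)
    have sint: "integrable M (\<lambda>b. indicator (S i) b * a)" for i and a :: real
    proof -
      have "integrable M (indicator (S i) :: 'g \<Rightarrow> real)"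
        by (rule integrable_real_indicator) (use Sfin[of i] in auto)
      then show ?thesis by simp
    qed
    have "(\<integral>b. f b \<partial>M) - (\<Sum>i<K. measure M (S i) * f (bs ! i)) = (\<integral>b. f b - (\<Sum>i<K. indicator (S i) b * f (bs ! i)) \<partial>M)"
    proof -
      have "(\<integral>b. (\<Sum>i<K. indicator (S i) b * f (bs ! i)) \<partial>M) = (\<Sum>i<K. \<integral>b. indicator (S i) b * f (bs ! i) \<partial>M)"
        by (rule Bochner_Integration.integral_sum[OF sint])
      also have "\<dots> = (\<Sum>i<K. measure M (S i) * f (bs ! i))" by simp
      finally have I1: "(\<integral>b. (\<Sum>i<K. indicator (S i) b * f (bs ! i)) \<partial>M) = (\<Sum>i<K. measure M (S i) * f (bs ! i))" .
      have I2: "integrable M (\<lambda>b. \<Sum>i<K. indicator (S i) b * f (bs ! i))"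
        by (rule Bochner_Integration.integrable_sum) (rule sint)
      show ?thesis unfolding Bochner_Integration.integral_diff[OF fint I2] I1 ..
    qed
    also have "\<bar>\<dots>\<bar> \<le> (\<integral>b. \<bar>f b - (\<Sum>i<K. indicator (S i) b * f (bs ! i))\<bar> \<partial>M)" by (rule integral_abs_bound)
    also have "\<dots> \<le> (\<integral>b. (c * e) * indicator (cball 0 r) b \<partial>M)"
    proof (rule integral_mono)
      show "integrable M (\<lambda>b. \<bar>f b - (\<Sum>i<K. indicator (S i) b * f (bs ! i))\<bar>)"
        by (intro integrable_abs Bochner_Integration.integrable_diff Bochner_Integration.integrable_sum fint sint)
      show "integrable M (\<lambda>b. c * e * indicator (cball 0 r) b)"
        using Vfin by (intro integrable_mult_right integrable_real_indicator) auto
      fix b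
      have "\<bar>f b - (\<Sum>i<K. indicator (S i) b * f (bs ! i))\<bar> \<le> (\<Sum>i<K. \<bar>indicator (S i) b * (f b - f (bs ! i))\<bar>)"
        unfolding eq by (rule sum_abs)
      also have "\<dots> \<le> (\<Sum>i<K. (c * e) * indicator (S i) b)"
      proof (rule sum_mono)
        fix i
        have "\<bar>f b - f (bs ! i)\<bar> \<le> c * e" if "b \<in> S i"
          using fl[of b "bs ! i"] that Ssub(1)[of i] c mult_left_mono[of "dist b (bs ! i)" e c] by (force simp: dist_commute)
        then show "\<bar>indicator (S i) b * (f b - f (bs ! i))\<bar> \<le> c * e * indicator (S i) b" by (auto simp: indicator_def)
      qed
      finally show "\<bar>f b - (\<Sum>i<K. indicator (S i) b * f (bs ! i))\<bar> \<le> c * e * indicator (cball 0 r) b"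
        by (simp add: ind sum_distrib_left)
    qed
    also have "\<dots> = c * e * V" using Vfin by (simp add: V_def)
    finally show ?thesis .
  qed
  define T where "T x = (\<integral>y. P x y \<partial>M)" for x
  have Tg: "T x = (\<integral>b. g b x \<partial>M)" for x unfolding T_def g_def by (rule integral_left[symmetric]) measurable
  have R1: "\<bar>T x - (\<Sum>i<K. measure M (S i) * g (bs ! i) x)\<bar> \<le> c * e * V" for x
    unfolding Tg using g_zero glip by (intro riemann) (auto simp: g_def)
  have R2: "\<bar>0 - (\<Sum>i<K. measure M (S i) * lam (bs ! i))\<bar> \<le> c * e * V"
    unfolding lamint[symmetric] using lamzero lamlip by (intro riemann) auto
  have sBd: "(\<lambda>x. \<Sum>i<K. measure M (S i) * g (bs ! i) x) \<in> Bd" by (intro Bd_sum gBd) simp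
  have "- (c * e * V) \<le> n (\<lambda>x. \<Sum>i<K. measure M (S i) * g (bs ! i) x)"
    using R2 by (subst n_sum) (auto simp: gBd lam_def abs_le_iff)
  also have "\<dots> \<le> n (\<lambda>x. - \<delta> + c * e * V)"
  proof (rule n_le[OF sBd])
    show "(\<lambda>x. - \<delta> + c * e * V) \<in> Bd" by (rule BdI[of _ "\<bar>- \<delta> + c * e * V\<bar>"]) auto
    fix x show "(\<Sum>i<K. measure M (S i) * g (bs ! i) x) \<le> - \<delta> + c * e * V"
      using R1[of x] neg[of x] by (simp add: T_def abs_le_iff)
  qed
  also have "\<dots> = - \<delta> + c * e * V" by (rule n_const)
  finally have "\<delta> \<le> 2 * (c * V * e)" by (simp add: mult_ac)
  also have "\<dots> \<le> 2 * ((c * V + 1) * e)" using e by (intro mult_left_mono mult_right_mono) auto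
  also have "\<dots> = \<delta> / 2" using cV by (simp add: e_def field_simps)
  finally show False using \<delta> by simp
qed

text \<open>The quotient \<open>h y / h x - 1\<close> has negative average around every
  \<open>x\<close> but is neither bounded nor antisymmetric. The function \<open>\<Psi>\<close>, the
  hyperbolic tangent of half the logarithm of \<open>h y / h x\<close>, is both and lies below half
  of that quotient, so \<open>Q = kern L * \<Psi>\<close> has integral at most
  \<open>- \<delta>\<close> in its second variable. As \<open>h\<close> is merely measurable,
  \<open>Q\<close> is smoothed in both variables by the tent of radius 1 before
  \<open>mean_antisymmetric_kernel\<close> is applied.\<close>

lemma antisymmetric_kernel_of_supersolution:
  assumes L: "L > 0" and s: "s < 1" and h [measurable]: "h \<in> borel_measurable borel" and hpos: "\<And>x. 0 < h x"
    and Ah: "\<And>x. (\<integral>\<^sup>+y. ennreal (kern L x y * h y) \<partial>M) \<le> ennreal (s * Z L * h x)"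
    and am: "amenable M"
  shows False
proof -
  define \<Psi> where "\<Psi> x y = (h y - h x) / (h y + h x)" for x y
  have \<Psi>1: "\<bar>\<Psi> x y\<bar> \<le> 1" for x y using hpos[of x] hpos[of y] by (simp add: \<Psi>_def abs_le_iff field_simps)
  have \<Psi>anti: "\<Psi> y x = - \<Psi> x y" for x y using hpos[of x] hpos[of y] by (simp add: \<Psi>_def field_simps)
  have \<Psi>le: "\<Psi> x y \<le> (h y / h x - 1) / 2" for x y
  proof -
    have "0 \<le> (h y - h x)\<^sup>2 / (2 * h x * (h y + h x))" using hpos[of x] hpos[of y] by simp
    also have "\<dots> = (h y / h x - 1) / 2 - \<Psi> x y"
      using hpos[of x] hpos[of y] by (simp add: \<Psi>_def divide_simps) (simp add: power2_eq_square algebra_simps)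
    finally show ?thesis by simp
  qed
  have [measurable]: "(\<lambda>p. \<Psi> (fst p) (snd p)) \<in> borel_measurable (borel \<Otimes>\<^sub>M borel)"
    unfolding \<Psi>_def by measurable
  have [measurable]: "\<Psi> x \<in> borel_measurable borel" for x unfolding \<Psi>_def[abs_def] by measurable
  have kern2 [measurable]: "(\<lambda>p::'g \<times> 'g. kern K (fst p) (snd p)) \<in> borel_measurable (borel \<Otimes>\<^sub>M borel)" for K
    using kern_measurable[of K] by (simp add: split_beta')
  have [measurable]: "kern K x \<in> borel_measurable borel" for K and x :: 'g by (rule CcD(5)[OF kern_Cc])
  define Q where "Q x y = kern L x y * \<Psi> x y" for x y
  have [measurable]: "(\<lambda>p. Q (fst p) (snd p)) \<in> borel_measurable (borel \<Otimes>\<^sub>M borel)" unfolding Q_def by measurable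
  have [measurable]: "Q x \<in> borel_measurable borel" for x unfolding Q_def[abs_def] by measurable
  have Qanti: "Q y x = - Q x y" for x y using \<Psi>anti[of y x] by (simp add: Q_def kern_sym)
  have Qle: "\<bar>Q x y\<bar> \<le> kern L x y" for x y using \<Psi>1[of x y] mult_left_mono[of "\<bar>\<Psi> x y\<bar>" 1 "kern L x y"] by (simp add: Q_def abs_mult)
  have Qint: "integrable M (Q x)" for x
    by (rule Bochner_Integration.integrable_bound[OF integrable_kern[of L x]]) (use Qle in auto)
  define \<delta> where "\<delta> = (1 - s) * Z L / 2"
  have \<delta>: "\<delta> > 0" using s Z_pos[OF L] by (simp add: \<delta>_def)
  have QD: "(\<integral>y. Q x y \<partial>M) \<le> - \<delta>" for x
  proof -
    have hint: "integrable M (\<lambda>y. kern L x y * h y)"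
      by (rule integrableI_bounded) (use Ah[of x] hpos in \<open>auto simp: less_imp_le le_less_trans\<close>)
    \<comment> \<open>\<open>ennreal\<close> sends negative numbers to 0, so a negative right side
      in \<open>Ah\<close> has to be excluded: it would make the integral zero, although the kernel
      has positive mass and \<open>h\<close> is positive.\<close>
    have s0: "0 \<le> s * Z L * h x"
    proof (rule ccontr)
      assume neg: "\<not> ?thesis"
      then have "(\<integral>\<^sup>+y. ennreal (kern L x y * h y) \<partial>M) = 0" using Ah[of x] by (simp add: ennreal_neg)
      then have "AE y in M. kern L x y * h y \<le> 0" by (subst (asm) nn_integral_0_iff_AE) (auto simp: ennreal_eq_0_iff)
      then have "AE y in M. ennreal (kern L x y) = 0"
      proof eventually_elim
        case (elim y) then show ?case using hpos[of y] by (simp add: mult_le_0_iff ennreal_neg not_le[symmetric])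
      qed
      then have "(\<integral>\<^sup>+y. ennreal (kern L x y) \<partial>M) = 0" by (subst nn_integral_0_iff_AE) auto
      then show False using Z_pos[OF L] by (simp add: nn_integral_kern)
    qed
    have "(\<integral>y. kern L x y * h y \<partial>M) \<le> s * Z L * h x"
      using Ah[of x] s0 hpos by (subst (asm) nn_integral_eq_integral[OF hint]) (auto simp: less_imp_le)
    then have le: "(\<integral>y. kern L x y * h y \<partial>M) / h x \<le> s * Z L" using hpos[of x] by (simp add: pos_divide_le_eq)
    have "(\<integral>y. Q x y \<partial>M) \<le> (\<integral>y. (kern L x y * h y / h x - kern L x y) / 2 \<partial>M)"
    proof (rule integral_mono)
      fix y show "Q x y \<le> (kern L x y * h y / h x - kern L x y) / 2"
        using mult_left_mono[OF \<Psi>le[of x y] kern_nonneg[of L x y]] by (simp add: Q_def algebra_simps)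
    qed (use Qint hint integrable_kern in auto)
    also have "\<dots> = ((\<integral>y. kern L x y * h y \<partial>M) / h x - Z L) / 2"
      using hint integrable_kern[of L x] by (simp add: integral_kern)
    also have "\<dots> \<le> (s * Z L - Z L) / 2" by (intro divide_right_mono diff_right_mono le) simp
    also have "\<dots> = - \<delta>" by (simp add: \<delta>_def field_simps)
    finally show ?thesis .
  qed
  define w where "w x p = kern 1 x (fst p) * kern L (fst p) (snd p)" for x and p :: "'g \<times> 'g"
  have mMM: "borel_measurable (M \<Otimes>\<^sub>M M) = borel_measurable (borel \<Otimes>\<^sub>M borel)"
    by (intro measurable_cong_sets sets_pair_measure_cong) auto
  have [measurable]: "w x \<in> borel_measurable (borel \<Otimes>\<^sub>M borel)" for x unfolding w_def[abs_def] by measurable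
  have w0: "0 \<le> w x p" for x p by (simp add: w_def)
  have wnn: "(\<integral>\<^sup>+p. ennreal (w x p) \<partial>(M \<Otimes>\<^sub>M M)) = ennreal (Z 1 * Z L)" for x
  proof -
    have "(\<integral>\<^sup>+p. ennreal (w x p) \<partial>(M \<Otimes>\<^sub>M M)) = (\<integral>\<^sup>+x'. \<integral>\<^sup>+y'. ennreal (w x (x', y')) \<partial>M \<partial>M)"
      by (rule sigma_finite_measure.nn_integral_fst[OF sigma_finite, symmetric]) (simp add: mMM)
    also have "\<dots> = (\<integral>\<^sup>+x'. ennreal (kern 1 x x') * ennreal (Z L) \<partial>M)"
      by (intro nn_integral_cong) (simp add: w_def ennreal_mult nn_integral_cmult nn_integral_kern)
    also have "\<dots> = ennreal (Z 1) * ennreal (Z L)" by (simp add: nn_integral_multc nn_integral_kern)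
    finally show ?thesis using Z_pos[of 1] Z_pos[OF L] by (simp add: ennreal_mult)
  qed
  have wint: "integrable (M \<Otimes>\<^sub>M M) (w x)" for x
    by (rule integrableI_bounded) (auto simp: mMM w0 wnn)
  have wI: "(\<integral>p. w x p \<partial>(M \<Otimes>\<^sub>M M)) = Z 1 * Z L" for x
    using wnn[of x] nn_integral_eq_integral[OF wint[of x]] w0 Z_pos[of 1] Z_pos[OF L]
    by (simp add: integral_nonneg_AE)
  define q where "q x y p = kern 1 x (fst p) * kern 1 y (snd p) * Q (fst p) (snd p)" for x y p
  have [measurable]: "q x y \<in> borel_measurable (borel \<Otimes>\<^sub>M borel)" for x y unfolding q_def[abs_def] by measurable
  have qle: "\<bar>q x y p\<bar> \<le> kern 1 y (snd p) * w x p" for x y p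
    using mult_left_mono[OF Qle[of "fst p" "snd p"], of "kern 1 x (fst p) * kern 1 y (snd p)"]
    by (simp add: q_def w_def abs_mult mult_ac)
  have qle': "\<bar>q x y p\<bar> \<le> w x p" for x y p
    using qle[of x y p] mult_right_mono[OF kern_le[of 1 y "snd p"] w0[of x p]] by simp
  have qint: "integrable (M \<Otimes>\<^sub>M M) (q x y)" for x y
    by (rule Bochner_Integration.integrable_bound[OF wint[of x]]) (use qle' w0 in \<open>auto simp: mMM\<close>)
  define P where "P x y = (\<integral>p. q x y p \<partial>(M \<Otimes>\<^sub>M M))" for x y
  define c where "c = Z 1 * Z L"
  have c0: "c \<ge> 0" using Z_pos[of 1] Z_pos[OF L] by (simp add: c_def)
  show False
  \<comment> \<open>Smoothing at both ends enlarges the range \<open>L\<close> by 2, and each of the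
    two tents contributes a factor \<open>Z 1\<close> to the divergence.\<close>
  proof (rule mean_antisymmetric_kernel[where P = P and c = c and r = "L + 2" and \<delta> = "Z 1 * (Z 1 * \<delta>)"])
    show "P y x = - P x y" for x y
    proof -
      have "P y x = (\<integral>(b, a). q y x (a, b) \<partial>(M \<Otimes>\<^sub>M M))"
        unfolding P_def by (rule integral_product_swap[symmetric]) (simp add: mMM)
      also have "\<dots> = (\<integral>p. - q x y p \<partial>(M \<Otimes>\<^sub>M M))"
      proof (intro Bochner_Integration.integral_cong refl)
        fix p :: "'g \<times> 'g"
        show "(case p of (b, a) \<Rightarrow> q y x (a, b)) = - q x y p"
          using Qanti[of "fst p" "snd p"] by (simp add: q_def split_beta')
      qed
      finally show ?thesis by (simp add: P_def)
    qed
    show "\<bar>P x y\<bar> \<le> c" for x y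
    proof -
      have "\<bar>P x y\<bar> \<le> (\<integral>p. \<bar>q x y p\<bar> \<partial>(M \<Otimes>\<^sub>M M))" unfolding P_def by (rule integral_abs_bound)
      also have "\<dots> \<le> (\<integral>p. w x p \<partial>(M \<Otimes>\<^sub>M M))" using qint wint qle' by (intro integral_mono) auto
      finally show ?thesis by (simp add: wI c_def)
    qed
    show "\<bar>P x y - P x y'\<bar> \<le> c * dist y y'" for x y y'
    proof -
      have "\<bar>P x y - P x y'\<bar> = \<bar>\<integral>p. q x y p - q x y' p \<partial>(M \<Otimes>\<^sub>M M)\<bar>" unfolding P_def using qint by simp
      also have "\<dots> \<le> (\<integral>p. \<bar>q x y p - q x y' p\<bar> \<partial>(M \<Otimes>\<^sub>M M))" by (rule integral_abs_bound)
      also have "\<dots> \<le> (\<integral>p. dist y y' * w x p \<partial>(M \<Otimes>\<^sub>M M))"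
      proof (rule integral_mono)
        fix p :: "'g \<times> 'g"
        have "\<bar>q x y p - q x y' p\<bar> = \<bar>kern 1 y (snd p) - kern 1 y' (snd p)\<bar> * (kern 1 x (fst p) * \<bar>Q (fst p) (snd p)\<bar>)"
          by (simp add: q_def abs_mult left_diff_distrib[symmetric] right_diff_distrib[symmetric])
        also have "\<dots> \<le> dist y y' * w x p"
          unfolding w_def using Qle kern_lip by (intro mult_mono mult_left_mono) auto
        finally show "\<bar>q x y p - q x y' p\<bar> \<le> dist y y' * w x p" .
      qed (use qint wint in auto)
      finally show ?thesis by (simp add: wI c_def mult.commute)
    qed
    show "P x y = 0" if "L + 2 < dist x y" for x y
    proof -
      have "q x y p = 0" for p
      proof (rule ccontr)
        assume nz: "q x y p \<noteq> 0"
        then have "dist x (fst p) < 1" "dist y (snd p) < 1" using kern_zero[of 1 x "fst p"] kern_zero[of 1 y "snd p"] by (auto simp: q_def not_le[symmetric])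
        moreover have "dist (fst p) (snd p) < L" using nz kern_zero[of L "fst p" "snd p"] by (auto simp: q_def Q_def not_le[symmetric])
        ultimately show False using that dist_triangle[of x y "fst p"] dist_triangle[of "fst p" y "snd p"] by (simp add: dist_commute)
      qed
      then show ?thesis by (simp add: P_def)
    qed
    show "(\<integral>y. P x y \<partial>M) \<le> - (Z 1 * (Z 1 * \<delta>))" for x
    proof -
      interpret T: pair_sigma_finite M "M \<Otimes>\<^sub>M M" ..
      have mq: "(\<lambda>(y, p). q x y p) \<in> borel_measurable (M \<Otimes>\<^sub>M (M \<Otimes>\<^sub>M M))" unfolding q_def split_beta' by measurable
      have mw: "(\<lambda>(y, p). kern 1 y (snd p) * w x p) \<in> borel_measurable (M \<Otimes>\<^sub>M (M \<Otimes>\<^sub>M M))" unfolding w_def split_beta' by measurable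
      have int: "integrable (M \<Otimes>\<^sub>M (M \<Otimes>\<^sub>M M)) (\<lambda>(y, p). q x y p)"
      proof (rule integrableI_bounded[OF mq])
        have "(\<integral>\<^sup>+z. ennreal (norm (case z of (y, p) \<Rightarrow> q x y p)) \<partial>(M \<Otimes>\<^sub>M (M \<Otimes>\<^sub>M M)))
            \<le> (\<integral>\<^sup>+z. ennreal (case z of (y, p) \<Rightarrow> kern 1 y (snd p) * w x p) \<partial>(M \<Otimes>\<^sub>M (M \<Otimes>\<^sub>M M)))"
          using qle by (intro nn_integral_mono ennreal_leI) (auto simp: split_beta')
        also have "\<dots> = (\<integral>\<^sup>+p. \<integral>\<^sup>+y. ennreal (kern 1 y (snd p) * w x p) \<partial>M \<partial>(M \<Otimes>\<^sub>M M))"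
          using T.nn_integral_snd[of "\<lambda>z. ennreal (case z of (y, p) \<Rightarrow> kern 1 y (snd p) * w x p)"] mw by simp
        also have "\<dots> = (\<integral>\<^sup>+p. ennreal (Z 1) * ennreal (w x p) \<partial>(M \<Otimes>\<^sub>M M))"
          by (intro nn_integral_cong) (simp add: kern_sym[of 1 _ "snd _"] ennreal_mult w0 nn_integral_multc nn_integral_kern)
        also have "\<dots> < \<infinity>" by (simp add: nn_integral_cmult mMM wnn ennreal_mult_less_top)
        finally show "(\<integral>\<^sup>+z. ennreal (norm (case z of (y, p) \<Rightarrow> q x y p)) \<partial>(M \<Otimes>\<^sub>M (M \<Otimes>\<^sub>M M))) < \<infinity>" .
      qed
      have "(\<integral>y. P x y \<partial>M) = (\<integral>p. \<integral>y. q x y p \<partial>M \<partial>(M \<Otimes>\<^sub>M M))"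
        unfolding P_def using T.Fubini_integral[OF int] by simp
      also have "\<dots> = (\<integral>p. Z 1 * (kern 1 x (fst p) * Q (fst p) (snd p)) \<partial>(M \<Otimes>\<^sub>M M))"
        by (intro Bochner_Integration.integral_cong refl) (simp add: q_def mult_ac kern_sym[of 1 _ "snd _"] integral_kern)
      also have "\<dots> = Z 1 * (\<integral>p. kern 1 x (fst p) * Q (fst p) (snd p) \<partial>(M \<Otimes>\<^sub>M M))" by simp
      also have "(\<integral>p. kern 1 x (fst p) * Q (fst p) (snd p) \<partial>(M \<Otimes>\<^sub>M M)) = (\<integral>x'. \<integral>y'. kern 1 x x' * Q x' y' \<partial>M \<partial>M)"
      proof -
        have "integrable (M \<Otimes>\<^sub>M M) (\<lambda>p. kern 1 x (fst p) * Q (fst p) (snd p))"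
          by (rule Bochner_Integration.integrable_bound[OF wint[of x]])
             (use Qle in \<open>auto simp: mMM w_def abs_mult intro!: mult_left_mono\<close>)
        from integral_fst'[OF this] show ?thesis by simp
      qed
      also have "\<dots> = (\<integral>x'. kern 1 x x' * (\<integral>y'. Q x' y' \<partial>M) \<partial>M)" by simp
      also have "\<dots> \<le> (\<integral>x'. kern 1 x x' * (- \<delta>) \<partial>M)"
      proof (rule integral_mono)
        show "integrable M (\<lambda>x'. kern 1 x x' * (\<integral>y'. Q x' y' \<partial>M))"
        proof (rule Bochner_Integration.integrable_bound[of M "\<lambda>x'. Z L * kern 1 x x'"])
          have B: "\<bar>\<integral>y'. Q x' y' \<partial>M\<bar> \<le> Z L" for x'
          proof -
            have "\<bar>\<integral>y'. Q x' y' \<partial>M\<bar> \<le> (\<integral>y'. \<bar>Q x' y'\<bar> \<partial>M)" by (rule integral_abs_bound)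
            also have "\<dots> \<le> (\<integral>y'. kern L x' y' \<partial>M)" using Qint Qle by (intro integral_mono integrable_abs integrable_kern) auto
            finally show ?thesis by (simp add: integral_kern)
          qed
          show "AE x' in M. norm (kern 1 x x' * (\<integral>y'. Q x' y' \<partial>M)) \<le> norm (Z L * kern 1 x x')"
            using Z_pos[OF L] mult_left_mono[OF B kern_nonneg[of 1 x]] by (intro AE_I2) (simp add: abs_mult mult.commute)
          have "(\<lambda>x'. \<integral>y'. Q x' y' \<partial>M) \<in> borel_measurable M"
            by (rule sigma_finite_measure.borel_measurable_lebesgue_integral[OF sigma_finite]) (simp add: split_beta')
          then show "(\<lambda>x'. kern 1 x x' * (\<integral>y'. Q x' y' \<partial>M)) \<in> borel_measurable M" by measurable
        qed (use integrable_kern in auto)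
        show "integrable M (\<lambda>x'. kern 1 x x' * - \<delta>)" using integrable_kern[of 1 x] by simp
        show "kern 1 x x' * (\<integral>y'. Q x' y' \<partial>M) \<le> kern 1 x x' * - \<delta>" for x'
          by (intro mult_left_mono QD) simp
      qed
      also have "\<dots> = - (Z 1 * \<delta>)" by (simp add: integral_kern)
      finally show ?thesis using Z_pos[of 1] by (simp add: mult_left_mono)
    qed
  qed (use am c0 \<delta> Z_pos[of 1] in auto)
qed

text \<open>A dichotomy for the iterates of averaging, started at a tent. If some step loses less
  than the factor \<open>1 - \<eta>\<close> of the squared norm, that iterate is almost invariant
  and \<open>foelner_of_almost_invariant\<close> applies. If every step loses it, the supersolution
  arises that amenability excludes.\<close>

theorem amenable_foelner:
  assumes am: "amenable M" and R: "R \<ge> 0" and eps: "eps > 0"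
  shows "\<exists>I. compact I \<and> emeasure M I \<noteq> 0 \<and> emeasure M (thickening R I - I) \<le> ennreal eps * emeasure M I"
proof -
  define L where "L = 2 * (1 + R)"
  have L: "L > 0" using R by (simp add: L_def)
  obtain \<eta> where \<eta>: "\<eta> > 0" "\<eta> < 1" and foel: "\<And>f. f \<in> Cc \<Longrightarrow> (\<integral>x. (f x)\<^sup>2 \<partial>M) > 0 \<Longrightarrow>
      (\<integral>x. (A L f x)\<^sup>2 \<partial>M) \<ge> (1 - \<eta>) * (\<integral>x. (f x)\<^sup>2 \<partial>M) \<Longrightarrow>
      \<exists>I. compact I \<and> emeasure M I \<noteq> 0 \<and> emeasure M (thickening R I - I) \<le> ennreal eps * emeasure M I"
    using foelner_of_almost_invariant[OF R eps L_def] by blast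
  define f where "f n = (A L ^^ n) (kern L 0)" for n
  have fCc: "f n \<in> Cc" for n unfolding f_def by (intro iterate_Cc kern_Cc L)
  have fS: "f (Suc n) = A L (f n)" for n by (simp add: f_def)
  have fpos: "(\<integral>x. f n x \<partial>M) > 0" for n
    by (induction n) (simp_all add: fS integral_A[OF fCc L], simp add: f_def integral_kern Z_pos[OF L])
  have f2: "(\<integral>x. (f n x)\<^sup>2 \<partial>M) > 0" for n
  proof (rule ccontr)
    assume "\<not> ?thesis"
    moreover have "0 \<le> (\<integral>x. (f n x)\<^sup>2 \<partial>M)" by (rule integral_nonneg_AE) simp
    ultimately have "(\<integral>x. (f n x)\<^sup>2 \<partial>M) = 0" by linarith
    then have "AE x in M. (f n x)\<^sup>2 = 0"
      by (subst (asm) integral_nonneg_eq_0_iff_AE[OF CcD(4)[OF Cc_sq[OF fCc]]]) auto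
    then have "AE x in M. f n x = 0" by simp
    then have "(\<integral>x. f n x \<partial>M) = 0" by (rule integral_eq_zero_AE)
    with fpos[of n] show False by simp
  qed
  show ?thesis
  proof (rule ccontr)
    assume neg: "\<not> ?thesis"
    have "(\<integral>x. (f (Suc n) x)\<^sup>2 \<partial>M) \<le> (1 - \<eta>) * (\<integral>x. (f n x)\<^sup>2 \<partial>M)" for n
    proof (rule ccontr)
      assume "\<not> ?thesis"
      then have "(\<integral>x. (A L (f n) x)\<^sup>2 \<partial>M) \<ge> (1 - \<eta>) * (\<integral>x. (f n x)\<^sup>2 \<partial>M)" by (simp add: fS)
      from foel[OF fCc f2 this] neg show False by simp
    qed
    then have contr: "(\<integral>x. ((A L ^^ Suc n) (kern L 0) x)\<^sup>2 \<partial>M) \<le> (1 - \<eta>) * (\<integral>x. ((A L ^^ n) (kern L 0) x)\<^sup>2 \<partial>M)" for n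
      unfolding f_def .
    show False
    proof (rule strict_supersolution[OF L _ _ contr])
      fix h s assume "s < 1" "h \<in> borel_measurable borel" "\<And>x. 0 < h x"
        "\<And>x. (\<integral>\<^sup>+y. ennreal (kern L x y * h y) \<partial>M) \<le> ennreal (s * Z L * h x)"
      then show False by (rule antisymmetric_kernel_of_supersolution[OF L _ _ _ _ am])
    qed (use \<eta> in auto)
  qed
qed

end

section \<open>The vague topology on configurations\<close>

definition vsum :: "('x \<times> 'y \<Rightarrow> real) \<Rightarrow> ('x \<rightharpoonup> 'y) \<Rightarrow> real" where
  "vsum \<phi> f = (\<Sum>\<^sub>\<infinity>x\<in>dom f. \<phi> (x, the (f x)))"

text \<open>A ball of radius 1/2 holds at most one point of a separated set, so the size of a finite
  cover by such balls is a bound that serves all separated sets at once.\<close>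

lemma separated_card_bound:
  assumes "\<And>(x::'x::metric_space) r. compact (cball x r)"
  shows "\<exists>N. \<forall>A. separated_set A \<longrightarrow> finite (A \<inter> cball (x::'x) r) \<and> card (A \<inter> cball x r) \<le> N"
proof -
  have "\<exists>k. finite k \<and> k \<subseteq> cball x r \<and> cball x r \<subseteq> (\<Union>y\<in>k. ball y (1/2))"
    using seq_compact_imp_totally_bounded[OF compact_imp_seq_compact[OF assms, of x r], rule_format, of "1/2"] by simp
  then obtain k where k: "finite k" "cball x r \<subseteq> (\<Union>y\<in>k. ball y (1/2))" by blast
  have "finite (A \<inter> cball x r) \<and> card (A \<inter> cball x r) \<le> card k" if A: "separated_set A" for A :: "'x set"
  proof -
    have "\<forall>z\<in>A \<inter> cball x r. \<exists>y\<in>k. dist y z < 1/2" using k(2) by (auto simp: subset_iff)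
    then obtain c where c: "\<And>z. z \<in> A \<inter> cball x r \<Longrightarrow> c z \<in> k \<and> dist (c z) z < 1/2" by metis
    have "inj_on c (A \<inter> cball x r)"
    proof (rule inj_onI, rule ccontr)
      fix z w assume z: "z \<in> A \<inter> cball x r" and w: "w \<in> A \<inter> cball x r" and eq: "c z = c w" and "z \<noteq> w"
      then have "1 \<le> dist z w" using A by (auto simp: separated_set_def)
      moreover have "dist z w < 1" using c[OF z] c[OF w] eq dist_triangle[of z w "c z"] by (simp add: dist_commute)
      ultimately show False by simp
    qed
    moreover have "c ` (A \<inter> cball x r) \<subseteq> k" using c by blast
    ultimately show ?thesis using k(1) by (meson inj_on_finite card_inj_on_le)
  qed
  then show ?thesis by blast
qed

lemma separated_finite:
  assumes "\<And>(x::'x::metric_space) r. compact (cball x r)" "separated_set A"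
  shows "finite (A \<inter> cball (x::'x) r)"
  using separated_card_bound[OF assms(1), of x r] assms(2) by blast

lemma vsum_nonneg:
  fixes \<phi> :: "'x::metric_space \<times> 'y \<Rightarrow> real"
  assumes proper: "\<And>(x::'x) r. compact (cball x r)" and sep: "separated_set (dom f)"
    and nonneg: "\<And>a. a \<in> dom f \<Longrightarrow> 0 \<le> \<phi> (a, the (f a))"
    and supp: "\<And>a. \<phi> (a, the (f a)) \<noteq> 0 \<Longrightarrow> dist b a < r"
  shows "0 \<le> vsum \<phi> f" and "vsum \<phi> f \<noteq> 0 \<longleftrightarrow> (\<exists>a\<in>dom f. \<phi> (a, the (f a)) \<noteq> 0)"
proof -
  let ?S = "dom f \<inter> cball b r"
  have fin: "finite ?S" by (rule separated_finite[OF proper sep])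
  have S: "a \<in> ?S" if "a \<in> dom f" "\<phi> (a, the (f a)) \<noteq> 0" for a
    using supp[OF that(2)] that(1) by auto
  have "vsum \<phi> f = (\<Sum>\<^sub>\<infinity>a\<in>?S. \<phi> (a, the (f a)))"
    unfolding vsum_def using S by (intro infsum_cong_neutral) blast+
  also have "\<dots> = (\<Sum>a\<in>?S. \<phi> (a, the (f a)))" using fin by simp
  finally have eq: "vsum \<phi> f = (\<Sum>a\<in>?S. \<phi> (a, the (f a)))" .
  show "0 \<le> vsum \<phi> f" unfolding eq using nonneg by (intro sum_nonneg) auto
  have "(\<Sum>a\<in>?S. \<phi> (a, the (f a))) = 0 \<longleftrightarrow> (\<forall>a\<in>?S. \<phi> (a, the (f a)) = 0)"
    using nonneg fin by (intro sum_nonneg_eq_0_iff) auto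
  then show "vsum \<phi> f \<noteq> 0 \<longleftrightarrow> (\<exists>a\<in>dom f. \<phi> (a, the (f a)) \<noteq> 0)" unfolding eq using S by blast
qed

locale proper_decoration =
  fixes Y :: "'y topology" and x0 :: "'x::metric_space"
  assumes proper_center: "\<And>r. compact (cball x0 r)"
    and Y_compact: "compact_space Y"
begin

lemma proper: "compact (cball (x::'x) r)"
proof -
  have "cball x r \<subseteq> cball x0 (dist x0 x + r)"
  proof
    fix z assume "z \<in> cball x r"
    then show "z \<in> cball x0 (dist x0 x + r)" using dist_triangle[of x0 z x] by simp
  qed
  then show ?thesis using compact_Int_closed[OF proper_center closed_cball, of "dist x0 x + r" x r]
    by (simp add: Int_absorb1)
qed

abbreviation Zt :: "('x \<times> 'y) topology" where "Zt \<equiv> prod_topology euclidean Y"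

lemma compactin_cyl: "compactin Zt (cball x r \<times> topspace Y)"
  using proper Y_compact by (simp add: compactin_Times compact_space_def)

text \<open>Since \<open>Y\<close> is compact, only the first coordinate can escape: the projection
  of a compact support is bounded, and conversely a closed cylinder over a ball is compact.\<close>

lemma Cc_in_iff:
  "\<phi> \<in> Cc_in Zt \<longleftrightarrow> continuous_map Zt euclidean \<phi> \<and> (\<exists>r. \<forall>x y. y \<in> topspace Y \<longrightarrow> r < dist x0 x \<longrightarrow> \<phi> (x, y) = 0)"
proof
  assume \<phi>: "\<phi> \<in> Cc_in Zt"
  let ?S = "{z \<in> topspace Zt. \<phi> z \<noteq> 0}"
  have K: "compactin Zt (Zt closure_of ?S)" and c: "continuous_map Zt euclidean \<phi>" using \<phi> by (auto simp: Cc_in_def)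
  have "compactin euclidean (fst ` (Zt closure_of ?S))"
    by (rule image_compactin[OF K continuous_map_fst])
  then have "bounded (fst ` (Zt closure_of ?S))" by (simp add: compact_imp_bounded)
  then obtain r where r: "\<And>x. x \<in> fst ` (Zt closure_of ?S) \<Longrightarrow> dist x0 x \<le> r"
    unfolding bounded_any_center[where a = x0] by blast
  have "\<phi> (x, y) = 0" if "y \<in> topspace Y" "r < dist x0 x" for x y
  proof (rule ccontr)
    assume "\<phi> (x, y) \<noteq> 0"
    then have "(x, y) \<in> Zt closure_of ?S" using closure_of_subset[of ?S Zt] that(1) by auto
    then show False using r[of x] that(2) by force
  qed
  with c show "continuous_map Zt euclidean \<phi> \<and> (\<exists>r. \<forall>x y. y \<in> topspace Y \<longrightarrow> r < dist x0 x \<longrightarrow> \<phi> (x, y) = 0)" by blast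
next
  assume "continuous_map Zt euclidean \<phi> \<and> (\<exists>r. \<forall>x y. y \<in> topspace Y \<longrightarrow> r < dist x0 x \<longrightarrow> \<phi> (x, y) = 0)"
  then obtain r where c: "continuous_map Zt euclidean \<phi>" and r: "\<And>x y. y \<in> topspace Y \<Longrightarrow> r < dist x0 x \<Longrightarrow> \<phi> (x, y) = 0" by blast
  let ?S = "{z \<in> topspace Zt. \<phi> z \<noteq> 0}"
  have cl: "closedin Zt (cball x0 r \<times> topspace Y)" by (simp add: closedin_prod_Times_iff)
  have "?S \<subseteq> cball x0 r \<times> topspace Y"
  proof
    fix z assume "z \<in> ?S"
    then show "z \<in> cball x0 r \<times> topspace Y" using r[of "snd z" "fst z"] by (cases z) (auto simp: not_less[symmetric])
  qed
  then have "Zt closure_of ?S \<subseteq> cball x0 r \<times> topspace Y" by (rule closure_of_minimal[OF _ cl])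
  then have "compactin Zt (Zt closure_of ?S)"
    by (rule closed_compactin[OF compactin_cyl]) simp
  with c show "\<phi> \<in> Cc_in Zt" by (simp add: Cc_in_def)
qed

lemma zero_Cc: "(\<lambda>_. 0) \<in> Cc_in Zt" by (simp add: Cc_in_iff)

lemma topspace_vague: "topspace (vague_topology Y) = (decorated_sets Y :: ('x \<rightharpoonup> 'y) set)"
proof -
  let ?B = "\<lambda>\<phi> U. {f \<in> decorated_sets Y. (\<Sum>\<^sub>\<infinity>x\<in>dom f. \<phi> (x::'x, the (f x) :: 'y)) \<in> U}"
  have "?B (\<lambda>_. 0) (UNIV :: real set) \<in> {?B \<phi> U | \<phi> U. \<phi> \<in> Cc_in Zt \<and> open U}"
    using zero_Cc by blast
  then show ?thesis unfolding vague_topology_def topology_generated_by_topspace by auto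
qed

lemma continuous_vsum: "\<phi> \<in> Cc_in Zt \<Longrightarrow> continuous_map (vague_topology Y) euclidean (vsum \<phi>)"
proof (unfold continuous_map_def, intro conjI allI impI)
  fix U :: "real set" assume \<phi>: "\<phi> \<in> Cc_in Zt" and U: "openin euclidean U"
  have "{f \<in> topspace (vague_topology Y). vsum \<phi> f \<in> U} = {f \<in> decorated_sets Y. (\<Sum>\<^sub>\<infinity>x\<in>dom f. \<phi> (x, the (f x))) \<in> U}"
    by (simp add: topspace_vague vsum_def)
  also have "openin (vague_topology Y) \<dots>"
    unfolding vague_topology_def using \<phi> U by (intro topology_generated_by_Basis) auto
  finally show "openin (vague_topology Y) {f \<in> topspace (vague_topology Y). vsum \<phi> f \<in> U}" .
qed auto

lemma continuous_into_vague:
  assumes "\<And>s. s \<in> topspace T \<Longrightarrow> F s \<in> decorated_sets Y"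
    and "\<And>\<phi>. \<phi> \<in> Cc_in Zt \<Longrightarrow> continuous_map T euclidean (\<lambda>s. vsum \<phi> (F s))"
  shows "continuous_map T (vague_topology Y) F"
  unfolding vague_topology_def
proof (rule continuous_on_generated_topo)
  fix S assume "S \<in> {{f \<in> decorated_sets Y. (\<Sum>\<^sub>\<infinity>x\<in>dom f. \<phi> (x, the (f x))) \<in> U} | \<phi> U. \<phi> \<in> Cc_in Zt \<and> open U}"
  then obtain \<phi> U where S: "S = {f \<in> decorated_sets Y. vsum \<phi> f \<in> U}" and \<phi>: "\<phi> \<in> Cc_in Zt" and U: "open U"
    by (auto simp: vsum_def)
  have "F -` S \<inter> topspace T = {s \<in> topspace T. vsum \<phi> (F s) \<in> U}" using assms(1) by (auto simp: S)
  also have "openin T \<dots>" using assms(2)[OF \<phi>] U by (simp add: continuous_map_def)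
  finally show "openin T (F -` S \<inter> topspace T)" .
next
  show "F ` topspace T \<subseteq> \<Union>{{f \<in> decorated_sets Y. (\<Sum>\<^sub>\<infinity>x\<in>dom f. \<phi> (x, the (f x))) \<in> U} | \<phi> U. \<phi> \<in> Cc_in Zt \<and> open U}"
    using assms(1) topspace_vague unfolding vague_topology_def topology_generated_by_topspace by blast
qed

section \<open>The Fell topology and compactness of the space of decorations\<close>

definition fell_closed :: "('x \<times> 'y) set set" where "fell_closed = {F. closedin Zt F}"
definition hit :: "('x \<times> 'y) set \<Rightarrow> ('x \<times> 'y) set set" where "hit U = {F. closedin Zt F \<and> F \<inter> U \<noteq> {}}"
definition miss :: "('x \<times> 'y) set \<Rightarrow> ('x \<times> 'y) set set" where "miss K = {F. closedin Zt F \<and> F \<inter> K = {}}"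
text \<open>The usual subbase of the Fell topology. It makes the closed subsets a compact space
  without any separation axiom; a decorated set is determined by its graph, and the graphs will turn
  out to form a closed part of this space.\<close>

definition fell_base :: "('x \<times> 'y) set set set" where
  "fell_base = {hit U | U. openin Zt U} \<union> {miss K | K. compactin Zt K}"
definition fell_topology :: "('x \<times> 'y) set topology" where
  "fell_topology = topology (arbitrary union_of (finite intersection_of (\<lambda>x. x \<in> fell_base) relative_to \<Union>fell_base))"

lemma Union_fell_base: "\<Union>fell_base = fell_closed"
proof -
  have "miss {} \<in> fell_base" by (auto simp: fell_base_def)
  then show ?thesis by (auto simp: fell_base_def fell_closed_def hit_def miss_def)
qed

lemma topspace_fell: "topspace fell_topology = fell_closed"
  unfolding fell_topology_def topspace_subbase Union_fell_base ..

lemma openin_fell: assumes "B \<in> fell_base" shows "openin fell_topology B"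
  unfolding fell_topology_def openin_subbase
proof (rule arbitrary_union_of_inc)
  have "\<Union>fell_base \<inter> B = B" using assms by blast
  moreover have "(finite intersection_of (\<lambda>x. x \<in> fell_base)) B" by (rule finite_intersection_of_inc) (rule assms)
  ultimately show "(finite intersection_of (\<lambda>x. x \<in> fell_base) relative_to \<Union>fell_base) B"
    unfolding relative_to_def by blast
qed

text \<open>Alexander's subbase theorem. Given a cover by subbasic sets, let \<open>F\<close> be the
  closed set left over by all \<open>U\<close> with \<open>hit U\<close> in the cover. No such
  \<open>hit U\<close> contains \<open>F\<close>, so some \<open>miss K\<close> does; then
  \<open>K\<close> is covered by these \<open>U\<close>, finitely many suffice, and their
  \<open>hit U\<close> together with \<open>miss K\<close> cover everything.\<close>

lemma compact_fell: "compact_space fell_topology"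
proof (rule Alexander_subbase)
  show "topology (arbitrary union_of (finite intersection_of (\<lambda>x. x \<in> fell_base) relative_to \<Union>fell_base)) = fell_topology"
    by (simp add: fell_topology_def)
  fix C assume C: "C \<subseteq> fell_base" "\<Union>C = topspace fell_topology"
  define \<U> where "\<U> = {U. openin Zt U \<and> hit U \<in> C}"
  define F where "F = topspace Zt - \<Union>\<U>"
  have "closedin Zt F" unfolding F_def \<U>_def by (intro closedin_diff[OF closedin_topspace] openin_Union) auto
  then have "F \<in> \<Union>C" using C(2) by (simp add: topspace_fell fell_closed_def)
  then obtain c where c: "c \<in> C" "F \<in> c" by blast
  have "\<not> (\<exists>U. c = hit U \<and> openin Zt U)" using c unfolding \<U>_def F_def hit_def by blast
  then obtain K where K: "c = miss K" "compactin Zt K" using c(1) C(1) by (auto simp: fell_base_def)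
  then have "K \<subseteq> \<Union>\<U>" using c(2) compactin_subset_topspace[OF K(2)] by (auto simp: F_def miss_def)
  then obtain \<V> where V: "finite \<V>" "\<V> \<subseteq> \<U>" "K \<subseteq> \<Union>\<V>"
    using K(2) unfolding compactin_def \<U>_def by (metis (no_types, lifting) mem_Collect_eq)
  show "\<exists>C'. finite C' \<and> C' \<subseteq> C \<and> \<Union>C' = topspace fell_topology"
  proof (intro exI[of _ "insert (miss K) (hit ` \<V>)"] conjI)
    show "finite (insert (miss K) (hit ` \<V>))" using V(1) by simp
    show sub: "insert (miss K) (hit ` \<V>) \<subseteq> C" using c(1) K(1) V(2) by (auto simp: \<U>_def)
    show "\<Union>(insert (miss K) (hit ` \<V>)) = topspace fell_topology"
    proof
      show "\<Union>(insert (miss K) (hit ` \<V>)) \<subseteq> topspace fell_topology" using sub C(2) by blast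
      show "topspace fell_topology \<subseteq> \<Union>(insert (miss K) (hit ` \<V>))"
      proof
        fix G assume "G \<in> topspace fell_topology"
        then have G: "closedin Zt G" by (simp add: topspace_fell fell_closed_def)
        show "G \<in> \<Union>(insert (miss K) (hit ` \<V>))"
        proof (cases "G \<inter> K = {}")
          case True
          then show ?thesis using G by (simp add: miss_def)
        next
          case False
          then obtain U where "U \<in> \<V>" "G \<inter> U \<noteq> {}" using V(3) by blast
          then show ?thesis using G by (auto simp: hit_def)
        qed
      qed
    qed
  qed
qed

definition separated_graphs :: "('x \<times> 'y) set set" where
  "separated_graphs = {F. closedin Zt F \<and> (\<forall>p\<in>F. \<forall>q\<in>F. p \<noteq> q \<longrightarrow> 1 \<le> dist (fst p) (fst q))}"

definition graph_map :: "('x \<times> 'y) set \<Rightarrow> ('x \<rightharpoonup> 'y)" where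
  "graph_map F x = (if \<exists>y. (x, y) \<in> F then Some (THE y. (x, y) \<in> F) else None)"

lemma separated_graph_subset: "F \<in> separated_graphs \<Longrightarrow> F \<subseteq> topspace Zt"
  by (rule closedin_subset) (simp add: separated_graphs_def)

lemma separated_graphD: "F \<in> separated_graphs \<Longrightarrow> p \<in> F \<Longrightarrow> q \<in> F \<Longrightarrow> dist (fst p) (fst q) < 1 \<Longrightarrow> p = q"
  by (force simp: separated_graphs_def)

lemma graph_map_eq: assumes "F \<in> separated_graphs" "(x, y) \<in> F" shows "graph_map F x = Some y"
proof -
  have "(THE y. (x, y) \<in> F) = y"
    using assms(2) separated_graphD[OF assms(1), of "(x, _)" "(x, _)"] by (intro the_equality) auto
  then show ?thesis using assms(2) by (auto simp: graph_map_def)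
qed

lemma dom_graph_map: "dom (graph_map F) = fst ` F"
  by (force simp: graph_map_def dom_def split: if_splits)

lemma graph_map_mem: assumes "F \<in> separated_graphs" "x \<in> fst ` F" shows "(x, the (graph_map F x)) \<in> F"
  using assms graph_map_eq[OF assms(1)] by force

lemma graph_map_decorated: assumes F: "F \<in> separated_graphs" shows "graph_map F \<in> decorated_sets Y"
proof -
  have sub: "F \<subseteq> topspace Zt" by (rule separated_graph_subset[OF F])
  have "separated_set (dom (graph_map F))"
    unfolding separated_set_def dom_graph_map using separated_graphD[OF F] by (force simp: not_less[symmetric])
  moreover have "ran (graph_map F) \<subseteq> topspace Y"
  proof
    fix y assume "y \<in> ran (graph_map F)"
    then obtain x where x: "graph_map F x = Some y" by (auto simp: ran_def)
    then have "x \<in> fst ` F" using dom_graph_map by blast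
    from graph_map_mem[OF F this] x sub show "y \<in> topspace Y" by auto
  qed
  ultimately show ?thesis by (simp add: decorated_sets_def)
qed

end

locale hausdorff_decoration = proper_decoration Y x0
  for Y :: "'y topology" and x0 :: "'x::metric_space" +
  assumes Y_hausdorff: "Hausdorff_space Y"
begin

lemma Zt_hausdorff: "Hausdorff_space Zt"
  using Y_hausdorff by (simp add: Hausdorff_space_prod_topology Hausdorff_space_euclidean)

text \<open>Two distinct points less than 1 apart have disjoint neighbourhoods, and moving each by
  less than half the slack \<open>1 - dist\<close> keeps them less than 1 apart. Hitting both
  neighbourhoods is an open condition that excludes separation.\<close>

lemma closedin_separated_graphs: "closedin fell_topology separated_graphs"
  unfolding closedin_def
proof (intro conjI)
  show "separated_graphs \<subseteq> topspace fell_topology" by (auto simp: topspace_fell fell_closed_def separated_graphs_def)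
  show "openin fell_topology (topspace fell_topology - separated_graphs)"
  proof (subst openin_subopen, intro ballI)
    fix F assume "F \<in> topspace fell_topology - separated_graphs"
    then have F: "closedin Zt F" and "F \<notin> separated_graphs" by (auto simp: topspace_fell fell_closed_def)
    then have "\<not> (\<forall>p\<in>F. \<forall>q\<in>F. p \<noteq> q \<longrightarrow> 1 \<le> dist (fst p) (fst q))" unfolding separated_graphs_def by blast
    then obtain p q where pq: "p \<in> F" "q \<in> F" "p \<noteq> q" "dist (fst p) (fst q) < 1" by (meson not_le)
    have "p \<in> topspace Zt" "q \<in> topspace Zt" using pq closedin_subset[OF F] by auto
    then obtain U V where UV: "openin Zt U" "openin Zt V" "p \<in> U" "q \<in> V" "disjnt U V"
      using Zt_hausdorff pq(3) unfolding Hausdorff_space_def by metis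
    define r where "r = (1 - dist (fst p) (fst q)) / 2"
    have r: "r > 0" using pq by (simp add: r_def)
    define U' where "U' = U \<inter> (ball (fst p) r \<times> topspace Y)"
    define V' where "V' = V \<inter> (ball (fst q) r \<times> topspace Y)"
    have "openin Zt U'" "openin Zt V'" unfolding U'_def V'_def using UV by (auto intro!: openin_Int simp: openin_prod_Times_iff)
    then have "openin fell_topology (hit U' \<inter> hit V')" by (intro openin_Int openin_fell) (auto simp: fell_base_def)
    moreover have "p \<in> U'" "q \<in> V'" using UV r \<open>p \<in> topspace Zt\<close> \<open>q \<in> topspace Zt\<close> by (auto simp: U'_def V'_def mem_Times_iff)
    then have "F \<in> hit U' \<inter> hit V'" using pq F by (auto simp: hit_def)
    moreover have "hit U' \<inter> hit V' \<subseteq> topspace fell_topology - separated_graphs"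
    proof
      fix G assume G: "G \<in> hit U' \<inter> hit V'"
      then obtain a b where ab: "a \<in> G" "a \<in> U'" "b \<in> G" "b \<in> V'" by (auto simp: hit_def)
      have "a \<noteq> b" using ab UV(5) by (auto simp: U'_def V'_def disjnt_def)
      moreover have "dist (fst a) (fst b) < 1"
      proof -
        have "dist (fst p) (fst a) < r" "dist (fst q) (fst b) < r" using ab by (auto simp: U'_def V'_def)
        moreover have "dist (fst a) (fst b) \<le> dist (fst p) (fst a) + dist (fst p) (fst q) + dist (fst q) (fst b)"
          using dist_triangle[of "fst a" "fst b" "fst p"] dist_triangle[of "fst p" "fst b" "fst q"] by (simp add: dist_commute)
        ultimately show ?thesis by (simp add: r_def field_simps)
      qed
      ultimately have "G \<notin> separated_graphs" using ab separated_graphD by blast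
      then show "G \<in> topspace fell_topology - separated_graphs" using G by (auto simp: topspace_fell fell_closed_def hit_def)
    qed
    ultimately show "\<exists>T. openin fell_topology T \<and> F \<in> T \<and> T \<subseteq> topspace fell_topology - separated_graphs" by blast
  qed
qed

text \<open>The graph of a decorated set is closed: the cylinder over a ball of radius 1/2 contains
  at most one of its points, and singletons are closed.\<close>

lemma graph_map_surj: assumes f: "f \<in> decorated_sets Y" shows "f \<in> graph_map ` separated_graphs"
proof
  define F where "F = {(x, the (f x)) | x. x \<in> dom f}"
  have sep: "separated_set (dom f)" and ran: "ran f \<subseteq> topspace Y" using f by (auto simp: decorated_sets_def)
  have sub: "F \<subseteq> topspace Zt" using ran by (auto simp: F_def ran_def)
  have close: "p = q" if "p \<in> F" "q \<in> F" "dist (fst p) (fst q) < 1" for p q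
    using that sep unfolding F_def separated_set_def by (force simp: not_less[symmetric])
  have "closedin Zt F"
    unfolding closedin_def
  proof (intro conjI sub)
    show "openin Zt (topspace Zt - F)"
    proof (subst openin_subopen, intro ballI)
      fix z assume z: "z \<in> topspace Zt - F"
      define B where "B = ball (fst z) (1/2) \<times> topspace Y"
      have B: "openin Zt B" "z \<in> B" using z by (auto simp: B_def openin_prod_Times_iff mem_Times_iff)
      show "\<exists>T. openin Zt T \<and> z \<in> T \<and> T \<subseteq> topspace Zt - F"
      proof (cases "\<exists>p. p \<in> F \<inter> B")
        case False
        then show ?thesis using B openin_subset[OF B(1)] by blast
      next
        case True
        then obtain p where p: "p \<in> F" "p \<in> B" by blast
        have "q = p" if "q \<in> F" "q \<in> B" for q
        proof (rule close[OF that(1) p(1)])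
          show "dist (fst q) (fst p) < 1"
            using that(2) p(2) dist_triangle[of "fst q" "fst p" "fst z"] by (auto simp: B_def dist_commute)
        qed
        then have "B - {p} \<subseteq> topspace Zt - F" using openin_subset[OF B(1)] by blast
        moreover have "openin Zt (B - {p})"
          using p sub by (intro openin_diff B closedin_Hausdorff_singleton[OF Zt_hausdorff]) auto
        moreover have "z \<in> B - {p}" using B z p by auto
        ultimately show ?thesis by blast
      qed
    qed
  qed
  moreover have "1 \<le> dist (fst p) (fst q)" if "p \<in> F" "q \<in> F" "p \<noteq> q" for p q
    using close[OF that(1,2)] that(3) by linarith
  ultimately show F: "F \<in> separated_graphs" by (simp add: separated_graphs_def)
  show "f = graph_map F"
  proof
    fix x show "f x = graph_map F x"
    proof (cases "x \<in> dom f")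
      case True
      then have "(x, the (f x)) \<in> F" by (auto simp: F_def)
      from graph_map_eq[OF F this] True show ?thesis by auto
    next
      case False
      then have "x \<notin> dom (graph_map F)" unfolding dom_graph_map by (auto simp: F_def)
      with False show ?thesis by (simp add: domIff)
    qed
  qed
qed

text \<open>Over the ball that carries the test function, \<open>F0\<close> has finitely many
  points. To hit a small neighbourhood \<open>U x\<close> of each and to miss the compact remainder
  \<open>K\<close> of the cylinder is an open condition. It places exactly one point of a separated
  graph in each \<open>U x\<close>, by the radius 1/2, and none elsewhere over the ball, so the two
  sums have matching terms that differ by less than \<open>\<epsilon>\<close>.\<close>

lemma continuous_graph_map: "continuous_map (subtopology fell_topology separated_graphs) (vague_topology Y) graph_map"
proof (rule continuous_into_vague)
  let ?T = "subtopology fell_topology separated_graphs"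
  have topT: "topspace ?T = separated_graphs" by (auto simp: topspace_fell fell_closed_def separated_graphs_def)
  show "graph_map F \<in> decorated_sets Y" if "F \<in> topspace ?T" for F using that graph_map_decorated topT by blast
  fix \<phi> :: "'x \<times> 'y \<Rightarrow> real" assume "\<phi> \<in> Cc_in Zt"
  then obtain r where c: "continuous_map Zt euclidean \<phi>" and r: "\<And>x y. y \<in> topspace Y \<Longrightarrow> r < dist x0 x \<Longrightarrow> \<phi> (x, y) = 0"
    unfolding Cc_in_iff by blast
  show "continuous_map ?T euclidean (\<lambda>F. vsum \<phi> (graph_map F))"
    unfolding continuous_map_def
  proof (intro conjI allI impI)
    fix V :: "real set" assume V: "openin euclidean V"
    show "openin ?T {F \<in> topspace ?T. vsum \<phi> (graph_map F) \<in> V}"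
    proof (subst openin_subopen, intro ballI)
      fix F0 assume "F0 \<in> {F \<in> topspace ?T. vsum \<phi> (graph_map F) \<in> V}"
      then have F0: "F0 \<in> separated_graphs" "vsum \<phi> (graph_map F0) \<in> V" using topT by auto
      have F0Z: "F0 \<subseteq> topspace Zt" by (rule separated_graph_subset[OF F0(1)])
      obtain e where e: "e > 0" "ball (vsum \<phi> (graph_map F0)) e \<subseteq> V" using F0(2) V by (metis open_openin openE)
      define f0 where "f0 = graph_map F0"
      define S where "S = fst ` F0 \<inter> cball x0 r"
      have S: "finite S" unfolding S_def dom_graph_map[symmetric]
        using graph_map_decorated[OF F0(1)] by (intro separated_finite[OF proper]) (auto simp: decorated_sets_def)
      define \<epsilon> where "\<epsilon> = e / (real (card S) + 1)"
      have \<epsilon>: "\<epsilon> > 0" using e(1) by (simp add: \<epsilon>_def)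
      define P where "P x = (x, the (f0 x))" for x
      have PF: "P x \<in> F0" if "x \<in> S" for x using that graph_map_mem[OF F0(1)] by (auto simp: S_def P_def f0_def)
      define U where "U x = {z \<in> topspace Zt. \<phi> z \<in> ball (\<phi> (P x)) \<epsilon>} \<inter> (ball x (1/2) \<times> topspace Y)" for x
      have oU: "openin Zt (U x)" for x unfolding U_def
        using c by (intro openin_Int) (auto simp: continuous_map_def openin_prod_Times_iff)
      have PU: "P x \<in> U x" if "x \<in> S" for x
        using PF[OF that] F0Z \<epsilon> by (auto simp: U_def P_def)
      define K where "K = cball x0 r \<times> topspace Y - (\<Union>x\<in>S. U x)"
      have K: "compactin Zt K"
      proof -
        have "closedin Zt K" unfolding K_def by (intro closedin_diff openin_Union) (auto simp: closedin_prod_Times_iff oU)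
        then show ?thesis by (intro closed_compactin[OF compactin_cyl]) (auto simp: K_def)
      qed
      define W where "W = miss K \<inter> (\<Inter>x\<in>S. hit (U x)) \<inter> topspace fell_topology"
      have oW: "openin fell_topology W"
      proof -
        have "openin fell_topology ((\<Inter>x\<in>S. hit (U x)) \<inter> topspace fell_topology)"
        proof (cases "S = {}")
          case False
          have "openin fell_topology (\<Inter>x\<in>S. hit (U x))"
            using S False oU by (intro openin_INT2 openin_fell) (auto simp: fell_base_def)
          then show ?thesis by (simp add: openin_Int)
        qed simp
        moreover have "openin fell_topology (miss K)" using K by (intro openin_fell) (auto simp: fell_base_def)
        ultimately show ?thesis unfolding W_def Int_assoc by (metis openin_Int)
      qed
      have inS: "x \<in> S" if "(x, y) \<in> F0" "dist x0 x \<le> r" for x y using that by (force simp: S_def)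
      have F0W: "F0 \<in> W"
      proof -
        have cl: "closedin Zt F0" using F0(1) by (simp add: separated_graphs_def)
        have "F0 \<inter> K = {}"
        proof (rule ccontr)
          assume "F0 \<inter> K \<noteq> {}"
          then obtain x y where xy: "(x, y) \<in> F0" "(x, y) \<in> K" by (metis disjoint_iff surj_pair)
          then have "x \<in> S" using inS by (auto simp: K_def)
          moreover have "P x = (x, y)" using graph_map_eq[OF F0(1) xy(1)] by (simp add: P_def f0_def)
          ultimately show False using PU[of x] xy(2) by (auto simp: K_def)
        qed
        then show ?thesis using cl PF PU by (auto simp: W_def miss_def hit_def topspace_fell fell_closed_def)
      qed
      have sum0: "vsum \<phi> f0 = (\<Sum>x\<in>S. \<phi> (P x))"
      proof -
        have "vsum \<phi> f0 = (\<Sum>\<^sub>\<infinity>x\<in>S. \<phi> (P x))"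
          unfolding vsum_def P_def
        proof (rule infsum_cong_neutral)
          fix x assume "x \<in> dom f0 - S"
          then have "x \<in> fst ` F0" "r < dist x0 x" by (auto simp: f0_def dom_graph_map S_def)
          then show "\<phi> (x, the (f0 x)) = 0"
            using r graph_map_mem[OF F0(1)] F0Z by (auto simp: f0_def)
        qed (auto simp: S_def f0_def dom_graph_map)
        then show ?thesis using S by simp
      qed
      have close: "\<bar>vsum \<phi> (graph_map F) - vsum \<phi> f0\<bar> < e" if F: "F \<in> separated_graphs" "F \<in> W" for F
      proof -
        have FZ: "F \<subseteq> topspace Zt" by (rule separated_graph_subset[OF F(1)])
        have "\<forall>x\<in>S. \<exists>p. p \<in> F \<and> p \<in> U x" using F(2) by (auto simp: W_def hit_def)
        then obtain p where p: "\<And>x. x \<in> S \<Longrightarrow> p x \<in> F" "\<And>x. x \<in> S \<Longrightarrow> p x \<in> U x" by metis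
        have uniq: "q = p x" if "x \<in> S" "q \<in> F" "q \<in> U x" for x q
        proof (rule separated_graphD[OF F(1) that(2) p(1)[OF that(1)]])
          show "dist (fst q) (fst (p x)) < 1"
            using that(3) p(2)[OF that(1)] dist_triangle[of "fst q" "fst (p x)" x] by (auto simp: U_def dist_commute)
        qed
        have inj: "inj_on (\<lambda>x. fst (p x)) S"
        proof (rule inj_onI, rule ccontr)
          fix x x' assume x: "x \<in> S" "x' \<in> S" "fst (p x) = fst (p x')" "x \<noteq> x'"
          have "dist x x' < 1" using p(2)[OF x(1)] p(2)[OF x(2)] x(3) dist_triangle[of x x' "fst (p x)"] by (auto simp: U_def dist_commute)
          then show False using separated_graphD[OF F0(1) PF[OF x(1)] PF[OF x(2)]] x(4) by (simp add: P_def)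
        qed
        have val: "\<phi> (fst (p x), the (graph_map F (fst (p x)))) = \<phi> (p x)" if "x \<in> S" for x
          using graph_map_eq[OF F(1), of "fst (p x)" "snd (p x)"] p(1)[OF that] by simp
        have "vsum \<phi> (graph_map F) = (\<Sum>\<^sub>\<infinity>x\<in>(\<lambda>x. fst (p x)) ` S. \<phi> (x, the (graph_map F x)))"
          unfolding vsum_def
        proof (rule infsum_cong_neutral)
          fix x assume x: "x \<in> dom (graph_map F) - (\<lambda>x. fst (p x)) ` S"
          define q where "q = (x, the (graph_map F x))"
          have q: "q \<in> F" using x graph_map_mem[OF F(1)] by (auto simp: dom_graph_map q_def)
          show "\<phi> (x, the (graph_map F x)) = 0"
          proof (rule ccontr)
            assume nz: "\<phi> (x, the (graph_map F x)) \<noteq> 0"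
            then have "q \<in> cball x0 r \<times> topspace Y" using r[of "snd q" "fst q"] q FZ by (auto simp: q_def not_less[symmetric])
            moreover have "q \<notin> K" using F(2) q by (auto simp: W_def miss_def)
            ultimately obtain x' where "x' \<in> S" "q \<in> U x'" by (auto simp: K_def)
            then have "q = p x'" using uniq q by blast
            then have "x = fst (p x')" by (metis fst_conv q_def)
            then show False using x \<open>x' \<in> S\<close> by blast
          qed
        next
          fix x assume "x \<in> (\<lambda>x. fst (p x)) ` S - dom (graph_map F)"
          then show "\<phi> (x, the (graph_map F x)) = 0" using p(1) by (auto simp: dom_graph_map)
        qed simp
        also have "\<dots> = (\<Sum>x\<in>S. \<phi> (p x))" using S inj val by (simp add: sum.reindex)
        finally have "\<bar>vsum \<phi> (graph_map F) - vsum \<phi> f0\<bar> = \<bar>\<Sum>x\<in>S. \<phi> (p x) - \<phi> (P x)\<bar>" by (simp add: sum0 sum_subtractf)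
        also have "\<dots> \<le> (\<Sum>x\<in>S. \<epsilon>)"
          using p(2) by (intro order_trans[OF sum_abs] sum_mono) (auto simp: U_def dist_real_def abs_minus_commute less_imp_le)
        also have "\<dots> < e" using e(1) by (simp add: \<epsilon>_def field_simps)
        finally show ?thesis .
      qed
      show "\<exists>T. openin ?T T \<and> F0 \<in> T \<and> T \<subseteq> {F \<in> topspace ?T. vsum \<phi> (graph_map F) \<in> V}"
      proof (intro exI[of _ "separated_graphs \<inter> W"] conjI)
        show "openin ?T (separated_graphs \<inter> W)" using oW by (auto simp: openin_subtopology)
        show "F0 \<in> separated_graphs \<inter> W" using F0 F0W by simp
        show "separated_graphs \<inter> W \<subseteq> {F \<in> topspace ?T. vsum \<phi> (graph_map F) \<in> V}"
          unfolding topT using close e(2) by (force simp: f0_def dist_real_def abs_minus_commute)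
      qed
    qed
  qed auto
qed

text \<open>The vague space is a continuous image of a closed part of the compact Fell
  space.\<close>

lemma compact_vague: "compact_space (vague_topology Y :: ('x \<rightharpoonup> 'y) topology)"
proof -
  let ?T = "subtopology fell_topology separated_graphs"
  have "compactin fell_topology separated_graphs"
    by (rule closedin_compact_space[OF compact_fell closedin_separated_graphs])
  then have "compact_space ?T" by (rule compact_space_subtopology)
  then have "compactin ?T (topspace ?T)" by (simp add: compact_space_def)
  from image_compactin[OF this continuous_graph_map]
  have c: "compactin (vague_topology Y) (graph_map ` topspace ?T)" .
  have "topspace (vague_topology Y) \<subseteq> graph_map ` topspace ?T"
  proof -
    have "topspace ?T = separated_graphs" by (auto simp: topspace_fell fell_closed_def separated_graphs_def)
    then show ?thesis using graph_map_surj by (auto simp: topspace_vague)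
  qed
  then have "graph_map ` topspace ?T = topspace (vague_topology Y)" using compactin_subset_topspace[OF c] by blast
  with c show ?thesis by (simp add: compact_space_def)
qed

text \<open>The space of decorations is itself used as a decoration; only its compactness is needed for that.\<close>

lemma outer_decoration: "proper_decoration (vague_topology Y :: ('x \<rightharpoonup> 'y) topology) x0"
  using proper compact_vague by (simp add: proper_decoration_def)

end

text \<open>A change of variables: testing the image against \<open>\<phi>\<close> is testing the
  original against \<open>\<phi>\<close> composed with \<open>t\<close> on points and
  \<open>\<tau>\<close> on decorations, which is again a test function.\<close>

lemma continuous_pushforward:
  fixes Y :: "'y topology" and Y' :: "'z topology" and t t' :: "'x::metric_space \<Rightarrow> 'x" and x0 :: 'x
  assumes Y: "proper_decoration Y x0" and Y': "proper_decoration Y' x0"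
    and t: "\<And>x. t' (t x) = x" "\<And>x. t (t' x) = x" "\<And>x y. dist (t x) (t y) = dist x y"
    and \<tau>: "continuous_map Y Y' \<tau>"
  shows "continuous_map (vague_topology Y) (vague_topology Y') (\<lambda>f x. map_option \<tau> (f (t' x)))"
proof -
  interpret A: proper_decoration Y x0 by (rule Y)
  interpret B: proper_decoration Y' x0 by (rule Y')
  have dom: "dom (\<lambda>x. map_option \<tau> (f (t' x))) = t ` dom f" for f
    using t by (auto simp: dom_def image_iff) metis+
  have tc: "continuous_map euclidean euclidean t"
    unfolding continuous_map_iff_continuous2 using t(3) by (auto simp: continuous_on_iff intro!: exI)
  show ?thesis
  proof (rule B.continuous_into_vague)
    fix f assume "f \<in> topspace (vague_topology Y :: ('x \<rightharpoonup> 'y) topology)"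
    then have f: "f \<in> decorated_sets Y" by (simp add: A.topspace_vague)
    have "separated_set (dom f)" using f by (simp add: decorated_sets_def)
    then have "separated_set (t ` dom f)" using t(3) unfolding separated_set_def by (metis imageE)
    moreover have "ran (\<lambda>x. map_option \<tau> (f (t' x))) \<subseteq> topspace Y'"
      using f \<tau> by (auto simp: ran_def decorated_sets_def continuous_map_def Pi_iff)
    ultimately show "(\<lambda>x. map_option \<tau> (f (t' x))) \<in> decorated_sets Y'"
      by (simp add: decorated_sets_def dom)
  next
    fix \<phi> assume "\<phi> \<in> Cc_in B.Zt"
    then obtain r where c: "continuous_map B.Zt euclidean \<phi>" and r: "\<And>x y. y \<in> topspace Y' \<Longrightarrow> r < dist x0 x \<Longrightarrow> \<phi> (x, y) = 0"
      unfolding B.Cc_in_iff by blast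
    define \<psi> where "\<psi> z = \<phi> (t (fst z), \<tau> (snd z))" for z
    have "\<psi> \<in> Cc_in A.Zt"
      unfolding A.Cc_in_iff
    proof (intro conjI exI allI impI)
      have "continuous_map A.Zt B.Zt (\<lambda>z. (t (fst z), \<tau> (snd z)))"
      proof -
        have "continuous_map A.Zt euclidean (t \<circ> fst)" by (rule continuous_map_compose[OF continuous_map_fst tc])
        moreover have "continuous_map A.Zt Y' (\<tau> \<circ> snd)" by (rule continuous_map_compose[OF continuous_map_snd \<tau>])
        ultimately show ?thesis by (simp add: continuous_map_pairwise o_def)
      qed
      from continuous_map_compose[OF this c] show "continuous_map A.Zt euclidean \<psi>" by (simp add: o_def \<psi>_def[abs_def])
      fix x y assume "y \<in> topspace Y" "r + dist (t x0) x0 < dist x0 x"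
      moreover have "dist x0 x = dist (t x0) (t x)" by (simp add: t(3))
      moreover have "dist (t x0) (t x) \<le> dist (t x0) x0 + dist x0 (t x)" by (rule dist_triangle)
      moreover have "\<tau> y \<in> topspace Y'" using \<tau> \<open>y \<in> topspace Y\<close> by (auto simp: continuous_map_def)
      ultimately show "\<psi> (x, y) = 0" using r[of "\<tau> y" "t x"] by (simp add: \<psi>_def)
    qed
    from A.continuous_vsum[OF this] have "continuous_map (vague_topology Y) euclidean (vsum \<psi>)" .
    moreover have "vsum \<phi> (\<lambda>x. map_option \<tau> (f (t' x))) = vsum \<psi> f" for f
    proof -
      have inj: "inj_on t (dom f)" by (metis inj_onI t(1))
      have "vsum \<phi> (\<lambda>x. map_option \<tau> (f (t' x))) = (\<Sum>\<^sub>\<infinity>x\<in>dom f. \<phi> (t x, the (map_option \<tau> (f (t' (t x))))))"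
        unfolding vsum_def dom by (subst infsum_reindex[OF inj]) (simp add: o_def)
      also have "\<dots> = vsum \<psi> f" unfolding vsum_def \<psi>_def by (intro infsum_cong) (auto simp: t(1))
      finally show ?thesis .
    qed
    ultimately show "continuous_map (vague_topology Y) euclidean (\<lambda>f. vsum \<phi> (\<lambda>x. map_option \<tau> (f (t' x))))" by simp
  qed
qed

section \<open>Configurations: neighbourhoods of entries and continuity of the action\<close>

locale config_space =
  fixes Cs :: "'c topology" and \<iota> :: "complex \<Rightarrow> 'c" and x0 :: "'x::metric_space"
  assumes proper: "\<And>(x::'x) r. compact (cball x r)"
    and compactification: "compactification Cs \<iota>"
begin

sublocale inner: hausdorff_decoration Cs x0
  using proper compactification
  by (simp add: hausdorff_decoration_def hausdorff_decoration_axioms_def proper_decoration_def compactification_def)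

sublocale outer: proper_decoration "vague_topology Cs :: ('x \<rightharpoonup> 'c) topology" x0
  by (rule inner.outer_decoration)

abbreviation CT :: "('x, 'c) config topology" where "CT \<equiv> config_topology Cs"

lemma topspace_CT: "topspace CT = {\<omega> \<in> decorated_sets (vague_topology Cs). \<forall>x\<in>dom \<omega>. dom (the (\<omega> x)) = dom \<omega>}"
  by (auto simp: config_topology_def outer.topspace_vague)

lemma CT_separated: "\<omega> \<in> topspace CT \<Longrightarrow> separated_set (dom \<omega>)"
  by (simp add: topspace_CT decorated_sets_def)

lemma continuous_vsum_CT:
  assumes "\<phi> \<in> Cc_in outer.Zt" shows "continuous_map CT euclidean (vsum \<phi>)"
  unfolding config_topology_def by (rule continuous_map_from_subtopology[OF outer.continuous_vsum[OF assms]])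

lemma continuous_count:
  assumes "continuous_on UNIV \<psi>" "\<And>x. r < dist x0 x \<Longrightarrow> \<psi> x = 0"
  shows "continuous_map CT euclidean (vsum (\<lambda>z. \<psi> (fst z)))"
proof (rule continuous_vsum_CT)
  have "continuous_map outer.Zt euclidean (\<psi> \<circ> fst)"
    by (rule continuous_map_compose[OF continuous_map_fst]) (simp add: assms(1))
  then show "(\<lambda>z. \<psi> (fst z)) \<in> Cc_in outer.Zt"
    unfolding outer.Cc_in_iff using assms(2) by (auto simp: o_def)
qed

text \<open>The test function is nested like the topology. A Urysohn function for \<open>V\<close>
  times a bump at \<open>y\<close> gives \<open>\<phi>1\<close>; its sum over a row is continuous in
  the row and, times a bump at \<open>x\<close>, gives \<open>\<phi>2\<close>. All terms are
  nonnegative, so positivity of the sum of \<open>\<phi>2\<close> exhibits the required pair of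
  points.\<close>

lemma entry_neighbourhood:
  assumes \<omega>: "\<omega> \<in> topspace CT" and xy: "x \<in> dom \<omega>" "y \<in> dom \<omega>" and r: "r > 0"
    and V: "openin Cs V" "the (the (\<omega> x) y) \<in> V"
  shows "\<exists>U. openin CT U \<and> \<omega> \<in> U \<and>
    (\<forall>\<omega>'\<in>U. \<exists>x'\<in>dom \<omega>'. \<exists>y'\<in>dom \<omega>'. dist x x' < r \<and> dist y y' < r \<and> the (the (\<omega>' x') y') \<in> V)"
proof -
  have Cs: "compact_space Cs" "Hausdorff_space Cs" using compactification by (auto simp: compactification_def)
  have V': "closedin Cs (topspace Cs - V)" using V(1) by (intro closedin_diff) auto
  have c: "the (the (\<omega> x) y) \<in> topspace Cs" using V openin_subset by blast
  obtain \<theta> where \<theta>: "continuous_map Cs (top_of_set {0..1::real}) \<theta>" "\<theta> ` (topspace Cs - V) \<subseteq> {0}" "\<theta> ` {the (the (\<omega> x) y)} \<subseteq> {1}"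
  proof (rule Urysohn_lemma[of Cs "topspace Cs - V" "{the (the (\<omega> x) y)}" 0 1])
    show "normal_space Cs" using Cs by (simp add: compact_Hausdorff_or_regular_imp_normal_space)
    show "closedin Cs {the (the (\<omega> x) y)}" using Cs c by (simp add: closedin_Hausdorff_singleton)
    show "disjnt (topspace Cs - V) {the (the (\<omega> x) y)}" using V(2) by (simp add: disjnt_def)
  qed (use V' that in auto)
  have \<theta>c: "continuous_map Cs euclidean \<theta>" using \<theta>(1) by (simp add: continuous_map_in_subtopology)
  have \<theta>0: "0 \<le> \<theta> z" "\<theta> z \<noteq> 0 \<Longrightarrow> z \<in> V" if "z \<in> topspace Cs" for z
    using \<theta> that by (auto simp: continuous_map_in_subtopology image_subset_iff)
  define \<psi> where "\<psi> a b = max 0 (r - dist a b)" for a b :: 'x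
  have \<psi>: "\<psi> a b \<ge> 0" "\<psi> a b \<noteq> 0 \<Longrightarrow> dist a b < r" for a b by (auto simp: \<psi>_def max_def split: if_splits)
  have \<psi>c: "continuous_on UNIV (\<psi> a)" for a unfolding \<psi>_def by (intro continuous_intros)
  have far: "\<psi> a b = 0" if "dist x0 a + r < dist x0 b" for a b
    using that dist_triangle[of x0 b a] by (simp add: \<psi>_def)
  define \<phi>1 where "\<phi>1 z = \<psi> y (fst z) * \<theta> (snd z)" for z
  have \<phi>1: "\<phi>1 \<in> Cc_in inner.Zt"
    unfolding inner.Cc_in_iff
  proof (intro conjI exI[of _ "dist x0 y + r"] allI impI)
    have "continuous_map inner.Zt euclidean (\<psi> y \<circ> fst)" "continuous_map inner.Zt euclidean (\<theta> \<circ> snd)"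
      by (rule continuous_map_compose[OF continuous_map_fst], simp add: \<psi>c, rule continuous_map_compose[OF continuous_map_snd \<theta>c])
    then show "continuous_map inner.Zt euclidean \<phi>1" unfolding \<phi>1_def[abs_def] by (auto simp: o_def intro!: continuous_map_real_mult)
  qed (simp add: \<phi>1_def far)
  define \<phi>2 where "\<phi>2 z = \<psi> x (fst z) * vsum \<phi>1 (snd z)" for z
  have \<phi>2: "\<phi>2 \<in> Cc_in outer.Zt"
    unfolding outer.Cc_in_iff
  proof (intro conjI exI[of _ "dist x0 x + r"] allI impI)
    have "continuous_map outer.Zt euclidean (\<psi> x \<circ> fst)" "continuous_map outer.Zt euclidean (vsum \<phi>1 \<circ> snd)"
      by (rule continuous_map_compose[OF continuous_map_fst], simp add: \<psi>c, rule continuous_map_compose[OF continuous_map_snd inner.continuous_vsum[OF \<phi>1]])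
    then show "continuous_map outer.Zt euclidean \<phi>2" unfolding \<phi>2_def[abs_def] by (auto simp: o_def intro!: continuous_map_real_mult)
  qed (simp add: \<phi>2_def far)
  have dec: "f \<in> decorated_sets Cs \<Longrightarrow> a \<in> dom f \<Longrightarrow> the (f a) \<in> topspace Cs" for f :: "'x \<rightharpoonup> 'c" and a
    by (auto simp: decorated_sets_def ran_def)
  have dec2: "the (\<omega>' a) \<in> decorated_sets Cs" if "\<omega>' \<in> topspace CT" "a \<in> dom \<omega>'" for \<omega>' a
  proof -
    have "the (\<omega>' a) \<in> ran \<omega>'" using that(2) by (auto simp: ran_def)
    moreover have "ran \<omega>' \<subseteq> topspace (vague_topology Cs)" using that(1) by (simp add: topspace_CT decorated_sets_def)
    ultimately show ?thesis using inner.topspace_vague by blast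
  qed
  have v1: "0 \<le> vsum \<phi>1 f" "vsum \<phi>1 f \<noteq> 0 \<longleftrightarrow> (\<exists>a\<in>dom f. \<phi>1 (a, the (f a)) \<noteq> 0)" if "f \<in> decorated_sets Cs" for f
  proof -
    have sep: "separated_set (dom f)" using that by (simp add: decorated_sets_def)
    have "0 \<le> \<phi>1 (a, the (f a))" if "a \<in> dom f" for a
      using dec[OF \<open>f \<in> decorated_sets Cs\<close> that] \<theta>0(1) \<psi>(1) by (simp add: \<phi>1_def)
    note vsum_nonneg[OF proper sep, of \<phi>1, OF this, where b = y and r = r]
    then show "0 \<le> vsum \<phi>1 f" "vsum \<phi>1 f \<noteq> 0 \<longleftrightarrow> (\<exists>a\<in>dom f. \<phi>1 (a, the (f a)) \<noteq> 0)"
      using \<psi>(2) by (auto simp: \<phi>1_def)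
  qed
  have v2: "0 \<le> vsum \<phi>2 \<omega>'" "vsum \<phi>2 \<omega>' \<noteq> 0 \<longleftrightarrow> (\<exists>a\<in>dom \<omega>'. \<phi>2 (a, the (\<omega>' a)) \<noteq> 0)" if "\<omega>' \<in> topspace CT" for \<omega>'
  proof -
    have "0 \<le> \<phi>2 (a, the (\<omega>' a))" if "a \<in> dom \<omega>'" for a
      using v1(1)[OF dec2[OF \<open>\<omega>' \<in> topspace CT\<close> that]] \<psi>(1) by (simp add: \<phi>2_def)
    note vsum_nonneg[OF proper CT_separated[OF that], of \<phi>2, OF this, where b = x and r = r]
    then show "0 \<le> vsum \<phi>2 \<omega>'" "vsum \<phi>2 \<omega>' \<noteq> 0 \<longleftrightarrow> (\<exists>a\<in>dom \<omega>'. \<phi>2 (a, the (\<omega>' a)) \<noteq> 0)"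
      using \<psi>(2) by (auto simp: \<phi>2_def)
  qed
  define U where "U = {\<omega>' \<in> topspace CT. vsum \<phi>2 \<omega>' \<in> {0<..}}"
  have "openin CT U" unfolding U_def
    by (rule openin_continuous_map_preimage[OF continuous_vsum_CT[OF \<phi>2]]) simp
  moreover have "\<omega> \<in> U"
  proof -
    have yd: "y \<in> dom (the (\<omega> x))" using \<omega> xy by (auto simp: topspace_CT)
    have "\<phi>1 (y, the (the (\<omega> x) y)) \<noteq> 0" using \<theta>(3) r by (simp add: \<phi>1_def \<psi>_def)
    then have "vsum \<phi>1 (the (\<omega> x)) \<noteq> 0" using v1(2)[OF dec2[OF \<omega> xy(1)]] yd by blast
    then have "\<phi>2 (x, the (\<omega> x)) \<noteq> 0" using r by (simp add: \<phi>2_def \<psi>_def)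
    then have "vsum \<phi>2 \<omega> \<noteq> 0" using v2(2)[OF \<omega>] xy(1) by blast
    then show ?thesis using v2(1)[OF \<omega>] \<omega> by (auto simp: U_def)
  qed
  moreover have "\<exists>x'\<in>dom \<omega>'. \<exists>y'\<in>dom \<omega>'. dist x x' < r \<and> dist y y' < r \<and> the (the (\<omega>' x') y') \<in> V" if "\<omega>' \<in> U" for \<omega>'
  proof -
    have t: "\<omega>' \<in> topspace CT" "vsum \<phi>2 \<omega>' \<noteq> 0" using that by (auto simp: U_def)
    then obtain x' where x': "x' \<in> dom \<omega>'" "\<phi>2 (x', the (\<omega>' x')) \<noteq> 0" using v2(2) by blast
    then have "dist x x' < r" "vsum \<phi>1 (the (\<omega>' x')) \<noteq> 0" using \<psi>(2) by (auto simp: \<phi>2_def)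
    then obtain y' where y': "y' \<in> dom (the (\<omega>' x'))" "\<phi>1 (y', the (the (\<omega>' x') y')) \<noteq> 0"
      using v1(2)[OF dec2[OF t(1) x'(1)]] by blast
    then have "dist y y' < r" "\<theta> (the (the (\<omega>' x') y')) \<noteq> 0" using \<psi>(2) by (auto simp: \<phi>1_def)
    moreover have "the (the (\<omega>' x') y') \<in> topspace Cs" by (rule dec[OF dec2[OF t(1) x'(1)] y'(1)])
    moreover have "y' \<in> dom \<omega>'" using t(1) x'(1) y'(1) by (auto simp: topspace_CT)
    ultimately show ?thesis using x'(1) \<open>dist x x' < r\<close> \<theta>0(2) by blast
  qed
  ultimately show ?thesis by blast
qed

text \<open>\<open>continuous_pushforward\<close> at both levels: first the points inside a row move
  with unchanged values, then the rows move and this first map acts on them as the decoration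
  map.\<close>

lemma continuous_config_act:
  fixes act :: "'g::{topological_group_add, metric_space} \<Rightarrow> 'x \<Rightarrow> 'x"
  assumes "isometric_action act"
  shows "continuous_map CT CT (config_act act g)"
proof -
  have t: "act (- g) (act g x) = x" "act g (act (- g) x) = x" "dist (act g x) (act g y) = dist x y" for x y
    using assms unfolding isometric_action_def by (metis add.left_inverse, metis add.right_inverse, blast)
  have "continuous_map (vague_topology Cs) (vague_topology Cs) (\<lambda>f x. map_option id (f (act (- g) x)))"
    by (rule continuous_pushforward[of Cs x0 Cs "act (- g)" "act g"]) (use t inner.proper_decoration_axioms in auto)
  then have c1: "continuous_map (vague_topology Cs) (vague_topology Cs) (\<lambda>f y. f (act (- g) y) :: 'c option)"
    by (simp add: option.map_id)
  have "continuous_map (vague_topology (vague_topology Cs)) (vague_topology (vague_topology Cs))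
      (\<lambda>\<omega> x. map_option (\<lambda>k y. k (act (- g) y) :: 'c option) (\<omega> (act (- g) x)))"
    by (rule continuous_pushforward[OF _ _ _ _ _ c1, of x0 "act (- g)" "act g"]) (use t outer.proper_decoration_axioms in auto)
  then have c2: "continuous_map (vague_topology (vague_topology Cs)) (vague_topology (vague_topology Cs)) (config_act act g :: ('x, 'c) config \<Rightarrow> _)"
    unfolding config_act_def .
  have "dom (the (config_act act g \<omega> x)) = dom (config_act act g \<omega>)"
    if "\<forall>x\<in>dom \<omega>. dom (the (\<omega> x)) = dom \<omega>" "x \<in> dom (config_act act g \<omega>)" for \<omega> :: "('x, 'c) config" and x
    using that by (fastforce simp: config_act_def dom_def)
  with c2 show ?thesis unfolding config_topology_def
    by (intro continuous_map_into_subtopology continuous_map_from_subtopology) auto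
qed

end

section \<open>Projections onto fixed spaces and traces\<close>

locale positive_contraction =
  fixes T :: "'a::{real_inner, complete_space} \<Rightarrow> 'a"
  assumes linear: "linear T"
    and sym: "T v \<bullet> w = v \<bullet> T w"
    and nonneg: "0 \<le> T v \<bullet> v"
    and le: "T v \<bullet> v \<le> v \<bullet> v"
begin

lemma pow_sym: "(T ^^ n) v \<bullet> w = v \<bullet> (T ^^ n) w"
  by (induction n arbitrary: v w) (auto simp: sym funpow_swap1)

lemma pow_inner: "(T ^^ m) v \<bullet> (T ^^ n) v = (T ^^ (m + n)) v \<bullet> v"
  by (metis funpow_add o_apply pow_sym inner_commute add.commute)

text \<open>The operator inequality \<open>T\<^sup>2 \<le> T\<close>: nonnegativity at
  \<open>v - T v\<close> bounds twice \<open>T v \<bullet> T v\<close> by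
  \<open>T v \<bullet> v\<close> plus the quadratic form at \<open>T v\<close>, and that form is at
  most \<open>T v \<bullet> T v\<close>.\<close>

lemma square_le: "T v \<bullet> T v \<le> T v \<bullet> v"
proof -
  have T1: "T (v - T v) = T v - T (T v)" by (rule linear_diff[OF linear])
  have "0 \<le> T (v - T v) \<bullet> (v - T v)" by (rule nonneg)
  moreover have "T (T v) \<bullet> T v \<le> T v \<bullet> T v" by (rule le)
  moreover have "T (T v) \<bullet> v = T v \<bullet> T v" by (rule sym)
  ultimately show ?thesis unfolding T1 by (simp add: inner_diff inner_commute)
qed

lemma norm_le: "norm (T v) \<le> norm v"
  unfolding norm_eq_sqrt_inner by (rule real_sqrt_le_mono) (rule order_trans[OF square_le le])

lemma bounded_linear: "bounded_linear T"
  by (rule bounded_linear_intro[of _ 1]) (use linear norm_le in \<open>auto simp: linear_add linear_scale\<close>)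

lemma pow_linear: "linear (T ^^ n)"
  by (induction n) (auto simp: linear_iff linear_add[OF linear] linear_scale[OF linear])

text \<open>Half of the powers is moved to the other side. For even \<open>n\<close> the bound
  \<open>le\<close> is then used at \<open>(T ^^ k) v\<close>, for odd \<open>n\<close> the bound
  \<open>square_le\<close>.\<close>

lemma moment_decreasing: "(T ^^ Suc n) v \<bullet> v \<le> (T ^^ n) v \<bullet> v"
proof (cases "even n")
  case True
  then obtain k where k: "n = k + k" by (metis evenE mult_2)
  have "(T ^^ Suc n) v \<bullet> v = T ((T ^^ k) v) \<bullet> (T ^^ k) v"
    using pow_inner[of "Suc k" v k] by (simp add: k)
  also have "\<dots> \<le> (T ^^ k) v \<bullet> (T ^^ k) v" by (rule le)
  finally show ?thesis using pow_inner[of k v k] by (simp add: k)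
next
  case False
  then obtain k where k: "n = Suc k + k" by (metis oddE mult_2 add_Suc Suc_eq_plus1)
  have "(T ^^ Suc n) v \<bullet> v = T ((T ^^ k) v) \<bullet> T ((T ^^ k) v)"
    using pow_inner[of "Suc k" v "Suc k"] by (simp add: k)
  also have "\<dots> \<le> T ((T ^^ k) v) \<bullet> (T ^^ k) v" by (rule square_le)
  finally show ?thesis using pow_inner[of "Suc k" v k] by (simp add: k)
qed

lemma moment_nonneg: "0 \<le> (T ^^ n) v \<bullet> v"
proof (cases "even n")
  case True
  then obtain k where k: "n = k + k" by (metis evenE mult_2)
  have "0 \<le> (T ^^ k) v \<bullet> (T ^^ k) v" by (rule inner_ge_zero)
  then show ?thesis unfolding pow_inner k .
next
  case False
  then obtain k where k: "n = Suc k + k" by (metis oddE mult_2 add_Suc Suc_eq_plus1)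
  have "0 \<le> (T ^^ Suc k) v \<bullet> (T ^^ k) v" using nonneg[of "(T ^^ k) v"] by simp
  then show ?thesis unfolding pow_inner k .
qed

text \<open>The squared distance of two iterates is a combination of three moments with coefficients
  1, -2, 1, and the moments converge by monotonicity. Four deviations of less than
  \<open>e\<^sup>2 / 4\<close> each give the Cauchy property.\<close>

lemma convergent_pow: "convergent (\<lambda>n. (T ^^ n) v)"
proof -
  define a where "a n = (T ^^ n) v \<bullet> v" for n
  have "decseq a" unfolding a_def by (intro decseq_SucI moment_decreasing)
  moreover have "\<And>n. 0 \<le> a n" unfolding a_def by (rule moment_nonneg)
  ultimately obtain L where L: "a \<longlonglongrightarrow> L" using decseq_convergent by blast
  have "Cauchy (\<lambda>n. (T ^^ n) v)"
  proof (rule metric_CauchyI)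
    fix e :: real assume e: "e > 0"
    then obtain N where N: "\<And>n. n \<ge> N \<Longrightarrow> \<bar>a n - L\<bar> < e\<^sup>2 / 4"
      using LIMSEQ_D[OF L, of "e\<^sup>2 / 4"] by auto
    have "dist ((T ^^ m) v) ((T ^^ n) v) < e" if "m \<ge> N" "n \<ge> N" for m n
    proof -
      have "(dist ((T ^^ m) v) ((T ^^ n) v))\<^sup>2 = a (m + m) - 2 * a (m + n) + a (n + n)"
        using pow_inner[of m v m] pow_inner[of n v n] pow_inner[of m v n]
        by (simp add: dist_norm power2_norm_eq_inner inner_diff inner_commute a_def)
      also have "\<dots> < e\<^sup>2"
      proof -
        have "m + m \<ge> N" "m + n \<ge> N" "n + n \<ge> N" using that by auto
        from N[OF this(1)] N[OF this(2)] N[OF this(3)] show ?thesis unfolding abs_less_iff by linarith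
      qed
      finally show ?thesis using e by (simp add: power_less_imp_less_base)
    qed
    then show "\<exists>N. \<forall>m\<ge>N. \<forall>n\<ge>N. dist ((T ^^ m) v) ((T ^^ n) v) < e" by blast
  qed
  then show ?thesis by (rule Cauchy_convergent)
qed

definition proj :: "'a \<Rightarrow> 'a" where "proj v = lim (\<lambda>n. (T ^^ n) v)"

lemma proj_lim: "(\<lambda>n. (T ^^ n) v) \<longlonglongrightarrow> proj v"
  using convergent_pow[of v] by (simp add: proj_def convergent_LIMSEQ_iff)

lemma proj_fix: "T (proj v) = proj v"
proof (rule LIMSEQ_unique)
  show "(\<lambda>n. (T ^^ Suc n) v) \<longlonglongrightarrow> proj v" by (rule LIMSEQ_Suc[OF proj_lim])
  show "(\<lambda>n. (T ^^ Suc n) v) \<longlonglongrightarrow> T (proj v)"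
    using bounded_linear.tendsto[OF bounded_linear proj_lim] by simp
qed

lemma proj_of_fix: assumes "T v = v" shows "proj v = v"
proof -
  have "(T ^^ n) v = v" for n by (induction n) (auto simp: assms)
  then show ?thesis using LIMSEQ_unique[OF proj_lim[of v]] by simp
qed

lemma proj_idem: "proj (proj v) = proj v" by (rule proj_of_fix[OF proj_fix])

text \<open>The spaces here are real; applied to multiplication by a complex scalar this recovers
  complex linearity of the projection.\<close>

lemma proj_commute:
  assumes "bounded_linear S" "\<And>v. S (T v) = T (S v)" shows "proj (S v) = S (proj v)"
proof (rule LIMSEQ_unique[OF proj_lim])
  have "(T ^^ n) (S v) = S ((T ^^ n) v)" for n by (induction n) (auto simp: assms(2))
  then show "(\<lambda>n. (T ^^ n) (S v)) \<longlonglongrightarrow> S (proj v)"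
    using bounded_linear.tendsto[OF assms(1) proj_lim] by simp
qed

lemma proj_sym: "proj v \<bullet> w = v \<bullet> proj w"
proof (rule LIMSEQ_unique)
  show "(\<lambda>n. (T ^^ n) v \<bullet> w) \<longlonglongrightarrow> proj v \<bullet> w" by (intro tendsto_intros proj_lim)
  show "(\<lambda>n. (T ^^ n) v \<bullet> w) \<longlonglongrightarrow> v \<bullet> proj w" unfolding pow_sym by (intro tendsto_intros proj_lim)
qed

lemma proj_inner: "proj v \<bullet> proj w = proj v \<bullet> w"
  using proj_sym[of "proj v" w] proj_idem[of v] by simp

lemma linear_proj: "linear proj"
proof (rule linearI)
  show "proj (v + w) = proj v + proj w" for v w
    using LIMSEQ_unique[OF proj_lim, of "v + w"] tendsto_add[OF proj_lim[of v] proj_lim[of w]]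
    by (simp add: linear_add[OF pow_linear])
  show "proj (c *\<^sub>R v) = c *\<^sub>R proj v" for c v
    using LIMSEQ_unique[OF proj_lim, of "c *\<^sub>R v"] tendsto_scaleR[OF tendsto_const proj_lim, of c v]
    by (simp add: linear_scale[OF pow_linear])
qed

lemma norm_proj_sq: "(norm (proj v))\<^sup>2 = proj v \<bullet> v"
  by (simp add: power2_norm_eq_inner proj_inner)

lemma norm_proj_le: "norm (proj v) \<le> norm v"
proof (cases "norm (proj v) = 0")
  case False
  have "norm (proj v) * norm (proj v) \<le> norm (proj v) * norm v"
    using norm_proj_sq[of v] norm_cauchy_schwarz[of "proj v" v] by (simp add: power2_eq_square)
  then show ?thesis using False by (simp add: mult_le_cancel_left)
qed simp

lemma moment_lim: "(\<lambda>n. (T ^^ n) v \<bullet> v) \<longlonglongrightarrow> proj v \<bullet> v"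
  by (intro tendsto_intros proj_lim)

lemma moment_le: "(T ^^ n) v \<bullet> v \<le> v \<bullet> v"
proof (induction n)
  case (Suc n)
  show ?case by (rule order_trans[OF moment_decreasing Suc])
qed simp

end

section \<open>Bessel's inequality and traces of projections\<close>

lemma bessel_finite:
  fixes q :: "'a::real_inner"
  assumes S: "finite S" and on: "\<And>e. e \<in> S \<Longrightarrow> e \<bullet> e = 1" "\<And>e f. e \<in> S \<Longrightarrow> f \<in> S \<Longrightarrow> e \<noteq> f \<Longrightarrow> e \<bullet> f = 0"
  shows "(\<Sum>e\<in>S. (e \<bullet> q)\<^sup>2) \<le> q \<bullet> q"
proof -
  define p where "p = (\<Sum>e\<in>S. (e \<bullet> q) *\<^sub>R e)"
  have ep: "f \<bullet> p = f \<bullet> q" if f: "f \<in> S" for f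
  proof -
    have "f \<bullet> p = (\<Sum>e\<in>S. (e \<bullet> q) * (f \<bullet> e))" by (simp add: p_def inner_sum_right)
    also have "\<dots> = (\<Sum>e\<in>S. if e = f then f \<bullet> q else 0)" using on f by (intro sum.cong) auto
    finally show ?thesis using S f by simp
  qed
  have pq: "p \<bullet> q = (\<Sum>e\<in>S. (e \<bullet> q)\<^sup>2)" by (simp add: p_def inner_sum_left power2_eq_square)
  have "p \<bullet> p = (\<Sum>e\<in>S. (e \<bullet> q) * (e \<bullet> p))" by (subst (1) p_def) (simp add: inner_sum_left)
  also have "\<dots> = p \<bullet> q" unfolding pq by (intro sum.cong) (auto simp: ep power2_eq_square)
  finally have "p \<bullet> p = p \<bullet> q" .
  moreover have "0 \<le> (q - p) \<bullet> (q - p)" by simp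
  ultimately show ?thesis unfolding pq[symmetric] by (simp add: inner_diff inner_commute)
qed

text \<open>If the vectors of the range of a projection that are orthogonal to \<open>B\<close> are orthogonal
  to \<open>S\<close>, then the trace over \<open>S\<close> is at most the cardinality of \<open>B\<close>: split off from \<open>Q\<close> the
  rank one projections onto \<open>Q b\<close>, one at a time.\<close>

lemma trace_le_card:
  fixes Q :: "'a::real_inner \<Rightarrow> 'a"
  assumes B: "finite B" and S: "finite S"
    and on: "\<And>e. e \<in> S \<Longrightarrow> e \<bullet> e = 1" "\<And>e f. e \<in> S \<Longrightarrow> f \<in> S \<Longrightarrow> e \<noteq> f \<Longrightarrow> e \<bullet> f = 0"
    and Q: "linear Q" "\<And>v w. Q v \<bullet> w = v \<bullet> Q w" "\<And>v. Q (Q v) = Q v"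
    and kill: "\<And>v e. Q v = v \<Longrightarrow> (\<And>b. b \<in> B \<Longrightarrow> v \<bullet> b = 0) \<Longrightarrow> e \<in> S \<Longrightarrow> v \<bullet> e = 0"
  shows "(\<Sum>e\<in>S. Q e \<bullet> e) \<le> real (card B)"
  using B Q kill
proof (induction B arbitrary: Q rule: finite_induct)
  case empty
  have "Q e \<bullet> e = 0" if "e \<in> S" for e by (rule empty(4)[OF empty(3)]) (use that in auto)
  then show ?case by simp
next
  case (insert b B)
  note lin = insert(4) and sym = insert(5) and idem = insert(6) and kl = insert(7)
  define q where "q = Q b"
  have Qq: "Q q = q" by (simp add: q_def idem)
  show ?case
  proof (cases "q = 0")
    case True
    have "(\<Sum>e\<in>S. Q e \<bullet> e) \<le> real (card B)"
    proof (rule insert.IH[OF lin sym idem])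
      fix v e assume v: "Q v = v" "\<And>b. b \<in> B \<Longrightarrow> v \<bullet> b = 0" "e \<in> S"
      have "v \<bullet> b = Q v \<bullet> b" by (simp only: v(1))
      also have "\<dots> = v \<bullet> Q b" by (rule sym)
      finally have "v \<bullet> b = 0" using True by (simp add: q_def)
      with v(2) have "v \<bullet> b' = 0" if "b' \<in> insert b B" for b' using that by auto
      then show "v \<bullet> e = 0" by (rule kl[OF v(1) _ v(3)])
    qed
    then show ?thesis using insert(1,2) by simp
  next
    case False
    then have qq: "q \<bullet> q > 0" by simp
    define Q' where "Q' v = Q v - ((v \<bullet> q) / (q \<bullet> q)) *\<^sub>R q" for v
    have lin': "linear Q'"
      unfolding Q'_def by (rule linearI)
        (simp_all add: linear_add[OF lin] linear_scale[OF lin] inner_add_left add_divide_distrib scaleR_add_left algebra_simps)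
    have sym': "Q' v \<bullet> w = v \<bullet> Q' w" for v w
      using sym[of v w] inner_commute[of q w] by (simp add: Q'_def inner_diff_left inner_diff_right)
    have Qv: "Q v \<bullet> q = v \<bullet> q" for v using sym[of v q] Qq by simp
    have Q'q: "Q' q = 0" using qq Qq by (simp add: Q'_def)
    have Q'Q: "Q' (Q v) = Q' v" for v by (simp add: Q'_def idem Qv)
    have idem': "Q' (Q' v) = Q' v" for v
      by (subst (2) Q'_def) (simp add: linear_diff[OF lin'] linear_scale[OF lin'] Q'q Q'Q)
    have IH: "(\<Sum>e\<in>S. Q' e \<bullet> e) \<le> real (card B)"
    proof (rule insert.IH[OF lin' sym' idem'])
      fix v e assume v: "Q' v = v" "\<And>b. b \<in> B \<Longrightarrow> v \<bullet> b = 0" "e \<in> S"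
      have "Q (Q' v) = Q' v" by (simp add: Q'_def linear_diff[OF lin] linear_scale[OF lin] idem Qq)
      then have Qvv: "Q v = v" using v(1) by simp
      have "v \<bullet> b = Q v \<bullet> b" by (simp only: Qvv)
      also have "\<dots> = v \<bullet> q" unfolding q_def by (rule sym)
      also have "\<dots> = Q' v \<bullet> q" by (simp only: v(1))
      also have "\<dots> = v \<bullet> Q' q" by (rule sym')
      finally have "v \<bullet> b = 0" by (simp add: Q'q)
      with v(2) have "v \<bullet> b' = 0" if "b' \<in> insert b B" for b' using that by auto
      then show "v \<bullet> e = 0" by (rule kl[OF Qvv _ v(3)])
    qed
    have "Q e \<bullet> e = Q' e \<bullet> e + (e \<bullet> q)\<^sup>2 / (q \<bullet> q)" for e
      by (simp add: Q'_def inner_diff power2_eq_square inner_commute)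
    then have "(\<Sum>e\<in>S. Q e \<bullet> e) = (\<Sum>e\<in>S. Q' e \<bullet> e) + (\<Sum>e\<in>S. (e \<bullet> q)\<^sup>2) / (q \<bullet> q)"
      by (simp add: sum.distrib sum_divide_distrib)
    \<comment> \<open>The split-off rank one projection has trace at most 1 over the orthonormal
      set, by Bessel's inequality for \<open>q\<close>.\<close>
    also have "\<dots> \<le> real (card B) + 1"
      using IH bessel_finite[OF S on, of q] qq by (intro add_mono) (auto simp: field_simps)
    finally show ?thesis using insert(1,2) by simp
  qed
qed

text \<open>The quadratic module of the interval from \<open>-a\<close> to \<open>a\<close>: sums of
  squares and of squares times \<open>a - t\<close> or \<open>a + t\<close>. Membership is a
  certificate that \<open>p(T)\<close> is positive for every symmetric \<open>T\<close> of norm at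
  most \<open>a\<close>; such certificates take the place of spectral theory.\<close>

inductive_set poly_cone :: "real \<Rightarrow> real poly set" for a where
  square: "s * s \<in> poly_cone a"
| minus: "s * s * [:a, -1:] \<in> poly_cone a"
| plus: "s * s * [:a, 1:] \<in> poly_cone a"
| add: "p \<in> poly_cone a \<Longrightarrow> q \<in> poly_cone a \<Longrightarrow> p + q \<in> poly_cone a"

lemma poly_cone_mult_square: "p \<in> poly_cone a \<Longrightarrow> t * t * p \<in> poly_cone a"
proof (induction rule: poly_cone.induct)
  case (square s)
  have eq: "t * t * (s * s) = (t * s) * (t * s)" by (simp only: mult_ac)
  show ?case unfolding eq by (rule poly_cone.square)
next
  case (minus s)
  have eq: "t * t * (s * s * [:a, -1:]) = (t * s) * (t * s) * [:a, -1:]" by (simp only: mult_ac)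
  show ?case unfolding eq by (rule poly_cone.minus)
next
  case (plus s)
  have eq: "t * t * (s * s * [:a, 1:]) = (t * s) * (t * s) * [:a, 1:]" by (simp only: mult_ac)
  show ?case unfolding eq by (rule poly_cone.plus)
next
  case (add p q)
  then show ?case unfolding distrib_left by (intro poly_cone.add)
qed

text \<open>The product \<open>m * p\<close> of the two linear factors is no generator, but their
  sum is the constant \<open>2 * a\<close>, so \<open>2 * a * m * p\<close> equals
  \<open>m\<^sup>2 * p + p\<^sup>2 * m\<close>. The constant is absorbed into the squares through
  \<open>c\<close>.\<close>

lemma poly_cone_square_mp:
  assumes "a > 0" shows "s * s * [:a, -1:] * [:a, 1:] \<in> poly_cone a"
proof -
  define c where "c = sqrt (1 / (2 * a))"
  have c: "c * c * (2 * a) = 1" using assms by (simp add: c_def real_sqrt_mult_self)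
  define m p :: "real poly" where "m = [:a, -1:]" and "p = [:a, 1:]"
  have mp: "m + p = [:2 * a:]" by (simp add: m_def p_def)
  have "(smult c s * m) * (smult c s * m) * p + (smult c s * p) * (smult c s * p) * m = smult (c * c) (s * s * m * p * (m + p))"
    by (simp add: algebra_simps smult_add_right)
  also have "\<dots> = smult (c * c * (2 * a)) (s * s * m * p)" unfolding mp by (simp add: mult_ac)
  also have "\<dots> = s * s * m * p" by (simp only: c smult_1_left)
  finally have eq: "(smult c s * m) * (smult c s * m) * p + (smult c s * p) * (smult c s * p) * m = s * s * m * p" .
  have "(smult c s * m) * (smult c s * m) * p + (smult c s * p) * (smult c s * p) * m \<in> poly_cone a"
    unfolding m_def p_def by (intro poly_cone.add poly_cone.plus poly_cone.minus)
  then have "s * s * m * p \<in> poly_cone a" by (simp only: eq)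
  then show ?thesis unfolding m_def p_def .
qed

lemma poly_cone_mult_minus: assumes a: "a > 0" and "p \<in> poly_cone a" shows "[:a, -1:] * p \<in> poly_cone a"
  using assms(2)
proof (induction rule: poly_cone.induct)
  case (square s) show ?case using poly_cone.minus[of s a] by (simp only: mult.commute)
next
  case (minus s)
  have eq: "[:a, -1:] * (s * s * [:a, -1:]) = (s * [:a, -1:]) * (s * [:a, -1:])" by (simp only: mult_ac)
  show ?case unfolding eq by (rule poly_cone.square)
next
  case (plus s)
  have eq: "[:a, -1:] * (s * s * [:a, 1:]) = s * s * [:a, -1:] * [:a, 1:]" by (simp only: mult_ac)
  show ?case unfolding eq by (rule poly_cone_square_mp[OF a])
next
  case (add p q)
  then show ?case unfolding distrib_left by (intro poly_cone.add)
qed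

lemma poly_cone_mult_plus: assumes a: "a > 0" and "p \<in> poly_cone a" shows "[:a, 1:] * p \<in> poly_cone a"
  using assms(2)
proof (induction rule: poly_cone.induct)
  case (square s) show ?case using poly_cone.plus[of s a] by (simp only: mult.commute)
next
  case (minus s)
  have eq: "[:a, 1:] * (s * s * [:a, -1:]) = s * s * [:a, -1:] * [:a, 1:]" by (simp only: mult_ac)
  show ?case unfolding eq by (rule poly_cone_square_mp[OF a])
next
  case (plus s)
  have eq: "[:a, 1:] * (s * s * [:a, 1:]) = (s * [:a, 1:]) * (s * [:a, 1:])" by (simp only: mult_ac)
  show ?case unfolding eq by (rule poly_cone.square)
next
  case (add p q)
  then show ?case unfolding distrib_left by (intro poly_cone.add)
qed

lemma poly_cone_const: "c \<ge> 0 \<Longrightarrow> [:c:] \<in> poly_cone a"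
  using poly_cone.square[of "[:sqrt c:]" a] by simp

lemma poly_nonneg_limit:
  assumes "\<And>d. d > 0 \<Longrightarrow> \<exists>t. \<bar>t - \<rho>\<bar> < d \<and> 0 \<le> poly q (t::real)" shows "0 \<le> poly q \<rho>"
proof (rule ccontr)
  assume "\<not> ?thesis"
  then have "poly q \<rho> < 0" by simp
  moreover have "isCont (poly q) \<rho>" by (rule poly_isCont)
  ultimately obtain d where "d > 0" "\<And>t. dist t \<rho> < d \<Longrightarrow> dist (poly q t) (poly q \<rho>) < - poly q \<rho>"
    unfolding continuous_at_eps_delta by (metis neg_0_less_iff_less)
  then show False using assms[of d] by (fastforce simp: dist_real_def)
qed

text \<open>Subtract the minimum over the interval: the difference vanishes at some point, so that a
  factor of lower degree that is again nonnegative splits off.\<close>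

lemma nonneg_poly_in_cone:
  assumes a: "a > 0" and r: "\<And>t. t \<in> {-a..a} \<Longrightarrow> 0 \<le> poly r t"
  shows "r \<in> poly_cone a"
  using r
proof (induction "degree r" arbitrary: r rule: less_induct)
  case less
  have "continuous_on {-a..a} (poly r)" by (intro continuous_intros)
  then obtain \<rho> where \<rho>: "\<rho> \<in> {-a..a}" "\<And>t. t \<in> {-a..a} \<Longrightarrow> poly r \<rho> \<le> poly r t"
    using continuous_attains_inf[of "{-a..a}" "poly r"] a by auto
  define c where "c = poly r \<rho>"
  have c: "c \<ge> 0" using less(2)[OF \<rho>(1)] by (simp add: c_def)
  show ?case
  proof (cases "degree r = 0")
    case True
    then obtain c' where "r = [:c':]" by (rule degree_eq_zeroE)
    then show ?thesis using less(2)[of 0] a by (simp add: poly_cone_const)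
  next
    case False
    define r0 where "r0 = r - [:c:]"
    have r0: "poly r0 t \<ge> 0" if "t \<in> {-a..a}" for t using \<rho>(2)[OF that] by (simp add: r0_def c_def)
    have deg0: "degree r0 = degree r" using False unfolding r0_def by (metis degree_add_eq_left degree_minus degree_pCons_0 diff_conv_add_uminus gr0I)
    have "poly r0 \<rho> = 0" by (simp add: r0_def c_def)
    then obtain q where q: "r0 = [:-\<rho>, 1:] * q" by (auto simp: poly_eq_0_iff_dvd elim: dvdE)
    have "r0 \<noteq> 0" using deg0 False by auto
    then have q0: "q \<noteq> 0" using q by auto
    have "degree r0 = Suc (degree q)" using q0 unfolding q by (subst degree_mult_eq) auto
    then have degq: "degree q < degree r" using deg0 by simp
    have pr0: "poly r0 t = (t - \<rho>) * poly q t" for t unfolding q by (simp add: algebra_simps)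
    have "r0 \<in> poly_cone a"
    \<comment> \<open>At an endpoint a simple zero is enough, since the linear factor is, up to
      sign, one of the two that the cone may be multiplied with.\<close>
    proof (cases "\<rho> = a \<or> \<rho> = -a")
      case True
      then show ?thesis
      proof
        assume \<rho>a: "\<rho> = a"
        have qn: "0 \<le> poly (- q) t" if "t \<in> {-a..<a}" for t
          using r0[of t] that unfolding pr0 \<rho>a by (simp add: zero_le_mult_iff)
        have "0 \<le> poly (- q) a"
        proof (rule poly_nonneg_limit)
          fix d :: real assume "d > 0"
          then show "\<exists>t. \<bar>t - a\<bar> < d \<and> 0 \<le> poly (- q) t" using a
            by (intro exI[of _ "a - min (d/2) a"] conjI qn) auto
        qed
        then have "0 \<le> poly (- q) t" if "t \<in> {-a..a}" for t using qn[of t] that by (cases "t = a") auto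
        then have "- q \<in> poly_cone a" using degq by (intro less(1)) auto
        moreover have "[:- a, 1:] = - [:a, -1:]" by simp
        then have "r0 = [:a, -1:] * (- q)" unfolding q \<rho>a by (simp only: mult_minus_left mult_minus_right)
        ultimately show ?thesis using poly_cone_mult_minus[OF a] by (simp only:)
      next
        assume \<rho>a: "\<rho> = -a"
        have qn: "0 \<le> poly q t" if "t \<in> {-a<..a}" for t
          using r0[of t] that unfolding pr0 \<rho>a by (simp add: zero_le_mult_iff)
        have "0 \<le> poly q (-a)"
        proof (rule poly_nonneg_limit)
          fix d :: real assume "d > 0"
          then show "\<exists>t. \<bar>t - (-a)\<bar> < d \<and> 0 \<le> poly q t" using a
            by (intro exI[of _ "-a + min (d/2) a"] conjI qn) auto
        qed
        then have "0 \<le> poly q t" if "t \<in> {-a..a}" for t using qn[of t] that by (cases "t = -a") auto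
        then have "q \<in> poly_cone a" using degq by (intro less(1)) auto
        from poly_cone_mult_plus[OF a this] show ?thesis unfolding q \<rho>a minus_minus .
      qed
    next
      \<comment> \<open>At an interior minimum the quotient \<open>q\<close> is nonpositive on the
        left and nonnegative on the right of \<open>\<rho>\<close>, hence zero there: the zero is
        double and a square splits off.\<close>
      case False
      then have \<rho>i: "-a < \<rho>" "\<rho> < a" using \<rho>(1) by auto
      have qr: "0 \<le> poly q t" if "\<rho> < t" "t \<le> a" for t
        using r0[of t] that \<rho>i unfolding pr0 by (simp add: zero_le_mult_iff)
      have ql: "0 \<le> poly (- q) t" if "-a \<le> t" "t < \<rho>" for t
        using r0[of t] that \<rho>i unfolding pr0 by (simp add: zero_le_mult_iff)
      have "0 \<le> poly q \<rho>"
      proof (rule poly_nonneg_limit)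
        fix d :: real assume "d > 0"
        then show "\<exists>t. \<bar>t - \<rho>\<bar> < d \<and> 0 \<le> poly q t" using \<rho>i
          by (intro exI[of _ "\<rho> + min (d/2) (a - \<rho>)"] conjI qr) auto
      qed
      moreover have "0 \<le> poly (- q) \<rho>"
      proof (rule poly_nonneg_limit)
        fix d :: real assume "d > 0"
        then show "\<exists>t. \<bar>t - \<rho>\<bar> < d \<and> 0 \<le> poly (- q) t" using \<rho>i
          by (intro exI[of _ "\<rho> - min (d/2) (\<rho> + a)"] conjI ql) auto
      qed
      ultimately have "poly q \<rho> = 0" by simp
      then obtain q2 where q2: "q = [:-\<rho>, 1:] * q2" by (auto simp: poly_eq_0_iff_dvd elim: dvdE)
      have "q2 \<noteq> 0" using q0 q2 by auto
      then have deg2: "degree q2 < degree q" unfolding q2 by (subst degree_mult_eq) auto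
      have pr2: "poly r0 t = (t - \<rho>)\<^sup>2 * poly q2 t" for t unfolding q q2 by (simp add: power2_eq_square algebra_simps)
      have q2n: "0 \<le> poly q2 t" if "t \<in> {-a..a}" "t \<noteq> \<rho>" for t
        using r0[OF that(1)] that(2) unfolding pr2 by (simp add: zero_le_mult_iff)
      have "0 \<le> poly q2 \<rho>"
      proof (rule poly_nonneg_limit)
        fix d :: real assume "d > 0"
        then show "\<exists>t. \<bar>t - \<rho>\<bar> < d \<and> 0 \<le> poly q2 t" using \<rho>i
          by (intro exI[of _ "\<rho> + min (d/2) (a - \<rho>)"] conjI q2n) auto
      qed
      then have "0 \<le> poly q2 t" if "t \<in> {-a..a}" for t using q2n[OF that] by (cases "t = \<rho>") auto
      then have "q2 \<in> poly_cone a" using degq deg2 by (intro less(1)) auto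
      from poly_cone_mult_square[OF this, of "[:-\<rho>, 1:]"] show ?thesis unfolding q q2 by (simp only: mult.assoc)
    qed
    then have "r0 + [:c:] \<in> poly_cone a" by (rule poly_cone.add[OF _ poly_cone_const[OF c]])
    then show ?thesis by (simp add: r0_def)
  qed
qed

section \<open>Polynomial calculus of a symmetric operator\<close>

definition rpoly_op :: "real poly \<Rightarrow> ('a::real_vector \<Rightarrow> 'a) \<Rightarrow> 'a \<Rightarrow> 'a" where
  "rpoly_op p T v = (\<Sum>i\<le>degree p. coeff p i *\<^sub>R (T ^^ i) v)"

lemma rpoly_op_ge: "degree p \<le> n \<Longrightarrow> rpoly_op p T v = (\<Sum>i\<le>n. coeff p i *\<^sub>R (T ^^ i) v)"
  unfolding rpoly_op_def by (rule sum.mono_neutral_left) (auto simp: coeff_eq_0)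

lemma rpoly_op_0: "rpoly_op 0 T v = 0" by (simp add: rpoly_op_def)

lemma rpoly_op_pCons:
  assumes "linear T" shows "rpoly_op (pCons a p) T v = a *\<^sub>R v + T (rpoly_op p T v)"
proof -
  have "rpoly_op (pCons a p) T v = (\<Sum>i\<le>Suc (degree p). coeff (pCons a p) i *\<^sub>R (T ^^ i) v)"
    by (rule rpoly_op_ge) (simp add: degree_pCons_le)
  also have "\<dots> = a *\<^sub>R v + (\<Sum>i\<le>degree p. coeff p i *\<^sub>R (T ^^ Suc i) v)"
    unfolding sum.atMost_Suc_shift by simp
  also have "(\<Sum>i\<le>degree p. coeff p i *\<^sub>R (T ^^ Suc i) v) = T (rpoly_op p T v)"
    by (simp add: rpoly_op_def linear_sum[OF assms] linear_scale[OF assms])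
  finally show ?thesis .
qed

lemma rpoly_op_add: "linear T \<Longrightarrow> rpoly_op (p + q) T v = rpoly_op p T v + rpoly_op q T v"
  using rpoly_op_ge[of p "max (degree p) (degree q)" T v] rpoly_op_ge[of q "max (degree p) (degree q)" T v]
    rpoly_op_ge[of "p + q" "max (degree p) (degree q)" T v]
  by (simp add: degree_add_le scaleR_add_left sum.distrib)

lemma rpoly_op_smult: "rpoly_op (smult c p) T v = c *\<^sub>R rpoly_op p T v"
  using rpoly_op_ge[of "smult c p" "degree p" T v] by (simp add: degree_smult_le rpoly_op_def scaleR_sum_right)

lemma rpoly_op_mult: assumes "linear T" shows "rpoly_op (p * q) T v = rpoly_op p T (rpoly_op q T v)"
proof (induction p)
  case (pCons a p)
  then show ?case by (simp add: rpoly_op_add[OF assms] rpoly_op_smult rpoly_op_pCons[OF assms])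
qed (simp add: rpoly_op_0)

lemma rpoly_op_sym:
  fixes T :: "'a::real_inner \<Rightarrow> 'a"
  assumes "linear T" "\<And>v w. T v \<bullet> w = v \<bullet> T w" shows "rpoly_op p T v \<bullet> w = v \<bullet> rpoly_op p T w"
proof (induction p arbitrary: v w)
  case (pCons a p)
  have "T (rpoly_op p T v) \<bullet> w = v \<bullet> T (rpoly_op p T w)"
  proof -
    have "rpoly_op p T (T w) = T (rpoly_op p T w)"
      using rpoly_op_mult[OF assms(1), of p "[:0, 1:]" w] rpoly_op_mult[OF assms(1), of "[:0, 1:]" p w]
      by (simp only: mult.commute[of p]) (simp add: rpoly_op_pCons[OF assms(1)] rpoly_op_0 linear_0[OF assms(1)])
    then show ?thesis using assms(2) pCons(2) by simp
  qed
  then show ?case by (simp add: rpoly_op_pCons[OF assms(1)] inner_add)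
qed (simp add: rpoly_op_0)

text \<open>One square root factor \<open>s(T)\<close> moves to the other side of the inner product,
  so a factor \<open>s * s\<close> merely replaces \<open>v\<close> by \<open>s(T) v\<close>. What
  remains are the identity and \<open>a - T\<close>, \<open>a + T\<close>, nonnegative by the
  Cauchy-Schwarz inequality and the norm bound.\<close>

lemma rpoly_op_cone:
  fixes T :: "'a::real_inner \<Rightarrow> 'a"
  assumes T: "linear T" "\<And>v w. T v \<bullet> w = v \<bullet> T w" "\<And>v. norm (T v) \<le> a * norm v"
    and p: "p \<in> poly_cone a"
  shows "0 \<le> rpoly_op p T v \<bullet> v"
  using p
proof (induction arbitrary: v rule: poly_cone.induct)
  have Tv: "\<bar>T v \<bullet> v\<bar> \<le> a * (v \<bullet> v)" for v
    using Cauchy_Schwarz_ineq2[of "T v" v] mult_right_mono[OF T(3)[of v] norm_ge_zero[of v]]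
    by (simp add: power2_norm_eq_inner[symmetric] power2_eq_square mult.assoc)
  have one: "rpoly_op [:a, c:] T v = a *\<^sub>R v + c *\<^sub>R T v" for c v
    by (simp add: rpoly_op_pCons[OF T(1)] rpoly_op_0 linear_0[OF T(1)] linear_scale[OF T(1)])
  have sq: "rpoly_op (s * s * p) T v \<bullet> v = rpoly_op p T (rpoly_op s T v) \<bullet> rpoly_op s T v" for s p v
  proof -
    have "rpoly_op (s * (p * s)) T v \<bullet> v = rpoly_op p T (rpoly_op s T v) \<bullet> rpoly_op s T v"
      unfolding rpoly_op_mult[OF T(1)] by (rule rpoly_op_sym[OF T(1,2)])
    then show ?thesis by (simp add: mult_ac)
  qed
  { case (square s)
    have "rpoly_op (s * s) T v \<bullet> v = rpoly_op s T v \<bullet> rpoly_op s T v"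
      unfolding rpoly_op_mult[OF T(1)] by (rule rpoly_op_sym[OF T(1,2)])
    then show ?case by simp }
  { case (minus s)
    show ?case unfolding sq one using Tv[of "rpoly_op s T v"] by (simp add: inner_add_left inner_diff_left abs_le_iff) }
  { case (plus s)
    show ?case unfolding sq one using Tv[of "rpoly_op s T v"] by (simp add: inner_add_left inner_diff_left abs_le_iff) }
qed (simp add: rpoly_op_add[OF T(1)] inner_add_left)

text \<open>For \<open>a = 0\<close> the operator vanishes and only the value at \<open>0\<close> matters.\<close>

lemma norm_rpoly_op_le:
  fixes T :: "'a::real_inner \<Rightarrow> 'a"
  assumes T: "linear T" "\<And>v w. T v \<bullet> w = v \<bullet> T w" "\<And>v. norm (T v) \<le> a * norm v" and a: "a \<ge> 0"
    and p: "\<And>t. t \<in> {-a..a} \<Longrightarrow> \<bar>poly p t\<bar> \<le> e"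
  shows "norm (rpoly_op p T v) \<le> e * norm v"
proof (cases "a = 0")
  case True
  then have "T w = 0" for w using T(3)[of w] by simp
  then have "rpoly_op p T v = poly p 0 *\<^sub>R v"
    by (cases p) (simp add: rpoly_op_pCons[OF T(1)])
  then show ?thesis using p[of 0] True by (simp add: mult_right_mono)
next
  case False
  have e: "e \<ge> 0" using p[of 0] a by force
  \<comment> \<open>The norm bound is the positivity of \<open>e\<^sup>2 - p(T)\<^sup>2\<close>, for
    which nonnegativity of the polynomial on the interval now suffices.\<close>
  have "[:e\<^sup>2:] - p * p \<in> poly_cone a"
  proof (rule nonneg_poly_in_cone)
    fix t assume "t \<in> {-a..a}"
    then have "\<bar>poly p t\<bar>\<^sup>2 \<le> e\<^sup>2" using p by (intro power_mono) auto
    then show "0 \<le> poly ([:e\<^sup>2:] - p * p) t" by (simp add: power2_eq_square)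
  qed (use False a in simp)
  from rpoly_op_cone[OF T this, of v]
  have "0 \<le> rpoly_op ([:e\<^sup>2:] + smult (-1) (p * p)) T v \<bullet> v" by simp
  also have "\<dots> = e\<^sup>2 * (v \<bullet> v) - rpoly_op p T (rpoly_op p T v) \<bullet> v"
    by (simp add: rpoly_op_add[OF T(1)] rpoly_op_smult rpoly_op_mult[OF T(1)] rpoly_op_pCons[OF T(1)] rpoly_op_0 linear_0[OF T(1)] inner_add_left inner_diff_left
        del: smult_minus_left smult_1_left)
  also have "rpoly_op p T (rpoly_op p T v) \<bullet> v = (norm (rpoly_op p T v))\<^sup>2"
    unfolding power2_norm_eq_inner by (rule rpoly_op_sym[OF T(1,2)])
  finally have "(norm (rpoly_op p T v))\<^sup>2 \<le> (e * norm v)\<^sup>2"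
    by (simp add: power_mult_distrib power2_norm_eq_inner)
  then show ?thesis by (rule power2_le_imp_le) (use e in simp)
qed

section \<open>Square summable functions as a Hilbert space\<close>

definition sq_summable :: "('x \<Rightarrow> complex) \<Rightarrow> bool" where
  "sq_summable v \<longleftrightarrow> (\<lambda>x. (cmod (v x))\<^sup>2) summable_on UNIV"

lemma sq_summable_bound:
  assumes "sq_summable v" "sq_summable w" "\<And>x. (cmod (u x))\<^sup>2 \<le> c * (cmod (v x))\<^sup>2 + d * (cmod (w x))\<^sup>2"
  shows "sq_summable u"
proof -
  have "(\<lambda>x. c * (cmod (v x))\<^sup>2 + d * (cmod (w x))\<^sup>2) summable_on UNIV"
    using assms(1,2) unfolding sq_summable_def by (intro summable_on_add summable_on_cmult_right)
  then show ?thesis unfolding sq_summable_def by (rule summable_on_comparison_test) (use assms(3) in auto)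
qed

lemma sq_summable_add: assumes "sq_summable v" "sq_summable w" shows "sq_summable (\<lambda>x. v x + w x)"
proof (rule sq_summable_bound[OF assms, of _ 2 2])
  fix x
  have "(cmod (v x + w x))\<^sup>2 \<le> (cmod (v x) + cmod (w x))\<^sup>2" by (intro power_mono norm_triangle_ineq) simp
  also have "\<dots> \<le> 2 * (cmod (v x))\<^sup>2 + 2 * (cmod (w x))\<^sup>2"
    using zero_le_power2[of "cmod (v x) - cmod (w x)"] by (simp add: power2_eq_square algebra_simps)
  finally show "(cmod (v x + w x))\<^sup>2 \<le> 2 * (cmod (v x))\<^sup>2 + 2 * (cmod (w x))\<^sup>2" .
qed

lemma sq_summable_mult: assumes "sq_summable v" shows "sq_summable (\<lambda>x. c * v x)"
  by (rule sq_summable_bound[OF assms assms, of _ "(cmod c)\<^sup>2" 0]) (simp add: norm_mult power_mult_distrib)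

lemma sq_summable_0: "sq_summable (\<lambda>x. 0)" by (simp add: sq_summable_def)

lemma sq_summable_inner:
  assumes "sq_summable v" "sq_summable w" shows "(\<lambda>x. v x \<bullet> w x) summable_on UNIV"
proof -
  have "(\<lambda>x. (cmod (v x))\<^sup>2 + (cmod (w x))\<^sup>2) summable_on UNIV"
    using assms unfolding sq_summable_def by (rule summable_on_add)
  then have "(\<lambda>x. norm (v x \<bullet> w x)) summable_on UNIV"
  proof (rule summable_on_comparison_test)
    fix x
    have "\<bar>v x \<bullet> w x\<bar> \<le> cmod (v x) * cmod (w x)" by (rule Cauchy_Schwarz_ineq2)
    moreover have "2 * cmod (v x) * cmod (w x) \<le> (cmod (v x))\<^sup>2 + (cmod (w x))\<^sup>2" by (rule sum_squares_bound)
    moreover have "0 \<le> cmod (v x) * cmod (w x)" by simp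
    ultimately show "norm (v x \<bullet> w x) \<le> (cmod (v x))\<^sup>2 + (cmod (w x))\<^sup>2" by simp
  qed simp
  then show ?thesis by (rule abs_summable_summable)
qed

text \<open>One type for all configurations: \<open>ell2 A\<close> is the subspace of functions
  vanishing off \<open>A\<close>. The inner product below is the real part of the Hermitian one;
  complex multiples enter only through \<open>cscale\<close>.\<close>

typedef 'x l2 = "{v :: 'x \<Rightarrow> complex. sq_summable v}" morphisms fun_of l2_of
  using sq_summable_0 by blast

lemma sq_summable_fun_of: "sq_summable (fun_of v)" using fun_of by blast

lemma fun_of_l2_of: "sq_summable v \<Longrightarrow> fun_of (l2_of v) = v" by (simp add: l2_of_inverse)

lemma l2_eqI: "(\<And>x. fun_of v x = fun_of w x) \<Longrightarrow> v = w"
  by (metis fun_of_inverse ext)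

instantiation l2 :: (type) real_vector
begin

definition "0 = l2_of (\<lambda>x. 0)"
definition "v + w = l2_of (\<lambda>x. fun_of v x + fun_of w x)"
definition "- v = l2_of (\<lambda>x. - fun_of v x)"
definition "v - w = l2_of (\<lambda>x. fun_of v x - fun_of w x)"
definition "c *\<^sub>R v = l2_of (\<lambda>x. complex_of_real c * fun_of v x)"

lemma l2_fun_simps:
  "fun_of (0 :: 'a l2) x = 0" "fun_of (v + w) x = fun_of v x + fun_of w x"
  "fun_of (- v) x = - fun_of v x" "fun_of (v - w) x = fun_of v x - fun_of w x"
  "fun_of (c *\<^sub>R v) x = complex_of_real c * fun_of v x"
proof -
  note s = sq_summable_fun_of[of v] sq_summable_fun_of[of w]
  show "fun_of (0 :: 'a l2) x = 0" by (simp add: zero_l2_def fun_of_l2_of sq_summable_0)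
  show "fun_of (v + w) x = fun_of v x + fun_of w x" by (simp add: plus_l2_def fun_of_l2_of sq_summable_add s)
  show "fun_of (- v) x = - fun_of v x" using sq_summable_mult[OF s(1), of "-1"] by (simp add: uminus_l2_def fun_of_l2_of)
  show "fun_of (v - w) x = fun_of v x - fun_of w x"
    using sq_summable_add[OF s(1) sq_summable_mult[OF s(2), of "-1"]] by (simp add: minus_l2_def fun_of_l2_of)
  show "fun_of (c *\<^sub>R v) x = complex_of_real c * fun_of v x"
    by (simp add: scaleR_l2_def fun_of_l2_of sq_summable_mult s)
qed

instance
  by standard (rule l2_eqI; simp add: l2_fun_simps algebra_simps)+

end

instantiation l2 :: (type) real_inner
begin

definition "v \<bullet> w = (\<Sum>\<^sub>\<infinity>x. fun_of v x \<bullet> fun_of w x)"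
definition "norm (v :: 'a l2) = sqrt (v \<bullet> v)"
definition "sgn (v :: 'a l2) = v /\<^sub>R norm v"
definition "dist (v :: 'a l2) w = norm (v - w)"
definition [code del]: "uniformity = (INF e\<in>{0<..}. principal {(x :: 'a l2, y). dist x y < e})"
definition [code del]: "open U \<longleftrightarrow> (\<forall>x\<in>U. eventually (\<lambda>(x', y). x' = x \<longrightarrow> y \<in> U) (uniformity :: ('a l2 \<times> 'a l2) filter))"

instance
proof
  fix u v w :: "'a l2" and a :: real
  note sm = sq_summable_inner[OF sq_summable_fun_of sq_summable_fun_of]
  show "dist u v = norm (u - v)" by (rule dist_l2_def)
  show "sgn u = u /\<^sub>R norm u" by (rule sgn_l2_def)
  show "uniformity = (INF e\<in>{0<..}. principal {(x :: 'a l2, y). dist x y < e})" by (rule uniformity_l2_def)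
  show "open U \<longleftrightarrow> (\<forall>x\<in>U. eventually (\<lambda>(x', y). x' = x \<longrightarrow> y \<in> U) uniformity)" for U :: "'a l2 set" by (rule open_l2_def)
  show "u \<bullet> v = v \<bullet> u" by (simp add: inner_l2_def inner_commute)
  show "(u + v) \<bullet> w = u \<bullet> w + v \<bullet> w"
    unfolding inner_l2_def by (simp add: l2_fun_simps inner_add_left infsum_add sm)
  show "a *\<^sub>R u \<bullet> v = a * (u \<bullet> v)"
  proof -
    have "a *\<^sub>R u \<bullet> v = (\<Sum>\<^sub>\<infinity>x. a * (fun_of u x \<bullet> fun_of v x))"
      unfolding inner_l2_def by (intro infsum_cong) (simp add: l2_fun_simps inner_complex_def algebra_simps)
    then show ?thesis by (simp add: inner_l2_def infsum_cmult_right')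
  qed
  show "0 \<le> u \<bullet> u" unfolding inner_l2_def by (intro infsum_nonneg) auto
  show "u \<bullet> u = 0 \<longleftrightarrow> u = 0"
  proof
    assume z: "u \<bullet> u = 0"
    show "u = 0"
    proof (rule l2_eqI)
      fix x
      have "fun_of u x \<bullet> fun_of u x = 0"
        by (rule nonneg_infsum_le_0D[of "\<lambda>x. fun_of u x \<bullet> fun_of u x" UNIV x]) (use z sm in \<open>auto simp: inner_l2_def\<close>)
      then show "fun_of u x = fun_of 0 x" by (simp add: l2_fun_simps)
    qed
  qed (simp add: inner_l2_def l2_fun_simps)
  show "norm u = sqrt (u \<bullet> u)" by (rule norm_l2_def)
qed

end

lemma l2_norm_sq: "(norm (v :: 'x l2))\<^sup>2 = (\<Sum>\<^sub>\<infinity>x. (cmod (fun_of v x))\<^sup>2)"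
  by (simp add: power2_norm_eq_inner inner_l2_def)

lemma l2_sum_le: assumes "finite F" shows "(\<Sum>x\<in>F. (cmod (fun_of v x))\<^sup>2) \<le> (norm v)\<^sup>2"
  unfolding l2_norm_sq
  by (rule finite_sum_le_infsum) (use assms sq_summable_fun_of[of v] in \<open>auto simp: sq_summable_def\<close>)

lemma l2_coord_le: "cmod (fun_of v x) \<le> norm v"
  using l2_sum_le[of "{x}" v] by (simp add: abs_le_square_iff[symmetric])

lemma l2_of_finite_sums:
  assumes "\<And>F. finite F \<Longrightarrow> (\<Sum>x\<in>F. (cmod (v x))\<^sup>2) \<le> b\<^sup>2" "b \<ge> 0"
  shows "sq_summable v" "norm (l2_of v) \<le> b"
proof -
  show s: "sq_summable v" unfolding sq_summable_def
    by (rule nonneg_bounded_partial_sums_imp_summable_on[of _ _ "b\<^sup>2"]) (use assms(1) in \<open>auto intro: eventually_finite_subsets_at_top_weakI\<close>)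
  have "(norm (l2_of v))\<^sup>2 \<le> b\<^sup>2" unfolding l2_norm_sq fun_of_l2_of[OF s]
    using s assms(1) by (intro infsum_le_finite_sums) (auto simp: sq_summable_def)
  then show "norm (l2_of v) \<le> b" by (rule power2_le_imp_le) (rule assms(2))
qed

text \<open>The pointwise limit is the candidate. Finite partial sums of the squared difference are
  bounded uniformly by letting the index \<open>m\<close> tend to infinity in each finite sum, and
  \<open>l2_of_finite_sums\<close> converts this into a norm estimate.\<close>

instance l2 :: (type) complete_space
proof
  fix X :: "nat \<Rightarrow> 'a l2" assume X: "Cauchy X"
  have "Cauchy (\<lambda>n. fun_of (X n) x)" for x
  proof (rule metric_CauchyI)
    fix e :: real assume "e > 0"
    then obtain N where "\<forall>m\<ge>N. \<forall>n\<ge>N. dist (X m) (X n) < e" using X metric_CauchyD by blast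
    moreover have "dist (fun_of (X m) x) (fun_of (X n) x) \<le> dist (X m) (X n)" for m n
      using l2_coord_le[of "X m - X n" x] by (simp add: dist_norm l2_fun_simps)
    ultimately show "\<exists>N. \<forall>m\<ge>N. \<forall>n\<ge>N. dist (fun_of (X m) x) (fun_of (X n) x) < e" by (meson le_less_trans)
  qed
  then have "\<forall>x. \<exists>l. (\<lambda>n. fun_of (X n) x) \<longlonglongrightarrow> l" using Cauchy_convergent convergent_def by blast
  then obtain L where L: "\<And>x. (\<lambda>n. fun_of (X n) x) \<longlonglongrightarrow> L x" by metis
  have close: "sq_summable (\<lambda>x. L x - fun_of (X n) x) \<and> norm (l2_of (\<lambda>x. L x - fun_of (X n) x)) \<le> e"
    if "e \<ge> 0" "\<And>m. m \<ge> N \<Longrightarrow> norm (X m - X n) \<le> e" for n N e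
  proof -
    have "(\<Sum>x\<in>F. (cmod (L x - fun_of (X n) x))\<^sup>2) \<le> e\<^sup>2" if F: "finite F" for F
    proof (rule LIMSEQ_le_const2)
      show "(\<lambda>m. \<Sum>x\<in>F. (cmod (fun_of (X m) x - fun_of (X n) x))\<^sup>2) \<longlonglongrightarrow> (\<Sum>x\<in>F. (cmod (L x - fun_of (X n) x))\<^sup>2)"
        by (intro tendsto_intros L)
      have "(\<Sum>x\<in>F. (cmod (fun_of (X m) x - fun_of (X n) x))\<^sup>2) \<le> e\<^sup>2" if "m \<ge> N" for m
      proof -
        have "(\<Sum>x\<in>F. (cmod (fun_of (X m) x - fun_of (X n) x))\<^sup>2) \<le> (norm (X m - X n))\<^sup>2"
          using l2_sum_le[OF F, of "X m - X n"] by (simp add: l2_fun_simps)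
        also have "\<dots> \<le> e\<^sup>2" using \<open>\<And>m. m \<ge> N \<Longrightarrow> norm (X m - X n) \<le> e\<close>[OF that] by (intro power_mono) auto
        finally show ?thesis .
      qed
      then show "\<exists>N. \<forall>m\<ge>N. (\<Sum>x\<in>F. (cmod (fun_of (X m) x - fun_of (X n) x))\<^sup>2) \<le> e\<^sup>2" by blast
    qed
    from l2_of_finite_sums[OF this \<open>e \<ge> 0\<close>] show ?thesis by blast
  qed
  obtain N0 where N0: "\<forall>m\<ge>N0. \<forall>n\<ge>N0. dist (X m) (X n) < 1" using X metric_CauchyD zero_less_one by blast
  have "norm (X m - X N0) \<le> 1" if "m \<ge> N0" for m using N0 that by (auto simp: dist_norm less_imp_le)
  then have "sq_summable (\<lambda>x. L x - fun_of (X N0) x)" using close[of 1 N0 N0] by auto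
  from sq_summable_add[OF this sq_summable_fun_of[of "X N0"]] have sL: "sq_summable L" by simp
  have "X \<longlonglongrightarrow> l2_of L"
  proof (rule metric_LIMSEQ_I)
    fix e :: real assume e: "e > 0"
    then obtain N where N: "\<forall>m\<ge>N. \<forall>n\<ge>N. dist (X m) (X n) < e / 2" using X metric_CauchyD[of X "e/2"] by auto
    have "dist (X n) (l2_of L) < e" if n: "n \<ge> N" for n
    proof -
      have "norm (l2_of (\<lambda>x. L x - fun_of (X n) x)) \<le> e / 2"
        using close[of "e / 2" N n] N n e by (auto simp: dist_norm less_imp_le)
      moreover have "l2_of (\<lambda>x. L x - fun_of (X n) x) = l2_of L - X n"
        by (simp add: minus_l2_def fun_of_l2_of[OF sL])
      ultimately show ?thesis using e by (simp add: dist_norm norm_minus_commute)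
    qed
    then show "\<exists>N. \<forall>n\<ge>N. dist (X n) (l2_of L) < e" by blast
  qed
  then show "convergent X" by (auto simp: convergent_def)
qed

definition del :: "'x \<Rightarrow> complex \<Rightarrow> 'x l2" where "del x z = l2_of (\<lambda>y. if y = x then z else 0)"

lemma fun_of_del: "fun_of (del x z) y = (if y = x then z else 0)"
proof -
  have "(\<lambda>y. (cmod (if y = x then z else 0))\<^sup>2) summable_on UNIV \<longleftrightarrow> (\<lambda>y. (cmod (if y = x then z else 0))\<^sup>2) summable_on {x}"
    by (rule summable_on_cong_neutral) auto
  then have "sq_summable (\<lambda>y. if y = x then z else 0)" by (simp add: sq_summable_def)
  then show ?thesis by (simp add: del_def fun_of_l2_of)
qed

lemma inner_del: "v \<bullet> del x z = fun_of v x \<bullet> z"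
proof -
  have "v \<bullet> del x z = (\<Sum>\<^sub>\<infinity>y\<in>{x}. fun_of v y \<bullet> z)"
    unfolding inner_l2_def by (rule infsum_cong_neutral) (auto simp: fun_of_del)
  then show ?thesis by simp
qed

lemma norm_del: "norm (del x z) = cmod z"
  by (simp add: norm_eq_sqrt_inner inner_del fun_of_del)

lemma l2_approx:
  assumes "e > 0" obtains F where "finite F" "F \<subseteq> {x. fun_of v x \<noteq> 0}" "norm (v - (\<Sum>x\<in>F. del x (fun_of v x))) < e"
proof -
  let ?S = "{x. fun_of v x \<noteq> 0}"
  have sm: "(\<lambda>x. (cmod (fun_of v x))\<^sup>2) summable_on ?S"
    using sq_summable_fun_of[of v] unfolding sq_summable_def by (rule summable_on_subset) simp
  have "((\<lambda>x. (cmod (fun_of v x))\<^sup>2) has_sum (norm v)\<^sup>2) ?S"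
  proof -
    have "(\<Sum>\<^sub>\<infinity>x\<in>?S. (cmod (fun_of v x))\<^sup>2) = (norm v)\<^sup>2" unfolding l2_norm_sq by (rule infsum_cong_neutral) auto
    with sm show ?thesis by (simp add: has_sum_infsum summable_iff_has_sum_infsum)
  qed
  moreover have "e\<^sup>2 > 0" using assms by simp
  ultimately have "eventually (\<lambda>F. dist (\<Sum>x\<in>F. (cmod (fun_of v x))\<^sup>2) ((norm v)\<^sup>2) < e\<^sup>2) (finite_subsets_at_top ?S)"
    unfolding has_sum_def tendsto_iff by blast
  then obtain F where F: "finite F" "F \<subseteq> ?S" "dist (\<Sum>x\<in>F. (cmod (fun_of v x))\<^sup>2) ((norm v)\<^sup>2) < e\<^sup>2"
    unfolding eventually_finite_subsets_at_top by blast
  define w where "w = (\<Sum>x\<in>F. del x (fun_of v x))"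
  have fw: "fun_of w x = (if x \<in> F then fun_of v x else 0)" for x
  proof -
    have "fun_of w x = (\<Sum>y\<in>F. fun_of (del y (fun_of v y)) x)"
      unfolding w_def using F(1) by (induction F rule: finite_induct) (auto simp: l2_fun_simps)
    also have "\<dots> = (\<Sum>y\<in>F. if y = x then fun_of v x else 0)" by (intro sum.cong) (auto simp: fun_of_del)
    finally show ?thesis using F(1) by simp
  qed
  have vw: "u \<bullet> w = (\<Sum>x\<in>F. fun_of u x \<bullet> fun_of v x)" for u by (simp add: w_def inner_sum_right inner_del)
  have "(norm (v - w))\<^sup>2 = (norm v)\<^sup>2 - 2 * (v \<bullet> w) + w \<bullet> w"
    by (simp add: power2_norm_eq_inner inner_diff inner_commute)
  also have "w \<bullet> w = (\<Sum>x\<in>F. (cmod (fun_of v x))\<^sup>2)" unfolding vw[of w] by (intro sum.cong) (auto simp: fw power2_norm_eq_inner)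
  also have "v \<bullet> w = (\<Sum>x\<in>F. (cmod (fun_of v x))\<^sup>2)" unfolding vw by (simp add: power2_norm_eq_inner)
  finally have "(norm (v - w))\<^sup>2 = (norm v)\<^sup>2 - (\<Sum>x\<in>F. (cmod (fun_of v x))\<^sup>2)" by simp
  also have "\<dots> < e\<^sup>2" using F(3) by (simp add: dist_real_def)
  finally have "norm (v - w) < e" using assms by (simp add: power_less_imp_less_base)
  then show thesis using that F(1,2) unfolding w_def by blast
qed

text \<open>Finite combinations of point masses are dense. All complex heights \<open>z\<close>
  occur in the hypothesis because the maps are only real linear.\<close>

lemma bounded_linear_l2_eq:
  fixes f g :: "'x l2 \<Rightarrow> 'b::real_normed_vector"
  assumes f: "bounded_linear f" and g: "bounded_linear g" and eq: "\<And>x z. f (del x z) = g (del x z)"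
  shows "f v = g v"
proof -
  interpret D: bounded_linear "\<lambda>v. f v - g v" by (rule bounded_linear_sub[OF f g])
  from D.pos_bounded obtain K where K: "K > 0" and "\<forall>v. norm (f v - g v) \<le> norm v * K"
    by (elim exE conjE)
  then have K2: "norm (f v - g v) \<le> norm v * K" for v by (simp only:)
  have "norm (f v - g v) \<le> e" if e: "e > 0" for e
  proof -
    obtain F where F: "finite F" "norm (v - (\<Sum>x\<in>F. del x (fun_of v x))) < e / K"
      by (rule l2_approx[of "e / K" v]) (use e K in auto)
    define w where "w = (\<Sum>x\<in>F. del x (fun_of v x))"
    have "f w - g w = 0" unfolding w_def by (simp add: D.sum eq)
    then have "f v - g v = f (v - w) - g (v - w)" using D.diff[of v w] by simp
    then have "norm (f v - g v) \<le> norm (v - w) * K" using K2[of "v - w"] by (simp only:)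
    also have "\<dots> \<le> e" using F(2) K unfolding w_def[symmetric] by (simp only: pos_less_divide_eq less_imp_le)
    finally show ?thesis .
  qed
  then have "norm (f v - g v) \<le> 0" by (rule field_le_epsilon[of _ 0, simplified])
  then show ?thesis by simp
qed

definition cscale :: "complex \<Rightarrow> 'x l2 \<Rightarrow> 'x l2" where "cscale c v = l2_of (\<lambda>x. c * fun_of v x)"

lemma fun_of_cscale: "fun_of (cscale c v) x = c * fun_of v x"
  by (simp add: cscale_def fun_of_l2_of sq_summable_mult sq_summable_fun_of)

lemma norm_cscale: "norm (cscale c v) = cmod c * norm v"
proof -
  have "(norm (cscale c v))\<^sup>2 = (cmod c * norm v)\<^sup>2"
    unfolding l2_norm_sq power_mult_distrib
    by (simp add: fun_of_cscale norm_mult power_mult_distrib infsum_cmult_right')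
  then show ?thesis by (simp add: power2_eq_iff_nonneg)
qed

lemma bounded_linear_cscale: "bounded_linear (cscale c)"
  by (rule bounded_linear_intro[of _ "cmod c"])
     (auto intro!: l2_eqI simp: fun_of_cscale l2_fun_simps algebra_simps norm_cscale)

definition chi :: "'x set \<Rightarrow> 'x l2 \<Rightarrow> 'x l2" where "chi J v = l2_of (\<lambda>x. if x \<in> J then fun_of v x else 0)"

lemma fun_of_chi: "fun_of (chi J v) x = (if x \<in> J then fun_of v x else 0)"
proof -
  have "sq_summable (\<lambda>x. if x \<in> J then fun_of v x else 0)"
    by (rule sq_summable_bound[OF sq_summable_fun_of[of v] sq_summable_0, of _ 1 0]) auto
  then show ?thesis by (simp add: chi_def fun_of_l2_of)
qed

lemma chi_sym: "chi J v \<bullet> w = v \<bullet> chi J w"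
  unfolding inner_l2_def by (intro infsum_cong) (auto simp: fun_of_chi)

lemma chi_chi: "chi J (chi J v) = chi J v" by (rule l2_eqI) (simp add: fun_of_chi)

lemma norm_chi_le: "norm (chi J v) \<le> norm v"
proof (rule power2_le_imp_le)
  have "(norm (chi J v))\<^sup>2 = chi J v \<bullet> v" by (simp add: power2_norm_eq_inner chi_sym[of J v "chi J v"] chi_chi inner_commute)
  also have "\<dots> \<le> norm (chi J v) * norm v" by (rule norm_cauchy_schwarz)
  finally have "norm (chi J v) * norm (chi J v) \<le> norm (chi J v) * norm v" by (simp add: power2_eq_square)
  then have "norm (chi J v) \<le> norm v" by (cases "norm (chi J v) = 0") (auto simp: mult_le_cancel_left)
  then show "(norm (chi J v))\<^sup>2 \<le> (norm v)\<^sup>2" by (intro power_mono) auto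
qed simp

lemma bounded_linear_chi: "bounded_linear (chi J)"
  by (rule bounded_linear_intro[of _ 1])
     (auto intro!: l2_eqI simp: fun_of_chi l2_fun_simps norm_chi_le)

lemma ell2_iff: "v \<in> ell2 A \<longleftrightarrow> sq_summable v \<and> (\<forall>x. x \<notin> A \<longrightarrow> v x = 0)"
proof -
  have "(\<lambda>x. (cmod (v x))\<^sup>2) summable_on A \<longleftrightarrow> (\<lambda>x. (cmod (v x))\<^sup>2) summable_on UNIV" if "\<forall>x. x \<notin> A \<longrightarrow> v x = 0"
    using that by (intro summable_on_cong_neutral) auto
  then show ?thesis by (auto simp: ell2_def sq_summable_def)
qed

lemma ell2_norm_l2: "v \<in> ell2 A \<Longrightarrow> ell2_norm A v = norm (l2_of v)"
proof -
  assume v: "v \<in> ell2 A"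
  have "ell2_norm A v = sqrt ((norm (l2_of v))\<^sup>2)"
    unfolding ell2_norm_def l2_norm_sq using v
    by (intro arg_cong[where f = sqrt] infsum_cong_neutral) (auto simp: ell2_iff fun_of_l2_of)
  then show ?thesis by simp
qed

lemma ell2_norm_fun_of: "(\<And>x. x \<notin> A \<Longrightarrow> fun_of v x = 0) \<Longrightarrow> ell2_norm A (fun_of v) = norm v"
  by (subst ell2_norm_l2) (auto simp: ell2_iff sq_summable_fun_of fun_of_inverse)

section \<open>Hermitian matrices of finite hopping range\<close>

definition mat_app :: "'x set \<Rightarrow> ('x \<Rightarrow> 'x \<Rightarrow> complex) \<Rightarrow> ('x \<Rightarrow> complex) \<Rightarrow> 'x \<Rightarrow> complex" where
  "mat_app A h v = (\<lambda>x. if x \<in> A then \<Sum>\<^sub>\<infinity>y\<in>A. h x y * v y else 0)"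

lemma ham_eq_mat_app: "ham \<iota> \<omega> = mat_app (dom \<omega>) (ham_entry \<iota> \<omega>)"
  by (simp add: fun_eq_iff ham_def mat_app_def)

lemma poly_map_Re: "poly (map_poly Re p) t = Re (poly p (complex_of_real t))"
  by (induction p) (auto simp: map_poly_pCons)

lemma poly_map_Im: "poly (map_poly Im p) t = Im (poly p (complex_of_real t))"
  by (induction p) (auto simp: map_poly_pCons)

lemma poly_map_of_real: "poly (map_poly complex_of_real p) (complex_of_real t) = complex_of_real (poly p t)"
  by (induction p) (auto simp: map_poly_pCons)

locale matrix_operator =
  fixes A :: "'x::metric_space set" and h :: "'x \<Rightarrow> 'x \<Rightarrow> complex" and C R E :: real
  assumes C0: "0 \<le> C"
    and bounded: "v \<in> ell2 A \<Longrightarrow> mat_app A h v \<in> ell2 A \<and> ell2_norm A (mat_app A h v) \<le> C * ell2_norm A v"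
    and herm: "x \<in> A \<Longrightarrow> y \<in> A \<Longrightarrow> h x y = cnj (h y x)"
    and range: "x \<in> A \<Longrightarrow> y \<in> A \<Longrightarrow> R \<le> dist x y \<Longrightarrow> h x y = 0"
    and fin: "finite (A \<inter> cball x r)"
begin

lemma mat_app_sum: "x \<in> A \<Longrightarrow> mat_app A h v x = (\<Sum>y\<in>A \<inter> cball x R. h x y * v y)"
proof -
  assume x: "x \<in> A"
  have "(\<Sum>\<^sub>\<infinity>y\<in>A. h x y * v y) = (\<Sum>\<^sub>\<infinity>y\<in>A \<inter> cball x R. h x y * v y)"
    using range[OF x] by (intro infsum_cong_neutral) auto
  then show ?thesis using x fin by (simp add: mat_app_def)
qed

lemma mat_app_chi: "mat_app A h (fun_of (chi A v)) = mat_app A h (fun_of v)"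
  unfolding mat_app_def by (intro ext if_cong refl infsum_cong) (simp add: fun_of_chi)

lemma fun_of_ell2: "(\<And>x. x \<notin> A \<Longrightarrow> fun_of v x = 0) \<Longrightarrow> fun_of v \<in> ell2 A"
  by (auto simp: ell2_iff sq_summable_fun_of)

lemma chi_ell2: "fun_of (chi A v) \<in> ell2 A" by (rule fun_of_ell2) (simp add: fun_of_chi)

text \<open>Defined on all of \<open>l2\<close>: values off \<open>A\<close> are ignored on input
  and are zero on output, so that operators of different configurations act on one space.\<close>

definition H :: "'x l2 \<Rightarrow> 'x l2" where "H v = l2_of (mat_app A h (fun_of v))"

lemma fun_of_H: "fun_of (H v) = mat_app A h (fun_of v)"
  using bounded[OF chi_ell2, of v] unfolding H_def mat_app_chi by (intro fun_of_l2_of) (simp add: ell2_iff)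

lemma H_off: "x \<notin> A \<Longrightarrow> fun_of (H v) x = 0" by (simp add: fun_of_H mat_app_def)

lemma H_chi: "H (chi A v) = H v" by (simp add: H_def mat_app_chi)

lemma norm_H: "norm (H v) \<le> C * norm v"
proof -
  have "norm (H v) = ell2_norm A (mat_app A h (fun_of v))"
    using ell2_norm_fun_of[of A "H v"] H_off by (simp add: fun_of_H)
  also have "\<dots> \<le> C * ell2_norm A (fun_of (chi A v))" using bounded[OF chi_ell2, of v] by (simp add: mat_app_chi)
  also have "ell2_norm A (fun_of (chi A v)) = norm (chi A v)" by (rule ell2_norm_fun_of) (simp add: fun_of_chi)
  also have "C * norm (chi A v) \<le> C * norm v" by (intro mult_left_mono norm_chi_le C0)
  finally show ?thesis .
qed

lemma H_add: "H (v + w) = H v + H w"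
proof (rule l2_eqI)
  show "fun_of (H (v + w)) x = fun_of (H v + H w) x" for x
    by (cases "x \<in> A") (simp_all add: fun_of_H mat_app_sum l2_fun_simps distrib_left sum.distrib, simp add: mat_app_def)
qed

lemma H_cscale: "H (cscale c v) = cscale c (H v)"
proof (rule l2_eqI)
  show "fun_of (H (cscale c v)) x = fun_of (cscale c (H v)) x" for x
    by (cases "x \<in> A") (simp_all add: fun_of_H mat_app_sum fun_of_cscale sum_distrib_left mult_ac, simp add: mat_app_def)
qed

lemma scaleR_cscale: "r *\<^sub>R v = cscale (complex_of_real r) v"
  by (rule l2_eqI) (simp add: l2_fun_simps fun_of_cscale)

lemma bounded_linear_H: "bounded_linear H"
  by (rule bounded_linear_intro[of _ C]) (auto simp: H_add scaleR_cscale H_cscale norm_H mult.commute)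

lemma H_del: "fun_of (H (del y z)) x = (if x \<in> A \<and> y \<in> A then h x y * z else 0)"
proof (cases "x \<in> A")
  case True
  have "mat_app A h (fun_of (del y z)) x = (\<Sum>\<^sub>\<infinity>y'\<in>A. h x y' * fun_of (del y z) y')" using True by (simp add: mat_app_def)
  also have "\<dots> = (\<Sum>\<^sub>\<infinity>y'\<in>A \<inter> {y}. h x y' * fun_of (del y z) y')"
    by (intro infsum_cong_neutral) (auto simp: fun_of_del)
  finally show ?thesis using True by (cases "y \<in> A") (simp_all add: fun_of_H fun_of_del)
qed (simp add: H_off)

text \<open>Both sides are bounded and linear in each argument, so it is enough to compare them on
  point masses, where the claim is \<open>herm\<close>.\<close>

lemma H_sym: "H v \<bullet> w = v \<bullet> H w"
proof (rule bounded_linear_l2_eq[of "\<lambda>v. H v \<bullet> w" "\<lambda>v. v \<bullet> H w"])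
  show "bounded_linear (\<lambda>v. H v \<bullet> w)"
    by (rule bounded_linear_compose[OF bounded_linear_inner_left bounded_linear_H])
  show "bounded_linear (\<lambda>v. v \<bullet> H w)" by (rule bounded_linear_inner_left)
  fix y z
  show "H (del y z) \<bullet> w = del y z \<bullet> H w"
  proof (rule bounded_linear_l2_eq[of "\<lambda>w. H (del y z) \<bullet> w" "\<lambda>w. del y z \<bullet> H w"])
    show "bounded_linear (\<lambda>w. H (del y z) \<bullet> w)" by (rule bounded_linear_inner_right)
    show "bounded_linear (\<lambda>w. del y z \<bullet> H w)"
      by (rule bounded_linear_compose[OF bounded_linear_inner_right bounded_linear_H])
    fix x z'
    have "H (del y z) \<bullet> del x z' = (if x \<in> A \<and> y \<in> A then (h x y * z) \<bullet> z' else 0)"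
      by (simp add: inner_del H_del)
    moreover have "del y z \<bullet> H (del x z') = (if x \<in> A \<and> y \<in> A then (h y x * z') \<bullet> z else 0)"
      by (subst inner_commute) (simp add: inner_del H_del)
    moreover have "(h x y * z) \<bullet> z' = (h y x * z') \<bullet> z" if "x \<in> A" "y \<in> A"
      by (subst herm[OF that]) (simp add: inner_complex_def algebra_simps)
    ultimately show "H (del y z) \<bullet> del x z' = del y z \<bullet> H (del x z')" by simp
  qed
qed

section \<open>Projections onto the solutions supported in a set\<close>

definition D :: "'x l2 \<Rightarrow> 'x l2" where "D v = H v - E *\<^sub>R v"

text \<open>\<open>C + \<bar>E\<bar>\<close> already bounds the norm of \<open>D\<close>; the extra
  1 makes \<open>S\<close> positive when both summands vanish.\<close>

definition S :: real where "S = C + \<bar>E\<bar> + 1"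

lemma S_pos: "S > 0" using C0 by (simp add: S_def)

lemma bounded_linear_D: "bounded_linear D"
  unfolding D_def by (intro bounded_linear_sub bounded_linear_H bounded_linear_scaleR_right)

lemma D_sym: "D v \<bullet> w = v \<bullet> D w"
  by (simp add: D_def inner_diff_left inner_diff_right H_sym)

lemma norm_D: "norm (D v) \<le> S * norm v"
proof -
  have "norm (D v) \<le> norm (H v) + norm (E *\<^sub>R v)" unfolding D_def by (rule norm_triangle_ineq4)
  also have "\<dots> \<le> C * norm v + \<bar>E\<bar> * norm v" using norm_H by (intro add_mono) auto
  also have "\<dots> \<le> S * norm v" by (simp add: S_def algebra_simps)
  finally show ?thesis .
qed

lemma D_cscale: "D (cscale c v) = cscale c (D v)"
  unfolding D_def H_cscale by (rule l2_eqI) (simp add: fun_of_cscale l2_fun_simps algebra_simps)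

lemma chi_cscale: "chi J (cscale c v) = cscale c (chi J v)"
  by (rule l2_eqI) (simp add: fun_of_cscale fun_of_chi)

text \<open>The square of \<open>D\<close> is compressed, not \<open>D\<close> itself: the quadratic
  form of \<open>T J\<close> contains the full norm of \<open>D (chi J v)\<close>, so a fixed vector
  solves the equation at every point, also outside \<open>J\<close>. Compressing \<open>D\<close>
  would produce eigenvectors of a truncated matrix that need not be solutions.\<close>

definition T :: "'x set \<Rightarrow> 'x l2 \<Rightarrow> 'x l2" where
  "T J v = chi J v - (1 / S\<^sup>2) *\<^sub>R chi J (D (D (chi J v)))"

lemma T_inner: "T J v \<bullet> w = chi J v \<bullet> chi J w - (D (chi J v) \<bullet> D (chi J w)) / S\<^sup>2"
  unfolding T_def inner_diff_left inner_scaleR_left chi_sym[of J "D _"] D_sym[of "D _"]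
  using chi_sym[of J "chi J v" w] by (simp add: chi_chi)

lemma linear_T: "linear (T J)"
proof -
  have "bounded_linear (T J)" unfolding T_def
    by (intro bounded_linear_sub bounded_linear_chi bounded_linear_compose[OF bounded_linear_scaleR_right]
      bounded_linear_compose[OF bounded_linear_chi] bounded_linear_compose[OF bounded_linear_D])
  then show ?thesis by (rule bounded_linear.linear)
qed

lemma D_chi_le: "D w \<bullet> D w / S\<^sup>2 \<le> w \<bullet> w"
proof -
  have "(norm (D w))\<^sup>2 \<le> (S * norm w)\<^sup>2" by (intro power_mono norm_D) simp
  then show ?thesis using S_pos by (simp add: power2_norm_eq_inner[symmetric] power_mult_distrib field_simps)
qed

lemma chi_inner_le: "chi J v \<bullet> chi J v \<le> v \<bullet> v"
  using power_mono[OF norm_chi_le[of J v], of 2] by (simp add: power2_norm_eq_inner)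

lemma positive_contraction_T: "positive_contraction (T J)"
proof (rule positive_contraction.intro)
  show "linear (T J)" by (rule linear_T)
  show "T J v \<bullet> w = v \<bullet> T J w" for v w
    using T_inner[of J v w] T_inner[of J w v] by (simp add: inner_commute)
  show "0 \<le> T J v \<bullet> v" for v using D_chi_le[of "chi J v"] by (simp add: T_inner)
  show "T J v \<bullet> v \<le> v \<bullet> v" for v
  proof -
    have "0 \<le> D (chi J v) \<bullet> D (chi J v) / S\<^sup>2" by simp
    then show ?thesis using chi_inner_le[of J v] unfolding T_inner by linarith
  qed
qed

definition V :: "'x set \<Rightarrow> 'x l2 set" where "V J = {v. chi J v = v \<and> D v = 0}"

text \<open>For a fixed vector \<open>v \<bullet> v\<close> equals the squared norm of
  \<open>chi J v\<close> minus a nonnegative term, while \<open>chi J\<close> does not increase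
  norms. Hence both inequalities are equalities.\<close>

lemma T_fix_iff: "T J v = v \<longleftrightarrow> v \<in> V J"
proof
  assume Tv: "T J v = v"
  have eq: "v \<bullet> v = chi J v \<bullet> chi J v - (D (chi J v) \<bullet> D (chi J v)) / S\<^sup>2" using T_inner[of J v v] Tv by simp
  have nn: "0 \<le> D (chi J v) \<bullet> D (chi J v) / S\<^sup>2" by simp
  have vv: "v \<bullet> v = chi J v \<bullet> chi J v" using eq nn chi_inner_le[of J v] by linarith
  then have "D (chi J v) \<bullet> D (chi J v) / S\<^sup>2 = 0" using eq by linarith
  then have D0: "D (chi J v) = 0" using S_pos by simp
  have "(v - chi J v) \<bullet> (v - chi J v) = 0"
    using vv chi_sym[of J "chi J v" v] by (simp add: inner_diff inner_commute chi_chi)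
  then have "chi J v = v" by simp
  with D0 show "v \<in> V J" by (simp add: V_def)
next
  assume "v \<in> V J"
  then show "T J v = v"
    by (simp add: V_def T_def linear_0[OF bounded_linear.linear[OF bounded_linear_chi]] linear_0[OF bounded_linear.linear[OF bounded_linear_D]])
qed

definition P :: "'x set \<Rightarrow> 'x l2 \<Rightarrow> 'x l2" where "P J = positive_contraction.proj (T J)"

lemmas pc = positive_contraction_T
lemma P_in_V: "P J v \<in> V J"
  unfolding P_def T_fix_iff[symmetric] by (rule positive_contraction.proj_fix[OF pc])
lemma P_of_V: "v \<in> V J \<Longrightarrow> P J v = v"
  unfolding P_def T_fix_iff[symmetric] by (rule positive_contraction.proj_of_fix[OF pc])
lemma P_sym: "P J v \<bullet> w = v \<bullet> P J w" unfolding P_def by (rule positive_contraction.proj_sym[OF pc])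
lemma linear_P: "linear (P J)" unfolding P_def by (rule positive_contraction.linear_proj[OF pc])
lemma norm_P_le: "norm (P J v) \<le> norm v" unfolding P_def by (rule positive_contraction.norm_proj_le[OF pc])

lemma T_cscale: "T J (cscale c v) = cscale c (T J v)"
proof -
  have "cscale c (T J v) = cscale c (chi J v) - (1 / S\<^sup>2) *\<^sub>R cscale c (chi J (D (D (chi J v))))"
    unfolding T_def by (simp add: linear_diff[OF bounded_linear.linear[OF bounded_linear_cscale]] linear_scale[OF bounded_linear.linear[OF bounded_linear_cscale]])
  then show ?thesis by (simp add: T_def chi_cscale D_cscale)
qed

lemma P_cscale: "P J (cscale c v) = cscale c (P J v)"
  unfolding P_def by (rule positive_contraction.proj_commute[OF pc bounded_linear_cscale]) (simp add: T_cscale)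

lemma V_cscale: "v \<in> V J \<Longrightarrow> cscale c v \<in> V J"
proof -
  have "cscale c 0 = 0" by (rule l2_eqI) (simp add: fun_of_cscale l2_fun_simps)
  then show "v \<in> V J \<Longrightarrow> cscale c v \<in> V J" by (simp add: V_def chi_cscale D_cscale)
qed

lemma chi_mono: "J \<subseteq> J' \<Longrightarrow> chi J v = v \<Longrightarrow> chi J' v = v"
proof (rule l2_eqI)
  fix x assume "J \<subseteq> J'" and v: "chi J v = v"
  then show "fun_of (chi J' v) x = fun_of v x"
    using fun_of_chi[of J v x] by (cases "x \<in> J") (auto simp: fun_of_chi)
qed

lemma V_mono: "J \<subseteq> J' \<Longrightarrow> V J \<subseteq> V J'" using chi_mono by (auto simp: V_def)

definition diag :: "'x set \<Rightarrow> 'x \<Rightarrow> real" where "diag J x = P J (del x 1) \<bullet> del x 1"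

lemma diag_norm: "(norm (P J (del x 1)))\<^sup>2 = diag J x"
  unfolding diag_def P_def by (rule positive_contraction.norm_proj_sq[OF pc])

lemma diag_nonneg: "0 \<le> diag J x" unfolding diag_norm[symmetric] by simp

lemma diag_lim: "(\<lambda>n. (T J ^^ n) (del x 1) \<bullet> del x 1) \<longlonglongrightarrow> diag J x"
  unfolding diag_def P_def by (rule positive_contraction.moment_lim[OF pc])

lemma moment_bounds: "0 \<le> (T J ^^ n) (del x 1) \<bullet> del x 1" "(T J ^^ n) (del x 1) \<bullet> del x 1 \<le> 1"
  using positive_contraction.moment_nonneg[OF pc, of n J "del x 1"] positive_contraction.moment_le[OF pc, of n J "del x 1"]
  by (simp_all add: power2_norm_eq_inner[symmetric] norm_del)

lemma diag_le_1: "diag J x \<le> 1"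
  by (rule LIMSEQ_le_const2[OF diag_lim]) (use moment_bounds in blast)

text \<open>The reproducing property of the projection: evaluation at \<open>x\<close> is the inner
  product with \<open>P J (del x 1)\<close>, whose squared norm is \<open>diag J x\<close>.\<close>

lemma diag_bound: assumes v: "v \<in> V J" shows "(cmod (fun_of v x))\<^sup>2 \<le> diag J x * (norm v)\<^sup>2"
proof (cases "fun_of v x = 0")
  case False
  \<comment> \<open>Multiplication by the conjugate value makes the coordinate at \<open>x\<close>
    real, so that the real inner product sees its full modulus.\<close>
  define w where "w = cscale (cnj (fun_of v x)) v"
  have w: "w \<in> V J" unfolding w_def by (rule V_cscale[OF v])
  have "(cmod (fun_of v x))\<^sup>2 = w \<bullet> del x 1"
    unfolding cmod_power2 by (simp add: w_def inner_del fun_of_cscale inner_complex_def power2_eq_square)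
  also have "\<dots> = w \<bullet> P J (del x 1)" using P_of_V[OF w] P_sym[of J w "del x 1"] by simp
  also have "\<dots> \<le> norm w * norm (P J (del x 1))" by (rule norm_cauchy_schwarz)
  also have "norm w = cmod (fun_of v x) * norm v" by (simp add: w_def norm_cscale)
  finally have "cmod (fun_of v x) \<le> norm v * norm (P J (del x 1))"
    using False by (simp add: power2_eq_square mult.assoc)
  then have "(cmod (fun_of v x))\<^sup>2 \<le> (norm v * norm (P J (del x 1)))\<^sup>2" by (intro power_mono) auto
  then show ?thesis by (simp add: power_mult_distrib diag_norm mult.commute)
qed (simp add: diag_nonneg)

lemma diag_attained: "P J (del x 1) \<in> V J" "(norm (P J (del x 1)))\<^sup>2 = diag J x" "diag J x \<le> cmod (fun_of (P J (del x 1)) x)"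
  using complex_Re_le_cmod[of "fun_of (P J (del x 1)) x"]
  by (auto simp: P_in_V diag_norm) (simp add: diag_def inner_del inner_complex_def)

text \<open>The converse of \<open>diag_attained\<close>. Together they describe
  \<open>diag J x\<close> as the largest \<open>c\<close> for which such a vector exists, without
  mention of the projection; monotonicity in \<open>J\<close> and invariance under the group follow
  by exhibiting a vector.\<close>

lemma diag_le_of:
  assumes "v \<in> V J" "(norm v)\<^sup>2 = c" "c \<le> cmod (fun_of v x)" "c \<ge> 0" shows "c \<le> diag J x"
proof (cases "c = 0")
  case False
  have "c * c \<le> (cmod (fun_of v x))\<^sup>2" using assms(3,4) by (simp add: power2_eq_square mult_mono)
  also have "\<dots> \<le> diag J x * c" using diag_bound[OF assms(1)] assms(2) by simp
  finally show ?thesis using False assms(4) by simp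
qed (simp add: diag_nonneg)

lemma diag_mono: "J \<subseteq> J' \<Longrightarrow> diag J x \<le> diag J' x"
  using diag_attained[of J x] V_mono[of J J'] diag_nonneg
  by (intro diag_le_of[of "P J (del x 1)" J' "diag J x"]) blast+

lemma P_P: assumes "J \<subseteq> J'" shows "P J' (P J v) = P J v" "P J (P J' v) = P J v"
proof -
  show 1: "P J' (P J v) = P J v" for v using P_of_V P_in_V V_mono[OF assms] by blast
  have "(P J (P J' v) - P J v) \<bullet> w = 0" for w
    using P_sym[of J "P J' v" w] P_sym[of J' v "P J w"] P_sym[of J v w] 1[of w] by (simp add: inner_diff_left)
  then have "P J (P J' v) - P J v = 0" using inner_eq_zero_iff by blast
  then show "P J (P J' v) = P J v" by simp
qed

definition Q :: "'x set \<Rightarrow> 'x set \<Rightarrow> 'x l2 \<Rightarrow> 'x l2" where "Q J J' v = P J' v - P J v"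

lemma Q_facts:
  assumes J: "J \<subseteq> J'"
  shows "linear (Q J J')" "Q J J' v \<bullet> w = v \<bullet> Q J J' w" "Q J J' (Q J J' v) = Q J J' v"
    "Q J J' (cscale c v) = cscale c (Q J J' v)" "Q J J' (del x 1) \<bullet> del x 1 = diag J' x - diag J x"
proof -
  show "linear (Q J J')" unfolding Q_def by (intro linear_compose_sub linear_P)
  show "Q J J' v \<bullet> w = v \<bullet> Q J J' w" by (simp add: Q_def inner_diff_left inner_diff_right P_sym)
  have PP: "P K (P K v) = P K v" for K v by (rule P_of_V[OF P_in_V])
  show "Q J J' (Q J J' v) = Q J J' v" by (simp add: Q_def linear_diff[OF linear_P] P_P[OF J] PP)
  show "Q J J' (cscale c v) = cscale c (Q J J' v)"
    by (simp add: Q_def P_cscale linear_diff[OF bounded_linear.linear[OF bounded_linear_cscale]])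
  show "Q J J' (del x 1) \<bullet> del x 1 = diag J' x - diag J x" by (simp add: Q_def inner_diff_left diag_def)
qed

lemma norm_Q_del: assumes "J \<subseteq> J'" shows "(norm (Q J J' (del x z)))\<^sup>2 = (cmod z)\<^sup>2 * (diag J' x - diag J x)"
proof -
  have "del x z = cscale z (del x 1)" by (rule l2_eqI) (simp add: fun_of_del fun_of_cscale)
  then have "norm (Q J J' (del x z)) = cmod z * norm (Q J J' (del x 1))" by (simp add: Q_facts(4)[OF assms] norm_cscale)
  moreover have "(norm (Q J J' (del x 1)))\<^sup>2 = diag J' x - diag J x"
    using Q_facts(2)[OF assms, of "del x 1" "Q J J' (del x 1)"] Q_facts(3,5)[OF assms]
    by (simp add: power2_norm_eq_inner inner_commute)
  ultimately show ?thesis by (simp add: power_mult_distrib)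
qed

text \<open>Approximate \<open>v\<close> by a finite combination \<open>w\<close> of point masses
  and project \<open>w\<close> onto \<open>V (J n)\<close>. The error is \<open>P A (v - w)\<close>,
  which is small, plus \<open>Q (J n) A w\<close>; on each point mass the squared norm of the latter
  is a multiple of the gap between the diagonals, which tends to 0.\<close>

lemma approximation:
  assumes J: "\<And>n. J n \<subseteq> A" and lim: "\<And>x. x \<in> A \<Longrightarrow> (\<lambda>n. diag (J n) x) \<longlonglongrightarrow> diag A x"
    and v: "v \<in> V A" and e: "e > 0"
  shows "\<exists>n w. w \<in> V (J n) \<and> norm (v - w) < e"
proof -
  obtain F where F: "finite F" "F \<subseteq> {x. fun_of v x \<noteq> 0}" "norm (v - (\<Sum>x\<in>F. del x (fun_of v x))) < e / 2"
    by (rule l2_approx[of "e / 2" v]) (use e in auto)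
  have FA: "F \<subseteq> A"
  proof
    fix x assume "x \<in> F"
    then have "fun_of v x \<noteq> 0" using F(2) by auto
    moreover have "fun_of v x = (if x \<in> A then fun_of v x else 0)" using v fun_of_chi[of A v x] by (simp add: V_def)
    ultimately show "x \<in> A" by presburger
  qed
  define w where "w = (\<Sum>x\<in>F. del x (fun_of v x))"
  have Qw: "norm (Q (J n) A w) \<le> (\<Sum>x\<in>F. cmod (fun_of v x) * sqrt (diag A x - diag (J n) x))" for n
  proof -
    have "norm (Q (J n) A w) \<le> (\<Sum>x\<in>F. norm (Q (J n) A (del x (fun_of v x))))"
      unfolding w_def linear_sum[OF Q_facts(1)[OF J]] by (rule norm_sum)
    also have "\<dots> = (\<Sum>x\<in>F. cmod (fun_of v x) * sqrt (diag A x - diag (J n) x))"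
    proof (rule sum.cong)
      fix x
      have "norm (Q (J n) A (del x (fun_of v x))) = sqrt ((cmod (fun_of v x))\<^sup>2 * (diag A x - diag (J n) x))"
        unfolding norm_Q_del[OF J, symmetric] by simp
      then show "norm (Q (J n) A (del x (fun_of v x))) = cmod (fun_of v x) * sqrt (diag A x - diag (J n) x)"
        by (simp add: real_sqrt_mult)
    qed simp
    finally show ?thesis .
  qed
  have "(\<lambda>n. \<Sum>x\<in>F. cmod (fun_of v x) * sqrt (diag A x - diag (J n) x)) \<longlonglongrightarrow> (\<Sum>x\<in>F. cmod (fun_of v x) * sqrt (diag A x - diag A x))"
    using FA by (intro tendsto_intros lim) auto
  then have "(\<lambda>n. \<Sum>x\<in>F. cmod (fun_of v x) * sqrt (diag A x - diag (J n) x)) \<longlonglongrightarrow> 0" by simp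
  from order_tendstoD(2)[OF this, of "e / 2"] obtain n where n: "(\<Sum>x\<in>F. cmod (fun_of v x) * sqrt (diag A x - diag (J n) x)) < e / 2"
    using e by (auto simp: eventually_sequentially)
  have "v - P (J n) w = P A (v - w) + Q (J n) A w"
    using P_of_V[OF v] by (simp add: Q_def linear_diff[OF linear_P])
  then have "norm (v - P (J n) w) \<le> norm (v - w) + norm (Q (J n) A w)"
    using norm_triangle_ineq[of "P A (v - w)" "Q (J n) A w"] norm_P_le[of A "v - w"] by simp
  also have "\<dots> < e" using F(3) Qw[of n] n by (simp add: w_def)
  finally show ?thesis using P_in_V by blast
qed

text \<open>A row \<open>x\<close> within \<open>R\<close> of some point of
  \<open>A \<inter> \<Lambda>\<close> couples only to points less than \<open>2 * R\<close> away
  from that point; those outside \<open>\<Lambda>\<close> carry the value 0, so truncation leaves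
  the row unchanged. Any other row sees no point of \<open>\<Lambda>\<close>, and the truncated
  vector contributes nothing to it.\<close>

lemma restrict_solution:
  assumes v: "v \<in> V A" and bd: "\<And>y x. y \<in> A \<Longrightarrow> y \<notin> \<Lambda> \<Longrightarrow> x \<in> A \<Longrightarrow> x \<in> \<Lambda> \<Longrightarrow> dist y x < 2 * R \<Longrightarrow> fun_of v y = 0"
  shows "chi \<Lambda> v \<in> V (A \<inter> \<Lambda>)"
proof -
  have vA: "fun_of v x = 0" if "x \<notin> A" for x using v that fun_of_chi[of A v x] by (auto simp: V_def)
  have Hv: "fun_of (H v) x = complex_of_real E * fun_of v x" for x
  proof -
    have "fun_of (D v) x = 0" using v by (simp add: V_def l2_fun_simps)
    then show ?thesis by (simp add: D_def l2_fun_simps)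
  qed
  have near: "dist x y < R" if "x \<in> A" "y \<in> A" "h x y \<noteq> 0" for x y
    using range[OF that(1,2)] that(3) by (auto simp: not_le[symmetric])
  have Rpos: "R > 0" if "x \<in> A" "y \<in> A" "h x y \<noteq> 0" for x y
    using near[OF that] zero_le_dist[of x y] by linarith
  have "fun_of (H (chi \<Lambda> v)) x = complex_of_real E * fun_of (chi \<Lambda> v) x" for x
  proof (cases "x \<in> A")
    case False then show ?thesis using vA by (simp add: H_off fun_of_chi)
  next
    case xA: True
    have Hx: "fun_of (H (chi \<Lambda> v)) x = (\<Sum>y\<in>A \<inter> cball x R. h x y * fun_of (chi \<Lambda> v) y)"
      using xA by (simp add: fun_of_H mat_app_sum)
    have Hx': "fun_of (H v) x = (\<Sum>y\<in>A \<inter> cball x R. h x y * fun_of v y)"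
      using xA by (simp add: fun_of_H mat_app_sum)
    show ?thesis
    proof (cases "\<exists>x'\<in>A \<inter> \<Lambda>. dist x x' < R")
      case True
      then obtain x' where x': "x' \<in> A" "x' \<in> \<Lambda>" "dist x x' < R" by auto
      have "h x y * fun_of (chi \<Lambda> v) y = h x y * fun_of v y" if y: "y \<in> A" for y
      proof (cases "y \<in> \<Lambda> \<or> h x y = 0")
        case False
        have "dist y x' \<le> dist x y + dist x x'" by (metis dist_commute dist_triangle)
        then have "dist y x' < 2 * R" using near[OF xA y] False x'(3) by simp
        then have "fun_of v y = 0" using bd[OF y _ x'(1,2)] False by simp
        then show ?thesis by (simp add: fun_of_chi)
      qed (auto simp: fun_of_chi)
      then have "fun_of (H (chi \<Lambda> v)) x = fun_of (H v) x" unfolding Hx Hx' by (intro sum.cong) auto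
      moreover have "fun_of (chi \<Lambda> v) x = fun_of v x"
      proof (cases "x \<in> \<Lambda>")
        case False
        have "dist x x' < 2 * R" using x'(3) zero_le_dist[of x x'] by linarith
        then show ?thesis using bd[OF xA False x'(1,2)] by (simp add: fun_of_chi)
      qed (simp add: fun_of_chi)
      ultimately show ?thesis using Hv[of x] by simp
    next
      case False
      have "h x y * fun_of (chi \<Lambda> v) y = 0" if "y \<in> A" for y
        using False near[OF xA that] that by (auto simp: fun_of_chi)
      then have H0: "fun_of (H (chi \<Lambda> v)) x = 0" unfolding Hx by (intro sum.neutral) auto
      show ?thesis
      proof (cases "x \<in> \<Lambda>")
        case True
        \<comment> \<open>A point of \<open>\<Lambda>\<close> that is not within \<open>R\<close> of
          itself: the hopping range is nonpositive, all entries in this row vanish, and the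
          eigenvalue equation itself gives the claim.\<close>
        then have "R \<le> 0" using False xA by (metis IntI dist_self not_le)
        then have "fun_of (H v) x = 0" unfolding Hx' using Rpos[OF xA] by (intro sum.neutral) force
        then show ?thesis using H0 Hv[of x] True by (simp add: fun_of_chi)
      qed (simp add: H0 fun_of_chi)
    qed
  qed
  then have "D (chi \<Lambda> v) = 0" by (intro l2_eqI) (simp add: D_def l2_fun_simps)
  moreover have "chi (A \<inter> \<Lambda>) (chi \<Lambda> v) = chi \<Lambda> v" by (rule l2_eqI) (use vA in \<open>auto simp: fun_of_chi\<close>)
  ultimately show ?thesis by (simp add: V_def)
qed

text \<open>\<open>trace_le_card\<close> with the conditions that \<open>v\<close> vanish on
  \<open>B\<close>. A vector in the range of \<open>Q\<close> that satisfies them restricts to a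
  solution supported in \<open>A \<inter> \<Lambda>\<close>; it is orthogonal to all of these, so
  the restriction is zero. The factor 2 counts real and imaginary part at each point of
  \<open>B\<close>.\<close>

lemma trace_bound:
  assumes \<Lambda>: "finite (A \<inter> \<Lambda>)" and B: "finite B"
    "\<And>y x. y \<in> A \<Longrightarrow> y \<notin> \<Lambda> \<Longrightarrow> x \<in> A \<Longrightarrow> x \<in> \<Lambda> \<Longrightarrow> dist y x < 2 * R \<Longrightarrow> y \<in> B"
  shows "(\<Sum>x\<in>A \<inter> \<Lambda>. diag A x - diag (A \<inter> \<Lambda>) x) \<le> 2 * real (card B)"
proof -
  let ?J = "A \<inter> \<Lambda>"
  let ?b = "(\<lambda>y. del y 1) ` B \<union> (\<lambda>y. del y \<i>) ` B"
  have J: "?J \<subseteq> A" by simp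
  have inj: "inj_on (\<lambda>x. del x (1::complex)) ?J"
  proof (rule inj_onI)
    fix x y :: 'x assume "del x (1::complex) = del y 1"
    then have "fun_of (del x 1) x = fun_of (del y 1) x" by simp
    then show "x = y" by (simp add: fun_of_del split: if_splits)
  qed
  have "(\<Sum>x\<in>?J. diag A x - diag ?J x) = (\<Sum>x\<in>?J. Q ?J A (del x 1) \<bullet> del x 1)"
    by (simp add: Q_facts(5)[OF J])
  also have "\<dots> = (\<Sum>e\<in>(\<lambda>x. del x 1) ` ?J. Q ?J A e \<bullet> e)" using inj by (simp add: sum.reindex)
  also have "\<dots> \<le> real (card ?b)"
  proof (rule trace_le_card)
    show "finite ?b" using B(1) by simp
    show "finite ((\<lambda>x. del x (1::complex)) ` ?J)" using \<Lambda> by simp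
    show "e \<bullet> e = 1" if "e \<in> (\<lambda>x. del x 1) ` ?J" for e using that by (auto simp: inner_del fun_of_del)
    show "e \<bullet> f = 0" if "e \<in> (\<lambda>x. del x 1) ` ?J" "f \<in> (\<lambda>x. del x 1) ` ?J" "e \<noteq> f" for e f
      using that by (auto simp: inner_del fun_of_del)
    show "linear (Q ?J A)" "\<And>v w. Q ?J A v \<bullet> w = v \<bullet> Q ?J A w" "\<And>v. Q ?J A (Q ?J A v) = Q ?J A v"
      by (rule Q_facts[OF J])+
    fix v e assume v: "Q ?J A v = v" and perp: "\<And>b. b \<in> ?b \<Longrightarrow> v \<bullet> b = 0" and e: "e \<in> (\<lambda>x. del x 1) ` ?J"
    have PA: "P A v = v"
    proof -
      have "P A (Q ?J A v) = Q ?J A v" by (simp add: Q_def linear_diff[OF linear_P] P_P[OF J] P_of_V[OF P_in_V])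
      then show ?thesis by (simp add: v)
    qed
    have PJ: "P ?J v = 0" using v PA by (simp add: Q_def)
    have vV: "v \<in> V A" using P_in_V[of A v] PA by simp
    have "fun_of v y = 0" if "y \<in> B" for y
      using perp[of "del y 1"] perp[of "del y \<i>"] that by (simp add: inner_del inner_complex_def complex_eq_iff)
    then have cV: "chi \<Lambda> v \<in> V ?J" using B(2) by (intro restrict_solution[OF vV]) blast
    have "chi \<Lambda> v \<bullet> chi \<Lambda> v = chi \<Lambda> v \<bullet> v" using chi_sym[of \<Lambda> "chi \<Lambda> v" v] by (simp add: chi_chi)
    also have "\<dots> = P ?J (chi \<Lambda> v) \<bullet> v" using P_of_V[OF cV] by simp
    also have "\<dots> = 0" using P_sym[of ?J "chi \<Lambda> v" v] PJ by simp
    finally have "chi \<Lambda> v = 0" by simp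
    moreover obtain x where x: "x \<in> \<Lambda>" "e = del x 1" using e by auto
    ultimately have "fun_of v x = 0" using fun_of_chi[of \<Lambda> v x] by (simp add: l2_fun_simps)
    then show "v \<bullet> e = 0" by (simp add: x inner_del)
  qed
  also have "real (card ?b) \<le> 2 * real (card B)"
    using card_Un_le[of "(\<lambda>y. del y (1::complex)) ` B" "(\<lambda>y. del y \<i>) ` B"]
      card_image_le[OF B(1), of "\<lambda>y. del y (1::complex)"] card_image_le[OF B(1), of "\<lambda>y. del y \<i>"] by simp
  finally show ?thesis .
qed

section \<open>Functional calculus of the matrix\<close>

abbreviation Hm :: "('x \<Rightarrow> complex) \<Rightarrow> 'x \<Rightarrow> complex" where "Hm \<equiv> mat_app A h"

lemma norm_H_onorm: "norm (H v) \<le> ell2_onorm A Hm * norm v" and onorm_le: "ell2_onorm A Hm \<le> C"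
  and onorm_nonneg: "0 \<le> ell2_onorm A Hm"
proof -
  let ?B = "{v \<in> ell2 A. ell2_norm A v \<le> 1}"
  have le: "ell2_norm A (Hm v) \<le> C" if "v \<in> ?B" for v
  proof -
    have "ell2_norm A (Hm v) \<le> C * ell2_norm A v" using that bounded by auto
    also have "\<dots> \<le> C * 1" using that C0 by (intro mult_left_mono) auto
    finally show ?thesis by simp
  qed
  have bdd: "bdd_above ((\<lambda>v. ell2_norm A (Hm v)) ` ?B)" using le by (intro bdd_aboveI2)
  have zero: "(\<lambda>_. 0) \<in> ?B" by (simp add: ell2_def ell2_norm_def)
  show "ell2_onorm A Hm \<le> C" unfolding ell2_onorm_def using zero le by (intro cSUP_least) blast+
  have "0 \<le> ell2_norm A (Hm (\<lambda>_. 0))" by (simp add: ell2_norm_def infsum_nonneg)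
  also have "\<dots> \<le> ell2_onorm A Hm" unfolding ell2_onorm_def by (rule cSUP_upper[OF zero bdd])
  finally show nn: "0 \<le> ell2_onorm A Hm" .
  show "norm (H v) \<le> ell2_onorm A Hm * norm v"
  proof (cases "chi A v = 0")
    case True
    have "H v = H (chi A v)" by (simp add: H_chi)
    also have "\<dots> = 0" unfolding True by (rule linear_0[OF bounded_linear.linear[OF bounded_linear_H]])
    finally show ?thesis using nn by simp
  next
    case False
    define w where "w = (1 / norm (chi A v)) *\<^sub>R chi A v"
    have w0: "fun_of w x = 0" if "x \<notin> A" for x using that by (simp add: w_def l2_fun_simps fun_of_chi)
    have "norm w = 1" using False by (simp add: w_def)
    then have "fun_of w \<in> ?B" using w0 ell2_norm_fun_of[of A w] fun_of_ell2[of w] by simp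
    then have "ell2_norm A (Hm (fun_of w)) \<le> ell2_onorm A Hm" unfolding ell2_onorm_def by (rule cSUP_upper[OF _ bdd])
    moreover have "ell2_norm A (Hm (fun_of w)) = norm (H w)"
      using ell2_norm_fun_of[of A "H w"] H_off by (simp add: fun_of_H)
    moreover have "H w = (1 / norm (chi A v)) *\<^sub>R H v"
      by (simp add: w_def linear_scale[OF bounded_linear.linear[OF bounded_linear_H]] H_chi)
    ultimately have "norm (H v) \<le> ell2_onorm A Hm * norm (chi A v)" using False by (simp add: field_simps)
    also have "\<dots> \<le> ell2_onorm A Hm * norm v" by (intro mult_left_mono norm_chi_le nn)
    finally show ?thesis .
  qed
qed

lemma linear_H: "linear H" by (rule bounded_linear.linear[OF bounded_linear_H])

lemma Hm_pow: "v \<in> ell2 A \<Longrightarrow> (Hm ^^ n) v = fun_of ((H ^^ n) (l2_of v))"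
  by (induction n) (auto simp: fun_of_H fun_of_l2_of ell2_iff)

lemma H_pow_off: "(\<And>x. x \<notin> A \<Longrightarrow> fun_of v x = 0) \<Longrightarrow> x \<notin> A \<Longrightarrow> fun_of ((H ^^ n) v) x = 0"
  by (cases n) (auto simp: H_off)

lemma fun_of_sum: "fun_of (\<Sum>i\<in>I. f i) x = (\<Sum>i\<in>I. fun_of (f i) x)"
  by (induction I rule: infinite_finite_induct) (auto simp: l2_fun_simps)

lemma fun_of_rpoly_op: "fun_of (rpoly_op p H v) x = (\<Sum>i\<le>degree p. complex_of_real (coeff p i) * fun_of ((H ^^ i) v) x)"
  by (simp add: rpoly_op_def fun_of_sum l2_fun_simps)

lemma rpoly_op_off: "(\<And>x. x \<notin> A \<Longrightarrow> fun_of v x = 0) \<Longrightarrow> x \<notin> A \<Longrightarrow> fun_of (rpoly_op p H v) x = 0"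
  by (simp add: fun_of_rpoly_op H_pow_off)

text \<open>The calculus \<open>rpoly_op\<close> is real, so a complex polynomial is split into its
  real and imaginary coefficient polynomials.\<close>

lemma poly_op_eq:
  assumes v: "v \<in> ell2 A"
  shows "poly_op p Hm v = fun_of (rpoly_op (map_poly Re p) H (l2_of v) + cscale \<i> (rpoly_op (map_poly Im p) H (l2_of v)))"
proof
  fix x
  have c: "coeff (map_poly Re p) i = Re (coeff p i)" "coeff (map_poly Im p) i = Im (coeff p i)" for i
    by (simp_all add: coeff_map_poly)
  have d: "degree (map_poly Re p) \<le> degree p" "degree (map_poly Im p) \<le> degree p"
    by (rule degree_le, simp add: c coeff_eq_0)+
  have "fun_of (rpoly_op q H (l2_of v)) x = (\<Sum>i\<le>degree p. complex_of_real (coeff q i) * fun_of ((H ^^ i) (l2_of v)) x)"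
    if "degree q \<le> degree p" for q
    by (simp add: rpoly_op_ge[OF that] fun_of_sum l2_fun_simps)
  note e = this[OF d(1)] this[OF d(2)]
  have "poly_op p Hm v x = (\<Sum>i\<le>degree p. (complex_of_real (Re (coeff p i)) + \<i> * complex_of_real (Im (coeff p i))) * fun_of ((H ^^ i) (l2_of v)) x)"
    unfolding poly_op_def by (simp add: Hm_pow[OF v] complex_eq[symmetric])
  also have "\<dots> = fun_of (rpoly_op (map_poly Re p) H (l2_of v) + cscale \<i> (rpoly_op (map_poly Im p) H (l2_of v))) x"
    unfolding l2_fun_simps fun_of_cscale e c by (simp add: distrib_right sum.distrib sum_distrib_left mult.assoc)
  finally show "poly_op p Hm v x = fun_of (rpoly_op (map_poly Re p) H (l2_of v) + cscale \<i> (rpoly_op (map_poly Im p) H (l2_of v))) x" .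
qed

text \<open>For approximating \<open>p n\<close> the real part minus \<open>q\<close> and the
  imaginary part are uniformly small on the interval, and \<open>norm_rpoly_op_le\<close> converts
  this into norm convergence to \<open>q(H) v\<close>. So \<open>q(H) v\<close> meets the defining
  condition.\<close>

lemma functional_calculus_eq:
  assumes v: "v \<in> ell2 A"
    and q: "\<And>t. t \<in> {- ell2_onorm A Hm .. ell2_onorm A Hm} \<Longrightarrow> \<phi> t = complex_of_real (poly q t)"
  shows "functional_calculus A Hm \<phi> v = fun_of (rpoly_op q H (l2_of v))"
proof -
  let ?a = "ell2_onorm A Hm" and ?V = "l2_of v"
  have V0: "fun_of ?V x = 0" if "x \<notin> A" for x using v that by (simp add: ell2_iff fun_of_l2_of)
  define w0 where "w0 = rpoly_op q H ?V"
  have w0: "fun_of w0 x = 0" if "x \<notin> A" for x unfolding w0_def by (rule rpoly_op_off[OF V0 that])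
  let ?P = "\<lambda>w. w \<in> ell2 A \<and> (\<forall>p :: nat \<Rightarrow> complex poly.
        uniform_limit {- ?a .. ?a} (\<lambda>n t. poly (p n) (complex_of_real t)) \<phi> sequentially
        \<longrightarrow> (\<lambda>n. ell2_norm A (\<lambda>x. poly_op (p n) Hm v x - w x)) \<longlonglongrightarrow> 0)"
  have P: "?P (fun_of w0)"
  proof (intro conjI allI impI)
    show "fun_of w0 \<in> ell2 A" by (rule fun_of_ell2[OF w0])
    fix p :: "nat \<Rightarrow> complex poly"
    assume ul: "uniform_limit {- ?a .. ?a} (\<lambda>n t. poly (p n) (complex_of_real t)) \<phi> sequentially"
    define re im where "re n = map_poly Re (p n) - q" and "im n = map_poly Im (p n)" for n
    have eq: "(\<lambda>x. poly_op (p n) Hm v x - fun_of w0 x) = fun_of (rpoly_op (re n) H ?V + cscale \<i> (rpoly_op (im n) H ?V))" for n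
    proof
      fix x
      have "rpoly_op (re n + q) H ?V = rpoly_op (re n) H ?V + w0" unfolding w0_def by (rule rpoly_op_add[OF linear_H])
      then have "rpoly_op (map_poly Re (p n)) H ?V = rpoly_op (re n) H ?V + w0" by (simp add: re_def)
      then show "poly_op (p n) Hm v x - fun_of w0 x = fun_of (rpoly_op (re n) H ?V + cscale \<i> (rpoly_op (im n) H ?V)) x"
        by (simp add: poly_op_eq[OF v] im_def l2_fun_simps)
    qed
    show "(\<lambda>n. ell2_norm A (\<lambda>x. poly_op (p n) Hm v x - fun_of w0 x)) \<longlonglongrightarrow> 0"
      unfolding eq
    proof (rule LIMSEQ_I)
      fix e :: real assume e: "e > 0"
      define d where "d = e / (2 * norm ?V + 1)"
      have d: "d > 0" using e by (simp add: d_def add_nonneg_pos)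
      from uniform_limitD[OF ul d] obtain N where N: "\<And>n t. n \<ge> N \<Longrightarrow> t \<in> {- ?a .. ?a} \<Longrightarrow> dist (poly (p n) (complex_of_real t)) (\<phi> t) < d"
        unfolding eventually_sequentially by blast
      have "norm (ell2_norm A (fun_of (rpoly_op (re n) H ?V + cscale \<i> (rpoly_op (im n) H ?V))) - 0) < e" if n: "n \<ge> N" for n
      proof -
        have cm: "cmod (poly (p n) (complex_of_real t) - complex_of_real (poly q t)) \<le> d" if "t \<in> {- ?a .. ?a}" for t
          using N[OF n that] q[OF that] by (simp add: dist_norm)
        have "\<bar>poly (re n) t\<bar> \<le> d" if "t \<in> {- ?a .. ?a}" for t
          using cm[OF that] abs_Re_le_cmod[of "poly (p n) (complex_of_real t) - complex_of_real (poly q t)"]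
          by (simp add: re_def poly_map_Re)
        then have r: "norm (rpoly_op (re n) H ?V) \<le> d * norm ?V"
          by (rule norm_rpoly_op_le[OF linear_H H_sym norm_H_onorm onorm_nonneg])
        have "\<bar>poly (im n) t\<bar> \<le> d" if "t \<in> {- ?a .. ?a}" for t
          using cm[OF that] abs_Im_le_cmod[of "poly (p n) (complex_of_real t) - complex_of_real (poly q t)"]
          by (simp add: im_def poly_map_Im)
        then have i: "norm (rpoly_op (im n) H ?V) \<le> d * norm ?V"
          by (rule norm_rpoly_op_le[OF linear_H H_sym norm_H_onorm onorm_nonneg])
        have "ell2_norm A (fun_of (rpoly_op (re n) H ?V + cscale \<i> (rpoly_op (im n) H ?V)))
            = norm (rpoly_op (re n) H ?V + cscale \<i> (rpoly_op (im n) H ?V))"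
          by (rule ell2_norm_fun_of) (simp add: l2_fun_simps fun_of_cscale rpoly_op_off[OF V0])
        also have "\<dots> \<le> d * norm ?V + d * norm ?V"
          using norm_triangle_ineq[of "rpoly_op (re n) H ?V" "cscale \<i> (rpoly_op (im n) H ?V)"] r i by (simp add: norm_cscale)
        also have "\<dots> < d * (2 * norm ?V + 1)" using d by (simp add: algebra_simps)
        also have "\<dots> = e"
        proof -
          have "2 * norm ?V + 1 \<noteq> 0" using norm_ge_zero[of ?V] by linarith
          then show ?thesis by (simp add: d_def)
        qed
        finally show ?thesis by (simp add: ell2_norm_def infsum_nonneg)
      qed
      then show "\<exists>N. \<forall>n\<ge>N. norm (ell2_norm A (fun_of (rpoly_op (re n) H ?V + cscale \<i> (rpoly_op (im n) H ?V))) - 0) < e" by blast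
    qed
  qed
  have "functional_calculus A Hm \<phi> v = fun_of w0"
    unfolding functional_calculus_def
  proof (rule the_equality[of ?P, OF P])
    fix w assume w: "?P w"
    \<comment> \<open>Uniqueness: the constant sequence \<open>q\<close> is itself admissible, so
      any other limit has distance zero from \<open>w0\<close>.\<close>
    define p where "p = (\<lambda>n::nat. map_poly complex_of_real q)"
    have ul: "uniform_limit {- ?a .. ?a} (\<lambda>n t. poly (p n) (complex_of_real t)) \<phi> sequentially"
      by (rule uniform_limitI) (simp add: p_def poly_map_of_real q)
    have Re: "map_poly Re (p n) = q" "map_poly Im (p n) = 0" for n
      unfolding p_def by (rule poly_eqI, simp add: coeff_map_poly)+
    have pv: "poly_op (p n) Hm v = fun_of w0" for n
      unfolding poly_op_eq[OF v] Re w0_def by (rule ext) (simp add: l2_fun_simps fun_of_cscale rpoly_op_0)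
    have "(\<lambda>n. ell2_norm A (\<lambda>x. fun_of w0 x - w x)) \<longlonglongrightarrow> 0"
      using conjunct2[OF w, rule_format, of p, OF ul] unfolding pv .
    then have n0: "ell2_norm A (\<lambda>x. fun_of w0 x - w x) = 0" by (simp add: LIMSEQ_const_iff)
    have wA: "w \<in> ell2 A" using w by blast
    then have sw: "sq_summable w" by (simp add: ell2_iff)
    have fe: "(\<lambda>x. fun_of w0 x - w x) = fun_of (w0 - l2_of w)" by (rule ext) (simp add: l2_fun_simps fun_of_l2_of[OF sw])
    have "ell2_norm A (fun_of (w0 - l2_of w)) = norm (w0 - l2_of w)"
      by (rule ell2_norm_fun_of) (use w0 wA in \<open>auto simp: l2_fun_simps fun_of_l2_of[OF sw] ell2_iff\<close>)
    then have "w0 - l2_of w = 0" using n0 fe by simp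
    then show "w = fun_of w0" by (simp add: fun_of_l2_of[OF sw])
  qed
  then show ?thesis by (simp add: w0_def)
qed

definition qpoly :: "real poly" where "qpoly = 1 - smult (1 / S\<^sup>2) ([:-E, 1:] * [:-E, 1:])"

lemma poly_qpoly: "poly qpoly t = 1 - ((t - E) / S)\<^sup>2"
  by (simp add: qpoly_def power2_eq_square algebra_simps add_divide_distrib diff_divide_distrib)

lemma T_qpoly: assumes v: "chi A v = v" shows "T A v = rpoly_op qpoly H v" and "chi A (T A v) = T A v"
proof -
  have D: "rpoly_op [:-E, 1:] H w = D w" for w
    by (simp add: rpoly_op_pCons[OF linear_H] rpoly_op_0 linear_0[OF linear_H] D_def)
  have "rpoly_op (1 + smult (- (1 / S\<^sup>2)) ([:-E, 1:] * [:-E, 1:])) H v = rpoly_op 1 H v + (- (1 / S\<^sup>2)) *\<^sub>R D (D v)"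
    unfolding rpoly_op_add[OF linear_H] rpoly_op_smult rpoly_op_mult[OF linear_H] D ..
  moreover have "rpoly_op 1 H v = v" by (simp add: rpoly_op_def)
  moreover have "qpoly = 1 + smult (- (1 / S\<^sup>2)) ([:-E, 1:] * [:-E, 1:])" unfolding qpoly_def by simp
  ultimately have "rpoly_op qpoly H v = v - (1 / S\<^sup>2) *\<^sub>R D (D v)" by simp
  moreover have "chi A (D (D v)) = D (D v)"
  proof (rule l2_eqI)
    have v0: "fun_of v x = 0" if "x \<notin> A" for x using v that fun_of_chi[of A v x] by simp
    show "fun_of (chi A (D (D v))) x = fun_of (D (D v)) x" for x
      using v0[of x] by (cases "x \<in> A") (simp_all add: fun_of_chi D_def l2_fun_simps H_off)
  qed
  ultimately show "T A v = rpoly_op qpoly H v" by (simp add: T_def v)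
  show "chi A (T A v) = T A v"
    unfolding T_def by (simp add: linear_diff[OF bounded_linear.linear[OF bounded_linear_chi]] linear_scale[OF bounded_linear.linear[OF bounded_linear_chi]] chi_chi)
qed

lemma T_pow_qpoly: assumes v: "chi A v = v" shows "(T A ^^ k) v = rpoly_op (qpoly ^ k) H v" "chi A ((T A ^^ k) v) = (T A ^^ k) v"
proof -
  have "chi A ((T A ^^ k) v) = (T A ^^ k) v \<and> (T A ^^ k) v = rpoly_op (qpoly ^ k) H v"
  proof (induction k)
    case 0
    have "rpoly_op 1 H v = v" by (simp add: rpoly_op_def)
    then show ?case using v by simp
  next
    case (Suc k)
    then have c: "chi A ((T A ^^ k) v) = (T A ^^ k) v" and IH: "(T A ^^ k) v = rpoly_op (qpoly ^ k) H v" by auto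
    have "T A ((T A ^^ k) v) = rpoly_op (qpoly * qpoly ^ k) H v"
      unfolding rpoly_op_mult[OF linear_H] T_qpoly(1)[OF c] unfolding IH ..
    then show ?case using T_qpoly(2)[OF c] by simp
  qed
  then show "(T A ^^ k) v = rpoly_op (qpoly ^ k) H v" "chi A ((T A ^^ k) v) = (T A ^^ k) v" by auto
qed

lemma T_pow_cscale: "(T J ^^ k) (cscale c v) = cscale c ((T J ^^ k) v)"
  by (induction k) (auto simp: T_cscale)

text \<open>Symmetry together with compatibility with multiplication by \<open>\<i>\<close>: the
  inner product with \<open>del x \<i>\<close> is the imaginary part and, moved to the other side,
  its own negative.\<close>

lemma T_pow_diag_real: "fun_of ((T J ^^ k) (del x 1)) x = complex_of_real ((T J ^^ k) (del x 1) \<bullet> del x 1)"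
proof (rule complex_eqI)
  let ?f = "fun_of ((T J ^^ k) (del x 1)) x"
  show "Re ?f = Re (complex_of_real ((T J ^^ k) (del x 1) \<bullet> del x 1))" by (simp add: inner_del inner_complex_def)
  have ci: "cscale \<i> (del x 1) = del x \<i>" by (rule l2_eqI) (simp add: fun_of_cscale fun_of_del)
  have "(T J ^^ k) (del x 1) \<bullet> del x \<i> = del x 1 \<bullet> (T J ^^ k) (del x \<i>)"
    by (rule positive_contraction.pow_sym[OF pc])
  also have "(T J ^^ k) (del x \<i>) = cscale \<i> ((T J ^^ k) (del x 1))" unfolding ci[symmetric] by (rule T_pow_cscale)
  also have "del x 1 \<bullet> cscale \<i> ((T J ^^ k) (del x 1)) = - Im ?f"
    by (subst inner_commute) (simp add: inner_del fun_of_cscale inner_complex_def)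
  finally show "Im ?f = Im (complex_of_real ((T J ^^ k) (del x 1) \<bullet> del x 1))" by (simp add: inner_del inner_complex_def)
qed

text \<open>The powers of \<open>T A\<close> are the powers of \<open>qpoly(H)\<close> on functions
  supported in \<open>A\<close>. Agreement for \<open>\<bar>t\<bar> \<le> C\<close> is enough
  because \<open>C\<close> bounds the operator norm.\<close>

lemma functional_calculus_del:
  assumes \<phi>: "\<And>t. \<bar>t\<bar> \<le> C \<Longrightarrow> \<phi> t = complex_of_real ((1 - ((t - E) / S)\<^sup>2) ^ k)" and x: "x \<in> A"
  shows "functional_calculus A Hm \<phi> (\<lambda>y. if y = x then 1 else 0) x = complex_of_real ((T A ^^ k) (del x 1) \<bullet> del x 1)"
proof -
  have f: "(\<lambda>y. if y = x then 1 else 0) = fun_of (del x 1)" by (rule ext) (simp add: fun_of_del)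
  have dA: "chi A (del x 1) = del x 1" by (rule l2_eqI) (use x in \<open>simp add: fun_of_chi fun_of_del\<close>)
  have "functional_calculus A Hm \<phi> (fun_of (del x 1)) = fun_of (rpoly_op (qpoly ^ k) H (l2_of (fun_of (del x 1))))"
  proof (rule functional_calculus_eq)
    show "fun_of (del x 1) \<in> ell2 A" by (rule fun_of_ell2) (use x in \<open>auto simp: fun_of_del\<close>)
    fix t assume "t \<in> {- ell2_onorm A Hm .. ell2_onorm A Hm}"
    then have "\<bar>t\<bar> \<le> C" using onorm_le by auto
    then show "\<phi> t = complex_of_real (poly (qpoly ^ k) t)" by (simp add: \<phi> poly_qpoly poly_power)
  qed
  then show ?thesis unfolding f fun_of_inverse using T_pow_qpoly(1)[OF dA, of k] T_pow_diag_real[of k A x] by simp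
qed

lemma functional_calculus_zero:
  assumes "\<And>t. \<bar>t\<bar> \<le> C \<Longrightarrow> \<phi> t = 0" and x: "x \<in> A"
  shows "functional_calculus A Hm \<phi> (\<lambda>y. if y = x then 1 else 0) x = 0"
proof -
  have f: "(\<lambda>y. if y = x then 1 else 0) = fun_of (del x 1)" by (rule ext) (simp add: fun_of_del)
  have "functional_calculus A Hm \<phi> (fun_of (del x 1)) = fun_of (rpoly_op 0 H (l2_of (fun_of (del x 1))))"
  proof (rule functional_calculus_eq)
    show "fun_of (del x 1) \<in> ell2 A" by (rule fun_of_ell2) (use x in \<open>auto simp: fun_of_del\<close>)
    fix t assume "t \<in> {- ell2_onorm A Hm .. ell2_onorm A Hm}"
    then have "\<bar>t\<bar> \<le> C" using onorm_le by auto
    then show "\<phi> t = complex_of_real (poly 0 t)" by (simp add: assms(1))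
  qed
  then show ?thesis unfolding f by (simp add: rpoly_op_0 l2_fun_simps)
qed

end

section \<open>Random operators\<close>

locale random_operator =
  fixes act :: "'g::{topological_group_add, metric_space} \<Rightarrow> 'x::{metric_space, second_countable_topology} \<Rightarrow> 'x"
    and haar :: "'g measure"
    and F' :: "'x set"
    and Cs :: "'c topology"
    and \<iota> :: "complex \<Rightarrow> 'c"
    and \<mu> :: "('x, 'c) config measure"
    and \<Omega> :: "('x, 'c) config set"
    and d :: real
    and s :: "'g \<Rightarrow> 'x \<Rightarrow> complex"
    and u :: "'x \<Rightarrow> real"
    and \<nu> :: "real measure"
    and E :: real
  assumes unimodular_haar: "unimodular_haar haar"
    and amenable: "amenable haar"
    and dist_add_left: "\<And>g x y :: 'g. dist (g + x) (g + y) = dist x y"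
    and precompact_ball: "\<And>(x :: 'g) r. compact (closure (ball x r))"
    and isometric: "isometric_action act"
    and fundamental: "fundamental_domain act F'"
    and F'_sigma_compact: "\<exists>K :: nat \<Rightarrow> 'x set. (\<forall>n. compact (K n)) \<and> F' = (\<Union>n. K n)"
    and F'_precompact: "compact (closure F')"
    and rough: "rough_isometry (group_coordinate act F')"
    and compactif: "compactification Cs \<iota>"
    and regular: "regular_probability (config_topology Cs) \<mu>"
    and invariant: "invariant_measure act \<mu>"
    and \<Omega>_eq: "\<Omega> = topological_support (config_topology Cs) \<mu>"
    and d_pos: "d > 0"
    and condition_A: "condition_A act s \<iota> \<mu> \<Omega>"
    and averaging: "averaging_function haar act u"
    and dos: "density_of_states \<iota> \<mu> \<Omega> d u \<nu>"
    and ergodic: "ergodic_measure act \<mu>"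
begin

sublocale haar: haar_metric_group haar
  by unfold_locales (rule unimodular_haar dist_add_left precompact_ball)+

section \<open>Group coordinates and properness of the space\<close>

lemma act_0: "act 0 x = x" and act_add: "act (g + k) x = act g (act k x)"
  and act_dist: "dist (act g x) (act g y) = dist x y" and act_cont: "continuous_on UNIV (\<lambda>(g, x). act g x)"
  using isometric by (auto simp: isometric_action_def)

lemma act_minus: "act (- g) (act g x) = x" "act g (act (- g) x) = x"
  using act_add[of "- g" g x] act_add[of g "- g" x] by (simp_all add: act_0)

lemma act_measurable: "(\<lambda>(g, x). act g x) \<in> borel_measurable (borel \<Otimes>\<^sub>M borel)"
proof -
  obtain B :: "'x set set" where "countable B" "topological_basis B" using ex_countable_basis by blast
  then show ?thesis using act_cont by (rule continuous_pair_borel_measurable)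
qed

lemma act_cont1: "continuous_on S (act g)"
  by (rule continuous_on_subset[of UNIV]) (auto simp: continuous_on_iff act_dist)

lemma act_measurable1 [measurable]: "act g \<in> borel_measurable borel"
  by (intro borel_measurable_continuous_onI act_cont1)

definition \<Phi> :: "'x \<Rightarrow> 'g" where "\<Phi> = group_coordinate act F'"

lemma \<Phi>_iff: "x \<in> act g ` F' \<longleftrightarrow> \<Phi> x = g"
proof -
  obtain p where p: "snd p \<in> F'" "x = act (fst p) (snd p)" and uniq: "\<And>q. snd q \<in> F' \<and> x = act (fst q) (snd q) \<Longrightarrow> q = p"
    using fundamental unfolding fundamental_domain_def by metis
  have *: "x \<in> act g ` F' \<longleftrightarrow> fst p = g" for g
    using p uniq[of "(g, _)"] by force
  then have "\<Phi> x = fst p" unfolding \<Phi>_def group_coordinate_def by simp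
  with * show ?thesis by simp
qed

lemma \<Phi>_act: "\<Phi> (act g x) = g + \<Phi> x"
proof -
  obtain y where "y \<in> F'" "x = act (\<Phi> x) y" using \<Phi>_iff[of x "\<Phi> x"] by auto
  then have "act g x \<in> act (g + \<Phi> x) ` F'" by (metis act_add imageI)
  then show ?thesis using \<Phi>_iff by blast
qed

definition IF :: "'g set \<Rightarrow> 'x set" where "IF I = {act g x | g x. g \<in> I \<and> x \<in> F'}"

lemma IF_iff: "x \<in> IF I \<longleftrightarrow> \<Phi> x \<in> I"
proof -
  have "x \<in> IF I \<longleftrightarrow> (\<exists>g\<in>I. x \<in> act g ` F')" unfolding IF_def by auto
  then show ?thesis by (simp add: \<Phi>_iff)
qed

lemma compact_act_image: "compact I \<Longrightarrow> compact K \<Longrightarrow> compact ((\<lambda>(g, x). act g x) ` (I \<times> K))"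
  by (intro compact_continuous_image compact_Times continuous_on_subset[OF act_cont]) auto

lemma IF_borel: assumes "compact I" shows "IF I \<in> sets borel"
proof -
  obtain K :: "nat \<Rightarrow> 'x set" where K: "\<And>n. compact (K n)" "F' = (\<Union>n. K n)" using F'_sigma_compact by blast
  have "IF I = (\<Union>n. (\<lambda>(g, x). act g x) ` (I \<times> K n))"
  proof -
    have "IF I = (\<lambda>(g, x). act g x) ` (I \<times> F')" unfolding IF_def by auto
    then show ?thesis by (subst (asm) K(2)) auto
  qed
  moreover have "(\<lambda>(g, x). act g x) ` (I \<times> K n) \<in> sets borel" for n
    by (intro borel_compact compact_act_image assms K(1))
  ultimately show ?thesis by auto
qed

lemma IF_bounded: assumes "compact I" shows "bounded (IF I)"
proof (rule bounded_subset)
  show "bounded ((\<lambda>(g, x). act g x) ` (I \<times> closure F'))"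
    by (intro compact_imp_bounded compact_act_image assms F'_precompact)
  show "IF I \<subseteq> (\<lambda>(g, x). act g x) ` (I \<times> closure F')"
    using closure_subset[of F'] by (auto simp: IF_def)
qed

lemma rough_constants: obtains a b where "a \<ge> 1" "b \<ge> 0" "\<And>x y. dist (\<Phi> x) (\<Phi> y) \<le> a * (dist x y + b)"
proof -
  obtain a b where ab: "a \<ge> 1" "b \<ge> 0" "\<And>x y. 1 / a * dist (\<Phi> x) (\<Phi> y) - b \<le> dist x y"
    using rough unfolding rough_isometry_def \<Phi>_def by blast
  have "dist (\<Phi> x) (\<Phi> y) \<le> a * (dist x y + b)" for x y
    using ab(1) ab(3)[of x y] by (simp add: field_simps)
  then show thesis using that ab by blast
qed

text \<open>A rough isometry maps bounded sets to bounded sets, and closed balls of the group are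
  compact.\<close>

lemma bounded_\<Phi>: assumes "bounded B" shows "\<exists>I. compact I \<and> emeasure haar I \<noteq> 0 \<and> B \<subseteq> IF I"
proof -
  obtain a b where ab: "a \<ge> 1" "b \<ge> 0" "\<And>x y. dist (\<Phi> x) (\<Phi> y) \<le> a * (dist x y + b)" by (rule rough_constants) blast
  obtain r where r: "\<And>x. x \<in> B \<Longrightarrow> dist undefined x \<le> r"
    using assms unfolding bounded_any_center[where a = "undefined :: 'x"] by blast
  \<comment> \<open>The lower bound 1 for the radius secures positive measure even if
    \<open>a * (r + b)\<close> is zero or negative.\<close>
  define I where "I = cball (\<Phi> undefined) (max 1 (a * (r + b)))"
  have "B \<subseteq> IF I"
  proof
    fix x assume "x \<in> B"
    have "dist (\<Phi> undefined) (\<Phi> x) \<le> a * (dist undefined x + b)" by (rule ab(3))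
    also have "\<dots> \<le> a * (r + b)" using r[OF \<open>x \<in> B\<close>] ab by (intro mult_left_mono) auto
    finally show "x \<in> IF I" by (simp add: IF_iff I_def)
  qed
  moreover have "emeasure haar I \<noteq> 0"
  proof -
    have "emeasure haar (ball (\<Phi> undefined) 1) \<le> emeasure haar I" by (rule emeasure_mono) (auto simp: I_def)
    then show ?thesis using haar.emeasure_ball_pos[of 1 "\<Phi> undefined"] by (metis not_gr_zero zero_less_one less_le_trans)
  qed
  ultimately show ?thesis using haar.compact_cball unfolding I_def by blast
qed

text \<open>A closed ball is a closed subset of the image of \<open>I \<times> closure F'\<close>
  under the continuous action, hence of a compact set.\<close>

lemma proper: "compact (cball (x :: 'x) r)"
proof -
  obtain I where I: "compact I" "cball x r \<subseteq> IF I" using bounded_\<Phi>[OF bounded_cball] by blast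
  let ?K = "(\<lambda>(g, x). act g x) ` (I \<times> closure F')"
  have "IF I \<subseteq> ?K" using closure_subset[of F'] by (auto simp: IF_def)
  with I have "cball x r \<subseteq> ?K" by blast
  then show ?thesis
    using compact_Int_closed[OF compact_act_image[OF I(1) F'_precompact] closed_cball[of x r]] by (simp add: Int_absorb1)
qed

sublocale config_space Cs \<iota> "undefined :: 'x"
  using proper compactif by unfold_locales

section \<open>The support of the measure and measurability of hitting events\<close>

lemma prob_\<mu>: "prob_space \<mu>" and space_\<mu>: "space \<mu> = topspace CT"
  and sets_\<mu>: "sets \<mu> = sigma_sets (topspace CT) {U. openin CT U}"
  and inner_\<mu>: "B \<in> sets \<mu> \<Longrightarrow> emeasure \<mu> B = (SUP K\<in>{K. compactin CT K \<and> K \<subseteq> B}. emeasure \<mu> K)"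
  using regular by (auto simp: regular_probability_def)

lemma open_sets: "openin CT U \<Longrightarrow> U \<in> sets \<mu>"
  unfolding sets_\<mu> by (rule sigma_sets.Basic) simp

lemma measurable_from_\<mu>:
  fixes f :: "_ \<Rightarrow> 'b::topological_space"
  assumes "continuous_map CT euclidean f" shows "f \<in> borel_measurable \<mu>"
proof (rule borel_measurableI)
  fix S :: "'b set" assume "open S"
  then have "openin CT {\<omega> \<in> topspace CT. f \<omega> \<in> S}" using assms by (intro openin_continuous_map_preimage) auto
  moreover have "f -` S \<inter> space \<mu> = {\<omega> \<in> topspace CT. f \<omega> \<in> S}" by (auto simp: space_\<mu>)
  ultimately show "f -` S \<inter> space \<mu> \<in> sets \<mu>" using open_sets by simp
qed

lemma \<Omega>_iff: "\<omega> \<in> \<Omega> \<longleftrightarrow> \<omega> \<in> topspace CT \<and> (\<forall>U. openin CT U \<and> \<omega> \<in> U \<longrightarrow> 0 < emeasure \<mu> U)"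
  by (simp add: \<Omega>_eq topological_support_def)

lemma \<Omega>_sub: "\<Omega> \<subseteq> topspace CT" by (auto simp: \<Omega>_iff)

definition null_open where "null_open = {U. openin CT U \<and> emeasure \<mu> U = 0}"

lemma \<Omega>_compl: "topspace CT - \<Omega> = \<Union>null_open"
proof
  show "topspace CT - \<Omega> \<subseteq> \<Union>null_open" by (auto simp: null_open_def \<Omega>_iff)
  show "\<Union>null_open \<subseteq> topspace CT - \<Omega>" using openin_subset by (fastforce simp: null_open_def \<Omega>_iff)
qed

text \<open>The complement of the support is a union of null open sets, possibly uncountable. A
  compact subset is covered by finitely many of them and thus null, and inner regularity passes this
  on to the whole complement.\<close>

lemma \<Omega>_sets [measurable]: "\<Omega> \<in> sets \<mu>" and emeasure_\<Omega>: "emeasure \<mu> \<Omega> = 1"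
proof -
  interpret prob_space \<mu> by (rule prob_\<mu>)
  have o: "openin CT (topspace CT - \<Omega>)" unfolding \<Omega>_compl null_open_def by (intro openin_Union) auto
  have eq: "\<Omega> = space \<mu> - (topspace CT - \<Omega>)" using \<Omega>_sub by (auto simp: space_\<mu>)
  show "\<Omega> \<in> sets \<mu>" by (subst eq) (intro sets.compl_sets open_sets[OF o])
  have "emeasure \<mu> K = 0" if K: "compactin CT K" "K \<subseteq> topspace CT - \<Omega>" for K
  proof -
    have "\<forall>U\<in>null_open. openin CT U" "K \<subseteq> \<Union>null_open" using K(2) by (auto simp: null_open_def \<Omega>_compl)
    then obtain \<F> where F: "finite \<F>" "\<F> \<subseteq> null_open" "K \<subseteq> \<Union>\<F>" using K(1) unfolding compactin_def by blast
    have "\<F> \<subseteq> null_sets \<mu>" using F(2) open_sets by (auto simp: null_open_def null_sets_def)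
    then have "\<Union>\<F> \<in> null_sets \<mu>" using F(1) null_sets_UN'[of \<F> "\<lambda>x. x" \<mu>] by (auto simp: countable_finite)
    then show ?thesis using F(3) by (metis emeasure_mono le_zero_eq null_setsD1 null_setsD2)
  qed
  then have "(SUP K\<in>{K. compactin CT K \<and> K \<subseteq> topspace CT - \<Omega>}. emeasure \<mu> K) \<le> 0"
    by (intro SUP_least) auto
  then have "emeasure \<mu> (topspace CT - \<Omega>) = 0" using inner_\<mu>[OF open_sets[OF o]] by simp
  then show "emeasure \<mu> \<Omega> = 1"
    using prob_compl[OF open_sets[OF o]] eq emeasure_eq_measure by (metis ennreal_1 diff_zero measure_eq_emeasure_eq_ennreal enn2real_0 measure_def)
qed

lemma config_act_top: "\<omega> \<in> topspace CT \<Longrightarrow> config_act act g \<omega> \<in> topspace CT"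
  using continuous_config_act[OF isometric, of g] by (auto simp: continuous_map_def)

lemma config_act_measurable [measurable]: "config_act act g \<in> measurable \<mu> \<mu>"
proof (rule measurable_sigma_sets[OF sets_\<mu>])
  show "{U. openin CT U} \<subseteq> Pow (topspace CT)" using openin_subset by blast
  show "config_act act g \<in> space \<mu> \<rightarrow> topspace CT" using config_act_top by (auto simp: space_\<mu>)
  fix U assume "U \<in> {U. openin CT U}"
  then have "openin CT {\<omega> \<in> topspace CT. config_act act g \<omega> \<in> U}"
    by (intro openin_continuous_map_preimage[OF continuous_config_act[OF isometric]]) simp
  moreover have "config_act act g -` U \<inter> space \<mu> = {\<omega> \<in> topspace CT. config_act act g \<omega> \<in> U}" by (auto simp: space_\<mu>)
  ultimately show "config_act act g -` U \<inter> space \<mu> \<in> sets \<mu>" using open_sets by simp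
qed

lemma distr_config_act: "distr \<mu> \<mu> (config_act act g) = \<mu>"
  using invariant by (simp add: invariant_measure_def)

text \<open>The preimage of a neighbourhood of the shifted configuration is a neighbourhood of
  \<open>\<omega>\<close> and, by invariance, has the same measure.\<close>

lemma config_act_\<Omega>: assumes "\<omega> \<in> \<Omega>" shows "config_act act g \<omega> \<in> \<Omega>"
  unfolding \<Omega>_iff
proof (intro conjI allI impI)
  have \<omega>: "\<omega> \<in> topspace CT" using assms \<Omega>_sub by blast
  show "config_act act g \<omega> \<in> topspace CT" by (rule config_act_top[OF \<omega>])
  fix U assume U: "openin CT U \<and> config_act act g \<omega> \<in> U"
  have eq: "config_act act g -` U \<inter> space \<mu> = {\<omega> \<in> topspace CT. config_act act g \<omega> \<in> U}" by (auto simp: space_\<mu>)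
  have "openin CT {\<omega> \<in> topspace CT. config_act act g \<omega> \<in> U}"
    using U by (intro openin_continuous_map_preimage[OF continuous_config_act[OF isometric]]) simp
  then have "0 < emeasure \<mu> {\<omega> \<in> topspace CT. config_act act g \<omega> \<in> U}" using assms U \<omega> unfolding \<Omega>_iff by blast
  also have "\<dots> = emeasure (distr \<mu> \<mu> (config_act act g)) U"
    using U open_sets by (subst emeasure_distr) (auto simp: eq)
  finally show "0 < emeasure \<mu> U" by (simp add: distr_config_act)
qed

lemma dom_config_act: "dom (config_act act g \<omega>) = act g ` dom \<omega>"
proof
  show "dom (config_act act g \<omega>) \<subseteq> act g ` dom \<omega>"
  proof
    fix x assume "x \<in> dom (config_act act g \<omega>)"
    then have "act (- g) x \<in> dom \<omega>" by (auto simp: config_act_def dom_def)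
    then show "x \<in> act g ` dom \<omega>" by (metis act_minus(2) imageI)
  qed
  show "act g ` dom \<omega> \<subseteq> dom (config_act act g \<omega>)" by (auto simp: config_act_def act_minus dom_def)
qed

lemma ham_entry_config_act:
  "x \<in> dom \<omega> \<Longrightarrow> ham_entry \<iota> (config_act act g \<omega>) (act g x) (act g y) = ham_entry \<iota> \<omega> x y"
  by (auto simp: ham_entry_def config_act_def act_minus)

lemma config_act_inverse: "config_act act g (config_act act (- g) \<omega>) = \<omega>"
proof
  fix x
  have "(\<lambda>k y. (\<lambda>k y. k (act g y)) k (act (- g) y)) = (\<lambda>k :: 'x \<rightharpoonup> 'c. k)" by (simp add: act_minus)
  then show "config_act act g (config_act act (- g) \<omega>) x = \<omega> x"
    by (simp add: config_act_def act_minus option.map_comp o_def option.map_ident)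
qed

declare domIff [iff del]

abbreviation Pr :: "('x, 'c) config measure" where "Pr \<equiv> restrict_space \<mu> \<Omega>"

lemma \<Omega>_inter: "\<Omega> \<inter> space \<mu> = \<Omega>" using \<Omega>_sub by (auto simp: space_\<mu>)

lemma space_Pr: "space Pr = \<Omega>" by (simp add: space_restrict_space \<Omega>_inter)

lemma sets_Pr: "B \<in> sets Pr \<longleftrightarrow> B \<in> sets \<mu> \<and> B \<subseteq> \<Omega>"
  by (subst sets_restrict_space_iff) (auto simp: \<Omega>_inter)

lemma emeasure_Pr: "B \<subseteq> \<Omega> \<Longrightarrow> emeasure Pr B = emeasure \<mu> B"
  by (rule emeasure_restrict_space) (simp_all add: \<Omega>_inter)

sublocale Pr: prob_space Pr
  by (rule prob_spaceI) (simp add: space_Pr emeasure_Pr emeasure_\<Omega>)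

lemma \<Omega>_separated: "\<omega> \<in> \<Omega> \<Longrightarrow> separated_set (dom \<omega>)"
  using CT_separated \<Omega>_sub by blast

lemma dom_finite: "\<omega> \<in> \<Omega> \<Longrightarrow> finite (dom \<omega> \<inter> cball x r)"
  by (rule separated_finite[OF proper \<Omega>_separated])

lemma separated_ball_unique: "separated_set A \<Longrightarrow> x \<in> A \<Longrightarrow> y \<in> A \<Longrightarrow> x \<in> ball q (1/2) \<Longrightarrow> y \<in> ball q (1/2) \<Longrightarrow> x = y"
  using dist_triangle_half_r[of q x 1 y] by (force simp: separated_set_def)

text \<open>For an open set the event is the nonvanishing of a continuous sum of distances to the
  complement. Borel sets are reached by induction over the generated sigma-algebra.\<close>

lemma hits_ball:
  assumes "B \<in> sets (borel :: 'x measure)"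
  shows "{\<omega> \<in> topspace CT. dom \<omega> \<inter> (ball q (1/2) \<inter> B) \<noteq> {}} \<in> sets \<mu>"
proof -
  let ?hit = "\<lambda>U. {\<omega> \<in> topspace CT. dom \<omega> \<inter> (ball q (1/2) \<inter> U) \<noteq> {}}"
  have basic: "?hit W \<in> sets \<mu>" if W: "open W" for W
  proof -
    let ?U = "ball q (1/2) \<inter> W"
    have U: "open ?U" using W by auto
    \<comment> \<open>By convention \<open>infdist\<close> to the empty set is 0, so the whole space
      needs its own value.\<close>
    define \<psi> where "\<psi> x = (if ?U = UNIV then 1 else infdist x (- ?U))" for x
    have \<psi>: "\<psi> x \<noteq> 0 \<longleftrightarrow> x \<in> ?U" for x
    proof (cases "?U = UNIV")
      case False
      then have "- ?U \<noteq> {}" by blast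
      then show ?thesis using in_closed_iff_infdist_zero[of "- ?U" x] U unfolding \<psi>_def closed_def by auto
    qed (auto simp: \<psi>_def)
    have \<psi>0: "0 \<le> \<psi> x" for x by (simp add: \<psi>_def infdist_nonneg)
    have c: "continuous_on UNIV \<psi>"
    proof (cases "?U = UNIV")
      case False
      then have "\<psi> = (\<lambda>x. infdist x (- ?U))" by (auto simp: \<psi>_def fun_eq_iff)
      then show ?thesis by (auto intro!: continuous_intros)
    next
      case True
      then have "\<psi> = (\<lambda>x. 1)" unfolding \<psi>_def by simp
      then show ?thesis by simp
    qed
    have z: "\<psi> x = 0" if "dist undefined q + 1 < dist undefined x" for x
      using that \<psi>[of x] dist_triangle[of undefined x q] by auto
    have "continuous_map CT euclidean (vsum (\<lambda>z. \<psi> (fst z)))"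
      by (rule continuous_count[OF c z])
    then have m: "vsum (\<lambda>z. \<psi> (fst z)) \<in> borel_measurable \<mu>" by (rule measurable_from_\<mu>)
    have "?hit W = {\<omega> \<in> space \<mu>. vsum (\<lambda>z. \<psi> (fst z)) \<omega> \<noteq> 0}"
    proof -
      have "vsum (\<lambda>z. \<psi> (fst z)) \<omega> \<noteq> 0 \<longleftrightarrow> (\<exists>a\<in>dom \<omega>. \<psi> (fst (a, the (\<omega> a))) \<noteq> 0)" if "\<omega> \<in> topspace CT" for \<omega>
        by (rule vsum_nonneg(2)[where b = q and r = "1/2", OF proper CT_separated[OF that]]) (auto simp: \<psi>0 \<psi>)
      then show ?thesis by (auto simp: space_\<mu> \<psi> simp del: mem_ball)
    qed
    then show ?thesis using m by simp
  qed
  have "B \<in> sigma_sets UNIV {S. open S}" using assms by (simp add: borel_def)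
  then show ?thesis
  proof induction
    case (Basic a)
    then show ?case using basic by simp
  next
    case (Compl a)
    \<comment> \<open>The reason for cutting with a ball of radius 1/2: a configuration has at most
      one point there, so meeting the complement of \<open>a\<close> means meeting the ball and not
      meeting \<open>a\<close>.\<close>
    have "?hit (UNIV - a) = ?hit UNIV - ?hit a"
      using separated_ball_unique[OF CT_separated] by fastforce
    then show ?case using basic[of UNIV] Compl by auto
  next
    case (Union a)
    have "?hit (\<Union>i. a i) = (\<Union>i. ?hit (a i))" by auto
    then show ?case using Union.IH by auto
  qed simp
qed

section \<open>A measurable enumeration of the points of a configuration\<close>

definition center :: "nat \<Rightarrow> 'x" where "center = (SOME q. \<forall>x. \<exists>i. x \<in> ball (q i) (1/2))"

lemma center: "\<exists>i. x \<in> ball (center i) (1/2)"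
proof -
  obtain D :: "'x set" where D: "countable D" "\<And>U. open U \<Longrightarrow> U \<noteq> {} \<Longrightarrow> \<exists>d\<in>D. d \<in> U"
    by (rule countable_dense_setE) blast
  have *: "\<exists>d\<in>D. d \<in> ball x (1/2)" for x by (rule D(2)) auto
  then have "D \<noteq> {}" by blast
  have "\<forall>x. \<exists>i. x \<in> ball (from_nat_into D i) (1/2)"
  proof
    fix x
    obtain d where "d \<in> D" "d \<in> ball x (1/2)" using * by blast
    then show "\<exists>i. x \<in> ball (from_nat_into D i) (1/2)"
      using from_nat_into_surj[OF D(1) \<open>d \<in> D\<close>] by (auto simp: dist_commute)
  qed
  then have "\<forall>x. \<exists>i. x \<in> ball (center i) (1/2)"
    unfolding center_def by (rule someI[where P = "\<lambda>q. \<forall>x. \<exists>i. x \<in> ball (q i) (1/2)"])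
  then show ?thesis by blast
qed

lemma hits:
  assumes "B \<in> sets (borel :: 'x measure)"
  shows "{\<omega> \<in> \<Omega>. dom \<omega> \<inter> B \<noteq> {}} \<in> sets Pr"
proof -
  have "{\<omega> \<in> \<Omega>. dom \<omega> \<inter> B \<noteq> {}} = (\<Union>i. {\<omega> \<in> topspace CT. dom \<omega> \<inter> (ball (center i) (1/2) \<inter> B) \<noteq> {}}) \<inter> \<Omega>"
    using center \<Omega>_sub by fast
  then show ?thesis using hits_ball[OF assms] unfolding sets_Pr by auto
qed

definition cell :: "nat \<Rightarrow> 'x set" where "cell = disjointed (\<lambda>i. ball (center i) (1/2))"

lemma cell_borel [measurable]: "cell i \<in> sets borel"
  unfolding cell_def disjointed_def by auto

lemma cell_cover: "\<exists>i. x \<in> cell i"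
  using UN_disjointed_eq[of "\<lambda>i. ball (center i) (1/2)"] center[of x] unfolding cell_def by blast

lemma cell_unique: "x \<in> cell i \<Longrightarrow> x \<in> cell j \<Longrightarrow> i = j"
  using disjoint_family_disjointed[of "\<lambda>i. ball (center i) (1/2)"] unfolding cell_def disjoint_family_on_def by blast

lemma cell_sub: "cell i \<subseteq> ball (center i) (1/2)"
  unfolding cell_def by (rule disjointed_subset)

text \<open>A cell contains at most one point of a configuration.  These points enumerate the
  configuration measurably; \<open>pt i \<omega>\<close> is a junk value unless \<open>hit i \<omega>\<close>.\<close>

definition hit :: "nat \<Rightarrow> ('x, 'c) config \<Rightarrow> bool" where "hit i \<omega> \<longleftrightarrow> dom \<omega> \<inter> cell i \<noteq> {}"

definition pt :: "nat \<Rightarrow> ('x, 'c) config \<Rightarrow> 'x" where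
  "pt i \<omega> = (if hit i \<omega> then THE x. x \<in> dom \<omega> \<inter> cell i else undefined)"

lemma pt_eq: assumes "\<omega> \<in> \<Omega>" "x \<in> dom \<omega>" "x \<in> cell i" shows "hit i \<omega>" "pt i \<omega> = x"
proof -
  show "hit i \<omega>" using assms by (auto simp: hit_def)
  moreover have "(THE x. x \<in> dom \<omega> \<inter> cell i) = x"
    using assms separated_ball_unique[OF \<Omega>_separated] cell_sub[of i] by (intro the_equality) blast+
  ultimately show "pt i \<omega> = x" by (simp add: pt_def)
qed

lemma pt_dom: assumes "\<omega> \<in> \<Omega>" "hit i \<omega>" shows "pt i \<omega> \<in> dom \<omega>" "pt i \<omega> \<in> cell i"
proof -
  obtain x where "x \<in> dom \<omega>" "x \<in> cell i" using assms(2) by (auto simp: hit_def)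
  with pt_eq(2)[OF assms(1)] show "pt i \<omega> \<in> dom \<omega>" "pt i \<omega> \<in> cell i" by blast+
qed

lemma dom_cases: assumes "\<omega> \<in> \<Omega>" "x \<in> dom \<omega>" obtains i where "hit i \<omega>" "x = pt i \<omega>"
  using cell_cover[of x] pt_eq[OF assms] by metis

lemma hit_measurable [measurable]: "Measurable.pred Pr (hit i)"
  using hits[OF cell_borel, of i] by (simp add: pred_def space_Pr hit_def)

lemma pt_measurable [measurable]: "pt i \<in> borel_measurable Pr"
proof (rule borel_measurableI)
  fix S :: "'x set" assume "open S"
  \<comment> \<open>Where cell \<open>i\<close> is empty, \<open>pt i\<close> takes the default
    value \<open>undefined\<close>, which contributes the second set exactly when it lies in
    \<open>S\<close>.\<close>
  have "pt i -` S \<inter> space Pr = {\<omega> \<in> \<Omega>. dom \<omega> \<inter> (cell i \<inter> S) \<noteq> {}} \<union> (if undefined \<in> S then {\<omega> \<in> space Pr. \<not> hit i \<omega>} else {})"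
  proof -
    have "pt i \<omega> \<in> S \<longleftrightarrow> dom \<omega> \<inter> (cell i \<inter> S) \<noteq> {} \<or> undefined \<in> S \<and> \<not> hit i \<omega>" if \<omega>: "\<omega> \<in> \<Omega>" for \<omega>
    proof (cases "hit i \<omega>")
      case True
      have "y = pt i \<omega>" if "y \<in> dom \<omega>" "y \<in> cell i" for y using pt_eq(2)[OF \<omega> that] by simp
      then have "dom \<omega> \<inter> (cell i \<inter> S) \<noteq> {} \<longleftrightarrow> pt i \<omega> \<in> S" using pt_dom[OF \<omega> True] by blast
      then show ?thesis using True by simp
    next
      case False
      then have "dom \<omega> \<inter> cell i = {}" by (simp add: hit_def)
      then have "dom \<omega> \<inter> (cell i \<inter> S) = {}" by blast
      then show ?thesis using False by (simp add: pt_def)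
    qed
    then have "{\<omega> \<in> \<Omega>. pt i \<omega> \<in> S} = {\<omega> \<in> \<Omega>. dom \<omega> \<inter> (cell i \<inter> S) \<noteq> {} \<or> undefined \<in> S \<and> \<not> hit i \<omega>}"
      by (intro Collect_cong conj_cong refl)
    moreover have "pt i -` S \<inter> space Pr = {\<omega> \<in> \<Omega>. pt i \<omega> \<in> S}" unfolding space_Pr by blast
    moreover have "{\<omega> \<in> \<Omega>. X \<omega> \<or> c \<and> Y \<omega>} = {\<omega> \<in> \<Omega>. X \<omega>} \<union> (if c then {\<omega> \<in> \<Omega>. Y \<omega>} else {})" for X Y c by auto
    ultimately show ?thesis unfolding space_Pr by (simp only:)
  qed
  moreover have "{\<omega> \<in> \<Omega>. dom \<omega> \<inter> (cell i \<inter> S) \<noteq> {}} \<in> sets Pr"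
    by (rule hits, rule sets.Int[OF cell_borel borel_open[OF \<open>open S\<close>]])
  moreover have "{\<omega> \<in> space Pr. \<not> hit i \<omega>} \<in> sets Pr"
    using hit_measurable[of i] unfolding pred_def by (rule sets.sets_Collect_neg)
  then have "(if undefined \<in> S then {\<omega> \<in> space Pr. \<not> hit i \<omega>} else {}) \<in> sets Pr" by (cases "undefined \<in> S") (simp_all only: if_True if_False sets.empty_sets)
  ultimately show "pt i -` S \<inter> space Pr \<in> sets Pr" by (simp only: sets.Un)
qed

section \<open>Sums over points, weights and mass transport\<close>

definition psum :: "('x, 'c) config \<Rightarrow> ('x \<Rightarrow> ennreal) \<Rightarrow> ennreal" where
  "psum \<omega> f = (\<integral>\<^sup>+x. f x \<partial>count_space (dom \<omega>))"

lemma psum_cong: "(\<And>x. x \<in> dom \<omega> \<Longrightarrow> f x = g x) \<Longrightarrow> psum \<omega> f = psum \<omega> g"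
  unfolding psum_def by (intro nn_integral_cong) simp

lemma psum_mono: "(\<And>x. x \<in> dom \<omega> \<Longrightarrow> f x \<le> g x) \<Longrightarrow> psum \<omega> f \<le> psum \<omega> g"
  unfolding psum_def by (intro nn_integral_mono) simp

lemma psum_pt: assumes "\<omega> \<in> \<Omega>"
  shows "psum \<omega> f = (\<integral>\<^sup>+i. (if hit i \<omega> then f (pt i \<omega>) else 0) \<partial>count_space UNIV)"
proof -
  have "bij_betw (\<lambda>i. pt i \<omega>) {i. hit i \<omega>} (dom \<omega>)"
    unfolding bij_betw_def
  proof
    show "inj_on (\<lambda>i. pt i \<omega>) {i. hit i \<omega>}"
      using pt_dom[OF assms] cell_unique by (intro inj_onI) (metis mem_Collect_eq)
    show "(\<lambda>i. pt i \<omega>) ` {i. hit i \<omega>} = dom \<omega>"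

      using pt_dom(1)[OF assms] by (auto elim: dom_cases[OF assms])
  qed
  then have "psum \<omega> f = (\<integral>\<^sup>+i. f (pt i \<omega>) \<partial>count_space {i. hit i \<omega>})"
    unfolding psum_def by (rule nn_integral_bij_count_space[symmetric])
  also have "\<dots> = (\<integral>\<^sup>+i. f (pt i \<omega>) * indicator {i. hit i \<omega>} i \<partial>count_space UNIV)"
    by (simp add: nn_integral_restrict_space[symmetric] restrict_count_space)
  also have "\<dots> = (\<integral>\<^sup>+i. (if hit i \<omega> then f (pt i \<omega>) else 0) \<partial>count_space UNIV)"
    by (intro nn_integral_cong) (simp add: indicator_def)
  finally show ?thesis .
qed

lemma psum_config_act: "psum (config_act act g \<omega>) f = psum \<omega> (\<lambda>x. f (act g x))"
proof -
  have "bij_betw (act g) (dom \<omega>) (dom (config_act act g \<omega>))"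
    unfolding bij_betw_def dom_config_act by (auto intro: inj_on_inverseI[of _ "act (- g)"] simp: act_minus)
  then show ?thesis unfolding psum_def by (rule nn_integral_bij_count_space[symmetric])
qed

lemma finite_psum:
  assumes "finite (dom \<omega> \<inter> S)" "\<And>x. x \<in> dom \<omega> \<Longrightarrow> x \<notin> S \<Longrightarrow> f x = 0"
  shows "psum \<omega> f = (\<Sum>x\<in>dom \<omega> \<inter> S. f x)"
  unfolding psum_def using assms
  by (subst nn_integral_count_space'[of "dom \<omega> \<inter> S"]) auto

lemma psum_card_bound: "\<exists>N :: nat. \<forall>\<omega>\<in>\<Omega>. psum \<omega> (indicator (cball x r)) \<le> of_nat N"
proof -
  obtain N where N: "\<And>A. separated_set A \<Longrightarrow> finite (A \<inter> cball x r) \<and> card (A \<inter> cball x r) \<le> N"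
    using separated_card_bound[OF proper, of x r] by blast
  have "psum \<omega> (indicator (cball x r)) \<le> of_nat N" if \<omega>: "\<omega> \<in> \<Omega>" for \<omega>
  proof -
    have "psum \<omega> (indicator (cball x r)) = of_nat (card (dom \<omega> \<inter> cball x r))"
      by (subst finite_psum[of \<omega> "cball x r"]) (use N[OF \<Omega>_separated[OF \<omega>]] in auto)
    also have "\<dots> \<le> of_nat N" using N[OF \<Omega>_separated[OF \<omega>]] by (simp add: of_nat_mono)
    finally show ?thesis .
  qed
  then show ?thesis by blast
qed

text \<open>Weights are only ever evaluated at points of the configuration, so measurability is
  required along the enumeration \<open>pt i\<close> and not jointly in \<open>\<omega>\<close> and
  \<open>x\<close>.\<close>

definition weight :: "(('x, 'c) config \<Rightarrow> 'x \<Rightarrow> real) \<Rightarrow> bool" where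
  "weight w \<longleftrightarrow> (\<forall>i. (\<lambda>\<omega>. if hit i \<omega> then w \<omega> (pt i \<omega>) else 0) \<in> borel_measurable Pr) \<and>
     (\<forall>\<omega>\<in>\<Omega>. \<forall>x\<in>dom \<omega>. 0 \<le> w \<omega> x \<and> w \<omega> x \<le> 1)"

lemma weight_measurable: assumes "weight w" shows "(\<lambda>(\<omega>, i). if hit i \<omega> then ennreal (w \<omega> (pt i \<omega>)) else 0) \<in> borel_measurable (Pr \<Otimes>\<^sub>M count_space UNIV)"
proof -
  have m: "(\<lambda>\<omega>. ennreal (if hit i \<omega> then w \<omega> (pt i \<omega>) else 0)) \<in> borel_measurable Pr" for i
    using assms unfolding weight_def by (intro measurable_compose[OF _ measurable_ennreal]) blast
  have e: "(\<lambda>(\<omega>, i). if hit i \<omega> then ennreal (w \<omega> (pt i \<omega>)) else 0) =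
    (\<lambda>z. ennreal (if hit (snd z) (fst z) then w (fst z) (pt (snd z) (fst z)) else 0))" by auto
  show ?thesis unfolding e
    by (rule measurable_compose_countable[where f = "\<lambda>i z. ennreal (if hit i (fst z) then w (fst z) (pt i (fst z)) else 0)" and g = snd])
       (rule measurable_compose[OF measurable_fst m], simp)
qed

lemma pt_measurable_pair: "(\<lambda>(\<omega>, i). pt i \<omega>) \<in> borel_measurable (Pr \<Otimes>\<^sub>M count_space UNIV)"
proof -
  have e: "(\<lambda>(\<omega>, i). pt i \<omega>) = (\<lambda>z. pt (snd z) (fst z))" by auto
  show ?thesis unfolding e
    by (rule measurable_compose_countable[where f = "\<lambda>i z. pt i (fst z)" and g = snd])
       (rule measurable_compose[OF measurable_fst pt_measurable], simp)
qed

text \<open>The measure \<open>\<Lambda> \<mapsto> \<integral> \<Sum>\<^bsub>x \<in> dom \<omega> \<inter> \<Lambda>\<^esub> w \<omega> x d\<mu>(\<omega>)\<close>; the intensity measure for \<open>w = 1\<close>.\<close>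

definition wmeas :: "(('x, 'c) config \<Rightarrow> 'x \<Rightarrow> real) \<Rightarrow> 'x measure" where
  "wmeas w = distr (density (Pr \<Otimes>\<^sub>M count_space UNIV) (\<lambda>(\<omega>, i). if hit i \<omega> then ennreal (w \<omega> (pt i \<omega>)) else 0))
     borel (\<lambda>(\<omega>, i). pt i \<omega>)"

lemma sets_wmeas [simp, measurable_cong]: "sets (wmeas w) = sets borel" and space_wmeas [simp]: "space (wmeas w) = UNIV"
  by (simp_all add: wmeas_def)

lemma
  assumes w: "weight w" and f: "f \<in> borel_measurable borel"
  shows nn_integral_wmeas: "(\<integral>\<^sup>+x. f x \<partial>wmeas w) = (\<integral>\<^sup>+\<omega>. psum \<omega> (\<lambda>x. ennreal (w \<omega> x) * f x) \<partial>Pr)"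
    and psum_measurable: "(\<lambda>\<omega>. psum \<omega> (\<lambda>x. ennreal (w \<omega> x) * f x)) \<in> borel_measurable Pr"
proof -
  interpret c: sigma_finite_measure "count_space (UNIV :: nat set)" by (rule sigma_finite_measure_count_space)
  note [measurable] = weight_measurable[OF w] pt_measurable_pair f
  let ?F = "\<lambda>z. (case z of (\<omega>, i) \<Rightarrow> if hit i \<omega> then ennreal (w \<omega> (pt i \<omega>)) else 0) * f (case z of (\<omega>, i) \<Rightarrow> pt i \<omega>)"
  have m: "?F \<in> borel_measurable (Pr \<Otimes>\<^sub>M count_space UNIV)" by measurable
  have e: "psum \<omega> (\<lambda>x. ennreal (w \<omega> x) * f x) = (\<integral>\<^sup>+i. ?F (\<omega>, i) \<partial>count_space UNIV)" if "\<omega> \<in> space Pr" for \<omega>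
    using that unfolding space_Pr by (subst psum_pt) (auto intro!: nn_integral_cong)
  have "(\<integral>\<^sup>+x. f x \<partial>wmeas w) = (\<integral>\<^sup>+z. f (case z of (\<omega>, i) \<Rightarrow> pt i \<omega>) \<partial>density (Pr \<Otimes>\<^sub>M count_space UNIV) (\<lambda>(\<omega>, i). if hit i \<omega> then ennreal (w \<omega> (pt i \<omega>)) else 0))"
    unfolding wmeas_def by (subst nn_integral_distr) (auto simp: f pt_measurable_pair)
  also have "\<dots> = (\<integral>\<^sup>+z. ?F z \<partial>(Pr \<Otimes>\<^sub>M count_space UNIV))"
    by (subst nn_integral_density) (auto simp: f pt_measurable_pair weight_measurable[OF w])
  also have "\<dots> = (\<integral>\<^sup>+\<omega>. (\<integral>\<^sup>+i. ?F (\<omega>, i) \<partial>count_space UNIV) \<partial>Pr)"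
    by (rule c.nn_integral_fst[symmetric, OF m])
  also have "\<dots> = (\<integral>\<^sup>+\<omega>. psum \<omega> (\<lambda>x. ennreal (w \<omega> x) * f x) \<partial>Pr)"
    by (intro nn_integral_cong) (simp only: e)
  finally show "(\<integral>\<^sup>+x. f x \<partial>wmeas w) = (\<integral>\<^sup>+\<omega>. psum \<omega> (\<lambda>x. ennreal (w \<omega> x) * f x) \<partial>Pr)" .
  show "(\<lambda>\<omega>. psum \<omega> (\<lambda>x. ennreal (w \<omega> x) * f x)) \<in> borel_measurable Pr"
    by (rule measurable_cong[THEN iffD2, OF e c.borel_measurable_nn_integral_fst[OF m]])
qed

lemma emeasure_wmeas: "weight w \<Longrightarrow> B \<in> sets borel \<Longrightarrow> emeasure (wmeas w) B = (\<integral>\<^sup>+\<omega>. psum \<omega> (\<lambda>x. ennreal (w \<omega> x) * indicator B x) \<partial>Pr)"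
  using nn_integral_wmeas[of w "indicator B"] by simp

lemma wmeas_bounded_finite: assumes w: "weight w" and B: "bounded B" "B \<in> sets borel" shows "emeasure (wmeas w) B < \<infinity>"
proof -
  obtain r where "\<forall>y\<in>B. dist undefined y \<le> r" using B(1) unfolding bounded_any_center[where a = "undefined :: 'x"] by blast
  then have r: "B \<subseteq> cball undefined r" by auto
  obtain N :: nat where N: "\<And>\<omega>. \<omega> \<in> \<Omega> \<Longrightarrow> psum \<omega> (indicator (cball undefined r)) \<le> of_nat N" using psum_card_bound by blast
  have "emeasure (wmeas w) B \<le> (\<integral>\<^sup>+\<omega>. of_nat N \<partial>Pr)"
    unfolding emeasure_wmeas[OF w B(2)]
  proof (rule nn_integral_mono)
    fix \<omega> assume "\<omega> \<in> space Pr"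
    then have \<omega>: "\<omega> \<in> \<Omega>" by (simp add: space_Pr)
    have "psum \<omega> (\<lambda>x. ennreal (w \<omega> x) * indicator B x) \<le> psum \<omega> (indicator (cball undefined r))"
      using w \<omega> r by (intro psum_mono) (auto simp: weight_def indicator_def ennreal_le_1)
    also have "\<dots> \<le> of_nat N" by (rule N[OF \<omega>])
    finally show "psum \<omega> (\<lambda>x. ennreal (w \<omega> x) * indicator B x) \<le> of_nat N" .
  qed
  also have "\<dots> < \<infinity>" using Pr.emeasure_space_1 unfolding space_Pr by (simp add: space_Pr emeasure_Pr emeasure_\<Omega> less_top[symmetric] ennreal_of_nat_eq_real_of_nat)
  finally show ?thesis .
qed

lemma sigma_finite_wmeas: assumes "weight w" shows "sigma_finite_measure (wmeas w)"
proof
  let ?A = "range (\<lambda>n :: nat. cball (undefined :: 'x) (real n))"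
  have "(\<Union>n :: nat. cball (undefined :: 'x) (real n)) = UNIV" by (auto simp: real_arch_simple)
  moreover have "emeasure (wmeas w) (cball undefined (real n)) \<noteq> \<infinity>" for n
    using wmeas_bounded_finite[OF assms, of "cball undefined (real n)"] by (simp add: less_top)
  ultimately show "\<exists>A. countable A \<and> A \<subseteq> sets (wmeas w) \<and> \<Union>A = space (wmeas w) \<and> (\<forall>a\<in>A. emeasure (wmeas w) a \<noteq> \<infinity>)"
    by (intro exI[of _ ?A]) auto
qed

lemma config_act_Pr [measurable]: "config_act act g \<in> measurable Pr Pr"
  by (rule measurable_restrict_space3[OF config_act_measurable]) (use config_act_\<Omega> in blast)

lemma distr_Pr: "distr Pr Pr (config_act act g) = Pr"
proof (rule measure_eqI)
  fix B assume "B \<in> sets (distr Pr Pr (config_act act g))"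
  then have B: "B \<in> sets Pr" by simp
  then have B': "B \<in> sets \<mu>" "B \<subseteq> \<Omega>" using sets_Pr by auto
  have sub: "config_act act g -` B \<inter> space \<mu> \<subseteq> \<Omega>"
  proof
    fix \<omega> assume "\<omega> \<in> config_act act g -` B \<inter> space \<mu>"
    then have "config_act act (- g) (config_act act g \<omega>) \<in> \<Omega>" using B' config_act_\<Omega> by blast
    then show "\<omega> \<in> \<Omega>" using config_act_inverse[of "- g" \<omega>] by simp
  qed
  have "emeasure (distr Pr Pr (config_act act g)) B = emeasure Pr (config_act act g -` B \<inter> space Pr)"
    by (rule emeasure_distr[OF config_act_Pr B])
  also have "config_act act g -` B \<inter> space Pr = config_act act g -` B \<inter> space \<mu>"
    using sub \<Omega>_inter unfolding space_Pr by blast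
  also have "emeasure Pr \<dots> = emeasure \<mu> \<dots>" by (rule emeasure_Pr[OF sub])
  also have "\<dots> = emeasure (distr \<mu> \<mu> (config_act act g)) B"
    by (rule emeasure_distr[OF config_act_measurable B'(1), symmetric])
  also have "\<dots> = emeasure Pr B" unfolding distr_config_act by (rule emeasure_Pr[OF B'(2), symmetric])
  finally show "emeasure (distr Pr Pr (config_act act g)) B = emeasure Pr B" .
qed simp

definition inv_weight :: "(('x, 'c) config \<Rightarrow> 'x \<Rightarrow> real) \<Rightarrow> bool" where
  "inv_weight w \<longleftrightarrow> weight w \<and> (\<forall>g. \<forall>\<omega>\<in>\<Omega>. \<forall>x\<in>dom \<omega>. w (config_act act g \<omega>) (act g x) = w \<omega> x)"

lemma wmeas_act:
  assumes w: "inv_weight w" and f: "f \<in> borel_measurable borel"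
  shows "(\<integral>\<^sup>+x. f (act g x) \<partial>wmeas w) = (\<integral>\<^sup>+x. f x \<partial>wmeas w)"
proof -
  have w': "weight w" using w by (simp add: inv_weight_def)
  let ?G = "\<lambda>\<omega>. psum \<omega> (\<lambda>x. ennreal (w \<omega> x) * f x)"
  have "(\<integral>\<^sup>+x. f (act g x) \<partial>wmeas w) = (\<integral>\<^sup>+\<omega>. psum \<omega> (\<lambda>x. ennreal (w \<omega> x) * f (act g x)) \<partial>Pr)"
    by (rule nn_integral_wmeas[OF w' measurable_compose[OF act_measurable1 f]])
  also have "\<dots> = (\<integral>\<^sup>+\<omega>. ?G (config_act act g \<omega>) \<partial>Pr)"
    unfolding psum_config_act
    by (intro nn_integral_cong psum_cong) (use w in \<open>auto simp: inv_weight_def space_Pr\<close>)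
  also have "\<dots> = (\<integral>\<^sup>+\<omega>. ?G \<omega> \<partial>distr Pr Pr (config_act act g))"
    by (subst nn_integral_distr[OF config_act_Pr]) (simp_all add: psum_measurable[OF w' f])
  also have "\<dots> = (\<integral>\<^sup>+\<omega>. ?G \<omega> \<partial>Pr)" unfolding distr_Pr ..
  finally show ?thesis by (simp add: nn_integral_wmeas[OF w' f])
qed

text \<open>Tonelli's theorem and invariance of \<open>wmeas w\<close> move the group element from
  \<open>f\<close> to the indicator. The elements \<open>g\<close> that carry \<open>x\<close> into
  \<open>IF I\<close> are those with \<open>g + \<Phi> x\<close> in \<open>I\<close>; right
  invariance of the Haar measure gives them mass \<open>|I|\<close>.\<close>

lemma mass_transport:
  assumes w: "inv_weight w" and f [measurable]: "f \<in> borel_measurable borel" and I: "compact I"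
  shows "(\<integral>\<^sup>+x. indicator (IF I) x * (\<integral>\<^sup>+g. f (act (- g) x) \<partial>haar) \<partial>wmeas w) = emeasure haar I * (\<integral>\<^sup>+x. f x \<partial>wmeas w)"
proof -
  have w': "weight w" using w by (simp add: inv_weight_def)
  interpret W: sigma_finite_measure "wmeas w" by (rule sigma_finite_wmeas[OF w'])
  interpret WH: pair_sigma_finite "wmeas w" haar by unfold_locales
  note [measurable] = IF_borel[OF I]
  have neg [measurable]: "uminus \<in> borel_measurable (borel :: 'g measure)"
    by (intro borel_measurable_continuous_onI continuous_intros)
  have s: "sets (wmeas w \<Otimes>\<^sub>M haar) = sets (borel \<Otimes>\<^sub>M borel)" by (intro sets_pair_measure_cong) simp_all
  have a1: "(\<lambda>(x, g). act g x) \<in> borel_measurable (borel \<Otimes>\<^sub>M borel)"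
    using measurable_compose[OF measurable_pair_swap' act_measurable] by (simp add: case_prod_unfold)
  have "(\<lambda>z. (fst z, - snd z)) \<in> measurable (borel \<Otimes>\<^sub>M borel) (borel \<Otimes>\<^sub>M borel :: ('x \<times> 'g) measure)" by measurable
  from measurable_compose[OF this a1]
  have a2: "(\<lambda>(x, g). act (- g) x) \<in> borel_measurable (borel \<Otimes>\<^sub>M borel)" by (simp add: case_prod_unfold)
  have m1: "(\<lambda>(x, g). indicator (IF I) x * f (act (- g) x)) \<in> borel_measurable (wmeas w \<Otimes>\<^sub>M haar)"
    unfolding measurable_cong_sets[OF s refl] using measurable_compose[OF a2 f] by (simp add: case_prod_unfold)
  have m2: "(\<lambda>(x, g). indicator (IF I) (act g x) * f x) \<in> borel_measurable (wmeas w \<Otimes>\<^sub>M haar)"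
    unfolding measurable_cong_sets[OF s refl]
    using measurable_compose[OF a1, of "indicator (IF I) :: _ \<Rightarrow> ennreal"] by (simp add: case_prod_unfold)
  have "(\<integral>\<^sup>+x. indicator (IF I) x * (\<integral>\<^sup>+g. f (act (- g) x) \<partial>haar) \<partial>wmeas w) =
      (\<integral>\<^sup>+x. (\<integral>\<^sup>+g. indicator (IF I) x * f (act (- g) x) \<partial>haar) \<partial>wmeas w)"
  proof (rule nn_integral_cong)
    fix x
    have "(\<lambda>g. act (- g) x) \<in> borel_measurable borel"
      using measurable_Pair2[OF a2, of x] by simp
    then have "(\<lambda>g. f (act (- g) x)) \<in> borel_measurable haar"
      unfolding measurable_cong_sets[OF haar.sets_M refl] by (rule measurable_compose[OF _ f])
    then show "indicator (IF I) x * (\<integral>\<^sup>+g. f (act (- g) x) \<partial>haar) = (\<integral>\<^sup>+g. indicator (IF I) x * f (act (- g) x) \<partial>haar)"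
      by (rule nn_integral_cmult[symmetric])
  qed
  also have "\<dots> = (\<integral>\<^sup>+g. (\<integral>\<^sup>+x. indicator (IF I) x * f (act (- g) x) \<partial>wmeas w) \<partial>haar)"
    by (rule WH.Fubini'[OF m1, symmetric])
  also have "\<dots> = (\<integral>\<^sup>+g. (\<integral>\<^sup>+x. indicator (IF I) (act g x) * f x \<partial>wmeas w) \<partial>haar)"
  proof (rule nn_integral_cong)
    fix g
    have "(\<lambda>x. indicator (IF I) x * f (act (- g) x)) \<in> borel_measurable borel" by measurable
    from wmeas_act[OF w this, of g]
    show "(\<integral>\<^sup>+x. indicator (IF I) x * f (act (- g) x) \<partial>wmeas w) = (\<integral>\<^sup>+x. indicator (IF I) (act g x) * f x \<partial>wmeas w)"
      by (simp add: act_minus)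
  qed
  also have "\<dots> = (\<integral>\<^sup>+x. (\<integral>\<^sup>+g. indicator (IF I) (act g x) * f x \<partial>haar) \<partial>wmeas w)"
    by (rule WH.Fubini'[OF m2])
  also have "\<dots> = (\<integral>\<^sup>+x. emeasure haar I * f x \<partial>wmeas w)"
  proof (rule nn_integral_cong)
    fix x
    have Ib [measurable]: "I \<in> sets borel" using I by (rule borel_compact)
    have "(\<integral>\<^sup>+g. indicator (IF I) (act g x) * f x \<partial>haar) = (\<integral>\<^sup>+g. indicator I (g + \<Phi> x) * f x \<partial>haar)"
      by (intro nn_integral_cong) (simp add: indicator_def IF_iff \<Phi>_act)
    also have "\<dots> = (\<integral>\<^sup>+g. indicator I g * f x \<partial>haar)"
      by (rule haar.nn_integral_right[of "\<lambda>g. indicator I g * f x"]) measurable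
    also have "\<dots> = emeasure haar I * f x"
      using Ib by (subst nn_integral_multc) simp_all
    finally show "(\<integral>\<^sup>+g. indicator (IF I) (act g x) * f x \<partial>haar) = emeasure haar I * f x" .
  qed
  also have "\<dots> = emeasure haar I * (\<integral>\<^sup>+x. f x \<partial>wmeas w)" by (rule nn_integral_cmult) simp
  finally show ?thesis .
qed

lemma u_borel [measurable]: "u \<in> borel_measurable borel" using averaging by (simp add: averaging_function_def)

lemma u_bounded: obtains K r where "K \<ge> 0" "\<And>x. \<bar>u x\<bar> \<le> K" "\<And>x. u x \<noteq> 0 \<Longrightarrow> x \<in> cball undefined r"
proof -
  obtain K where K: "\<And>x. norm (u x) \<le> K" using averaging by (auto simp: averaging_function_def bounded_iff)
  have "compact (closure {x. u x \<noteq> 0})" using averaging by (simp add: averaging_function_def compactly_supported_def)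
  then have "bounded (closure {x. u x \<noteq> 0})" by (rule compact_imp_bounded)
  then obtain r where "\<forall>y\<in>closure {x. u x \<noteq> 0}. dist undefined y \<le> r"
    unfolding bounded_any_center[where a = "undefined :: 'x"] by blast
  then have "x \<in> cball undefined r" if "u x \<noteq> 0" for x using that closure_subset[of "{x. u x \<noteq> 0}"] by auto
  moreover have "K \<ge> 0" using K[of undefined] norm_ge_zero order_trans by blast
  ultimately show thesis using that K by auto
qed

lemma
  assumes w: "weight w"
  shows integrable_u: "integrable (wmeas w) u"
    and u_parts_finite: "(\<integral>\<^sup>+x. ennreal (u x) \<partial>wmeas w) < \<infinity>" "(\<integral>\<^sup>+x. ennreal (- u x) \<partial>wmeas w) < \<infinity>"
proof -
  obtain K r where u: "K \<ge> 0" "\<And>x. \<bar>u x\<bar> \<le> K" "\<And>x. u x \<noteq> 0 \<Longrightarrow> x \<in> cball undefined r" by (rule u_bounded) blast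
  have fin: "emeasure (wmeas w) (cball undefined r) < \<infinity>" by (rule wmeas_bounded_finite[OF w]) auto
  have b: "(\<integral>\<^sup>+x. ennreal \<bar>u x\<bar> \<partial>wmeas w) < \<infinity>"
  proof -
    have "(\<integral>\<^sup>+x. ennreal \<bar>u x\<bar> \<partial>wmeas w) \<le> (\<integral>\<^sup>+x. ennreal K * indicator (cball undefined r) x \<partial>wmeas w)"
      using u(2,3) by (intro nn_integral_mono) (force simp: indicator_def intro: ennreal_leI)
    also have "\<dots> = ennreal K * emeasure (wmeas w) (cball undefined r)" by (rule nn_integral_cmult_indicator) simp
    also have "\<dots> < \<infinity>" using fin by (simp add: ennreal_mult_less_top)
    finally show ?thesis .
  qed
  show "integrable (wmeas w) u" unfolding integrable_iff_bounded using b by simp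
  have "(\<integral>\<^sup>+x. ennreal (u x) \<partial>wmeas w) \<le> (\<integral>\<^sup>+x. ennreal \<bar>u x\<bar> \<partial>wmeas w)"
       "(\<integral>\<^sup>+x. ennreal (- u x) \<partial>wmeas w) \<le> (\<integral>\<^sup>+x. ennreal \<bar>u x\<bar> \<partial>wmeas w)"
    by (intro nn_integral_mono ennreal_leI; simp)+
  then show "(\<integral>\<^sup>+x. ennreal (u x) \<partial>wmeas w) < \<infinity>" "(\<integral>\<^sup>+x. ennreal (- u x) \<partial>wmeas w) < \<infinity>"
    using b by (auto intro: le_less_trans)
qed

text \<open>\<open>u\<close> may change sign, so its normalisation is written additively in terms of
  positive and negative part, which is meaningful for extended nonnegative integrals.\<close>

lemma u_orbit:
  "(\<integral>\<^sup>+g. ennreal (u (act (- g) x)) \<partial>haar) = 1 + (\<integral>\<^sup>+g. ennreal (- u (act (- g) x)) \<partial>haar)"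
proof -
  have h: "has_bochner_integral haar (\<lambda>g. u (act (- g) x)) 1" using averaging by (simp add: averaging_function_def)
  let ?A = "\<integral>\<^sup>+g. ennreal (u (act (- g) x)) \<partial>haar" and ?B = "\<integral>\<^sup>+g. ennreal (- u (act (- g) x)) \<partial>haar"
  have i: "integrable haar (\<lambda>g. u (act (- g) x))" and e: "(\<integral>g. u (act (- g) x) \<partial>haar) = 1"
    using h by (auto simp: has_bochner_integral_iff)
  have f: "?A \<noteq> \<infinity>" "?B \<noteq> \<infinity>" using i by (auto simp: real_integrable_def)
  have "enn2real ?A = 1 + enn2real ?B" using real_lebesgue_integral_def[OF i] e by simp
  then have "ennreal (enn2real ?A) = ennreal 1 + ennreal (enn2real ?B)" by (simp add: ennreal_plus[symmetric] del: ennreal_plus ennreal_1)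
  then show ?thesis using f by (simp add: less_top)
qed

text \<open>Mass transport for the positive and for the negative part of \<open>u\<close>, combined
  by \<open>u_orbit\<close>; the finite negative contribution cancels. Comparing the two parts on a
  single set \<open>I0\<close> of positive finite measure gives nonnegativity.\<close>

lemma
  assumes w: "inv_weight w"
  shows wmeas_IF: "compact I \<Longrightarrow> emeasure (wmeas w) (IF I) = emeasure haar I * ennreal (\<integral>x. u x \<partial>wmeas w)"
    and integral_u_nonneg: "0 \<le> (\<integral>x. u x \<partial>wmeas w)"
proof -
  have w': "weight w" using w by (simp add: inv_weight_def)
  let ?C = "\<integral>\<^sup>+x. ennreal (u x) \<partial>wmeas w" and ?B = "\<integral>\<^sup>+x. ennreal (- u x) \<partial>wmeas w"
  have fin: "?C < \<infinity>" "?B < \<infinity>" using u_parts_finite[OF w'] by auto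
  have key: "emeasure (wmeas w) (IF I) + emeasure haar I * ?B = emeasure haar I * ?C" if I: "compact I" for I
  proof -
    note [measurable] = IF_borel[OF I]
    have um: "(\<lambda>x. \<integral>\<^sup>+g. ennreal (- u (act (- g) x)) \<partial>haar) \<in> borel_measurable borel"
    proof -
      have neg [measurable]: "uminus \<in> borel_measurable (borel :: 'g measure)"
        by (intro borel_measurable_continuous_onI continuous_intros)
      have "(\<lambda>z. (- snd z, fst z)) \<in> measurable (borel \<Otimes>\<^sub>M borel) (borel \<Otimes>\<^sub>M borel :: ('g \<times> 'x) measure)" by measurable
      from measurable_compose[OF this act_measurable]
      have [measurable]: "(\<lambda>z. act (- snd z) (fst z)) \<in> borel_measurable (borel \<Otimes>\<^sub>M borel)" by (simp add: case_prod_unfold)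
      have "(\<lambda>z. ennreal (- u (act (- snd z) (fst z)))) \<in> borel_measurable (borel \<Otimes>\<^sub>M borel)" by measurable
      then have "(\<lambda>z. ennreal (- u (act (- snd z) (fst z)))) \<in> borel_measurable (borel \<Otimes>\<^sub>M haar)"
        by (subst measurable_cong_sets[OF sets_pair_measure_cong[OF refl haar.sets_M] refl])
      from sigma_finite_measure.borel_measurable_nn_integral_fst[OF haar.sigma_finite this] show ?thesis by simp
    qed
    have "emeasure haar I * ?C = (\<integral>\<^sup>+x. indicator (IF I) x * (\<integral>\<^sup>+g. ennreal (u (act (- g) x)) \<partial>haar) \<partial>wmeas w)"
      by (rule mass_transport[OF w _ I, symmetric]) measurable
    also have "\<dots> = (\<integral>\<^sup>+x. indicator (IF I) x + indicator (IF I) x * (\<integral>\<^sup>+g. ennreal (- u (act (- g) x)) \<partial>haar) \<partial>wmeas w)"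
      by (intro nn_integral_cong) (simp add: u_orbit distrib_left)
    also have "\<dots> = (\<integral>\<^sup>+x. indicator (IF I) x \<partial>wmeas w) + (\<integral>\<^sup>+x. indicator (IF I) x * (\<integral>\<^sup>+g. ennreal (- u (act (- g) x)) \<partial>haar) \<partial>wmeas w)"
      using um by (intro nn_integral_add) (simp_all add: measurable_cong_sets[OF sets_wmeas refl])
    also have "(\<integral>\<^sup>+x. indicator (IF I) x * (\<integral>\<^sup>+g. ennreal (- u (act (- g) x)) \<partial>haar) \<partial>wmeas w) = emeasure haar I * ?B"
      by (rule mass_transport[OF w _ I]) measurable
    finally show ?thesis using IF_borel[OF I] by simp
  qed
  have Ceq: "?C = ennreal (enn2real ?C)" "?B = ennreal (enn2real ?B)" using fin by (auto simp: less_top)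
  have int: "(\<integral>x. u x \<partial>wmeas w) = enn2real ?C - enn2real ?B" by (rule real_lebesgue_integral_def[OF integrable_u[OF w']])
  obtain I0 where I0: "compact I0" "emeasure haar I0 \<noteq> 0" using bounded_\<Phi>[of "{}"] by auto
  have I0f: "emeasure haar I0 \<noteq> \<infinity>" using haar.emeasure_compact[OF I0(1)] by auto
  have le: "?B \<le> ?C"
  proof -
    have "emeasure haar I0 * ?B \<le> emeasure haar I0 * ?C" using key[OF I0(1), symmetric] by (simp add: add_increasing)
    then show ?thesis using I0(2) I0f by (subst (asm) ennreal_mult_le_mult_iff) auto
  qed
  have "enn2real ?B \<le> enn2real ?C" by (rule enn2real_mono[OF le]) (use fin in simp)
  then show nn: "0 \<le> (\<integral>x. u x \<partial>wmeas w)" using int by simp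
  have C: "?C = ennreal (\<integral>x. u x \<partial>wmeas w) + ?B"
  proof -
    have "ennreal (\<integral>x. u x \<partial>wmeas w) + ennreal (enn2real ?B) = ennreal (enn2real ?C)"
      by (subst ennreal_plus[symmetric]) (use nn int in simp_all)
    then show ?thesis using Ceq by simp
  qed
  show "emeasure (wmeas w) (IF I) = emeasure haar I * ennreal (\<integral>x. u x \<partial>wmeas w)" if I: "compact I"
  proof -
    have "emeasure (wmeas w) (IF I) + emeasure haar I * ?B = emeasure haar I * ennreal (\<integral>x. u x \<partial>wmeas w) + emeasure haar I * ?B"
      by (subst key[OF I], subst C) (simp add: distrib_left)
    moreover have "emeasure haar I * ?B \<noteq> \<infinity>"
      using haar.emeasure_compact[OF I] fin by (auto simp: ennreal_mult_eq_top_iff)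
    ultimately show ?thesis by (simp add: ennreal_add_left_cancel add.commute)
  qed
qed

lemma wmeas_null_iff:
  assumes w: "weight w"
  shows "emeasure (wmeas w) UNIV = 0 \<longleftrightarrow> (AE \<omega> in Pr. \<forall>x\<in>dom \<omega>. w \<omega> x = 0)"
proof -
  have m: "(\<lambda>\<omega>. psum \<omega> (\<lambda>x. ennreal (w \<omega> x))) \<in> borel_measurable Pr"
    using psum_measurable[OF w, of "\<lambda>x. 1"] by simp
  have "emeasure (wmeas w) UNIV = (\<integral>\<^sup>+\<omega>. psum \<omega> (\<lambda>x. ennreal (w \<omega> x)) \<partial>Pr)"
    using emeasure_wmeas[OF w, of UNIV] by simp
  then have "emeasure (wmeas w) UNIV = 0 \<longleftrightarrow> (AE \<omega> in Pr. psum \<omega> (\<lambda>x. ennreal (w \<omega> x)) = 0)"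
    using nn_integral_0_iff_AE[OF m] by simp
  also have "\<dots> \<longleftrightarrow> (AE \<omega> in Pr. \<forall>x\<in>dom \<omega>. w \<omega> x = 0)"
  proof (rule AE_cong)
    fix \<omega> assume "\<omega> \<in> space Pr"
    then have \<omega>: "\<omega> \<in> \<Omega>" by (simp add: space_Pr)
    have "psum \<omega> (\<lambda>x. ennreal (w \<omega> x)) = 0 \<longleftrightarrow> (\<forall>x\<in>dom \<omega>. ennreal (w \<omega> x) = 0)"
      unfolding psum_def by (subst nn_integral_0_iff_AE) (auto simp: AE_count_space)
    also have "\<dots> \<longleftrightarrow> (\<forall>x\<in>dom \<omega>. w \<omega> x = 0)" using w \<omega> by (auto simp: weight_def ennreal_eq_0_iff intro: antisym)
    finally show "psum \<omega> (\<lambda>x. ennreal (w \<omega> x)) = 0 \<longleftrightarrow> (\<forall>x\<in>dom \<omega>. w \<omega> x = 0)" .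
  qed
  finally show ?thesis .
qed

text \<open>Every ball of the space lies in some \<open>IF I\<close>, whose mass is a multiple of
  the integral, so a zero integral forces the zero measure.\<close>

lemma integral_u_zero_iff:
  assumes w: "inv_weight w"
  shows "(\<integral>x. u x \<partial>wmeas w) = 0 \<longleftrightarrow> (AE \<omega> in Pr. \<forall>x\<in>dom \<omega>. w \<omega> x = 0)"
proof -
  have w': "weight w" using w by (simp add: inv_weight_def)
  have "(\<integral>x. u x \<partial>wmeas w) = 0 \<longleftrightarrow> emeasure (wmeas w) UNIV = 0"
  proof
    assume z: "(\<integral>x. u x \<partial>wmeas w) = 0"
    have "cball undefined (real n) \<in> null_sets (wmeas w)" for n :: nat
    proof -
      obtain I where I: "compact I" "cball (undefined :: 'x) (real n) \<subseteq> IF I" using bounded_\<Phi>[OF bounded_cball] by blast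
      have "IF I \<in> null_sets (wmeas w)" using wmeas_IF[OF w I(1)] z IF_borel[OF I(1)] by (auto simp: null_sets_def)
      then show ?thesis by (rule null_sets_subset[OF _ _ I(2)]) simp
    qed
    then have "(\<Union>n :: nat. cball (undefined :: 'x) (real n)) \<in> null_sets (wmeas w)" by (intro null_sets_UN) auto
    moreover have "(\<Union>n :: nat. cball (undefined :: 'x) (real n)) = UNIV" by (auto simp: real_arch_simple)
    ultimately show "emeasure (wmeas w) UNIV = 0" by auto
  next
    assume "emeasure (wmeas w) UNIV = 0"
    then have "UNIV \<in> null_sets (wmeas w)" by auto
    then have "AE x in wmeas w. u x = 0" by (rule AE_I'[where N = UNIV]) auto
    then show "(\<integral>x. u x \<partial>wmeas w) = 0" by (rule integral_eq_zero_AE)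
  qed
  then show ?thesis using wmeas_null_iff[OF w'] by simp
qed

section \<open>Measurable sections and Hermitian symmetry\<close>

definition C :: real where
  "C = (SOME c. 0 \<le> c \<and> (\<forall>\<omega>\<in>\<Omega>. \<forall>v\<in>ell2 (dom \<omega>).
     ham \<iota> \<omega> v \<in> ell2 (dom \<omega>) \<and> ell2_norm (dom \<omega>) (ham \<iota> \<omega> v) \<le> c * ell2_norm (dom \<omega>) v))"

definition R :: real where
  "R = (SOME r. \<forall>\<omega>\<in>\<Omega>. \<forall>x\<in>dom \<omega>. \<forall>y\<in>dom \<omega>. r \<le> dist x y \<longrightarrow> ham_entry \<iota> \<omega> x y = 0)"

lemma C_nonneg: "0 \<le> C"
  and ham_bounded: "\<And>\<omega> v. \<omega> \<in> \<Omega> \<Longrightarrow> v \<in> ell2 (dom \<omega>) \<Longrightarrow>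
     ham \<iota> \<omega> v \<in> ell2 (dom \<omega>) \<and> ell2_norm (dom \<omega>) (ham \<iota> \<omega> v) \<le> C * ell2_norm (dom \<omega>) v"
proof -
  obtain c where c: "\<forall>\<omega>\<in>\<Omega>. \<forall>v\<in>ell2 (dom \<omega>).
     ham \<iota> \<omega> v \<in> ell2 (dom \<omega>) \<and> ell2_norm (dom \<omega>) (ham \<iota> \<omega> v) \<le> c * ell2_norm (dom \<omega>) v"
    using condition_A unfolding condition_A_def uniformly_bounded_def by (elim conjE exE)
  \<comment> \<open>Nothing in \<open>uniformly_bounded\<close> makes its constant nonnegative,
    which \<open>matrix_operator\<close> asks for.\<close>
  have "0 \<le> max c 0 \<and> (\<forall>\<omega>\<in>\<Omega>. \<forall>v\<in>ell2 (dom \<omega>).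
     ham \<iota> \<omega> v \<in> ell2 (dom \<omega>) \<and> ell2_norm (dom \<omega>) (ham \<iota> \<omega> v) \<le> max c 0 * ell2_norm (dom \<omega>) v)"
  proof (intro conjI ballI)
    fix \<omega> v assume v: "\<omega> \<in> \<Omega>" "v \<in> ell2 (dom \<omega>)"
    have n: "0 \<le> ell2_norm (dom \<omega>) v" unfolding ell2_norm_l2[OF v(2)] by simp
    have "ell2_norm (dom \<omega>) (ham \<iota> \<omega> v) \<le> c * ell2_norm (dom \<omega>) v" using c v by blast
    also have "\<dots> \<le> max c 0 * ell2_norm (dom \<omega>) v" by (intro mult_right_mono n) simp
    finally show "ell2_norm (dom \<omega>) (ham \<iota> \<omega> v) \<le> max c 0 * ell2_norm (dom \<omega>) v" .
  qed (use c in auto)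
  then have *: "0 \<le> C \<and> (\<forall>\<omega>\<in>\<Omega>. \<forall>v\<in>ell2 (dom \<omega>).
     ham \<iota> \<omega> v \<in> ell2 (dom \<omega>) \<and> ell2_norm (dom \<omega>) (ham \<iota> \<omega> v) \<le> C * ell2_norm (dom \<omega>) v)"
    unfolding C_def by (rule someI)
  then show "0 \<le> C" by (rule conjunct1)
  fix \<omega> v assume "\<omega> \<in> \<Omega>" "v \<in> ell2 (dom \<omega>)"
  with * show "ham \<iota> \<omega> v \<in> ell2 (dom \<omega>) \<and> ell2_norm (dom \<omega>) (ham \<iota> \<omega> v) \<le> C * ell2_norm (dom \<omega>) v" by blast
qed

lemma hopping_range: "\<omega> \<in> \<Omega> \<Longrightarrow> x \<in> dom \<omega> \<Longrightarrow> y \<in> dom \<omega> \<Longrightarrow> R \<le> dist x y \<Longrightarrow> ham_entry \<iota> \<omega> x y = 0"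
proof -
  obtain r where "\<forall>\<omega>\<in>\<Omega>. \<forall>x\<in>dom \<omega>. \<forall>y\<in>dom \<omega>. r \<le> dist x y \<longrightarrow> ham_entry \<iota> \<omega> x y = 0"
    using condition_A unfolding condition_A_def finite_hopping_range_def by (elim conjE exE)
  then have "\<forall>\<omega>\<in>\<Omega>. \<forall>x\<in>dom \<omega>. \<forall>y\<in>dom \<omega>. R \<le> dist x y \<longrightarrow> ham_entry \<iota> \<omega> x y = 0"
    unfolding R_def by (rule someI)
  then show "\<omega> \<in> \<Omega> \<Longrightarrow> x \<in> dom \<omega> \<Longrightarrow> y \<in> dom \<omega> \<Longrightarrow> R \<le> dist x y \<Longrightarrow> ham_entry \<iota> \<omega> x y = 0" by blast
qed

text \<open>Measurability of what \<open>H\<close> produces is known only through its action on the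
  direct integral. Uniformly bounded measurable sections belong to that space and are preserved by
  \<open>H\<close>, so every operator polynomial can be traced through them.\<close>

definition bounded_section :: "(('x, 'c) config \<Rightarrow> 'x l2) \<Rightarrow> bool" where
  "bounded_section F \<longleftrightarrow> (\<forall>\<omega>\<in>\<Omega>. \<forall>x. x \<notin> dom \<omega> \<longrightarrow> fun_of (F \<omega>) x = 0) \<and>
     (\<lambda>(\<omega>, x). fun_of (F \<omega>) x) \<in> borel_measurable (Pr \<Otimes>\<^sub>M borel) \<and>
     (\<exists>c. \<forall>\<omega>\<in>\<Omega>. norm (F \<omega>) \<le> c)"

lemma section_ell2: "bounded_section F \<Longrightarrow> \<omega> \<in> \<Omega> \<Longrightarrow> fun_of (F \<omega>) \<in> ell2 (dom \<omega>)"
  by (auto simp: bounded_section_def ell2_iff sq_summable_fun_of)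

lemma section_direct: assumes F: "bounded_section F" shows "(\<lambda>\<omega>. fun_of (F \<omega>)) \<in> direct_integral \<mu> \<Omega>"
proof -
  obtain c where c: "\<And>\<omega>. \<omega> \<in> \<Omega> \<Longrightarrow> norm (F \<omega>) \<le> c" using F unfolding bounded_section_def by blast
  have "(\<integral>\<^sup>+\<omega>\<in>\<Omega>. ennreal ((ell2_norm (dom \<omega>) (fun_of (F \<omega>)))\<^sup>2) \<partial>\<mu>) \<le> (\<integral>\<^sup>+\<omega>. ennreal (c\<^sup>2) \<partial>\<mu>)"
  proof (rule nn_integral_mono)
    fix \<omega>
    have "(norm (F \<omega>))\<^sup>2 \<le> c\<^sup>2" if "\<omega> \<in> \<Omega>" using c[OF that] by (intro power_mono) auto
    then show "ennreal ((ell2_norm (dom \<omega>) (fun_of (F \<omega>)))\<^sup>2) * indicator \<Omega> \<omega> \<le> ennreal (c\<^sup>2)"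
      using F by (auto simp: indicator_def bounded_section_def ell2_norm_fun_of intro: ennreal_leI)
  qed
  also have "\<dots> < \<infinity>" using prob_space.emeasure_space_1[OF prob_\<mu>] by simp
  finally show ?thesis using F section_ell2[OF F] by (auto simp: direct_integral_def bounded_section_def)
qed

lemma ham_direct: "f \<in> direct_integral \<mu> \<Omega> \<Longrightarrow> (\<lambda>\<omega>. ham \<iota> \<omega> (f \<omega>)) \<in> direct_integral \<mu> \<Omega>"
  and ham_symmetric: "f \<in> direct_integral \<mu> \<Omega> \<Longrightarrow> g \<in> direct_integral \<mu> \<Omega> \<Longrightarrow>
      direct_integral_inner \<mu> \<Omega> (\<lambda>\<omega>. ham \<iota> \<omega> (f \<omega>)) g = direct_integral_inner \<mu> \<Omega> f (\<lambda>\<omega>. ham \<iota> \<omega> (g \<omega>))"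
  using condition_A unfolding condition_A_def selfadjoint_direct_integral_def by blast+

lemma section_at_pt:
  assumes "(\<lambda>(\<omega>, x). f \<omega> x) \<in> borel_measurable (Pr \<Otimes>\<^sub>M borel)"
  shows "(\<lambda>\<omega>. f \<omega> (pt i \<omega>)) \<in> borel_measurable Pr"
proof -
  have "(\<lambda>\<omega>. (\<omega>, pt i \<omega>)) \<in> measurable Pr (Pr \<Otimes>\<^sub>M borel)" by measurable
  from measurable_compose[OF this assms] show ?thesis by simp
qed

text \<open>The test section: the point mass at the \<open>i\<close>-th point, switched on over the
  event \<open>B\<close> only. Letting \<open>B\<close> vary localises identities of
  integrals.\<close>

definition dsec :: "nat \<Rightarrow> ('x, 'c) config set \<Rightarrow> ('x, 'c) config \<Rightarrow> 'x l2" where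
  "dsec i B \<omega> = (if hit i \<omega> then del (pt i \<omega>) (indicator B \<omega>) else 0)"

lemma fun_of_dsec: "fun_of (dsec i B \<omega>) x = (if hit i \<omega> \<and> x = pt i \<omega> then indicator B \<omega> else 0)"
  by (simp add: dsec_def fun_of_del l2_fun_simps)

lemma bounded_section_dsec: assumes B: "B \<in> sets Pr" shows "bounded_section (dsec i B)"
  unfolding bounded_section_def
proof (intro conjI ballI allI impI exI[of _ 1])
  fix \<omega> assume \<omega>: "\<omega> \<in> \<Omega>"
  show "norm (dsec i B \<omega>) \<le> 1" by (simp add: dsec_def norm_del indicator_def)
  fix x assume "x \<notin> dom \<omega>"
  then show "fun_of (dsec i B \<omega>) x = 0" using pt_dom(1)[OF \<omega>] by (auto simp: fun_of_dsec)
next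
  have [measurable]: "Measurable.pred (Pr \<Otimes>\<^sub>M borel) (\<lambda>z. snd z = pt i (fst z))"
    unfolding pred_def by (intro measurable_equality_set measurable_snd measurable_compose[OF measurable_fst pt_measurable])
  have [measurable]: "Measurable.pred (Pr \<Otimes>\<^sub>M (borel :: 'x measure)) (\<lambda>z. hit i (fst z))"
    by (rule measurable_compose[OF measurable_fst hit_measurable])
  have [measurable]: "(\<lambda>z. indicator B (fst z) :: complex) \<in> borel_measurable (Pr \<Otimes>\<^sub>M (borel :: 'x measure))"
    using B by (intro measurable_compose[OF measurable_fst]) simp
  have "(\<lambda>z. if hit i (fst z) \<and> snd z = pt i (fst z) then indicator B (fst z) else (0::complex)) \<in> borel_measurable (Pr \<Otimes>\<^sub>M borel)"
    by (intro measurable_If) measurable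
  then show "(\<lambda>(\<omega>, x). fun_of (dsec i B \<omega>) x) \<in> borel_measurable (Pr \<Otimes>\<^sub>M borel)"
    by (simp add: fun_of_dsec case_prod_unfold)
qed

lemma ham_del: "ham \<iota> \<omega> (fun_of (del y z)) x = (if x \<in> dom \<omega> \<and> y \<in> dom \<omega> then ham_entry \<iota> \<omega> x y * z else 0)"
proof -
  have "(\<Sum>\<^sub>\<infinity>k\<in>dom \<omega>. ham_entry \<iota> \<omega> x k * fun_of (del y z) k) = (\<Sum>\<^sub>\<infinity>k\<in>dom \<omega> \<inter> {y}. ham_entry \<iota> \<omega> x k * fun_of (del y z) k)"
    by (rule infsum_cong_neutral) (auto simp: fun_of_del)
  then show ?thesis by (auto simp: ham_def fun_of_del)
qed

lemma ham_dsec: "ham \<iota> \<omega> (fun_of (dsec i B \<omega>)) x =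
    (if hit i \<omega> \<and> x \<in> dom \<omega> \<and> pt i \<omega> \<in> dom \<omega> then ham_entry \<iota> \<omega> x (pt i \<omega>) * indicator B \<omega> else 0)"
proof (cases "hit i \<omega>")
  case True
  then show ?thesis by (simp add: dsec_def ham_del)
next
  case False
  then show ?thesis by (simp add: dsec_def ham_def l2_fun_simps)
qed

lemma ham_entry_bound: assumes "\<omega> \<in> \<Omega>" "x \<in> dom \<omega>" "y \<in> dom \<omega>" shows "cmod (ham_entry \<iota> \<omega> x y) \<le> C"
proof -
  have d: "fun_of (del y 1) \<in> ell2 (dom \<omega>)" using assms by (auto simp: ell2_iff sq_summable_fun_of fun_of_del)
  note h = ham_bounded[OF assms(1) d]
  have "ham_entry \<iota> \<omega> x y = fun_of (l2_of (ham \<iota> \<omega> (fun_of (del y 1)))) x"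
    using h assms by (simp add: ell2_iff fun_of_l2_of ham_del)
  then have "cmod (ham_entry \<iota> \<omega> x y) \<le> norm (l2_of (ham \<iota> \<omega> (fun_of (del y 1))))" by (simp add: l2_coord_le)
  also have "\<dots> \<le> C * ell2_norm (dom \<omega>) (fun_of (del y 1))" using h ell2_norm_l2[OF conjunct1[OF h]] by simp
  also have "\<dots> = C"
  proof -
    have "ell2_norm (dom \<omega>) (fun_of (del y 1)) = norm (del y 1 :: 'x l2)"
      by (rule ell2_norm_fun_of) (use assms in \<open>auto simp: fun_of_del\<close>)
    then show ?thesis by (simp add: norm_del)
  qed
  finally show ?thesis .
qed

lemma direct_inner_Pr: "direct_integral_inner \<mu> \<Omega> f g = (LINT \<omega>|Pr. ell2_inner (dom \<omega>) (f \<omega>) (g \<omega>))"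
  unfolding direct_integral_inner_def set_lebesgue_integral_def
  by (rule integral_restrict_space[symmetric]) (simp add: \<Omega>_inter)

definition entry :: "nat \<Rightarrow> nat \<Rightarrow> ('x, 'c) config \<Rightarrow> complex" where
  "entry i j \<omega> = (if hit i \<omega> \<and> hit j \<omega> then ham_entry \<iota> \<omega> (pt i \<omega>) (pt j \<omega>) else 0)"

lemma entry_measurable: "entry i j \<in> borel_measurable Pr"
proof -
  have O: "\<Omega> \<in> sets Pr" by (simp add: sets_Pr)
  have "(\<lambda>\<omega>. ham \<iota> \<omega> (fun_of (dsec j \<Omega> \<omega>))) \<in> direct_integral \<mu> \<Omega>"
    by (intro ham_direct section_direct bounded_section_dsec O)
  then have "(\<lambda>(\<omega>, x). ham \<iota> \<omega> (fun_of (dsec j \<Omega> \<omega>)) x) \<in> borel_measurable (Pr \<Otimes>\<^sub>M borel)"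
    by (simp add: direct_integral_def)
  from section_at_pt[OF this]
  have m: "(\<lambda>\<omega>. ham \<iota> \<omega> (fun_of (dsec j \<Omega> \<omega>)) (pt i \<omega>)) \<in> borel_measurable Pr" .
  have "(\<lambda>\<omega>. if hit i \<omega> then ham \<iota> \<omega> (fun_of (dsec j \<Omega> \<omega>)) (pt i \<omega>) else 0) \<in> borel_measurable Pr"
    by (rule measurable_If[OF m measurable_const hit_measurable[unfolded pred_def]]) simp
  then show ?thesis
  proof (rule measurable_cong[THEN iffD2, rotated])
    fix \<omega> assume "\<omega> \<in> space Pr"
    then have \<omega>: "\<omega> \<in> \<Omega>" by (simp add: space_Pr)
    show "entry i j \<omega> = (if hit i \<omega> then ham \<iota> \<omega> (fun_of (dsec j \<Omega> \<omega>)) (pt i \<omega>) else 0)"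
      using \<omega> pt_dom(1)[OF \<omega>] by (simp add: entry_def ham_dsec)
  qed
qed

lemma entry_integrable: "integrable Pr (entry i j)"
proof (rule Pr.integrable_const_bound[where B = C])
  show "AE \<omega> in Pr. cmod (entry i j \<omega>) \<le> C"
    by (rule AE_I2) (simp add: entry_def space_Pr ham_entry_bound pt_dom C_nonneg)
qed (rule entry_measurable)

text \<open>Symmetry of the direct integral, tested with point \<open>i\<close> over an arbitrary
  event \<open>B\<close> and with point \<open>j\<close>, says that both sides have equal integrals
  over every \<open>B\<close>.\<close>

lemma entry_hermitian_AE: "AE \<omega> in Pr. cnj (entry j i \<omega>) = entry i j \<omega>"
proof -
  have O: "\<Omega> \<in> sets Pr" by (simp add: sets_Pr)
  have i1: "integrable Pr (\<lambda>\<omega>. cnj (entry j i \<omega>))"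
    by (rule integrable_bounded_linear[OF bounded_linear_cnj entry_integrable])
  have "AE \<omega> in Pr. cnj (entry j i \<omega>) - entry i j \<omega> = 0"
  proof (rule Pr.density_zero)
    show "integrable Pr (\<lambda>\<omega>. cnj (entry j i \<omega>) - entry i j \<omega>)" by (intro Bochner_Integration.integrable_diff i1 entry_integrable)
    fix B assume B: "B \<in> sets Pr"
    note s = section_direct[OF bounded_section_dsec[OF B, of i]] section_direct[OF bounded_section_dsec[OF O, of j]]
    have l: "ell2_inner (dom \<omega>) (ham \<iota> \<omega> (fun_of (dsec i B \<omega>))) (fun_of (dsec j \<Omega> \<omega>)) = indicator B \<omega> *\<^sub>R cnj (entry j i \<omega>)"
      and r: "ell2_inner (dom \<omega>) (fun_of (dsec i B \<omega>)) (ham \<iota> \<omega> (fun_of (dsec j \<Omega> \<omega>))) = indicator B \<omega> *\<^sub>R entry i j \<omega>"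
      if "\<omega> \<in> space Pr" for \<omega>
    proof -
      have \<omega>: "\<omega> \<in> \<Omega>" using that by (simp add: space_Pr)
      have "ell2_inner (dom \<omega>) v (fun_of (dsec j \<Omega> \<omega>)) = (\<Sum>\<^sub>\<infinity>x\<in>(if hit j \<omega> then {pt j \<omega>} else {}). cnj (v x) * fun_of (dsec j \<Omega> \<omega>) x)" for v
        unfolding ell2_inner_def by (rule infsum_cong_neutral) (use pt_dom(1)[OF \<omega>] in \<open>auto simp: fun_of_dsec split: if_splits\<close>)
      then show "ell2_inner (dom \<omega>) (ham \<iota> \<omega> (fun_of (dsec i B \<omega>))) (fun_of (dsec j \<Omega> \<omega>)) = indicator B \<omega> *\<^sub>R cnj (entry j i \<omega>)"
        using \<omega> pt_dom(1)[OF \<omega>] by (simp add: fun_of_dsec ham_dsec entry_def indicator_def)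
      have "ell2_inner (dom \<omega>) (fun_of (dsec i B \<omega>)) v = (\<Sum>\<^sub>\<infinity>x\<in>(if hit i \<omega> then {pt i \<omega>} else {}). cnj (fun_of (dsec i B \<omega>) x) * v x)" for v
        unfolding ell2_inner_def by (rule infsum_cong_neutral) (use pt_dom(1)[OF \<omega>] in \<open>auto simp: fun_of_dsec split: if_splits\<close>)
      then show "ell2_inner (dom \<omega>) (fun_of (dsec i B \<omega>)) (ham \<iota> \<omega> (fun_of (dsec j \<Omega> \<omega>))) = indicator B \<omega> *\<^sub>R entry i j \<omega>"
        using \<omega> pt_dom(1)[OF \<omega>] by (simp add: fun_of_dsec ham_dsec entry_def indicator_def)
    qed
    have "(LINT \<omega>|Pr. indicator B \<omega> *\<^sub>R cnj (entry j i \<omega>)) = (LINT \<omega>|Pr. indicator B \<omega> *\<^sub>R entry i j \<omega>)"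
      using ham_symmetric[OF s] unfolding direct_inner_Pr
      by (simp only: Bochner_Integration.integral_cong[OF refl l] Bochner_Integration.integral_cong[OF refl r])
    then show "set_lebesgue_integral Pr B (\<lambda>\<omega>. cnj (entry j i \<omega>) - entry i j \<omega>) = 0"
      unfolding set_lebesgue_integral_def scaleR_diff_right
      by (subst Bochner_Integration.integral_diff) (auto intro!: integrable_mult_indicator B i1 entry_integrable)
  qed
  then show ?thesis by (rule AE_mp) (rule AE_I2, simp)
qed

lemma hermitian_AE: "AE \<omega> in Pr. \<forall>x\<in>dom \<omega>. \<forall>y\<in>dom \<omega>. ham_entry \<iota> \<omega> x y = cnj (ham_entry \<iota> \<omega> y x)"
proof -
  have "AE \<omega> in Pr. \<forall>i j. cnj (entry j i \<omega>) = entry i j \<omega>"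
    unfolding AE_all_countable using entry_hermitian_AE by blast
  then show ?thesis
  proof (rule AE_mp, intro AE_I2 impI ballI)
    fix \<omega> x y assume \<omega>: "\<omega> \<in> space Pr" and h: "\<forall>i j. cnj (entry j i \<omega>) = entry i j \<omega>" and x: "x \<in> dom \<omega>" and y: "y \<in> dom \<omega>"
    have \<omega>': "\<omega> \<in> \<Omega>" using \<omega> by (simp add: space_Pr)
    obtain i where i: "hit i \<omega>" "x = pt i \<omega>" by (rule dom_cases[OF \<omega>' x])
    obtain j where j: "hit j \<omega>" "y = pt j \<omega>" by (rule dom_cases[OF \<omega>' y])
    have "cnj (entry j i \<omega>) = entry i j \<omega>" using h by blast
    then show "ham_entry \<iota> \<omega> x y = cnj (ham_entry \<iota> \<omega> y x)" using i j by (simp add: entry_def)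
  qed
qed

lemma entry_in_range: "\<omega> \<in> \<Omega> \<Longrightarrow> x \<in> dom \<omega> \<Longrightarrow> y \<in> dom \<omega> \<Longrightarrow> \<exists>z. the (the (\<omega> x) y) = \<iota> z"
  using condition_A unfolding condition_A_def by blast

lemma inj_\<iota>: "inj \<iota>"

proof -
  have "homeomorphic_map euclidean (subtopology Cs (range \<iota>)) \<iota>"
    using compactif by (simp add: compactification_def embedding_map_def)
  from homeomorphic_imp_injective_map[OF this] show ?thesis by simp
qed

lemma ham_entry_\<iota>: "\<omega> \<in> \<Omega> \<Longrightarrow> x \<in> dom \<omega> \<Longrightarrow> y \<in> dom \<omega> \<Longrightarrow> the (the (\<omega> x) y) = \<iota> (ham_entry \<iota> \<omega> x y)"
  using entry_in_range[of \<omega> x y] inj_\<iota> by (auto simp: ham_entry_def)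

lemma open_embedding: assumes "open V" obtains W where "openin Cs W" "\<And>z. \<iota> z \<in> W \<longleftrightarrow> z \<in> V"
proof -
  have "homeomorphic_map euclidean (subtopology Cs (range \<iota>)) \<iota>"
    using compactif by (simp add: compactification_def embedding_map_def)
  then have "openin (subtopology Cs (range \<iota>)) (\<iota> ` V)"
    using assms homeomorphic_map_openness_eq[of euclidean "subtopology Cs (range \<iota>)" \<iota> V] homeomorphic_map_openness by fastforce
  then obtain W where W: "openin Cs W" "\<iota> ` V = W \<inter> range \<iota>" by (auto simp: openin_subtopology)
  have "\<iota> z \<in> W \<longleftrightarrow> z \<in> V" for z
  proof
    assume "\<iota> z \<in> W"
    then have "\<iota> z \<in> \<iota> ` V" using W(2) by blast
    then show "z \<in> V" using inj_\<iota> by (auto dest: injD)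
  next
    assume "z \<in> V"
    then show "\<iota> z \<in> W" using W(2) by blast
  qed
  with W(1) that show thesis by blast
qed

text \<open>A neighbourhood of a point of the support has positive measure, so it cannot avoid a set
  of full measure.\<close>

lemma AE_open: assumes "AE \<omega> in Pr. Q \<omega>" "openin CT U" "\<omega> \<in> U" "\<omega> \<in> \<Omega>" shows "\<exists>\<omega>'\<in>U \<inter> \<Omega>. Q \<omega>'"
proof (rule ccontr)
  assume n: "\<not> ?thesis"
  have U: "U \<inter> \<Omega> \<in> sets Pr" using open_sets[OF assms(2)] by (auto simp: sets_Pr)
  have "AE \<omega> in Pr. \<omega> \<notin> U \<inter> \<Omega>" using assms(1) by (rule AE_mp) (rule AE_I2, use n in blast)
  then have "emeasure Pr (U \<inter> \<Omega>) = 0" using U AE_iff_measurable[OF U, of "\<lambda>\<omega>. \<omega> \<notin> U \<inter> \<Omega>"] sets.sets_into_space[OF U] by fastforce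
  moreover have "emeasure Pr (U \<inter> \<Omega>) = emeasure \<mu> U"
  proof -
    have "AE \<omega> in \<mu>. \<omega> \<in> \<Omega>"
      using prob_space.AE_in_set_eq_1[OF prob_\<mu> \<Omega>_sets] emeasure_\<Omega> by (simp add: measure_def)
    then have "emeasure \<mu> (U \<inter> \<Omega>) = emeasure \<mu> U"
      using open_sets[OF assms(2)] \<Omega>_sets by (intro emeasure_eq_AE) (auto elim: AE_mp)
    then show ?thesis by (simp add: emeasure_Pr)
  qed
  ultimately show False using assms(2-4) by (auto simp: \<Omega>_iff)
qed

text \<open>The vague topology sees the matrix entries, so a relation between them that holds almost
  everywhere extends to the whole support.\<close>

lemma hermitian:
  assumes \<omega>: "\<omega> \<in> \<Omega>" and x: "x \<in> dom \<omega>" and y: "y \<in> dom \<omega>"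
  shows "ham_entry \<iota> \<omega> x y = cnj (ham_entry \<iota> \<omega> y x)"
proof (rule ccontr)
  let ?a = "ham_entry \<iota> \<omega> x y" and ?b = "ham_entry \<iota> \<omega> y x"
  assume "?a \<noteq> cnj ?b"
  then obtain V V' where V: "open V" "open V'" "?a \<in> V" "cnj ?b \<in> V'" "V \<inter> V' = {}" by (rule hausdorff[THEN exE]) blast
  obtain W where W: "openin Cs W" "\<And>z. \<iota> z \<in> W \<longleftrightarrow> z \<in> V" using open_embedding[OF V(1)] by blast
  have "open (cnj -` V')" using V(2) by (intro open_vimage continuous_intros)
  then obtain W' where W': "openin Cs W'" "\<And>z. \<iota> z \<in> W' \<longleftrightarrow> z \<in> cnj -` V'" using open_embedding by blast
  have half: "(0 :: real) < 1/2" by simp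
  have t: "\<omega> \<in> topspace CT" using \<omega> \<Omega>_sub by blast
  have e1: "the (the (\<omega> x) y) \<in> W" using V(3) W(2) ham_entry_\<iota>[OF \<omega> x y] by simp
  have e2: "the (the (\<omega> y) x) \<in> W'" using V(4) W'(2) ham_entry_\<iota>[OF \<omega> y x] by simp
  obtain U where U: "openin CT U" "\<omega> \<in> U"
    "\<forall>\<omega>'\<in>U. \<exists>x'\<in>dom \<omega>'. \<exists>y'\<in>dom \<omega>'. dist x x' < 1/2 \<and> dist y y' < 1/2 \<and> the (the (\<omega>' x') y') \<in> W"
    using entry_neighbourhood[OF t x y half W(1) e1] by (elim exE conjE)
  obtain U' where U': "openin CT U'" "\<omega> \<in> U'"
    "\<forall>\<omega>'\<in>U'. \<exists>y'\<in>dom \<omega>'. \<exists>x'\<in>dom \<omega>'. dist y y' < 1/2 \<and> dist x x' < 1/2 \<and> the (the (\<omega>' y') x') \<in> W'"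
    using entry_neighbourhood[OF t y x half W'(1) e2] by (elim exE conjE)
  have "\<exists>\<omega>'\<in>(U \<inter> U') \<inter> \<Omega>. \<forall>x\<in>dom \<omega>'. \<forall>y\<in>dom \<omega>'. ham_entry \<iota> \<omega>' x y = cnj (ham_entry \<iota> \<omega>' y x)"
    by (rule AE_open[OF hermitian_AE _ _ \<omega>]) (use U U' in auto)
  then obtain \<omega>' where o: "\<omega>' \<in> U" "\<omega>' \<in> U'" "\<omega>' \<in> \<Omega>"
    and herm: "\<forall>x\<in>dom \<omega>'. \<forall>y\<in>dom \<omega>'. ham_entry \<iota> \<omega>' x y = cnj (ham_entry \<iota> \<omega>' y x)" by blast
  obtain x1 y1 where p1: "x1 \<in> dom \<omega>'" "y1 \<in> dom \<omega>'" "dist x x1 < 1/2" "dist y y1 < 1/2" "the (the (\<omega>' x1) y1) \<in> W"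
    using U(3) o(1) by blast
  obtain x2 y2 where p2: "x2 \<in> dom \<omega>'" "y2 \<in> dom \<omega>'" "dist x x2 < 1/2" "dist y y2 < 1/2" "the (the (\<omega>' y2) x2) \<in> W'"
    using U'(3) o(2) by blast
  \<comment> \<open>The radius 1/2 was chosen for this: a separated set has at most one point that
    near to \<open>x\<close>, so both neighbourhoods speak of the same pair of points.\<close>
  have "x1 = x2" "y1 = y2"
    using separated_ball_unique[OF \<Omega>_separated[OF o(3)], of x1 x2 x] separated_ball_unique[OF \<Omega>_separated[OF o(3)], of y1 y2 y] p1 p2 by auto
  then have "ham_entry \<iota> \<omega>' x1 y1 \<in> V" "cnj (ham_entry \<iota> \<omega>' y1 x1) \<in> V'"
    using p1 p2 W(2) W'(2) ham_entry_\<iota>[OF o(3) p1(1,2)] ham_entry_\<iota>[OF o(3) p1(2,1)] by simp_all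
  moreover have "ham_entry \<iota> \<omega>' x1 y1 = cnj (ham_entry \<iota> \<omega>' y1 x1)" using herm p1 by blast
  ultimately show False using V(5) by auto
qed

lemma mop: assumes "\<omega> \<in> \<Omega>" shows "matrix_operator (dom \<omega>) (ham_entry \<iota> \<omega>) C R"
proof
  show "0 \<le> C" by (rule C_nonneg)
  show "mat_app (dom \<omega>) (ham_entry \<iota> \<omega>) v \<in> ell2 (dom \<omega>) \<and> ell2_norm (dom \<omega>) (mat_app (dom \<omega>) (ham_entry \<iota> \<omega>) v) \<le> C * ell2_norm (dom \<omega>) v"
    if "v \<in> ell2 (dom \<omega>)" for v using ham_bounded[OF assms that] by (simp add: ham_eq_mat_app)
  show "ham_entry \<iota> \<omega> x y = cnj (ham_entry \<iota> \<omega> y x)" if "x \<in> dom \<omega>" "y \<in> dom \<omega>" for x y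
    by (rule hermitian[OF assms that])
  show "ham_entry \<iota> \<omega> x y = 0" if "x \<in> dom \<omega>" "y \<in> dom \<omega>" "R \<le> dist x y" for x y
    by (rule hopping_range[OF assms that])
  show "finite (dom \<omega> \<inter> cball x r)" for x r by (rule dom_finite[OF assms])
qed

lemma bounded_section_diff: assumes "bounded_section F" "bounded_section G" shows "bounded_section (\<lambda>\<omega>. F \<omega> - G \<omega>)"
proof -
  obtain c c' where c: "\<And>\<omega>. \<omega> \<in> \<Omega> \<Longrightarrow> norm (F \<omega>) \<le> c" "\<And>\<omega>. \<omega> \<in> \<Omega> \<Longrightarrow> norm (G \<omega>) \<le> c'"
    using assms unfolding bounded_section_def by blast
  have "norm (F \<omega> - G \<omega>) \<le> c + c'" if "\<omega> \<in> \<Omega>" for \<omega>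
    using norm_triangle_ineq4[of "F \<omega>" "G \<omega>"] c[OF that] by linarith
  moreover have "(\<lambda>z. fun_of (F (fst z)) (snd z) - fun_of (G (fst z)) (snd z)) \<in> borel_measurable (Pr \<Otimes>\<^sub>M borel)"
    using assms unfolding bounded_section_def case_prod_unfold by (intro borel_measurable_diff) blast+
  ultimately show ?thesis using assms unfolding bounded_section_def by (auto simp: l2_fun_simps case_prod_unfold)
qed

lemma bounded_section_scaleR: assumes "bounded_section F" shows "bounded_section (\<lambda>\<omega>. a *\<^sub>R F \<omega>)"
proof -
  obtain c where c: "\<And>\<omega>. \<omega> \<in> \<Omega> \<Longrightarrow> norm (F \<omega>) \<le> c" using assms unfolding bounded_section_def by blast
  have "norm (a *\<^sub>R F \<omega>) \<le> \<bar>a\<bar> * c" if "\<omega> \<in> \<Omega>" for \<omega> using c[OF that] by (simp add: mult_left_mono)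
  moreover have "(\<lambda>z. complex_of_real a * fun_of (F (fst z)) (snd z)) \<in> borel_measurable (Pr \<Otimes>\<^sub>M borel)"
    using assms unfolding bounded_section_def case_prod_unfold by (intro borel_measurable_times borel_measurable_const) blast
  ultimately show ?thesis using assms unfolding bounded_section_def by (auto simp: l2_fun_simps case_prod_unfold simp del: norm_scaleR)
qed

lemma bounded_section_chi:
  assumes F: "bounded_section F" and J [measurable]: "J \<in> sets borel"
  shows "bounded_section (\<lambda>\<omega>. chi (J \<inter> dom \<omega>) (F \<omega>))"
proof -
  obtain c where c: "\<And>\<omega>. \<omega> \<in> \<Omega> \<Longrightarrow> norm (F \<omega>) \<le> c" using F unfolding bounded_section_def by blast
  have m: "(\<lambda>z. fun_of (F (fst z)) (snd z)) \<in> borel_measurable (Pr \<Otimes>\<^sub>M borel)"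
    using F unfolding bounded_section_def case_prod_unfold by blast
  have "{z \<in> space (Pr \<Otimes>\<^sub>M borel). snd z \<in> J} \<in> sets (Pr \<Otimes>\<^sub>M borel)"
    using measurable_sets[OF measurable_snd J, of Pr] by (simp add: vimage_def Int_def conj_commute)
  from measurable_If[OF m measurable_const this, of 0]
  have "(\<lambda>z. if snd z \<in> J then fun_of (F (fst z)) (snd z) else 0) \<in> borel_measurable (Pr \<Otimes>\<^sub>M borel)" by simp
  then have "(\<lambda>z. fun_of (chi (J \<inter> dom (fst z)) (F (fst z))) (snd z)) \<in> borel_measurable (Pr \<Otimes>\<^sub>M borel)"
    by (rule measurable_cong[THEN iffD2, rotated])
       (use F in \<open>auto simp: fun_of_chi space_pair_measure space_Pr bounded_section_def\<close>)
  moreover have "norm (chi (J \<inter> dom \<omega>) (F \<omega>)) \<le> c" if "\<omega> \<in> \<Omega>" for \<omega>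
    using norm_chi_le[of "J \<inter> dom \<omega>" "F \<omega>"] c[OF that] by linarith
  ultimately show ?thesis unfolding bounded_section_def by (auto simp: fun_of_chi case_prod_unfold)
qed

section \<open>Invariant weights from the projections\<close>

abbreviation "Hl \<omega> \<equiv> matrix_operator.H (dom \<omega>) (ham_entry \<iota> \<omega>)"
abbreviation "Dl \<omega> \<equiv> matrix_operator.D (dom \<omega>) (ham_entry \<iota> \<omega>) E"
abbreviation "Tl J \<omega> \<equiv> matrix_operator.T (dom \<omega>) (ham_entry \<iota> \<omega>) C E (J \<inter> dom \<omega>)"
abbreviation "Vl J \<omega> \<equiv> matrix_operator.V (dom \<omega>) (ham_entry \<iota> \<omega>) E (J \<inter> dom \<omega>)"

lemma fun_of_Hl: "\<omega> \<in> \<Omega> \<Longrightarrow> fun_of (Hl \<omega> v) = ham \<iota> \<omega> (fun_of v)"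
  by (simp add: matrix_operator.fun_of_H[OF mop] ham_eq_mat_app)

lemma bounded_section_Hl: assumes F: "bounded_section F" shows "bounded_section (\<lambda>\<omega>. Hl \<omega> (F \<omega>))"
proof -
  obtain c where c: "\<And>\<omega>. \<omega> \<in> \<Omega> \<Longrightarrow> norm (F \<omega>) \<le> c" using F unfolding bounded_section_def by blast
  have "norm (Hl \<omega> (F \<omega>)) \<le> C * c" if "\<omega> \<in> \<Omega>" for \<omega>
    using matrix_operator.norm_H[OF mop[OF that], of "F \<omega>"] mult_left_mono[OF c[OF that] C_nonneg] by linarith
  moreover have "(\<lambda>(\<omega>, x). ham \<iota> \<omega> (fun_of (F \<omega>)) x) \<in> borel_measurable (Pr \<Otimes>\<^sub>M borel)"
    using ham_direct[OF section_direct[OF F]] by (simp add: direct_integral_def)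
  then have "(\<lambda>(\<omega>, x). fun_of (Hl \<omega> (F \<omega>)) x) \<in> borel_measurable (Pr \<Otimes>\<^sub>M borel)"
    by (rule measurable_cong[THEN iffD2, rotated]) (auto simp: space_pair_measure space_Pr fun_of_Hl)
  moreover have "fun_of (Hl \<omega> (F \<omega>)) x = 0" if "\<omega> \<in> \<Omega>" "x \<notin> dom \<omega>" for \<omega> x
    by (rule matrix_operator.H_off[OF mop[OF that(1)] that(2)])
  ultimately show ?thesis unfolding bounded_section_def by blast
qed

lemma bounded_section_cong: "bounded_section F \<Longrightarrow> (\<And>\<omega>. \<omega> \<in> \<Omega> \<Longrightarrow> G \<omega> = F \<omega>) \<Longrightarrow> bounded_section G"
proof -
  assume F: "bounded_section F" and e: "\<And>\<omega>. \<omega> \<in> \<Omega> \<Longrightarrow> G \<omega> = F \<omega>"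
  have "(\<lambda>(\<omega>, x). fun_of (F \<omega>) x) \<in> borel_measurable (Pr \<Otimes>\<^sub>M borel)" using F by (simp add: bounded_section_def)
  then have "(\<lambda>(\<omega>, x). fun_of (G \<omega>) x) \<in> borel_measurable (Pr \<Otimes>\<^sub>M borel)"
    by (rule measurable_cong[THEN iffD2, rotated]) (auto simp: space_pair_measure space_Pr e)
  then show ?thesis using F e by (auto simp: bounded_section_def)
qed

lemma bounded_section_Dl: "bounded_section F \<Longrightarrow> bounded_section (\<lambda>\<omega>. Dl \<omega> (F \<omega>))"
  by (rule bounded_section_cong[OF bounded_section_diff[OF bounded_section_Hl bounded_section_scaleR]])
     (assumption+, rule matrix_operator.D_def[OF mop])

lemma bounded_section_Tl:
  assumes F: "bounded_section F" and J: "J \<in> sets borel"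
  shows "bounded_section (\<lambda>\<omega>. Tl J \<omega> (F \<omega>))"
  by (rule bounded_section_cong[OF bounded_section_diff[OF bounded_section_chi[OF F J]
        bounded_section_scaleR[OF bounded_section_chi[OF bounded_section_Dl[OF bounded_section_Dl[OF bounded_section_chi[OF F J]]] J]]]])
     (rule matrix_operator.T_def[OF mop])

lemma bounded_section_Tl_pow:
  assumes F: "bounded_section F" and J: "J \<in> sets borel"
  shows "bounded_section (\<lambda>\<omega>. (Tl J \<omega> ^^ k) (F \<omega>))"
proof (induction k)
  case (Suc k)
  show ?case using bounded_section_Tl[OF Suc J] by simp
qed (simp add: F)

definition mom :: "'x set \<Rightarrow> nat \<Rightarrow> ('x, 'c) config \<Rightarrow> 'x \<Rightarrow> real" where
  "mom J k \<omega> x = (Tl J \<omega> ^^ k) (del x 1) \<bullet> del x 1"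

text \<open>\<open>dg J \<omega>\<close> is the diagonal of the projection onto the \<open>\<ell>\<^sup>2\<close> solutions supported in \<open>J\<close>,
  and \<open>dgs\<close> below that of the projection onto the closure of the compactly supported ones.\<close>

definition dg :: "'x set \<Rightarrow> ('x, 'c) config \<Rightarrow> 'x \<Rightarrow> real" where
  "dg J \<omega> x = matrix_operator.diag (dom \<omega>) (ham_entry \<iota> \<omega>) C E (J \<inter> dom \<omega>) x"

text \<open>At the \<open>i\<close>-th point the moment is a coordinate of a power of
  \<open>T\<close> applied to the section \<open>dsec i \<Omega>\<close>, and such powers are
  measurable sections.\<close>

lemma weight_mom: assumes J: "J \<in> sets borel" shows "weight (mom J k)"
  unfolding weight_def
proof (intro conjI allI ballI)
  fix i
  have O: "\<Omega> \<in> sets Pr" by (simp add: sets_Pr)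
  have "bounded_section (\<lambda>\<omega>. (Tl J \<omega> ^^ k) (dsec i \<Omega> \<omega>))"
    by (intro bounded_section_Tl_pow bounded_section_dsec O J)
  then have "(\<lambda>(\<omega>, x). fun_of ((Tl J \<omega> ^^ k) (dsec i \<Omega> \<omega>)) x) \<in> borel_measurable (Pr \<Otimes>\<^sub>M borel)"
    by (simp add: bounded_section_def)
  from section_at_pt[OF this]
  have "(\<lambda>\<omega>. Re (fun_of ((Tl J \<omega> ^^ k) (dsec i \<Omega> \<omega>)) (pt i \<omega>))) \<in> borel_measurable Pr" by simp
  from measurable_If[OF this measurable_const hit_measurable[unfolded pred_def], of 0]
  have "(\<lambda>\<omega>. if hit i \<omega> then Re (fun_of ((Tl J \<omega> ^^ k) (dsec i \<Omega> \<omega>)) (pt i \<omega>)) else 0) \<in> borel_measurable Pr" by simp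
  then show "(\<lambda>\<omega>. if hit i \<omega> then mom J k \<omega> (pt i \<omega>) else 0) \<in> borel_measurable Pr"
    by (rule measurable_cong[THEN iffD2, rotated]) (simp add: space_Pr dsec_def mom_def inner_del inner_complex_def)
next
  fix \<omega> x assume "\<omega> \<in> \<Omega>"
  then show "0 \<le> mom J k \<omega> x" "mom J k \<omega> x \<le> 1"
    unfolding mom_def by (rule matrix_operator.moment_bounds[OF mop])+
qed

lemma mom_lim: "\<omega> \<in> \<Omega> \<Longrightarrow> (\<lambda>k. mom J k \<omega> x) \<longlonglongrightarrow> dg J \<omega> x"
  unfolding mom_def dg_def by (rule matrix_operator.diag_lim[OF mop])

lemma dg_bounds: "\<omega> \<in> \<Omega> \<Longrightarrow> 0 \<le> dg J \<omega> x" "\<omega> \<in> \<Omega> \<Longrightarrow> dg J \<omega> x \<le> 1"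
  unfolding dg_def by (rule matrix_operator.diag_nonneg[OF mop] matrix_operator.diag_le_1[OF mop], assumption)+

lemma dg_mono: "\<omega> \<in> \<Omega> \<Longrightarrow> J \<subseteq> J' \<Longrightarrow> dg J \<omega> x \<le> dg J' \<omega> x"
  unfolding dg_def by (rule matrix_operator.diag_mono[OF mop]) auto

lemma weight_limit:
  assumes w: "\<And>k :: nat. weight (w k)" and lim: "\<And>\<omega> x. \<omega> \<in> \<Omega> \<Longrightarrow> (\<lambda>k. w k \<omega> x) \<longlonglongrightarrow> v \<omega> x"
    and b: "\<And>\<omega> x. \<omega> \<in> \<Omega> \<Longrightarrow> 0 \<le> v \<omega> x" "\<And>\<omega> x. \<omega> \<in> \<Omega> \<Longrightarrow> v \<omega> x \<le> 1"
  shows "weight v"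
  unfolding weight_def
proof (intro conjI allI ballI)
  fix i
  show "(\<lambda>\<omega>. if hit i \<omega> then v \<omega> (pt i \<omega>) else 0) \<in> borel_measurable Pr"
  proof (rule borel_measurable_LIMSEQ_real)
    show "(\<lambda>\<omega>. if hit i \<omega> then w k \<omega> (pt i \<omega>) else 0) \<in> borel_measurable Pr" for k
      using w[of k] unfolding weight_def by blast
    show "(\<lambda>k. if hit i \<omega> then w k \<omega> (pt i \<omega>) else 0) \<longlonglongrightarrow> (if hit i \<omega> then v \<omega> (pt i \<omega>) else 0)" if "\<omega> \<in> space Pr" for \<omega>
      using lim that by (simp add: space_Pr)
  qed
qed (use b in auto)

lemma weight_dg: "J \<in> sets borel \<Longrightarrow> weight (dg J)"
  by (rule weight_limit[OF weight_mom mom_lim dg_bounds])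

lemma Vl_iff: assumes "\<omega> \<in> \<Omega>"
  shows "v \<in> Vl J \<omega> \<longleftrightarrow> (\<forall>x. x \<notin> J \<inter> dom \<omega> \<longrightarrow> fun_of v x = 0) \<and> (\<forall>x. ham \<iota> \<omega> (fun_of v) x - complex_of_real E * fun_of v x = 0)"
proof -
  have "chi (J \<inter> dom \<omega>) v = v \<longleftrightarrow> (\<forall>x. x \<notin> J \<inter> dom \<omega> \<longrightarrow> fun_of v x = 0)"
  proof
    assume h: "chi (J \<inter> dom \<omega>) v = v"
    show "\<forall>x. x \<notin> J \<inter> dom \<omega> \<longrightarrow> fun_of v x = 0"
      by (subst h[symmetric]) (simp add: fun_of_chi)
  qed (auto intro!: l2_eqI simp: fun_of_chi)
  moreover have "Dl \<omega> v = 0 \<longleftrightarrow> (\<forall>x. ham \<iota> \<omega> (fun_of v) x - complex_of_real E * fun_of v x = 0)"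
  proof -
    have e: "fun_of (Dl \<omega> v) x = ham \<iota> \<omega> (fun_of v) x - complex_of_real E * fun_of v x" for x
      by (simp add: matrix_operator.D_def[OF mop[OF assms]] l2_fun_simps fun_of_Hl[OF assms])
    show ?thesis
    proof
      assume "Dl \<omega> v = 0" then show "\<forall>x. ham \<iota> \<omega> (fun_of v) x - complex_of_real E * fun_of v x = 0"
        unfolding e[symmetric] by (simp add: l2_fun_simps)
    next
      assume "\<forall>x. ham \<iota> \<omega> (fun_of v) x - complex_of_real E * fun_of v x = 0"
      then show "Dl \<omega> v = 0" unfolding e[symmetric] by (intro l2_eqI) (simp add: l2_fun_simps)
    qed
  qed
  ultimately show ?thesis unfolding matrix_operator.V_def[OF mop[OF assms]] by blast
qed

lemma bij_act: "bij_betw (act g) UNIV UNIV"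
  by (rule bij_betw_byWitness[where f' = "act (- g)"]) (auto simp: act_minus)

lemma bij_act_dom: "bij_betw (act g) (dom \<omega>) (dom (config_act act g \<omega>))"
  unfolding bij_betw_def dom_config_act by (auto intro: inj_on_inverseI[of _ "act (- g)"] simp: act_minus)

lemma ham_config_act: "ham \<iota> (config_act act g \<omega>) (\<lambda>y. v (act (- g) y)) (act g x) = ham \<iota> \<omega> v x"
proof -
  have iff: "act g x \<in> act g ` dom \<omega> \<longleftrightarrow> x \<in> dom \<omega>" by (metis act_minus(1) imageE imageI)
  have "(\<Sum>\<^sub>\<infinity>y\<in>dom (config_act act g \<omega>). ham_entry \<iota> (config_act act g \<omega>) (act g x) y * v (act (- g) y)) =
      (\<Sum>\<^sub>\<infinity>y\<in>dom \<omega>. ham_entry \<iota> (config_act act g \<omega>) (act g x) (act g y) * v (act (- g) (act g y)))"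
    by (rule infsum_reindex_bij_betw[OF bij_act_dom, symmetric])
  also have "x \<in> dom \<omega> \<Longrightarrow> \<dots> = (\<Sum>\<^sub>\<infinity>y\<in>dom \<omega>. ham_entry \<iota> \<omega> x y * v y)"
    by (intro infsum_cong) (simp add: ham_entry_config_act act_minus)
  finally show ?thesis using iff by (simp add: ham_def dom_config_act)
qed

text \<open>The extremal vector of \<open>diag_attained\<close> is transported along the action. It
  solves the equation for the moved configuration with the same norm and the same value, so
  \<open>diag_le_of\<close> applies; the opposite inequality follows with
  \<open>- g\<close>.\<close>

lemma dg_le_config_act: assumes \<omega>: "\<omega> \<in> \<Omega>" shows "dg J \<omega> x \<le> dg (act g ` J) (config_act act g \<omega>) (act g x)"
proof -
  note \<omega>' = config_act_\<Omega>[OF \<omega>, of g]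
  define v where "v = matrix_operator.P (dom \<omega>) (ham_entry \<iota> \<omega>) C E (J \<inter> dom \<omega>) (del x 1)"
  note att = matrix_operator.diag_attained[OF mop[OF \<omega>], where E = E and J = "J \<inter> dom \<omega>" and x = x, folded v_def dg_def]
  have s: "sq_summable (\<lambda>y. fun_of v (act (- g) y))"
    using sq_summable_fun_of[of v] summable_on_reindex_bij_betw[OF bij_act[of "- g"], of "\<lambda>x. (cmod (fun_of v x))\<^sup>2"]
    unfolding sq_summable_def by simp
  let ?v = "l2_of (\<lambda>y. fun_of v (act (- g) y))"
  have f: "fun_of ?v y = fun_of v (act (- g) y)" for y by (simp add: fun_of_l2_of[OF s])
  have n: "(norm ?v)\<^sup>2 = (norm v)\<^sup>2"
    unfolding l2_norm_sq f by (rule infsum_reindex_bij_betw[OF bij_act, of "\<lambda>x. (cmod (fun_of v x))\<^sup>2"])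
  have "?v \<in> Vl (act g ` J) (config_act act g \<omega>)"
    unfolding Vl_iff[OF \<omega>']
  proof (intro conjI allI impI)
    fix y assume y: "y \<notin> act g ` J \<inter> dom (config_act act g \<omega>)"
    have "act (- g) y \<notin> J \<inter> dom \<omega>"
    proof
      assume "act (- g) y \<in> J \<inter> dom \<omega>"
      then have "act g (act (- g) y) \<in> act g ` J \<inter> act g ` dom \<omega>" by blast
      with y show False by (simp add: act_minus dom_config_act)
    qed
    then show "fun_of ?v y = 0" using att(1) unfolding f Vl_iff[OF \<omega>] by blast
  next
    fix y
    have "ham \<iota> (config_act act g \<omega>) (\<lambda>y. fun_of v (act (- g) y)) (act g (act (- g) y)) = ham \<iota> \<omega> (fun_of v) (act (- g) y)"
      by (rule ham_config_act)
    then show "ham \<iota> (config_act act g \<omega>) (fun_of ?v) y - complex_of_real E * fun_of ?v y = 0"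
      using att(1) unfolding Vl_iff[OF \<omega>] by (simp add: fun_of_l2_of[OF s] act_minus)
  qed
  then show ?thesis
    unfolding dg_def[of "act g ` J"]
    by (rule matrix_operator.diag_le_of[OF mop[OF \<omega>']]) (use att n \<omega> in \<open>simp_all add: f act_minus dg_bounds\<close>)
qed

lemma dg_config_act: assumes \<omega>: "\<omega> \<in> \<Omega>" shows "dg (act g ` J) (config_act act g \<omega>) (act g x) = dg J \<omega> x"
proof (rule antisym)
  show "dg J \<omega> x \<le> dg (act g ` J) (config_act act g \<omega>) (act g x)" by (rule dg_le_config_act[OF \<omega>])
  have "act (- g) ` act g ` J = J" by (simp add: image_image act_minus)
  then show "dg (act g ` J) (config_act act g \<omega>) (act g x) \<le> dg J \<omega> x"
    using dg_le_config_act[OF config_act_\<Omega>[OF \<omega>, of g], of "act g ` J" "act g x" "- g"] config_act_inverse[of "- g" \<omega>]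
    by (simp add: act_minus)
qed

lemma range_act: "range (act g) = UNIV" using bij_act by (simp add: bij_betw_def)

lemma inv_weight_dg: "inv_weight (dg UNIV)"
  unfolding inv_weight_def using weight_dg[of UNIV] dg_config_act[of _ _ UNIV] by (simp add: range_act)

definition dgs :: "('x, 'c) config \<Rightarrow> 'x \<Rightarrow> real" where
  "dgs \<omega> x = (SUP n. dg (cball undefined (real n)) \<omega> x)"

lemma dgs_lim: assumes \<omega>: "\<omega> \<in> \<Omega>" shows "(\<lambda>n. dg (cball undefined (real n)) \<omega> x) \<longlonglongrightarrow> dgs \<omega> x"
  unfolding dgs_def
proof (rule LIMSEQ_incseq_SUP)
  show "bdd_above (range (\<lambda>n. dg (cball undefined (real n)) \<omega> x))"
    by (rule bdd_aboveI[of _ 1]) (use dg_bounds(2)[OF \<omega>] in auto)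
  show "incseq (\<lambda>n. dg (cball undefined (real n)) \<omega> x)"
    by (intro incseq_SucI dg_mono[OF \<omega>]) auto
qed

text \<open>Together with \<open>dgs_le\<close> this makes \<open>dgs\<close> the supremum over all
  bounded sets. That description has no distinguished centre, whence the invariance in
  \<open>dgs_config_act\<close>.\<close>

lemma dg_le_dgs: assumes \<omega>: "\<omega> \<in> \<Omega>" and J: "bounded J" shows "dg J \<omega> x \<le> dgs \<omega> x"
proof -
  obtain r where "\<forall>y\<in>J. dist undefined y \<le> r" using J unfolding bounded_any_center[where a = "undefined :: 'x"] by blast
  moreover obtain n :: nat where "r \<le> real n" using real_arch_simple by blast
  ultimately have "J \<subseteq> cball undefined (real n)" by force
  then have "dg J \<omega> x \<le> dg (cball undefined (real n)) \<omega> x" by (rule dg_mono[OF \<omega>])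
  also have "\<dots> \<le> dgs \<omega> x" unfolding dgs_def
    by (rule cSUP_upper[OF UNIV_I bdd_aboveI[of _ 1]]) (use dg_bounds(2)[OF \<omega>] in auto)
  finally show ?thesis .
qed

lemma dgs_le: assumes \<omega>: "\<omega> \<in> \<Omega>" and le: "\<And>J. bounded J \<Longrightarrow> dg J \<omega> x \<le> c" shows "dgs \<omega> x \<le> c"
  unfolding dgs_def by (rule cSUP_least) (auto intro: le)

lemma dgs_config_act: assumes \<omega>: "\<omega> \<in> \<Omega>" shows "dgs (config_act act g \<omega>) (act g x) = dgs \<omega> x"
proof -
  have b: "bounded J \<Longrightarrow> bounded (act g ` J)" for J g
    unfolding bounded_def by (elim exE, rule exI[of _ "act g _"]) (auto simp: act_dist)
  have le: "dgs \<omega> x \<le> dgs (config_act act g \<omega>) (act g x)" if "\<omega> \<in> \<Omega>" for \<omega> g x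
  proof (rule dgs_le[OF that])
    fix J :: "'x set" assume J: "bounded J"
    show "dg J \<omega> x \<le> dgs (config_act act g \<omega>) (act g x)"
      using dg_le_dgs[OF config_act_\<Omega>[OF that] b[OF J], of g g "act g x"] dg_config_act[OF that] by simp
  qed
  show ?thesis
    using le[OF \<omega>, of x g] le[OF config_act_\<Omega>[OF \<omega>, of g], of "act g x" "- g"] config_act_inverse[of "- g" \<omega>]
    by (simp add: act_minus)
qed

definition defect :: "('x, 'c) config \<Rightarrow> 'x \<Rightarrow> real" where "defect \<omega> x = dg UNIV \<omega> x - dgs \<omega> x"

lemma inv_weight_defect: "inv_weight defect"
proof -
  have u: "UNIV \<in> sets (borel :: 'x measure)" and c: "\<And>n. cball undefined (real n) \<in> sets (borel :: 'x measure)" by auto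
  have "weight dgs"
  proof (rule weight_limit[OF weight_dg[OF c] dgs_lim])
    show "dgs \<omega> x \<le> 1" if "\<omega> \<in> \<Omega>" for \<omega> x by (rule dgs_le[OF that dg_bounds(2)[OF that]])
    show "0 \<le> dgs \<omega> x" if "\<omega> \<in> \<Omega>" for \<omega> x
      using dg_bounds(1)[OF that, of "{}" x] dg_le_dgs[OF that bounded_empty, of x] by linarith
  qed
  then have "weight defect"
    unfolding weight_def
  proof (intro conjI allI ballI)
    fix i assume "(\<forall>i. (\<lambda>\<omega>. if hit i \<omega> then dgs \<omega> (pt i \<omega>) else 0) \<in> borel_measurable Pr) \<and> (\<forall>\<omega>\<in>\<Omega>. \<forall>x\<in>dom \<omega>. 0 \<le> dgs \<omega> x \<and> dgs \<omega> x \<le> 1)"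
    then have m: "(\<lambda>\<omega>. if hit i \<omega> then dgs \<omega> (pt i \<omega>) else 0) \<in> borel_measurable Pr" by blast
    have m': "(\<lambda>\<omega>. if hit i \<omega> then dg UNIV \<omega> (pt i \<omega>) else 0) \<in> borel_measurable Pr" using weight_dg[OF u] unfolding weight_def by blast
    have "(\<lambda>\<omega>. if hit i \<omega> then defect \<omega> (pt i \<omega>) else 0) =
        (\<lambda>\<omega>. (if hit i \<omega> then dg UNIV \<omega> (pt i \<omega>) else 0) - (if hit i \<omega> then dgs \<omega> (pt i \<omega>) else 0))"
      by (auto simp: defect_def)
    then show "(\<lambda>\<omega>. if hit i \<omega> then defect \<omega> (pt i \<omega>) else 0) \<in> borel_measurable Pr"
      using borel_measurable_diff[OF m' m] by simp
  next
    fix \<omega> x assume \<omega>: "\<omega> \<in> \<Omega>"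
    show "0 \<le> defect \<omega> x" unfolding defect_def using dgs_le[OF \<omega> dg_mono[OF \<omega> subset_UNIV], of x] by simp
    have "0 \<le> dgs \<omega> x" using dg_bounds(1)[OF \<omega>, of "{}" x] dg_le_dgs[OF \<omega> bounded_empty, of x] by linarith
    then show "defect \<omega> x \<le> 1" unfolding defect_def using dg_bounds(2)[OF \<omega>, of UNIV x] by linarith
  qed
  then show ?thesis unfolding inv_weight_def defect_def
    using inv_weight_dg dgs_config_act by (simp add: inv_weight_def)
qed

section \<open>Vanishing of the defect along Foelner sets\<close>

lemma compact_thickening: fixes I :: "'g set" assumes "compact I" shows "compact (thickening r I)"
proof (cases "I = {}")
  case False
  have "thickening r I = {x. infdist x I \<le> r}"
  proof (intro set_eqI iffI)
    fix x assume "x \<in> thickening r I"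
    then obtain y where "y \<in> I" "dist x y \<le> r" by (auto simp: thickening_def)
    then show "x \<in> {x. infdist x I \<le> r}" using infdist_le[of y I x] by simp
  next
    fix x assume "x \<in> {x. infdist x I \<le> r}"
    moreover obtain y where y: "y \<in> I" "\<forall>z\<in>I. dist x y \<le> dist x z"
      using continuous_attains_inf[OF assms False continuous_on_dist[OF continuous_on_const continuous_on_id], of x] by blast
    moreover have "dist x y \<le> infdist x I" using y(2) False by (auto simp: infdist_def intro: cINF_greatest)
    ultimately have "y \<in> I" "dist x y \<le> r" by auto
    then show "x \<in> thickening r I" by (auto simp: thickening_def)
  qed
  moreover have "closed {x. infdist x I \<le> r}" by (intro closed_Collect_le continuous_intros)
  moreover have "\<exists>c R. thickening r I \<subseteq> cball c R"
  proof -
    obtain c e where ce: "\<forall>y\<in>I. dist c y \<le> e" using compact_imp_bounded[OF assms] by (auto simp: bounded_def)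
    have "thickening r I \<subseteq> cball c (e + r)"
    proof
      fix x assume "x \<in> thickening r I"
      then obtain y where y: "y \<in> I" "dist x y \<le> r" by (auto simp: thickening_def)
      have "dist c x \<le> dist c y + dist x y" by (metis dist_triangle dist_commute)
      then show "x \<in> cball c (e + r)" using ce y by fastforce
    qed
    then show ?thesis by blast
  qed
  ultimately show ?thesis using haar.compact_cball by (metis compact_Int_closed inf.absorb_iff2)
qed (simp add: thickening_def)

lemma inv_weight_one: "inv_weight (\<lambda>_ _. 1)"
  unfolding inv_weight_def weight_def by (auto intro!: measurable_If_set)

text \<open>Points less than \<open>2 * R\<close> apart have group coordinates at most
  \<open>a * (2 * \<bar>R\<bar> + b)\<close> apart, so the boundary layer of \<open>IF I\<close>
  lies in \<open>IF J - IF I\<close>. Since \<open>IF I\<close> is bounded, its own diagonal lies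
  below \<open>dgs\<close>, and \<open>trace_bound\<close> applies.\<close>

lemma defect_psum:
  assumes I: "compact I" and a: "a \<ge> 1" "b \<ge> 0" "\<And>x y. dist (\<Phi> x) (\<Phi> y) \<le> a * (dist x y + b)"
    and J: "compact J" "thickening (a * (2 * \<bar>R\<bar> + b)) I \<subseteq> J" and \<omega>: "\<omega> \<in> \<Omega>"
  shows "psum \<omega> (\<lambda>x. ennreal (defect \<omega> x) * indicator (IF I) x) \<le> 2 * psum \<omega> (indicator (IF J - IF I))"
proof -
  have fin: "finite (dom \<omega> \<inter> B)" if B: "bounded B" for B
  proof -
    obtain e where "\<forall>y\<in>B. dist undefined y \<le> e" using B unfolding bounded_any_center[where a = "undefined :: 'x"] by blast
    then have "dom \<omega> \<inter> B \<subseteq> dom \<omega> \<inter> cball undefined e" by auto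
    then show ?thesis using dom_finite[OF \<omega>] finite_subset by blast
  qed
  have fI: "finite (dom \<omega> \<inter> IF I)" by (rule fin[OF IF_bounded[OF I]])
  have fJ: "finite (dom \<omega> \<inter> (IF J - IF I))" by (rule fin[OF bounded_subset[OF IF_bounded[OF J(1)]]]) blast
  have B: "y \<in> dom \<omega> \<inter> (IF J - IF I)" if "y \<in> dom \<omega>" "y \<notin> IF I" "x \<in> dom \<omega>" "x \<in> IF I" "dist y x < 2 * R" for x y
  proof -
    have "dist (\<Phi> y) (\<Phi> x) \<le> a * (dist y x + b)" by (rule a(3))
    also have "\<dots> \<le> a * (2 * \<bar>R\<bar> + b)" using that(5) a by (intro mult_left_mono) auto
    finally have "\<Phi> y \<in> J" using that(4) J(2) by (auto simp: thickening_def IF_iff)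
    then show ?thesis using that(1,2) by (simp add: IF_iff)
  qed
  have tb: "(\<Sum>x\<in>dom \<omega> \<inter> IF I. dg UNIV \<omega> x - dg (IF I) \<omega> x) \<le> 2 * real (card (dom \<omega> \<inter> (IF J - IF I)))"
    using matrix_operator.trace_bound[OF mop[OF \<omega>] fI fJ B, where E = E] unfolding dg_def by (simp add: Int_commute)
  have "psum \<omega> (\<lambda>x. ennreal (defect \<omega> x) * indicator (IF I) x) = (\<Sum>x\<in>dom \<omega> \<inter> IF I. ennreal (defect \<omega> x) * indicator (IF I) x)"
    by (rule finite_psum[OF fI]) simp
  also have "\<dots> \<le> (\<Sum>x\<in>dom \<omega> \<inter> IF I. ennreal (dg UNIV \<omega> x - dg (IF I) \<omega> x))"
  proof (rule sum_mono)
    fix x assume x: "x \<in> dom \<omega> \<inter> IF I"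
    have "defect \<omega> x \<le> dg UNIV \<omega> x - dg (IF I) \<omega> x"
      using dg_le_dgs[OF \<omega> IF_bounded[OF I], of x] by (simp add: defect_def)
    then show "ennreal (defect \<omega> x) * indicator (IF I) x \<le> ennreal (dg UNIV \<omega> x - dg (IF I) \<omega> x)"
      using x by (simp add: ennreal_leI)
  qed
  also have "\<dots> = ennreal (\<Sum>x\<in>dom \<omega> \<inter> IF I. dg UNIV \<omega> x - dg (IF I) \<omega> x)"
    by (rule sum_ennreal) (simp add: dg_mono[OF \<omega> subset_UNIV])
  also have "\<dots> \<le> ennreal (2 * real (card (dom \<omega> \<inter> (IF J - IF I))))" by (rule ennreal_leI[OF tb])
  also have "\<dots> = 2 * psum \<omega> (indicator (IF J - IF I))"
  proof -
    have "psum \<omega> (indicator (IF J - IF I)) = (\<Sum>x\<in>dom \<omega> \<inter> (IF J - IF I). 1)"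
      by (subst finite_psum[OF fJ]) (auto simp: indicator_def)
    then show ?thesis by (simp add: ennreal_mult ennreal_of_nat_eq_real_of_nat)
  qed
  finally show ?thesis .
qed

lemma integral_defect: "(\<integral>x. u x \<partial>wmeas defect) = 0"
proof (rule ccontr)
  define c1 where "c1 = (\<integral>x. u x \<partial>wmeas (\<lambda>_ _. 1))"
  define c2 where "c2 = (\<integral>x. u x \<partial>wmeas defect)"
  assume "(\<integral>x. u x \<partial>wmeas defect) \<noteq> 0"
  then have c2: "c2 > 0" using integral_u_nonneg[OF inv_weight_defect] unfolding c2_def by simp
  have c1: "c1 \<ge> 0" unfolding c1_def by (rule integral_u_nonneg[OF inv_weight_one])
  have w1: "weight (\<lambda>_ _. 1)" and w2: "weight defect" using inv_weight_one inv_weight_defect by (simp_all add: inv_weight_def)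
  obtain a b where ab: "a \<ge> 1" "b \<ge> 0" "\<And>x y. dist (\<Phi> x) (\<Phi> y) \<le> a * (dist x y + b)" by (rule rough_constants) blast
  define r where "r = a * (2 * \<bar>R\<bar> + b)"
  have r: "r \<ge> 0" using ab by (simp add: r_def)
  \<comment> \<open>The estimate ends in \<open>c2 \<le> 2 * eps * c1\<close>; with this choice the
    right side is at most \<open>c2 / 2\<close>, also when \<open>c1\<close> is 0.\<close>
  define eps where "eps = c2 / (4 * (c1 + 1))"
  have eps: "eps > 0" using c1 c2 by (simp add: eps_def)
  obtain I where I: "compact I" "emeasure haar I \<noteq> 0" "emeasure haar (thickening r I - I) \<le> ennreal eps * emeasure haar I"
    using haar.amenable_foelner[OF amenable r eps] by (elim exE conjE)
  let ?J = "thickening r I"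
  have J: "compact ?J" by (rule compact_thickening[OF I(1)])
  have IJ: "I \<subseteq> ?J" using r by (auto simp: thickening_def intro!: bexI)
  note [measurable] = IF_borel[OF I(1)] IF_borel[OF J]
  have fI: "emeasure haar I \<noteq> \<infinity>" using haar.emeasure_compact[OF I(1)] by auto
  have diff: "emeasure (wmeas (\<lambda>_ _. 1)) (IF ?J - IF I) = emeasure haar (?J - I) * ennreal c1"
  proof -
    let ?m = "wmeas (\<lambda>_ _. 1)"
    have "emeasure ?m (IF ?J) = emeasure ?m (IF I) + emeasure ?m (IF ?J - IF I)"
    proof -
      have "IF ?J = IF I \<union> (IF ?J - IF I)" using IJ by (auto simp: IF_iff)
      moreover have "emeasure ?m (IF I \<union> (IF ?J - IF I)) = emeasure ?m (IF I) + emeasure ?m (IF ?J - IF I)"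
        by (rule plus_emeasure[symmetric]) auto
      ultimately show ?thesis by simp
    qed
    note h1 = this
    have h2: "emeasure haar ?J = emeasure haar I + emeasure haar (?J - I)"
    proof -
      have "?J = I \<union> (?J - I)" using IJ by auto
      moreover have "emeasure haar (I \<union> (?J - I)) = emeasure haar I + emeasure haar (?J - I)"
        by (rule plus_emeasure[symmetric]) (auto simp: I(1) J borel_compact)
      ultimately show ?thesis by simp
    qed
    have "emeasure haar I * ennreal c1 + emeasure ?m (IF ?J - IF I) = emeasure haar I * ennreal c1 + emeasure haar (?J - I) * ennreal c1"
      by (rule h1[unfolded wmeas_IF[OF inv_weight_one I(1)] wmeas_IF[OF inv_weight_one J] h2 distrib_right, folded c1_def, symmetric])
    moreover have "emeasure haar I * ennreal c1 \<noteq> \<infinity>" using fI by (auto simp: ennreal_mult_eq_top_iff)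
    ultimately show ?thesis by (simp add: ennreal_add_left_cancel)
  qed
  have "emeasure haar I * ennreal c2 = (\<integral>\<^sup>+\<omega>. psum \<omega> (\<lambda>x. ennreal (defect \<omega> x) * indicator (IF I) x) \<partial>Pr)"
    unfolding c2_def wmeas_IF[OF inv_weight_defect I(1), symmetric] by (rule emeasure_wmeas[OF w2]) measurable
  also have "\<dots> \<le> (\<integral>\<^sup>+\<omega>. 2 * psum \<omega> (indicator (IF ?J - IF I)) \<partial>Pr)"
    by (rule nn_integral_mono, rule defect_psum[OF I(1) ab J]) (simp_all add: r_def space_Pr)
  also have "\<dots> = 2 * (\<integral>\<^sup>+\<omega>. psum \<omega> (indicator (IF ?J - IF I)) \<partial>Pr)"
    using psum_measurable[OF w1, of "indicator (IF ?J - IF I)"] by (intro nn_integral_cmult) simp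
  also have "(\<integral>\<^sup>+\<omega>. psum \<omega> (indicator (IF ?J - IF I)) \<partial>Pr) = emeasure (wmeas (\<lambda>_ _. 1)) (IF ?J - IF I)"
    by (subst emeasure_wmeas[OF w1]) auto
  finally have "emeasure haar I * ennreal c2 \<le> 2 * (emeasure haar (?J - I) * ennreal c1)" unfolding diff .
  also have "\<dots> \<le> 2 * (ennreal eps * emeasure haar I * ennreal c1)"
    by (intro mult_left_mono mult_right_mono I(3)) simp_all
  also have "\<dots> = emeasure haar I * ennreal (2 * eps * c1)"
    using eps c1 by (simp add: ennreal_mult mult_ac)
  finally have "emeasure haar I * ennreal c2 \<le> emeasure haar I * ennreal (2 * eps * c1)" .
  then have "ennreal c2 \<le> ennreal (2 * eps * c1)" using I(2) fI by (subst (asm) ennreal_mult_le_mult_iff) auto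
  then have "c2 \<le> 2 * eps * c1" using eps c1 by (subst (asm) ennreal_le_iff) auto
  moreover have "2 * eps * c1 < c2"
  proof -
    have "2 * eps * c1 \<le> 2 * eps * (c1 + 1)" using eps by simp
    also have "\<dots> = c2 / 2" using c1 by (simp add: eps_def field_simps)
    finally show ?thesis using c2 by simp
  qed
  ultimately show False by simp
qed

lemma dg_eq_dgs: "AE \<omega> in Pr. \<forall>x\<in>dom \<omega>. dg UNIV \<omega> x = dgs \<omega> x"
  using integral_u_zero_iff[OF inv_weight_defect] integral_defect by (simp add: defect_def)

text \<open>The link between the sums in the trace and the measure \<open>wmeas w\<close>. Since
  \<open>u\<close> is signed, its two parts are integrated separately; both are finite, so they may
  be subtracted.\<close>

lemma integral_weighted_sum:
  assumes w: "weight w"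
  shows "integrable Pr (\<lambda>\<omega>. \<Sum>\<^sub>\<infinity>x\<in>dom \<omega>. u x * w \<omega> x)"
    and "(\<integral>\<omega>. (\<Sum>\<^sub>\<infinity>x\<in>dom \<omega>. u x * w \<omega> x) \<partial>Pr) = (\<integral>x. u x \<partial>wmeas w)"
proof -
  let ?p = "\<lambda>\<omega>. psum \<omega> (\<lambda>x. ennreal (w \<omega> x) * ennreal (u x))" and ?n = "\<lambda>\<omega>. psum \<omega> (\<lambda>x. ennreal (w \<omega> x) * ennreal (- u x))"
  obtain K r where u: "K \<ge> 0" "\<And>x. \<bar>u x\<bar> \<le> K" "\<And>x. u x \<noteq> 0 \<Longrightarrow> x \<in> cball undefined r" by (rule u_bounded) blast
  have um: "(\<lambda>x. ennreal (u x)) \<in> borel_measurable borel" "(\<lambda>x. ennreal (- u x)) \<in> borel_measurable borel" by measurable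
  have pm: "?p \<in> borel_measurable Pr" and nm: "?n \<in> borel_measurable Pr" by (rule psum_measurable[OF w um(1)] psum_measurable[OF w um(2)])+
  have part: "psum \<omega> (\<lambda>x. ennreal (w \<omega> x) * ennreal (f x)) = ennreal (\<Sum>x\<in>dom \<omega> \<inter> cball undefined r. w \<omega> x * max 0 (f x))"
    if \<omega>: "\<omega> \<in> \<Omega>" and f: "\<And>x. x \<notin> cball undefined r \<Longrightarrow> f x = 0" for \<omega> f
  proof -
    have "psum \<omega> (\<lambda>x. ennreal (w \<omega> x) * ennreal (f x)) = (\<Sum>x\<in>dom \<omega> \<inter> cball undefined r. ennreal (w \<omega> x) * ennreal (f x))"
      by (rule finite_psum[OF dom_finite[OF \<omega>]]) (simp add: f)
    also have "\<dots> = (\<Sum>x\<in>dom \<omega> \<inter> cball undefined r. ennreal (w \<omega> x * max 0 (f x)))"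
      by (intro sum.cong refl) (use w \<omega> in \<open>auto simp: weight_def ennreal_mult max_def ennreal_neg\<close>)
    also have "\<dots> = ennreal (\<Sum>x\<in>dom \<omega> \<inter> cball undefined r. w \<omega> x * max 0 (f x))"
      by (rule sum_ennreal) (use w \<omega> in \<open>auto simp: weight_def\<close>)
    finally show ?thesis .
  qed
  have z: "u x = 0" "- u x = 0" if "x \<notin> cball undefined r" for x using u(3)[of x] that by auto
  have eq: "(\<Sum>\<^sub>\<infinity>x\<in>dom \<omega>. u x * w \<omega> x) = enn2real (?p \<omega>) - enn2real (?n \<omega>)" if "\<omega> \<in> space Pr" for \<omega>
  proof -
    have \<omega>: "\<omega> \<in> \<Omega>" using that by (simp add: space_Pr)
    have s: "0 \<le> (\<Sum>x\<in>dom \<omega> \<inter> cball undefined r. w \<omega> x * max 0 (f x))" for f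
      by (rule sum_nonneg) (use w \<omega> in \<open>auto simp: weight_def\<close>)
    have "(\<Sum>\<^sub>\<infinity>x\<in>dom \<omega>. u x * w \<omega> x) = (\<Sum>\<^sub>\<infinity>x\<in>dom \<omega> \<inter> cball undefined r. u x * w \<omega> x)"
      by (rule infsum_cong_neutral) (use z in auto)
    also have "\<dots> = (\<Sum>x\<in>dom \<omega> \<inter> cball undefined r. u x * w \<omega> x)" by (rule infsum_finite[OF dom_finite[OF \<omega>]])
    also have "\<dots> = (\<Sum>x\<in>dom \<omega> \<inter> cball undefined r. w \<omega> x * max 0 (u x)) - (\<Sum>x\<in>dom \<omega> \<inter> cball undefined r. w \<omega> x * max 0 (- u x))"
      unfolding sum_subtractf[symmetric] by (intro sum.cong refl) (auto simp: max_def)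
    finally show ?thesis
      using part[OF \<omega> z(1)] part[OF \<omega> z(2)] s[of u] s[of "\<lambda>x. - u x"] by simp
  qed
  have ip: "(\<integral>\<^sup>+\<omega>. ?p \<omega> \<partial>Pr) = (\<integral>\<^sup>+x. ennreal (u x) \<partial>wmeas w)" and "in": "(\<integral>\<^sup>+\<omega>. ?n \<omega> \<partial>Pr) = (\<integral>\<^sup>+x. ennreal (- u x) \<partial>wmeas w)"
    by (rule nn_integral_wmeas[OF w um(1), symmetric] nn_integral_wmeas[OF w um(2), symmetric])+
  have fp: "?p \<omega> < top" "?n \<omega> < top" if "\<omega> \<in> space Pr" for \<omega>
    using that part[of \<omega> u] part[of \<omega> "\<lambda>x. - u x"] z by (simp_all add: space_Pr)
  have ep: "(\<integral>\<^sup>+\<omega>. ennreal (enn2real (?p \<omega>)) \<partial>Pr) = (\<integral>\<^sup>+\<omega>. ?p \<omega> \<partial>Pr)"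
    and en: "(\<integral>\<^sup>+\<omega>. ennreal (enn2real (?n \<omega>)) \<partial>Pr) = (\<integral>\<^sup>+\<omega>. ?n \<omega> \<partial>Pr)"
    using fp by (auto intro!: nn_integral_cong ennreal_enn2real)
  have fin: "(\<integral>\<^sup>+\<omega>. ennreal (enn2real (?p \<omega>)) \<partial>Pr) < \<infinity>" "(\<integral>\<^sup>+\<omega>. ennreal (enn2real (?n \<omega>)) \<partial>Pr) < \<infinity>"
    unfolding ep en ip "in" by (rule u_parts_finite[OF w])+
  have m1: "(\<lambda>\<omega>. enn2real (?p \<omega>)) \<in> borel_measurable Pr" and m2: "(\<lambda>\<omega>. enn2real (?n \<omega>)) \<in> borel_measurable Pr"
    by (rule borel_measurable_enn2real[OF pm] borel_measurable_enn2real[OF nm])+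
  have i1: "integrable Pr (\<lambda>\<omega>. enn2real (?p \<omega>))" and i2: "integrable Pr (\<lambda>\<omega>. enn2real (?n \<omega>))"
    using fin m1 m2 by (simp_all add: integrable_iff_bounded)
  show "integrable Pr (\<lambda>\<omega>. \<Sum>\<^sub>\<infinity>x\<in>dom \<omega>. u x * w \<omega> x)"
    using Bochner_Integration.integrable_diff[OF i1 i2] by (rule Bochner_Integration.integrable_cong[THEN iffD1, rotated 2]) (simp_all add: eq)
  have "(\<integral>\<omega>. (\<Sum>\<^sub>\<infinity>x\<in>dom \<omega>. u x * w \<omega> x) \<partial>Pr) = (\<integral>\<omega>. enn2real (?p \<omega>) - enn2real (?n \<omega>) \<partial>Pr)"
    by (rule Bochner_Integration.integral_cong[OF refl eq])
  also have "\<dots> = (\<integral>\<omega>. enn2real (?p \<omega>) \<partial>Pr) - (\<integral>\<omega>. enn2real (?n \<omega>) \<partial>Pr)"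
    by (rule Bochner_Integration.integral_diff[OF i1 i2])
  also have "(\<integral>\<omega>. enn2real (?p \<omega>) \<partial>Pr) = enn2real (\<integral>\<^sup>+x. ennreal (u x) \<partial>wmeas w)"
    unfolding ip[symmetric] ep[symmetric] by (rule integral_eq_nn_integral[OF m1]) simp
  also have "(\<integral>\<omega>. enn2real (?n \<omega>) \<partial>Pr) = enn2real (\<integral>\<^sup>+x. ennreal (- u x) \<partial>wmeas w)"
    unfolding "in"[symmetric] en[symmetric] by (rule integral_eq_nn_integral[OF m2]) simp
  also have "enn2real (\<integral>\<^sup>+x. ennreal (u x) \<partial>wmeas w) - enn2real (\<integral>\<^sup>+x. ennreal (- u x) \<partial>wmeas w) = (\<integral>x. u x \<partial>wmeas w)"
    by (rule real_lebesgue_integral_def[OF integrable_u[OF w], symmetric])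
  finally show "(\<integral>\<omega>. (\<Sum>\<^sub>\<infinity>x\<in>dom \<omega>. u x * w \<omega> x) \<partial>Pr) = (\<integral>x. u x \<partial>wmeas w)" .
qed

section \<open>The jump of the integrated density of states\<close>

lemma finite_weighted_sum:
  fixes w :: "'x \<Rightarrow> 'a::real_normed_algebra_1"
  assumes \<omega>: "\<omega> \<in> \<Omega>" and r: "\<And>x. u x \<noteq> 0 \<Longrightarrow> x \<in> cball undefined r"
  shows "(\<Sum>\<^sub>\<infinity>x\<in>dom \<omega>. of_real (u x) * w x) = (\<Sum>x\<in>dom \<omega> \<inter> cball undefined r. of_real (u x) * w x)"
proof -
  have "(\<Sum>\<^sub>\<infinity>x\<in>dom \<omega>. of_real (u x) * w x) = (\<Sum>\<^sub>\<infinity>x\<in>dom \<omega> \<inter> cball undefined r. of_real (u x) * w x)"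
  proof (rule infsum_cong_neutral)
    fix x assume "x \<in> dom \<omega> - dom \<omega> \<inter> cball undefined r"
    then have "u x = 0" using r by blast
    then show "of_real (u x) * w x = 0" by simp
  qed auto
  then show ?thesis by (simp add: infsum_finite[OF dom_finite[OF \<omega>]])
qed

text \<open>In the basis of point masses the trace only involves the diagonal of
  \<open>\<phi>(H)\<close>, and its sum is finite because \<open>u\<close> has bounded
  support.\<close>

lemma dos_integral:
  assumes "continuous_on UNIV \<phi>" "compactly_supported (\<phi> :: real \<Rightarrow> complex)"
    and F: "\<And>\<omega> x. \<omega> \<in> \<Omega> \<Longrightarrow> x \<in> dom \<omega> \<Longrightarrow>
      functional_calculus (dom \<omega>) (mat_app (dom \<omega>) (ham_entry \<iota> \<omega>)) \<phi> (\<lambda>y. if y = x then 1 else 0) x = complex_of_real (w \<omega> x)"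
  shows "(LINT t|\<nu>. \<phi> t) = complex_of_real (1 / d * (\<integral>\<omega>. (\<Sum>\<^sub>\<infinity>x\<in>dom \<omega>. u x * w \<omega> x) \<partial>Pr))"
proof -
  obtain K r where u: "K \<ge> 0" "\<And>x. \<bar>u x\<bar> \<le> K" "\<And>x. u x \<noteq> 0 \<Longrightarrow> x \<in> cball undefined r" by (rule u_bounded) blast
  have "(LINT t|\<nu>. \<phi> t) = complex_of_real (1 / d) * (LINT \<omega>:\<Omega>|\<mu>. op_trace (dom \<omega>)
      (\<lambda>v x. complex_of_real (u x) * functional_calculus (dom \<omega>) (ham \<iota> \<omega>) \<phi> v x))"
    using dos assms(1,2) unfolding density_of_states_def by blast
  also have "(LINT \<omega>:\<Omega>|\<mu>. op_trace (dom \<omega>) (\<lambda>v x. complex_of_real (u x) * functional_calculus (dom \<omega>) (ham \<iota> \<omega>) \<phi> v x)) =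
     (LINT \<omega>|Pr. op_trace (dom \<omega>) (\<lambda>v x. complex_of_real (u x) * functional_calculus (dom \<omega>) (ham \<iota> \<omega>) \<phi> v x))"
    unfolding set_lebesgue_integral_def by (rule integral_restrict_space[symmetric]) (simp add: \<Omega>_inter)
  also have "\<dots> = (LINT \<omega>|Pr. complex_of_real (\<Sum>\<^sub>\<infinity>x\<in>dom \<omega>. u x * w \<omega> x))"
  proof (rule Bochner_Integration.integral_cong[OF refl])
    fix \<omega> assume "\<omega> \<in> space Pr"
    then have \<omega>: "\<omega> \<in> \<Omega>" by (simp add: space_Pr)
    have "op_trace (dom \<omega>) (\<lambda>v x. complex_of_real (u x) * functional_calculus (dom \<omega>) (ham \<iota> \<omega>) \<phi> v x) =
       (\<Sum>\<^sub>\<infinity>x\<in>dom \<omega>. complex_of_real (u x) * complex_of_real (w \<omega> x))"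
      unfolding op_trace_def ham_eq_mat_app by (intro infsum_cong) (simp add: F[OF \<omega>])
    also have "\<dots> = complex_of_real (\<Sum>\<^sub>\<infinity>x\<in>dom \<omega>. u x * w \<omega> x)"
      using finite_weighted_sum[OF \<omega> u(3), of "\<lambda>x. complex_of_real (w \<omega> x)"] finite_weighted_sum[OF \<omega> u(3), of "w \<omega>"] by simp
    finally show "op_trace (dom \<omega>) (\<lambda>v x. complex_of_real (u x) * functional_calculus (dom \<omega>) (ham \<iota> \<omega>) \<phi> v x) = \<dots>" .
  qed
  finally show ?thesis by simp
qed

lemma sets_\<nu>: "sets \<nu> = sets borel" and \<nu>_compact: "compact K \<Longrightarrow> emeasure \<nu> K < \<infinity>"
  using dos by (auto simp: density_of_states_def)

text \<open>The defining property only makes \<open>\<nu>\<close> finite on compact sets. Test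
  functions vanishing on the interval from \<open>- C\<close> to \<open>C\<close>, which contains
  all spectra, show that there is no mass elsewhere.\<close>

lemma \<nu>_outside: "emeasure \<nu> (- {-C..C}) = 0"
proof -
  have null: "{t. C < \<bar>t\<bar> \<and> \<bar>t\<bar> < real n} \<in> null_sets \<nu>" for n :: nat
  proof -
    \<comment> \<open>Continuous, and positive exactly where \<open>C < \<bar>t\<bar>\<close> and
      \<open>\<bar>t\<bar> < real n\<close>.\<close>
    define \<psi> :: "real \<Rightarrow> real" where "\<psi> t = max 0 (min (\<bar>t\<bar> - C) (real n - \<bar>t\<bar>))" for t
    have c: "continuous_on UNIV \<psi>" unfolding \<psi>_def by (intro continuous_intros)
    have b: "\<bar>\<psi> t\<bar> \<le> real n * indicator {- real n..real n} t" for t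
      using C_nonneg by (auto simp: \<psi>_def indicator_def)
    have supp: "compactly_supported (\<lambda>t. complex_of_real (\<psi> t))"
      unfolding compactly_supported_def
    proof (rule compact_closure[THEN iffD2], rule bounded_subset)
      show "bounded {- real n..real n}" by simp
      show "{t. complex_of_real (\<psi> t) \<noteq> 0} \<subseteq> {- real n..real n}" by (auto simp: \<psi>_def)
    qed
    have m [measurable]: "\<psi> \<in> borel_measurable \<nu>"
      unfolding measurable_cong_sets[OF sets_\<nu> refl] by (rule borel_measurable_continuous_onI[OF c])
    have i: "integrable \<nu> \<psi>"
    proof (rule Bochner_Integration.integrable_bound[OF _ m])
      show "integrable \<nu> (\<lambda>t. real n * indicator {- real n..real n} t)"
        using \<nu>_compact[of "{- real n..real n}"] by (intro integrable_mult_right integrable_real_indicator) (auto simp: sets_\<nu>)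
      show "AE t in \<nu>. norm (\<psi> t) \<le> norm (real n * indicator {- real n..real n} t)"
        by (rule AE_I2) (use b in \<open>simp add: indicator_def split: if_splits\<close>)
    qed
    have "(LINT t|\<nu>. complex_of_real (\<psi> t)) = complex_of_real (1 / d * (\<integral>\<omega>. (\<Sum>\<^sub>\<infinity>x\<in>dom \<omega>. u x * 0) \<partial>Pr))"
    proof (rule dos_integral[OF _ supp])
      show "continuous_on UNIV (\<lambda>t. complex_of_real (\<psi> t))" using c by (intro continuous_intros)
      fix \<omega> x assume "\<omega> \<in> \<Omega>" "x \<in> dom \<omega>"
      then show "functional_calculus (dom \<omega>) (mat_app (dom \<omega>) (ham_entry \<iota> \<omega>)) (\<lambda>t. complex_of_real (\<psi> t)) (\<lambda>y. if y = x then 1 else 0) x = complex_of_real 0"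
        unfolding of_real_0 by (intro matrix_operator.functional_calculus_zero[OF mop]) (auto simp: \<psi>_def)
    qed
    then have "(LINT t|\<nu>. \<psi> t) = 0" by simp
    moreover have "AE t in \<nu>. 0 \<le> \<psi> t" by (simp add: \<psi>_def)
    ultimately have "AE t in \<nu>. \<psi> t = 0"
      using integral_nonneg_eq_0_iff_AE[OF i] by blast
    then have "AE t in \<nu>. t \<notin> {t. C < \<bar>t\<bar> \<and> \<bar>t\<bar> < real n}"
      by (rule AE_mp) (rule AE_I2, auto simp: \<psi>_def)
    moreover have "{t. C < \<bar>t\<bar> \<and> \<bar>t\<bar> < real n} \<in> sets \<nu>" unfolding sets_\<nu> by measurable
    ultimately show ?thesis by (simp add: AE_iff_null_sets)
  qed
  have "(\<Union>n. {t. C < \<bar>t\<bar> \<and> \<bar>t\<bar> < real n}) \<in> null_sets \<nu>" by (rule null_sets_UN) (rule null)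
  moreover have "(\<Union>n. {t. C < \<bar>t\<bar> \<and> \<bar>t\<bar> < real n}) = - {-C..C}"
  proof (intro set_eqI iffI)
    fix t assume "t \<in> - {-C..C}"
    moreover obtain n :: nat where "\<bar>t\<bar> < real n" using reals_Archimedean2 by blast
    ultimately show "t \<in> (\<Union>n. {t. C < \<bar>t\<bar> \<and> \<bar>t\<bar> < real n})" by auto
  qed (use C_nonneg in auto)
  ultimately show ?thesis by auto
qed

text \<open>By \<open>\<nu>_outside\<close> the measure is finite, so \<open>integrated_dos\<close>
  is a genuine distribution function; on sets of infinite measure \<open>measure\<close> would
  return 0.\<close>

lemma isCont_dos: "isCont (integrated_dos \<nu>) E \<longleftrightarrow> measure \<nu> {E} = 0"
proof -
  have sp: "space \<nu> = UNIV" using sets_eq_imp_space_eq[OF sets_\<nu>] by simp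
  have "emeasure \<nu> UNIV \<le> emeasure \<nu> {-C..C} + emeasure \<nu> (- {-C..C})"
    using emeasure_subadditive[of "{-C..C}" \<nu> "- {-C..C}"] by (simp add: sets_\<nu>)
  also have "\<dots> < \<infinity>" using \<nu>_compact[of "{-C..C}"] by (simp add: \<nu>_outside)
  finally have "emeasure \<nu> (space \<nu>) \<noteq> \<infinity>" by (simp add: sp)
  then interpret finite_borel_measure \<nu>
    using finite_measureI[of \<nu>] sets_\<nu> by (simp add: finite_borel_measure_def finite_borel_measure_axioms_def)
  have "integrated_dos \<nu> = cdf \<nu>" by (simp add: fun_eq_iff integrated_dos_def cdf_def)
  then show ?thesis by (simp add: isCont_cdf)
qed

lemma mom_integral_lim: "(\<lambda>k. \<integral>x. u x \<partial>wmeas (mom UNIV (Suc k))) \<longlonglongrightarrow> (\<integral>x. u x \<partial>wmeas (dg UNIV))"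
proof -
  have w: "weight (mom UNIV k)" "weight (dg UNIV)" for k by (auto intro!: weight_mom weight_dg)
  obtain K r where u: "K \<ge> 0" "\<And>x. \<bar>u x\<bar> \<le> K" "\<And>x. u x \<noteq> 0 \<Longrightarrow> x \<in> cball undefined r" by (rule u_bounded) blast
  obtain N where N: "\<And>A. separated_set A \<Longrightarrow> finite (A \<inter> cball (undefined :: 'x) r) \<and> card (A \<inter> cball undefined r) \<le> N"
    using separated_card_bound[OF proper, of "undefined :: 'x" r] by blast
  have fs: "(\<Sum>\<^sub>\<infinity>x\<in>dom \<omega>. u x * v x) = (\<Sum>x\<in>dom \<omega> \<inter> cball undefined r. u x * v x)" if "\<omega> \<in> \<Omega>" for \<omega> v
    using finite_weighted_sum[OF that u(3), of v] by simp
  have "(\<lambda>k. \<integral>\<omega>. (\<Sum>\<^sub>\<infinity>x\<in>dom \<omega>. u x * mom UNIV (Suc k) \<omega> x) \<partial>Pr) \<longlonglongrightarrow> (\<integral>\<omega>. (\<Sum>\<^sub>\<infinity>x\<in>dom \<omega>. u x * dg UNIV \<omega> x) \<partial>Pr)"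
  \<comment> \<open>\<open>N\<close> bounds the number of points in the support ball of
    \<open>u\<close> for all configurations at once, \<open>K\<close> bounds \<open>u\<close>, and
    moments are at most 1.\<close>
  proof (rule integral_dominated_convergence[where w = "\<lambda>_. real N * K"])
    show "(\<lambda>\<omega>. \<Sum>\<^sub>\<infinity>x\<in>dom \<omega>. u x * dg UNIV \<omega> x) \<in> borel_measurable Pr"
      by (rule borel_measurable_integrable[OF integral_weighted_sum(1)[OF w(2)]])
    show "(\<lambda>\<omega>. \<Sum>\<^sub>\<infinity>x\<in>dom \<omega>. u x * mom UNIV (Suc k) \<omega> x) \<in> borel_measurable Pr" for k
      by (rule borel_measurable_integrable[OF integral_weighted_sum(1)[OF w(1)]])
    show "integrable Pr (\<lambda>_. real N * K)" by simp
    show "AE \<omega> in Pr. (\<lambda>k. \<Sum>\<^sub>\<infinity>x\<in>dom \<omega>. u x * mom UNIV (Suc k) \<omega> x) \<longlonglongrightarrow> (\<Sum>\<^sub>\<infinity>x\<in>dom \<omega>. u x * dg UNIV \<omega> x)"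
    proof (rule AE_I2)
      fix \<omega> assume "\<omega> \<in> space Pr"
      then have \<omega>: "\<omega> \<in> \<Omega>" by (simp add: space_Pr)
      show "(\<lambda>k. \<Sum>\<^sub>\<infinity>x\<in>dom \<omega>. u x * mom UNIV (Suc k) \<omega> x) \<longlonglongrightarrow> (\<Sum>\<^sub>\<infinity>x\<in>dom \<omega>. u x * dg UNIV \<omega> x)"
        unfolding fs[OF \<omega>] by (intro tendsto_sum tendsto_mult tendsto_const LIMSEQ_Suc mom_lim[OF \<omega>])
    qed
    fix k
    show "AE \<omega> in Pr. norm (\<Sum>\<^sub>\<infinity>x\<in>dom \<omega>. u x * mom UNIV (Suc k) \<omega> x) \<le> real N * K"
    proof (rule AE_I2)
      fix \<omega> assume "\<omega> \<in> space Pr"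
      then have \<omega>: "\<omega> \<in> \<Omega>" by (simp add: space_Pr)
      have "\<bar>u x * mom UNIV (Suc k) \<omega> x\<bar> \<le> K" if "x \<in> dom \<omega>" for x
      proof -
        have "0 \<le> mom UNIV (Suc k) \<omega> x" "mom UNIV (Suc k) \<omega> x \<le> 1" using w(1)[of "Suc k"] \<omega> that unfolding weight_def by blast+
        then have "\<bar>u x * mom UNIV (Suc k) \<omega> x\<bar> \<le> K * 1" unfolding abs_mult using u(1,2) by (intro mult_mono) auto
        then show ?thesis by simp
      qed
      then have "norm (\<Sum>x\<in>dom \<omega> \<inter> cball undefined r. u x * mom UNIV (Suc k) \<omega> x) \<le> real (card (dom \<omega> \<inter> cball undefined r)) * K"
        by (intro sum_norm_bound) auto
      also have "\<dots> \<le> real N * K" using N[OF \<Omega>_separated[OF \<omega>]] u(1) by (intro mult_right_mono) auto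
      finally show "norm (\<Sum>\<^sub>\<infinity>x\<in>dom \<omega>. u x * mom UNIV (Suc k) \<omega> x) \<le> real N * K" unfolding fs[OF \<omega>] .
    qed
  qed
  then show ?thesis unfolding integral_weighted_sum(2)[OF w(1)] integral_weighted_sum(2)[OF w(2)] .
qed

lemma dos_jump: "measure \<nu> {E} = 1 / d * (\<integral>x. u x \<partial>wmeas (dg UNIV))"
proof -
  define S where "S = C + \<bar>E\<bar> + 1"
  have S: "S > 0" using C_nonneg by (simp add: S_def)
  \<comment> \<open>The truncation at 0 gives compact support and does not act for
    \<open>\<bar>t\<bar> \<le> C\<close>, where \<open>\<bar>t - E\<bar> \<le> S\<close>. The
    exponent starts at 1 because the zeroth power would be 1 outside the interval too.\<close>
  define \<phi> :: "nat \<Rightarrow> real \<Rightarrow> real" where "\<phi> k t = max 0 (1 - ((t - E) / S)\<^sup>2) ^ Suc k" for k t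
  have c: "continuous_on UNIV (\<phi> k)" for k unfolding \<phi>_def by (intro continuous_intros) (use S in auto)
  have out: "\<phi> k t = 0" if "t \<notin> {E - S..E + S}" for k t
  proof -
    have "1 \<le> \<bar>(t - E) / S\<bar>" using that S by (auto simp: abs_div field_simps)
    then have "1 \<le> ((t - E) / S)\<^sup>2" by (metis abs_le_square_iff abs_one one_power2)
    then show ?thesis by (simp add: \<phi>_def)
  qed
  have b: "0 \<le> \<phi> k t" "\<phi> k t \<le> 1" for k t unfolding \<phi>_def by (simp, rule power_le_one) auto
  have supp: "compactly_supported (\<lambda>t. complex_of_real (\<phi> k t))" for k
    unfolding compactly_supported_def
  proof (rule compact_closure[THEN iffD2], rule bounded_subset)
    show "bounded {E - S..E + S}" by simp
    show "{t. complex_of_real (\<phi> k t) \<noteq> 0} \<subseteq> {E - S..E + S}"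
    proof
      fix t assume "t \<in> {t. complex_of_real (\<phi> k t) \<noteq> 0}"
      then have "\<phi> k t \<noteq> 0" by simp
      then show "t \<in> {E - S..E + S}" using out by blast
    qed
  qed
  have "(LINT t|\<nu>. complex_of_real (\<phi> k t)) = complex_of_real (1 / d * (\<integral>\<omega>. (\<Sum>\<^sub>\<infinity>x\<in>dom \<omega>. u x * mom UNIV (Suc k) \<omega> x) \<partial>Pr))" for k
  proof (rule dos_integral[OF _ supp])
    show "continuous_on UNIV (\<lambda>t. complex_of_real (\<phi> k t))" using c by (intro continuous_intros)
    fix \<omega> x assume \<omega>: "\<omega> \<in> \<Omega>" and x: "x \<in> dom \<omega>"
    have "\<phi> k t = (1 - ((t - E) / S)\<^sup>2) ^ Suc k" if "\<bar>t\<bar> \<le> C" for t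
    proof -
      have "\<bar>(t - E) / S\<bar> \<le> 1" using that S by (simp add: abs_div S_def)
      then have "((t - E) / S)\<^sup>2 \<le> 1" by (simp add: abs_square_le_1)
      then show ?thesis by (simp add: \<phi>_def max_def)
    qed
    then have "functional_calculus (dom \<omega>) (mat_app (dom \<omega>) (ham_entry \<iota> \<omega>)) (\<lambda>t. complex_of_real (\<phi> k t)) (\<lambda>y. if y = x then 1 else 0) x =
        complex_of_real ((matrix_operator.T (dom \<omega>) (ham_entry \<iota> \<omega>) C E (dom \<omega>) ^^ Suc k) (del x 1) \<bullet> del x 1)"
      by (intro matrix_operator.functional_calculus_del[OF mop[OF \<omega>] _ x]) (simp add: matrix_operator.S_def[OF mop[OF \<omega>]] S_def)
    then show "functional_calculus (dom \<omega>) (mat_app (dom \<omega>) (ham_entry \<iota> \<omega>)) (\<lambda>t. complex_of_real (\<phi> k t)) (\<lambda>y. if y = x then 1 else 0) x =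
        complex_of_real (mom UNIV (Suc k) \<omega> x)"
      by (simp add: mom_def del: funpow.simps)
  qed
  then have e: "(LINT t|\<nu>. \<phi> k t) = 1 / d * (\<integral>x. u x \<partial>wmeas (mom UNIV (Suc k)))" for k
    unfolding integral_complex_of_real of_real_eq_iff using integral_weighted_sum(2)[OF weight_mom[of UNIV "Suc k"]] by simp
  have l1: "(\<lambda>k. LINT t|\<nu>. \<phi> k t) \<longlonglongrightarrow> (LINT t|\<nu>. indicator {E} t)"
  proof (rule integral_dominated_convergence[where w = "indicator {E - S..E + S}"])
    show "(indicator {E} :: real \<Rightarrow> real) \<in> borel_measurable \<nu>"
      unfolding measurable_cong_sets[OF sets_\<nu> refl] by simp
    show "\<phi> k \<in> borel_measurable \<nu>" for k
      unfolding measurable_cong_sets[OF sets_\<nu> refl] by (rule borel_measurable_continuous_onI[OF c])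
    show "integrable \<nu> (indicator {E - S..E + S} :: real \<Rightarrow> real)"
      using \<nu>_compact[of "{E - S..E + S}"] by (intro integrable_real_indicator) (auto simp: sets_\<nu>)
    show "AE t in \<nu>. norm (\<phi> k t) \<le> indicator {E - S..E + S} t" for k
      using b[of k] out[of _ k] by (intro AE_I2) (auto simp: indicator_def)
    show "AE t in \<nu>. (\<lambda>k. \<phi> k t) \<longlonglongrightarrow> indicator {E} t"
    proof (rule AE_I2)
      fix t
      show "(\<lambda>k. \<phi> k t) \<longlonglongrightarrow> indicator {E} t"
      proof (cases "t = E")
        case False
        then have "0 < ((t - E) / S)\<^sup>2" using S by simp
        then have "max 0 (1 - ((t - E) / S)\<^sup>2) < 1" by auto
        then have "(\<lambda>k. max 0 (1 - ((t - E) / S)\<^sup>2) ^ Suc k) \<longlonglongrightarrow> 0" by (intro LIMSEQ_Suc LIMSEQ_realpow_zero) auto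
        then show ?thesis using False by (simp add: \<phi>_def)
      qed (simp add: \<phi>_def)
    qed
  qed
  have l2: "(\<lambda>k. LINT t|\<nu>. \<phi> k t) \<longlonglongrightarrow> 1 / d * (\<integral>x. u x \<partial>wmeas (dg UNIV))"
    unfolding e by (intro tendsto_mult tendsto_const mom_integral_lim)
  have "(LINT t|\<nu>. indicator {E} t) = measure \<nu> {E}"
    using sets_eq_imp_space_eq[OF sets_\<nu>] by simp
  then show ?thesis using LIMSEQ_unique[OF l1 l2] by simp
qed

lemma isCont_iff: "isCont (integrated_dos \<nu>) E \<longleftrightarrow> (AE \<omega> in Pr. \<forall>x\<in>dom \<omega>. dg UNIV \<omega> x = 0)"
  unfolding isCont_dos dos_jump integral_u_zero_iff[OF inv_weight_dg, symmetric] using d_pos by simp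

section \<open>From the weights back to solutions\<close>

lemma solutions_iff:
  assumes \<omega>: "\<omega> \<in> \<Omega>"
  shows "v \<in> solutions \<iota> \<omega> E \<longleftrightarrow> v \<in> ell2 (dom \<omega>) \<and> l2_of v \<in> Vl UNIV \<omega>"
proof (cases "v \<in> ell2 (dom \<omega>)")
  case True
  then have f: "fun_of (l2_of v) = v" and z: "\<And>x. x \<notin> dom \<omega> \<Longrightarrow> v x = 0" by (simp_all add: ell2_iff fun_of_l2_of)
  show ?thesis unfolding solutions_def Vl_iff[OF \<omega>] f using True z by simp
qed (simp add: solutions_def)

lemma compact_solution:
  assumes \<omega>: "\<omega> \<in> \<Omega>" and v: "v \<in> Vl J \<omega>" "v \<noteq> 0" and J: "bounded J"
  shows "fun_of v \<in> compact_solutions \<iota> \<omega> E"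
proof -
  have V: "\<And>x. x \<notin> J \<inter> dom \<omega> \<Longrightarrow> fun_of v x = 0" "\<And>x. ham \<iota> \<omega> (fun_of v) x - complex_of_real E * fun_of v x = 0"
    using v(1) unfolding Vl_iff[OF \<omega>] by blast+
  have "fun_of v \<in> ell2 (dom \<omega>)" using V(1) by (simp add: ell2_iff sq_summable_fun_of)
  moreover have "compactly_supported (fun_of v)"
  proof -
    obtain r where "\<forall>y\<in>J. dist undefined y \<le> r" using J unfolding bounded_any_center[where a = "undefined :: 'x"] by blast
    then have "{x. fun_of v x \<noteq> 0} \<subseteq> cball undefined r" using V(1) by fastforce
    then have "closure {x. fun_of v x \<noteq> 0} \<subseteq> cball undefined r" by (rule closure_minimal) simp
    then show ?thesis unfolding compactly_supported_def
      using compact_Int_closed[OF proper closed_closure] by (metis inf.absorb_iff2)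
  qed
  moreover have "\<exists>x. fun_of v x \<noteq> 0" using v(2) l2_eqI[of v 0] by (auto simp: l2_fun_simps)
  ultimately show ?thesis using V(2) by (simp add: compact_solutions_def solutions_def)
qed

lemma in_span: "v \<in> A \<Longrightarrow> v \<in> complex_span A" and zero_in_span: "(\<lambda>x. 0) \<in> complex_span A"
proof -
  show "v \<in> A \<Longrightarrow> v \<in> complex_span A"
    unfolding complex_span_def by (intro CollectI exI[of _ "{v}"] exI[of _ "\<lambda>_. 1"]) auto
  show "(\<lambda>x. 0) \<in> complex_span A"
    unfolding complex_span_def by (intro CollectI exI[of _ "{}"]) auto
qed

lemma span_solutions:
  assumes \<omega>: "\<omega> \<in> \<Omega>" and w: "w \<in> complex_span (compact_solutions \<iota> \<omega> E)"
  shows "w \<in> solutions \<iota> \<omega> E"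
proof -
  obtain t c where t: "finite t" "t \<subseteq> compact_solutions \<iota> \<omega> E" "w = (\<lambda>x. \<Sum>v\<in>t. c v * v x)"
    using w unfolding complex_span_def by blast
  have s: "v \<in> ell2 (dom \<omega>)" "ham \<iota> \<omega> v x = complex_of_real E * v x" if "v \<in> t" for v x
    using t(2) that by (auto simp: compact_solutions_def solutions_def)
  have w: "w = fun_of (\<Sum>v\<in>t. cscale (c v) (l2_of v))"
  proof
    fix x
    have "fun_of (\<Sum>v\<in>t. cscale (c v) (l2_of v)) x = (\<Sum>v\<in>t. c v * fun_of (l2_of v) x)"
      using t(1) by (induction t) (auto simp: l2_fun_simps fun_of_cscale)
    also have "\<dots> = (\<Sum>v\<in>t. c v * v x)" by (rule sum.cong[OF refl]) (use s(1) in \<open>simp add: ell2_iff fun_of_l2_of\<close>)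
    finally show "w x = fun_of (\<Sum>v\<in>t. cscale (c v) (l2_of v)) x" by (simp add: t(3))
  qed
  have off: "w x = 0" if "x \<notin> dom \<omega>" for x
    unfolding t(3) by (rule sum.neutral) (use s(1) that in \<open>auto simp: ell2_iff\<close>)
  have e: "w \<in> ell2 (dom \<omega>)" using off unfolding ell2_iff by (simp add: w sq_summable_fun_of)
  have "ham \<iota> \<omega> w x = complex_of_real E * w x" for x
  proof (cases "x \<in> dom \<omega>")
    case True
    have hs: "ham \<iota> \<omega> v x = (\<Sum>y\<in>dom \<omega> \<inter> cball x R. ham_entry \<iota> \<omega> x y * v y)" for v
      unfolding ham_eq_mat_app by (rule matrix_operator.mat_app_sum[OF mop[OF \<omega>] True])
    have "ham \<iota> \<omega> w x = (\<Sum>v\<in>t. c v * ham \<iota> \<omega> v x)"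
      unfolding hs t(3) sum_distrib_left by (subst sum.swap) (simp add: mult_ac)
    also have "\<dots> = complex_of_real E * w x" by (simp add: s(2) t(3) sum_distrib_left mult_ac)
    finally show ?thesis .
  qed (simp add: ham_def off)
  then show ?thesis using e by (simp add: solutions_def)
qed

text \<open>Equality of the diagonals is the convergence that \<open>approximation\<close> asks for,
  which gives density of the compactly supported solutions. A nonzero value of \<open>dgs\<close> is
  already nonzero on some ball, so there are such solutions. Conversely, limits of solutions are
  solutions because \<open>D\<close> is bounded.\<close>

lemma spanned:
  assumes \<omega>: "\<omega> \<in> \<Omega>" and eq: "\<And>x. x \<in> dom \<omega> \<Longrightarrow> dg UNIV \<omega> x = dgs \<omega> x"
    and x: "x \<in> dom \<omega>" "dg UNIV \<omega> x \<noteq> 0"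
  shows "spanned_by_compact_solutions \<iota> \<omega> E"
  unfolding spanned_by_compact_solutions_def
proof (intro conjI equalityI subsetI)
  have "(SUP n. dg (cball undefined (real n)) \<omega> x) \<noteq> 0" using eq[OF x(1)] x(2) by (simp add: dgs_def)
  then obtain n :: nat where n: "dg (cball undefined (real n)) \<omega> x \<noteq> 0" by fastforce
  define v where "v = matrix_operator.P (dom \<omega>) (ham_entry \<iota> \<omega>) C E (cball undefined (real n) \<inter> dom \<omega>) (del x 1)"
  note att = matrix_operator.diag_attained[OF mop[OF \<omega>], where E = E and J = "cball undefined (real n) \<inter> dom \<omega>" and x = x, folded v_def dg_def]
  have "v \<noteq> 0" using att(2) n by auto
  then show "compact_solutions \<iota> \<omega> E \<noteq> {}" using compact_solution[OF \<omega> att(1) _ bounded_cball] by blast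
next
  fix v assume "v \<in> solutions \<iota> \<omega> E"
  then have v: "v \<in> ell2 (dom \<omega>)" "l2_of v \<in> Vl UNIV \<omega>" using solutions_iff[OF \<omega>] by blast+
  have "\<exists>w\<in>complex_span (compact_solutions \<iota> \<omega> E). ell2_norm (dom \<omega>) (\<lambda>x. v x - w x) < e" if e: "e > 0" for e
  proof -
    have "\<exists>n w. w \<in> Vl (cball undefined (real n)) \<omega> \<and> norm (l2_of v - w) < e"
    proof (rule matrix_operator.approximation[OF mop[OF \<omega>] _ _ _ e])
      show "(\<lambda>n. matrix_operator.diag (dom \<omega>) (ham_entry \<iota> \<omega>) C E (cball undefined (real n) \<inter> dom \<omega>) x) \<longlonglongrightarrow>
         matrix_operator.diag (dom \<omega>) (ham_entry \<iota> \<omega>) C E (dom \<omega>) x" if "x \<in> dom \<omega>" for x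
        using dgs_lim[OF \<omega>, of x] eq[OF that] by (simp add: dg_def)
      show "l2_of v \<in> matrix_operator.V (dom \<omega>) (ham_entry \<iota> \<omega>) E (dom \<omega>)" using v(2) by simp
    qed simp
    then obtain n w where w: "w \<in> Vl (cball undefined (real n)) \<omega>" "norm (l2_of v - w) < e" by blast
    have "fun_of w \<in> complex_span (compact_solutions \<iota> \<omega> E)"
    proof (cases "w = 0")
      case True
      then have "fun_of w = (\<lambda>x. 0)" by (simp add: fun_eq_iff l2_fun_simps)
      then show ?thesis by (simp add: zero_in_span)
    next
      case False
      then show ?thesis by (intro in_span compact_solution[OF \<omega> w(1) _ bounded_cball])
    qed
    moreover have "ell2_norm (dom \<omega>) (\<lambda>x. v x - fun_of w x) < e"
    proof -
      have "(\<lambda>x. v x - fun_of w x) = fun_of (l2_of v - w)"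
        using v(1) by (simp add: fun_eq_iff l2_fun_simps ell2_iff fun_of_l2_of)
      moreover have "ell2_norm (dom \<omega>) (fun_of (l2_of v - w)) = norm (l2_of v - w)"
        using v(1) w(1) unfolding Vl_iff[OF \<omega>]
        by (intro ell2_norm_fun_of) (simp add: l2_fun_simps ell2_iff fun_of_l2_of)
      ultimately show ?thesis using w(2) by simp
    qed
    ultimately show ?thesis by blast
  qed
  then show "v \<in> ell2_closure (dom \<omega>) (complex_span (compact_solutions \<iota> \<omega> E))"
    using v(1) by (simp add: ell2_closure_def)
next
  interpret m: matrix_operator "dom \<omega>" "ham_entry \<iota> \<omega>" C R E by (rule mop[OF \<omega>])
  fix v assume "v \<in> ell2_closure (dom \<omega>) (complex_span (compact_solutions \<iota> \<omega> E))"
  then have v: "v \<in> ell2 (dom \<omega>)"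
    and app: "\<And>e. e > 0 \<Longrightarrow> \<exists>w\<in>complex_span (compact_solutions \<iota> \<omega> E). ell2_norm (dom \<omega>) (\<lambda>x. v x - w x) < e"
    by (auto simp: ell2_closure_def)
  have fv: "fun_of (l2_of v) = v" and off: "\<And>x. x \<notin> dom \<omega> \<Longrightarrow> v x = 0" using v by (simp_all add: ell2_iff fun_of_l2_of)
  have "norm (m.D (l2_of v)) \<le> 0 + e" if e: "e > 0" for e
  proof -
    obtain w where w: "w \<in> complex_span (compact_solutions \<iota> \<omega> E)" "ell2_norm (dom \<omega>) (\<lambda>x. v x - w x) < e / m.S"
      using app[of "e / m.S"] e m.S_pos by auto
    have ws: "w \<in> ell2 (dom \<omega>)" "l2_of w \<in> Vl UNIV \<omega>" using span_solutions[OF \<omega> w(1)] solutions_iff[OF \<omega>] by blast+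
    have fw: "fun_of (l2_of w) = w" using ws(1) by (simp add: ell2_iff fun_of_l2_of)
    have "(\<lambda>x. v x - w x) = fun_of (l2_of v - l2_of w)" by (simp add: fun_eq_iff l2_fun_simps fv fw)
    moreover have "ell2_norm (dom \<omega>) (fun_of (l2_of v - l2_of w)) = norm (l2_of v - l2_of w)"
      using off ws(1) by (intro ell2_norm_fun_of) (simp add: l2_fun_simps fv fw ell2_iff)
    ultimately have n: "norm (l2_of v - l2_of w) < e / m.S" using w(2) by simp
    have "m.D (l2_of w) = 0" using ws(2) by (simp add: m.V_def)
    then have "m.D (l2_of v) = m.D (l2_of v - l2_of w)"
      by (simp add: linear_diff[OF bounded_linear.linear[OF m.bounded_linear_D]])
    also have "norm \<dots> \<le> m.S * norm (l2_of v - l2_of w)" by (rule m.norm_D)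
    also have "\<dots> \<le> e" using n m.S_pos by (simp add: field_simps)
    finally show ?thesis by simp
  qed
  then have "norm (m.D (l2_of v)) \<le> 0" by (rule field_le_epsilon)
  moreover have "chi (dom \<omega>) (l2_of v) = l2_of v" by (rule l2_eqI) (simp add: fun_of_chi fv off)
  ultimately have "l2_of v \<in> Vl UNIV \<omega>" by (simp add: m.V_def)
  then show "v \<in> solutions \<iota> \<omega> E" using v solutions_iff[OF \<omega>] by blast
qed

text \<open>The diagonal dominates the squared value of any solution at \<open>x\<close>, relative
  to its norm.\<close>

lemma vanishing_dg_no_solutions:
  assumes \<omega>: "\<omega> \<in> \<Omega>" and z: "\<forall>x\<in>dom \<omega>. dg UNIV \<omega> x = 0" and v: "v \<in> solutions \<iota> \<omega> E"
  shows "v x = 0"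
proof (cases "x \<in> dom \<omega>")
  case True
  have V: "v \<in> ell2 (dom \<omega>)" "l2_of v \<in> Vl UNIV \<omega>" using v solutions_iff[OF \<omega>] by blast+
  have "(cmod (fun_of (l2_of v) x))\<^sup>2 \<le> dg UNIV \<omega> x * (norm (l2_of v))\<^sup>2"
    unfolding dg_def by (rule matrix_operator.diag_bound[OF mop[OF \<omega>] V(2)])
  then show ?thesis using z True V(1) by (simp add: ell2_iff fun_of_l2_of)
next
  case False
  then show ?thesis using v by (auto simp: solutions_def ell2_iff)
qed

text \<open>The event that \<open>E\<close> is no eigenvalue. Phrased through \<open>dg\<close>, it
  is measurable by the enumeration of the points and invariant because \<open>dg UNIV\<close> is an
  invariant weight.\<close>

definition empty_kernel :: "('x, 'c) config set" where
  "empty_kernel = {\<omega> \<in> \<Omega>. \<forall>x\<in>dom \<omega>. dg UNIV \<omega> x = 0}"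

lemma empty_kernel_sets: "empty_kernel \<in> sets Pr"
proof -
  have m: "(\<lambda>\<omega>. if hit i \<omega> then dg UNIV \<omega> (pt i \<omega>) else 0) \<in> borel_measurable Pr" for i
    using weight_dg[of UNIV] unfolding weight_def by simp
  have "empty_kernel = (\<Inter>i. {\<omega> \<in> space Pr. (if hit i \<omega> then dg UNIV \<omega> (pt i \<omega>) else 0) = 0})"
  proof (intro set_eqI iffI)
    fix \<omega> assume "\<omega> \<in> empty_kernel"
    then show "\<omega> \<in> (\<Inter>i. {\<omega> \<in> space Pr. (if hit i \<omega> then dg UNIV \<omega> (pt i \<omega>) else 0) = 0})"
      using pt_dom(1)[of \<omega>] by (auto simp: empty_kernel_def space_Pr)
  next
    fix \<omega> assume h: "\<omega> \<in> (\<Inter>i. {\<omega> \<in> space Pr. (if hit i \<omega> then dg UNIV \<omega> (pt i \<omega>) else 0) = 0})"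
    then have \<omega>: "\<omega> \<in> \<Omega>" by (simp add: space_Pr)
    have "dg UNIV \<omega> x = 0" if x: "x \<in> dom \<omega>" for x
    proof -
      obtain i where i: "hit i \<omega>" "x = pt i \<omega>" by (rule dom_cases[OF \<omega> x])
      have "(if hit i \<omega> then dg UNIV \<omega> (pt i \<omega>) else 0) = 0" using h by blast
      then show ?thesis using i by simp
    qed
    then show "\<omega> \<in> empty_kernel" using \<omega> by (simp add: empty_kernel_def)
  qed
  moreover have "{\<omega> \<in> space Pr. (if hit i \<omega> then dg UNIV \<omega> (pt i \<omega>) else 0) = 0} \<in> sets Pr" for i
    by (rule borel_measurable_eq[OF m borel_measurable_const])
  ultimately show ?thesis by auto
qed

lemma config_act_empty_kernel: "config_act act g ` empty_kernel = empty_kernel"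
proof -
  have sub: "config_act act g ` empty_kernel \<subseteq> empty_kernel" for g
    using config_act_\<Omega> inv_weight_dg unfolding empty_kernel_def inv_weight_def by (auto simp: dom_config_act)
  have "\<omega> \<in> config_act act g ` empty_kernel" if "\<omega> \<in> empty_kernel" for \<omega>
    using sub[of "- g"] that config_act_inverse[of g \<omega>] by (intro image_eqI[of _ _ "config_act act (- g) \<omega>"]) auto
  with sub show ?thesis by blast
qed

lemma AE_Pr: "(AE \<omega> in Pr. Q \<omega>) \<longleftrightarrow> (AE \<omega> in \<mu>. \<omega> \<in> \<Omega> \<longrightarrow> Q \<omega>)"
  by (rule AE_restrict_space_iff) (simp add: \<Omega>_inter)

text \<open>By ergodicity \<open>empty_kernel\<close> has measure 0 or 1, and a discontinuity rules
  out 1 by \<open>isCont_iff\<close>. Almost every configuration thus has a point with positive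
  diagonal, and there \<open>dg_eq_dgs\<close> feeds \<open>spanned\<close>.\<close>

lemma AE_spanned: assumes "\<not> isCont (integrated_dos \<nu>) E" shows "AE \<omega> in Pr. spanned_by_compact_solutions \<iota> \<omega> E"
proof -
  have s: "empty_kernel \<in> sets \<mu>" and sub: "empty_kernel \<subseteq> \<Omega>" using empty_kernel_sets sets_Pr by auto
  have "emeasure \<mu> empty_kernel \<noteq> 1"
  proof
    assume "emeasure \<mu> empty_kernel = 1"
    then have "Pr.prob empty_kernel = 1" by (simp add: measure_def emeasure_Pr[OF sub])
    then have "AE \<omega> in Pr. \<omega> \<in> empty_kernel" using Pr.AE_in_set_eq_1[OF empty_kernel_sets] by simp
    then have "AE \<omega> in Pr. \<forall>x\<in>dom \<omega>. dg UNIV \<omega> x = 0" by (rule AE_mp) (rule AE_I2, simp add: empty_kernel_def)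
    then show False using assms isCont_iff by simp
  qed
  then have "emeasure \<mu> empty_kernel = 0"
    using ergodic s config_act_empty_kernel unfolding ergodic_measure_def by blast
  then have "empty_kernel \<in> null_sets Pr" using empty_kernel_sets by (simp add: null_sets_def emeasure_Pr[OF sub])
  then have "AE \<omega> in Pr. \<omega> \<notin> empty_kernel" by (rule AE_not_in)
  with dg_eq_dgs show ?thesis
  proof (rule AE_mp[OF AE_conjI], intro AE_I2 impI)
    fix \<omega> assume "\<omega> \<in> space Pr" and h: "(\<forall>x\<in>dom \<omega>. dg UNIV \<omega> x = dgs \<omega> x) \<and> \<omega> \<notin> empty_kernel"
    then have \<omega>: "\<omega> \<in> \<Omega>" by (simp add: space_Pr)
    obtain x where "x \<in> dom \<omega>" "dg UNIV \<omega> x \<noteq> 0" using h \<omega> by (auto simp: empty_kernel_def)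
    then show "spanned_by_compact_solutions \<iota> \<omega> E" using h by (intro spanned[OF \<omega>]) auto
  qed
qed

lemma compact_solutions_on_set:
  assumes "AE \<omega> in Pr. spanned_by_compact_solutions \<iota> \<omega> E"
  shows "\<exists>\<Omega>'\<in>sets \<mu>. \<Omega>' \<subseteq> \<Omega> \<and> emeasure \<mu> \<Omega>' > 0 \<and> (\<forall>\<omega>\<in>\<Omega>'. compact_solutions \<iota> \<omega> E \<noteq> {})"
proof -
  obtain N where N: "\<And>\<omega>. \<omega> \<in> space Pr - N \<Longrightarrow> spanned_by_compact_solutions \<iota> \<omega> E" "N \<in> null_sets Pr"
  proof (rule AE_E3[OF assms])
    fix N assume a: "\<And>\<omega>. \<omega> \<in> space Pr - N \<Longrightarrow> spanned_by_compact_solutions \<iota> \<omega> E" and b: "N \<in> null_sets Pr"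
    show thesis by (rule that[OF a b])
  qed
  have s: "\<Omega> - N \<in> sets Pr"
    using sets.Diff[OF sets.top null_setsD2[OF N(2)]] unfolding space_Pr .
  have "emeasure Pr (\<Omega> - N) = 1"
    using emeasure_Diff_null_set[OF N(2) sets.top] Pr.emeasure_space_1 unfolding space_Pr by (rule trans)
  then have "emeasure \<mu> (\<Omega> - N) = 1" unfolding emeasure_Pr[OF Diff_subset] .
  then have "emeasure \<mu> (\<Omega> - N) > 0" by (simp only: zero_less_one)
  moreover have "\<forall>\<omega>\<in>\<Omega> - N. compact_solutions \<iota> \<omega> E \<noteq> {}"
  proof
    fix \<omega> assume "\<omega> \<in> \<Omega> - N"
    then have "\<omega> \<in> space Pr - N" unfolding space_Pr .
    then have "spanned_by_compact_solutions \<iota> \<omega> E" by (rule N(1))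
    then show "compact_solutions \<iota> \<omega> E \<noteq> {}" unfolding spanned_by_compact_solutions_def by (rule conjunct1)
  qed
  moreover have "\<Omega> - N \<in> sets \<mu>" using s unfolding sets_Pr by (rule conjunct1)
  ultimately show ?thesis by (intro bexI[of _ "\<Omega> - N"] conjI Diff_subset)
qed

text \<open>Continuity makes the diagonal vanish almost surely, which leaves no nontrivial solution
  outside a null set.\<close>

lemma discontinuous_of_solutions:
  assumes B: "B \<in> sets \<mu>" "B \<subseteq> \<Omega>" "emeasure \<mu> B > 0"
    and sol: "\<And>\<omega>. \<omega> \<in> B \<Longrightarrow> \<exists>v\<in>solutions \<iota> \<omega> E. \<exists>x. v x \<noteq> 0"
  shows "\<not> isCont (integrated_dos \<nu>) E"
proof
  assume "isCont (integrated_dos \<nu>) E"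
  then have "AE \<omega> in Pr. \<forall>x\<in>dom \<omega>. dg UNIV \<omega> x = 0" by (simp add: isCont_iff)
  then have "AE \<omega> in Pr. \<omega> \<notin> B"
  proof (rule AE_mp, intro AE_I2 impI notI)
    fix \<omega> assume z: "\<forall>x\<in>dom \<omega>. dg UNIV \<omega> x = 0" and "\<omega> \<in> B"
    then obtain v x where "v \<in> solutions \<iota> \<omega> E" "v x \<noteq> 0" using sol by blast
    moreover have "\<omega> \<in> \<Omega>" using \<open>\<omega> \<in> B\<close> B(2) by blast
    ultimately show False using vanishing_dg_no_solutions[OF _ z] by blast
  qed
  moreover have "B \<in> sets Pr" using B sets_Pr by blast
  ultimately have "B \<in> null_sets Pr" by (simp add: AE_iff_null_sets)
  then show False using B by (simp add: null_sets_def emeasure_Pr)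
qed

end

theorem corollary2p3:
  fixes act :: "'g::{topological_group_add, metric_space} \<Rightarrow>
                'x::{metric_space, second_countable_topology} \<Rightarrow> 'x"
    and haar :: "'g measure"
    and F' :: "'x set"
    and Cs :: "'c topology"
    and \<iota> :: "complex \<Rightarrow> 'c"
    and \<mu> :: "('x, 'c) config measure"
    and \<Omega> :: "('x, 'c) config set"
    and d :: real
    and s :: "'g \<Rightarrow> 'x \<Rightarrow> complex"
    and u :: "'x \<Rightarrow> real"
    and \<nu> :: "real measure"
    and E :: real
  assumes "locally_compact_space (euclidean :: 'x topology)"
    and "locally_compact_space (euclidean :: 'g topology)"
    and "unimodular_haar haar"
    and "amenable haar"
    and "\<And>g x y :: 'g. dist (g + x) (g + y) = dist x y"
    and "\<And>(x :: 'g) r. compact (closure (ball x r))"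
    and "isometric_action act"
    and "fundamental_domain act F'"
    and "\<exists>K :: nat \<Rightarrow> 'x set. (\<forall>n. compact (K n)) \<and> F' = (\<Union>n. K n)"
    and "compact (closure F')"
    and "rough_isometry (group_coordinate act F')"
    and "compactification Cs \<iota>"
    and "regular_probability (config_topology Cs) \<mu>"
    and "invariant_measure act \<mu>"
    and "\<Omega> = topological_support (config_topology Cs) \<mu>"
    and "\<Omega> \<noteq> {Map.empty}"
    and "d > 0"
    and "\<And>I. compact I \<Longrightarrow> emeasure haar I \<noteq> 0 \<Longrightarrow>
           intensity \<mu> \<Omega> {act g x | g x. g \<in> I \<and> x \<in> F'} = ennreal d * emeasure haar I"
    and "\<And>g x. cmod (s g x) = 1"
    and "condition_A act s \<iota> \<mu> \<Omega>"
    and "averaging_function haar act u"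
    and "density_of_states \<iota> \<mu> \<Omega> d u \<nu>"
    and "ergodic_measure act \<mu>"
  shows "(\<not> isCont (integrated_dos \<nu>) E \<longleftrightarrow>
            (\<exists>\<Omega>'\<in>sets \<mu>. \<Omega>' \<subseteq> \<Omega> \<and> emeasure \<mu> \<Omega>' > 0 \<and>
               (\<forall>\<omega>\<in>\<Omega>'. \<exists>v\<in>ell2 (dom \<omega>). compactly_supported v \<and> (\<exists>x. v x \<noteq> 0) \<and>
                  (\<forall>x. ham \<iota> \<omega> v x - complex_of_real E * v x = 0))))
       \<and> (\<not> isCont (integrated_dos \<nu>) E \<longleftrightarrow>
            (AE \<omega> in \<mu>. \<omega> \<in> \<Omega> \<longrightarrow> spanned_by_compact_solutions \<iota> \<omega> E))"
proof -
  interpret random_operator act haar F' Cs \<iota> \<mu> \<Omega> d s u \<nu> E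
    by (rule random_operator.intro) (fact assms)+
  have sol: "(\<exists>v\<in>ell2 (dom \<omega>). compactly_supported v \<and> (\<exists>x. v x \<noteq> 0) \<and> (\<forall>x. ham \<iota> \<omega> v x - complex_of_real E * v x = 0))
      \<longleftrightarrow> compact_solutions \<iota> \<omega> E \<noteq> {}" for \<omega>
    by (auto simp: compact_solutions_def solutions_def)
  have ii: "\<not> isCont (integrated_dos \<nu>) E"
    if h: "\<exists>\<Omega>'\<in>sets \<mu>. \<Omega>' \<subseteq> \<Omega> \<and> emeasure \<mu> \<Omega>' > 0 \<and> (\<forall>\<omega>\<in>\<Omega>'. compact_solutions \<iota> \<omega> E \<noteq> {})"
  proof -
    obtain B where B: "B \<in> sets \<mu>" "B \<subseteq> \<Omega>" "emeasure \<mu> B > 0" "\<forall>\<omega>\<in>B. compact_solutions \<iota> \<omega> E \<noteq> {}"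
      using h by (elim bexE conjE)
    show ?thesis
    proof (rule discontinuous_of_solutions[OF B(1-3)])
      fix \<omega> assume "\<omega> \<in> B"
      then have "compact_solutions \<iota> \<omega> E \<noteq> {}" using B(4) by simp
      then show "\<exists>v\<in>solutions \<iota> \<omega> E. \<exists>x. v x \<noteq> 0" by (auto simp: compact_solutions_def)
    qed
  qed
  \<comment> \<open>The circle of implications: discontinuity gives the spanning property almost
    everywhere, this gives compactly supported solutions on a set of positive measure, and these
    give discontinuity.\<close>
  show ?thesis
    unfolding sol AE_Pr[symmetric]
    by (intro conjI iffI) (erule AE_spanned compact_solutions_on_set[OF AE_spanned] ii ii[OF compact_solutions_on_set])+
qed

end
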